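(* For $0<\delta<1$ let $F\in L^2(\mathbb R^n;\mathbb C^m)$ and let $u_\delta\in H^1(\mathbb R^n;\mathbb C^m)$ solve $$-\nabla\cdot\big(A^{(\delta)}(y)\nabla u_\delta\big)+u_\delta=F\quad\text{in }\mathbb R^n,\qquad A^{(\delta)}=\delta^{-1}\chi_BA_1+(1-\chi_B)A_2 .$$ For a.e. $\theta\in\square^*$ let $v(\theta,\cdot)\in V_\theta$ be the unique solution of $$\int_{\square\setminus B}A_2(\nabla v+\mathrm i\theta\otimes v):\overline{(\nabla\phi+\mathrm i\theta\otimes\phi)}\,dy+\int_\square v\cdot\overline\phi\,dy=\int_\square UF(\theta,y)\cdot\overline{\phi(y)}\,dy\qquad\forall\phi\in V_\theta,$$ and set $u^{(0)}:=U^{-1}v$. Then $$\gamma_0^{-1}\int_{\mathbb R^n}|\nabla u_\delta-\nabla u^{(0)}|^2+\int_{\mathbb R^n}|u_\delta-u^{(0)}|^2\le\nu^{-2}\delta^2\int_{\mathbb R^n}|F|^2 .$$ The limit $u^{(0)}\in H^{(0)}:=\{u\in H^1(\mathbb R^n;\mathbb C^m):\nabla u=0\text{ in }B_1\}$, $B_1:=\bigcup_{l\in\mathbb Z^n}(B+l)$, is the solution of $$\int_{\mathbb R^n\setminus B_1}A_2\nabla u^{(0)}:\overline{\nabla\tilde u}+\int_{\mathbb R^n}u^{(0)}\cdot\overline{\tilde u}=\int_{\mathbb R^n}F\cdot\overline{\tilde u}\qquad\forall\tilde u\in H^{(0)} .$$ In particular, $\int_{B_1}|\nabla u_\delta|^2\le\gamma_0\nu^{-2}\delta^2\int_{\mathbb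 R^n}|F|^2$.
   Context: $n,m\ge1$, $\square=[-\frac12,\frac12]^n$, $\square^*=[-\pi,\pi]^n$. $B$ is a connected open set with Lipschitz boundary and $\overline B\subset(-\frac12,\frac12)^n$; $\chi_B$ is the ($\square$-periodically extended) characteristic function of $B$. $A_1,A_2$ are $\square$-periodic bounded measurable Hermitian tensor-valued coefficients such that, for some $\gamma_0\ge1$, $\gamma_0^{-1}\int_B|\nabla\phi|^2\le\int_BA_1\nabla\phi:\overline{\nabla\phi}\le\gamma_0\int_B|\nabla\phi|^2$ for all $\phi\in H^1(B;\mathbb C^m)$, and $\gamma_0^{-1}\int_{\square\setminus B}|\nabla\phi|^2\le\int_{\square\setminus B}A_2\nabla\phi:\overline{\nabla\phi}\le\gamma_0\int_{\square\setminus B}|\nabla\phi|^2$ for all $\phi\in H^1(\square\setminus B;\mathbb C^m)$. $U:L^2(\mathbb R^n)\to L^2(\square^*\times\square)$ (acting componentwise) is the unitary Floquet–Bloch–Gelfand transform, the continuous extension of $UF(\theta,y)=(2\pi)^{-n/2}\sum_{l\in\mathbb Z^n}F(y+l)e^{-\mathrm i\theta\cdot(y+l)}$, $F\in C_0^\infty$. $V_\theta:=\{v\in H^1_{per}(\square;\mathbb C^m): v(y)=e^{-\mathrm i\theta\cdot y}c\text{ for }y\in B,\text{ for some constant }c\in\mathbb C^m\}$. On $H^1_{per}(\square;\mathbb C^m)$ put $a_\theta(u,\tilde u)=\int_BA_1(\nabla u+\mathrm i\theta\otimes u):\overline{(\nabla\tilde u+\mathrm i\theta\otimes\tilde u)}$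 and $b_\theta(u,\tilde u)=\int_{\square\setminus B}A_2(\nabla u+\mathrm i\theta\otimes u):\overline{(\nabla\tilde u+\mathrm i\theta\otimes\tilde u)}+\int_\square u\cdot\overline{\tilde u}$, and let $W_\theta$ be the orthogonal complement of $V_\theta$ with respect to $a_\theta+b_\theta$. $\nu>0$ is a constant independent of $\theta\in\square^*$ with $\nu(a_\theta[w]+b_\theta[w])\le a_\theta[w]$ for all $w\in W_\theta$, $\theta\in\square^*$, where $a[w]:=a(w,w)$ (such a constant exists). *)

theory Defs
  imports "HOL-Analysis.Analysis"
begin
definition cell :: "(real^'n) set" where
  "cell = cbox (\<chi> i. - 1/2) (\<chi> i. 1/2)"

definition dual_cell :: "(real^'n) set" where
  "dual_cell = cbox (\<chi> i. - pi) (\<chi> i. pi)"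

definition lattice :: "(real^'n) set" where
  "lattice = {l. \<forall>i. l $ i \<in> \<int>}"

definition periodic :: "(real^'n \<Rightarrow> 'b) \<Rightarrow> bool" where
  "periodic f \<longleftrightarrow> (\<forall>l\<in>lattice. \<forall>y. f (y + l) = f y)"

definition translates :: "(real^'n) set \<Rightarrow> (real^'n) set" where
  "translates B = (\<Union>l\<in>lattice. (\<lambda>y. y + l) ` B)"

text \<open>Locally, up to a rotation, \<open>\<Omega>\<close> is the strict epigraph of a Lipschitz function. The graph
  direction is \<open>e\<close>; the function \<open>g\<close> only matters on the hyperplane orthogonal to \<open>e\<close>.\<close>

definition lipschitz_boundary :: "(real^'n) set \<Rightarrow> bool" where
  "lipschitz_boundary \<Omega> \<longleftrightarrow>
    (\<forall>p\<in>frontier \<Omega>. \<exists>e r L g. norm e = 1 \<and> 0 < r \<and> L-lipschitz_on {z. z \<bullet> e = 0} g \<and>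
      \<Omega> \<inter> ball p r = {x \<in> ball p r. g (x - (x \<bullet> e) *\<^sub>R e) < x \<bullet> e})"

text \<open>The gradient of a \<open>\<complex>\<^sup>m\<close>-valued function is a \<open>complex^'m^'n\<close>: entry \<open>$ j $ k\<close> is the \<open>j\<close>-th
  partial derivative of the \<open>k\<close>-th component. The norm on this type is the Frobenius norm.
  \<open>hdot u v\<close> is \<open>u\<close> dotted with the conjugate of \<open>v\<close> (linear in \<open>u\<close>), likewise \<open>contract\<close>.\<close>

definition hdot :: "complex^'m \<Rightarrow> complex^'m \<Rightarrow> complex" where
  "hdot u v = (\<Sum>k\<in>UNIV. u $ k * cnj (v $ k))"

definition contract :: "complex^'m^'n \<Rightarrow> complex^'m^'n \<Rightarrow> complex" where
  "contract M N = (\<Sum>j\<in>UNIV. \<Sum>k\<in>UNIV. M $ j $ k * cnj (N $ j $ k))"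

definition tapply :: "complex^'m^'n^'m^'n \<Rightarrow> complex^'m^'n \<Rightarrow> complex^'m^'n" where
  "tapply A M = (\<chi> j k. \<Sum>p\<in>UNIV. \<Sum>q\<in>UNIV. A $ j $ k $ p $ q * M $ p $ q)"

definition hermitian_tensor :: "complex^'m^'n^'m^'n \<Rightarrow> bool" where
  "hermitian_tensor A \<longleftrightarrow> (\<forall>j k p q. A $ j $ k $ p $ q = cnj (A $ p $ q $ j $ k))"

definition tensor :: "real^'n \<Rightarrow> complex^'m \<Rightarrow> complex^'m^'n" where
  "tensor \<theta> u = (\<chi> j k. complex_of_real (\<theta> $ j) * u $ k)"

definition cscale :: "complex \<Rightarrow> complex^'m^'n \<Rightarrow> complex^'m^'n" where
  "cscale c M = (\<chi> j k. c * M $ j $ k)"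

text \<open>Elements of these spaces are functions on the whole type, of which only the values on \<open>\<Omega>\<close>
  matter; identification almost everywhere is left explicit.\<close>

definition L2 :: "'a::euclidean_space set \<Rightarrow> ('a \<Rightarrow> 'b::real_normed_vector) set" where
  "L2 \<Omega> = {f. f \<in> borel_measurable (lebesgue_on \<Omega>) \<and>
               integrable (lebesgue_on \<Omega>) (\<lambda>x. (norm (f x))\<^sup>2)}"

definition L2_tendsto ::
  "'a::euclidean_space set \<Rightarrow> (nat \<Rightarrow> 'a \<Rightarrow> 'b::real_normed_vector) \<Rightarrow> ('a \<Rightarrow> 'b) \<Rightarrow> bool" where
  "L2_tendsto \<Omega> f g \<longleftrightarrow> (\<forall>k. f k \<in> L2 \<Omega>) \<and> g \<in> L2 \<Omega> \<and>
     (\<lambda>k. LINT x|lebesgue_on \<Omega>. (norm (f k x - g x))\<^sup>2) \<longlonglongrightarrow> 0"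

primrec C_diff :: "nat \<Rightarrow> ('a::euclidean_space \<Rightarrow> 'b::real_normed_vector) \<Rightarrow> bool" where
  "C_diff 0 f = continuous_on UNIV f"
| "C_diff (Suc k) f =
    ((\<forall>x. f differentiable (at x)) \<and> (\<forall>h. C_diff k (\<lambda>x. frechet_derivative f (at x) h)))"

definition smooth :: "('a::euclidean_space \<Rightarrow> 'b::real_normed_vector) \<Rightarrow> bool" where
  "smooth f \<longleftrightarrow> (\<forall>k. C_diff k f)"

definition test_functions ::
  "'a::euclidean_space set \<Rightarrow> ('a \<Rightarrow> 'b::real_normed_vector) set" where
  "test_functions \<Omega> = {\<phi>. smooth \<phi> \<and> compact (closure {x. \<phi> x \<noteq> 0}) \<and> closure {x. \<phi> x \<noteq> 0} \<subseteq> \<Omega>}"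

definition partial :: "'n \<Rightarrow> (real^'n \<Rightarrow> 'b::real_normed_vector) \<Rightarrow> real^'n \<Rightarrow> 'b" where
  "partial j f x = frechet_derivative f (at x) (axis j 1)"

definition classical_grad :: "(real^'n \<Rightarrow> complex^'m) \<Rightarrow> real^'n \<Rightarrow> complex^'m^'n" where
  "classical_grad f x = (\<chi> j. partial j f x)"

definition weak_gradient ::
  "(real^'n) set \<Rightarrow> (real^'n \<Rightarrow> complex^'m) \<Rightarrow> (real^'n \<Rightarrow> complex^'m^'n) \<Rightarrow> bool" where
  "weak_gradient \<Omega> u G \<longleftrightarrow>
    (\<forall>\<phi> :: real^'n \<Rightarrow> real. \<phi> \<in> test_functions \<Omega> \<longrightarrow>
      (\<forall>j. (LINT x|lebesgue_on \<Omega>. partial j \<phi> x *\<^sub>R u x)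
         = - (LINT x|lebesgue_on \<Omega>. \<phi> x *\<^sub>R (G x $ j))))"

definition H1 :: "(real^'n) set \<Rightarrow> (real^'n \<Rightarrow> complex^'m) set" where
  "H1 \<Omega> = {u \<in> L2 \<Omega>. \<exists>G\<in>L2 \<Omega>. weak_gradient \<Omega> u G}"

text \<open>For \<open>\<Omega>\<close> open and \<open>u \<in> H1 \<Omega>\<close> the weak gradient is determined up to a null set of \<open>\<Omega>\<close>;
  \<open>grad\<close> picks a representative.\<close>

definition grad ::
  "(real^'n) set \<Rightarrow> (real^'n \<Rightarrow> complex^'m) \<Rightarrow> real^'n \<Rightarrow> complex^'m^'n" where
  "grad \<Omega> u = (SOME G. G \<in> L2 \<Omega> \<and> weak_gradient \<Omega> u G)"

text \<open>The closure of the smooth periodic functions in the \<open>H\<^sup>1\<close>-norm of the cell.\<close>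

definition H1per :: "(real^'n \<Rightarrow> complex^'m) set" where
  "H1per = {u \<in> H1 (interior cell). \<exists>\<phi>. (\<forall>k. smooth (\<phi> k) \<and> periodic (\<phi> k)) \<and>
      L2_tendsto (interior cell) \<phi> u \<and>
      L2_tendsto (interior cell) (\<lambda>k. classical_grad (\<phi> k)) (grad (interior cell) u)}"

text \<open>The middle term is real for Hermitian \<open>A\<close>; \<open>Re\<close> only serves the comparison.\<close>

definition elliptic_on ::
  "(real^'n) set \<Rightarrow> (real^'n \<Rightarrow> complex^'m^'n^'m^'n) \<Rightarrow> real \<Rightarrow> bool" where
  "elliptic_on \<Omega> A \<gamma> \<longleftrightarrow> (\<forall>\<phi>\<in>H1 \<Omega>.
     inverse \<gamma> * (LINT y:\<Omega>|lebesgue. (norm (grad \<Omega> \<phi> y))\<^sup>2)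
       \<le> Re (LINT y:\<Omega>|lebesgue. contract (tapply (A y) (grad \<Omega> \<phi> y)) (grad \<Omega> \<phi> y)) \<and>
     Re (LINT y:\<Omega>|lebesgue. contract (tapply (A y) (grad \<Omega> \<phi> y)) (grad \<Omega> \<phi> y))
       \<le> \<gamma> * (LINT y:\<Omega>|lebesgue. (norm (grad \<Omega> \<phi> y))\<^sup>2))"

definition coefficient :: "(real^'n \<Rightarrow> complex^'m^'n^'m^'n) \<Rightarrow> bool" where
  "coefficient A \<longleftrightarrow> A \<in> borel_measurable lebesgue \<and> bounded (range A) \<and> periodic A \<and>
     (\<forall>y. hermitian_tensor (A y))"

definition A_delta :: "(real^'n) set \<Rightarrow> (real^'n \<Rightarrow> complex^'m^'n^'m^'n)
    \<Rightarrow> (real^'n \<Rightarrow> complex^'m^'n^'m^'n) \<Rightarrow> real \<Rightarrow> real^'n \<Rightarrow> complex^'m^'n^'m^'n" where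
  "A_delta B A1 A2 \<delta> y = (inverse \<delta> * indicator (translates B) y) *\<^sub>R A1 y
     + (1 - indicator (translates B) y) *\<^sub>R A2 y"

definition bloch_grad ::
  "real^'n \<Rightarrow> (real^'n \<Rightarrow> complex^'m) \<Rightarrow> real^'n \<Rightarrow> complex^'m^'n" where
  "bloch_grad \<theta> u y = grad (interior cell) u y + cscale \<i> (tensor \<theta> (u y))"

definition a_form :: "(real^'n) set \<Rightarrow> (real^'n \<Rightarrow> complex^'m^'n^'m^'n) \<Rightarrow> real^'n
    \<Rightarrow> (real^'n \<Rightarrow> complex^'m) \<Rightarrow> (real^'n \<Rightarrow> complex^'m) \<Rightarrow> complex" where
  "a_form B A1 \<theta> u w =
    (LINT y:B|lebesgue. contract (tapply (A1 y) (bloch_grad \<theta> u y)) (bloch_grad \<theta> w y))"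

definition b_form :: "(real^'n) set \<Rightarrow> (real^'n \<Rightarrow> complex^'m^'n^'m^'n) \<Rightarrow> real^'n
    \<Rightarrow> (real^'n \<Rightarrow> complex^'m) \<Rightarrow> (real^'n \<Rightarrow> complex^'m) \<Rightarrow> complex" where
  "b_form B A2 \<theta> u w =
    (LINT y:cell - B|lebesgue. contract (tapply (A2 y) (bloch_grad \<theta> u y)) (bloch_grad \<theta> w y))
    + (LINT y:cell|lebesgue. hdot (u y) (w y))"

definition V_space :: "(real^'n) set \<Rightarrow> real^'n \<Rightarrow> (real^'n \<Rightarrow> complex^'m) set" where
  "V_space B \<theta> = {v \<in> H1per. \<exists>c. AE y in lebesgue_on B. v y = exp (- \<i> * complex_of_real (\<theta> \<bullet> y)) *s c}"

definition W_space :: "(real^'n) set \<Rightarrow> (real^'n \<Rightarrow> complex^'m^'n^'m^'n)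
    \<Rightarrow> (real^'n \<Rightarrow> complex^'m^'n^'m^'n) \<Rightarrow> real^'n \<Rightarrow> (real^'n \<Rightarrow> complex^'m) set" where
  "W_space B A1 A2 \<theta> = {w \<in> H1per. \<forall>v\<in>V_space B \<theta>. a_form B A1 \<theta> w v + b_form B A2 \<theta> w v = 0}"

definition H0 :: "(real^'n) set \<Rightarrow> (real^'n \<Rightarrow> complex^'m) set" where
  "H0 B = {u \<in> H1 UNIV. AE y in lebesgue_on (translates B). grad UNIV u y = 0}"

definition gelfand_smooth ::
  "(real^'n \<Rightarrow> complex^'m) \<Rightarrow> real^'n \<Rightarrow> real^'n \<Rightarrow> complex^'m" where
  "gelfand_smooth F \<theta> y = (2 * pi) powr (- real CARD('n) / 2) *\<^sub>R
     (\<Sum>\<^sub>\<infinity>l\<in>lattice. exp (- \<i> * complex_of_real (\<theta> \<bullet> (y + l))) *s F (y + l))"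

text \<open>Continuous extension from test functions to \<open>L\<^sup>2\<close>; the value is determined up to a null set
  of \<open>dual_cell \<times> cell\<close>.\<close>

definition gelfand :: "(real^'n \<Rightarrow> complex^'m) \<Rightarrow> real^'n \<Rightarrow> real^'n \<Rightarrow> complex^'m" where
  "gelfand F = (SOME w. \<exists>\<Phi>. (\<forall>k. \<Phi> k \<in> test_functions UNIV) \<and> L2_tendsto UNIV \<Phi> F \<and>
     L2_tendsto (dual_cell \<times> cell) (\<lambda>k. case_prod (gelfand_smooth (\<Phi> k))) (case_prod w))"

definition gelfand_inv :: "(real^'n \<Rightarrow> real^'n \<Rightarrow> complex^'m) \<Rightarrow> real^'n \<Rightarrow> complex^'m" where
  "gelfand_inv w = (SOME F. F \<in> L2 UNIV \<and>
     (AE (\<theta>, y) in lebesgue_on (dual_cell \<times> cell). gelfand F \<theta> y = w \<theta> y))"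

definition solves_delta :: "(real^'n) set \<Rightarrow> (real^'n \<Rightarrow> complex^'m^'n^'m^'n)
    \<Rightarrow> (real^'n \<Rightarrow> complex^'m^'n^'m^'n) \<Rightarrow> real
    \<Rightarrow> (real^'n \<Rightarrow> complex^'m) \<Rightarrow> (real^'n \<Rightarrow> complex^'m) \<Rightarrow> bool" where
  "solves_delta B A1 A2 \<delta> F u \<longleftrightarrow> u \<in> H1 UNIV \<and> (\<forall>\<phi>\<in>H1 UNIV.
     (LINT y|lebesgue. contract (tapply (A_delta B A1 A2 \<delta> y) (grad UNIV u y)) (grad UNIV \<phi> y))
     + (LINT y|lebesgue. hdot (u y) (\<phi> y)) = (LINT y|lebesgue. hdot (F y) (\<phi> y)))"

text \<open>The left-hand side of the fibre problem is exactly \<open>b_form\<close>.\<close>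

definition solves_fibre :: "(real^'n) set \<Rightarrow> (real^'n \<Rightarrow> complex^'m^'n^'m^'n)
    \<Rightarrow> (real^'n \<Rightarrow> complex^'m) \<Rightarrow> real^'n \<Rightarrow> (real^'n \<Rightarrow> complex^'m) \<Rightarrow> bool" where
  "solves_fibre B A2 F \<theta> v \<longleftrightarrow> v \<in> V_space B \<theta> \<and>
     (\<forall>\<phi>\<in>V_space B \<theta>. b_form B A2 \<theta> v \<phi> = (LINT y:cell|lebesgue. hdot (gelfand F \<theta> y) (\<phi> y)))"

definition solves_limit :: "(real^'n) set \<Rightarrow> (real^'n \<Rightarrow> complex^'m^'n^'m^'n)
    \<Rightarrow> (real^'n \<Rightarrow> complex^'m) \<Rightarrow> (real^'n \<Rightarrow> complex^'m) \<Rightarrow> bool" where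
  "solves_limit B A2 F u \<longleftrightarrow> u \<in> H0 B \<and> (\<forall>\<phi>\<in>H0 B.
     (LINT y:- translates B|lebesgue. contract (tapply (A2 y) (grad UNIV u y)) (grad UNIV \<phi> y))
     + (LINT y|lebesgue. hdot (u y) (\<phi> y)) = (LINT y|lebesgue. hdot (F y) (\<phi> y)))"

end

theory Submission
 imports Defs
begin

text \<open>The limit problem is solved on the whole space by Riesz' theorem. If a field on the whole space
 is orthogonal to the admissible pairs (function, gradient vanishing on the inclusions), then almost every fibre of its
 transform is orthogonal to the fibre space: a fibre element is turned into an admissible pair by extending it
 quasi-periodically and multiplying by a cut-off that is constant near each inclusion. Hence the fibres of the limit
 solve the fibre problems, and the fibres of the error lie in \<open>W_space\<close>, where the spectral gap applies. Integrating
 the gap over the dual cell and testing the equation for the error with the error itself gives the estimate.\<close>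

text \<open>Two obstacles shape the proof. The fibre spaces vary with \<theta>, so building the
  field v fibre by fibre would call for a measurable selection; solving on the whole space first
  gives it as the transform of one function. Secondly, a test on the whole space yields statements
  outside a null set of \<theta> that may depend on the test function, whereas almost every fibre
  must be orthogonal to its entire fibre space. The order of quantifiers comes out right because
  finite lattice sums pair to exactly zero with every fibre element at every \<theta>; the null set
  stems only from the convergence of these sums along one subsequence, fixed before the element is
  chosen.

  Gradients and transforms are chosen representatives. The argument therefore works with pairs
  (function, gradient) and with the relation \<open>glim\<close>, saying that a field on
  \<open>dual_cell \<times> cell\<close> is the transform of a given field. It covers functions,
  gradients and fluxes alike; \<open>gelfand_glim\<close> and \<open>gelfand_inv_limit\<close> tie
  it to the choices in the statement.\<close>

abbreviation seq_tendsto :: "(nat \<Rightarrow> 'a::topological_space) \<Rightarrow> 'a \<Rightarrow> bool" ("((_)/ ~> (_))" [60, 60] 60)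
 where "X ~> L \<equiv> X \<longlonglongrightarrow> L"

notation scaleR (infixr "*r" 75)

abbreviation cellM :: "(real^'n) measure" where "cellM \<equiv> lebesgue_on cell"
abbreviation dualM :: "(real^'n) measure" where "dualM \<equiv> lebesgue_on dual_cell"

section \<open>Square integrable functions over an arbitrary measure\<close>

definition sqint :: "'a measure => ('a => 'b::euclidean_space) set" where
 "sqint M = {f. f : borel_measurable M & integrable M (%x. (norm (f x))\<^sup>2)}"

text \<open>For complex fields this is the real part of the Hermitian product. The imaginary part is
  the same expression with the second argument multiplied by the imaginary unit, so complex
  equations are handled as pairs of real ones.\<close>

definition l2inner :: "'a measure => ('a => 'b::euclidean_space) => ('a => 'b) => real" where
 "l2inner M f g = (LINT x|M. f x \<bullet> g x)"

definition l2norm :: "'a measure => ('a => 'b::euclidean_space) => real" where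
 "l2norm M f = sqrt (LINT x|M. (norm (f x))\<^sup>2)"

lemma L2_eq_sqint: "L2 Om = sqint (lebesgue_on Om)"
 by (simp add: L2_def sqint_def)

lemma sqintD:
 assumes "f : sqint M"
 shows "f : borel_measurable M" and "integrable M (%x. (norm (f x))\<^sup>2)"
 using assms by (auto simp: sqint_def)

lemma integrable_real_bound:
 fixes f :: "'a => real" and g :: "'a => 'b::{banach, second_countable_topology}"
 assumes "integrable M f" "g : borel_measurable M" "!!x. norm (g x) <= f x"
 shows "integrable M g"
proof (rule Bochner_Integration.integrable_bound[OF assms(1,2)])
 have "norm (g x) <= norm (f x)" for x using assms(3)[of x] by simp
 then show "AE x in M. norm (g x) <= norm (f x)" by simp
qed

lemma sqint_dominated:
 assumes "f : sqint M" "g : borel_measurable M" "!!x. norm (g x) <= C * norm (f x)"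
 shows "g : sqint M"
proof -
 have "integrable M (%x. C\<^sup>2 * (norm (f x))\<^sup>2)"
  using assms(1) by (simp add: sqint_def)
 moreover have "(%x. (norm (g x))\<^sup>2) : borel_measurable M" using assms(2) by measurable
 moreover have "norm ((norm (g x))\<^sup>2) <= C\<^sup>2 * (norm (f x))\<^sup>2" for x
  using power_mono[OF assms(3)[of x], of 2] by (simp add: power_mult_distrib)
 ultimately have "integrable M (%x. (norm (g x))\<^sup>2)" by (rule integrable_real_bound)
 then show ?thesis using assms(2) by (simp add: sqint_def)
qed

lemma sqint_zero [simp]: "(%x. 0) : sqint M"
 by (simp add: sqint_def)

lemma sqint_scaleR: "f : sqint M ==> (%x. c *r f x) : sqint M"
 by (rule sqint_dominated[where f=f and C="\<bar>c\<bar>"]) (auto simp: sqint_def)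

lemma sqint_add:
 assumes "f : sqint M" "g : sqint M"
 shows "(%x. f x + g x) : sqint M"
proof -
 note [measurable] = assms[THEN sqintD(1)]
 have "integrable M (%x. 2 * (norm (f x))\<^sup>2 + 2 * (norm (g x))\<^sup>2)"
  using assms by (simp add: sqint_def)
 moreover have "(%x. (norm (f x + g x))\<^sup>2) : borel_measurable M" by measurable
 moreover have "norm ((norm (f x + g x))\<^sup>2) <= 2 * (norm (f x))\<^sup>2 + 2 * (norm (g x))\<^sup>2" for x
 proof -
  have "(norm (f x + g x))\<^sup>2 <= (norm (f x) + norm (g x))\<^sup>2"
   by (simp add: norm_triangle_ineq power_mono)
  also have "... <= 2 * (norm (f x))\<^sup>2 + 2 * (norm (g x))\<^sup>2"
   using sum_squares_ge_zero[of "norm (f x) - norm (g x)" 0] by (simp add: power2_eq_square algebra_simps)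
  finally show ?thesis by simp
 qed
 ultimately have "integrable M (%x. (norm (f x + g x))\<^sup>2)" by (rule integrable_real_bound)
 then show ?thesis by (simp add: sqint_def)
qed

lemma sqint_minus: "f : sqint M ==> (%x. - f x) : sqint M"
 using sqint_scaleR[of f M "-1"] by simp

lemma sqint_diff: "f : sqint M ==> g : sqint M ==> (%x. f x - g x) : sqint M"
 using sqint_add[of f M "%x. - g x"] sqint_minus[of g M] by simp

lemma sqint_sum:
 assumes "!!i. i : I ==> f i : sqint M"
 shows "(%x. \<Sum>i\<in>I. f i x) : sqint M"
 using assms by (induction I rule: infinite_finite_induct) (auto intro!: sqint_add)

lemma sqint_mult_integrable:
 assumes "f : sqint M" "g : sqint M"
 shows "integrable M (%x. norm (f x) * norm (g x))"
proof -
 note [measurable] = assms[THEN sqintD(1)]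
 have "integrable M (%x. (norm (f x))\<^sup>2 + (norm (g x))\<^sup>2)"
  using assms by (simp add: sqint_def)
 moreover have "(%x. norm (f x) * norm (g x)) : borel_measurable M" by measurable
 moreover have "norm (norm (f x) * norm (g x)) <= (norm (f x))\<^sup>2 + (norm (g x))\<^sup>2" for x
 proof -
  have "2 * (norm (f x) * norm (g x)) <= (norm (f x))\<^sup>2 + (norm (g x))\<^sup>2"
   using sum_squares_ge_zero[of "norm (f x) - norm (g x)" 0] by (simp add: power2_eq_square algebra_simps)
  moreover have "0 <= norm (f x) * norm (g x)" by simp
  ultimately show ?thesis unfolding real_norm_def abs_of_nonneg[OF \<open>0 <= norm (f x) * norm (g x)\<close>] by linarith
 qed
 ultimately show ?thesis by (rule integrable_real_bound)
qed

lemma inner_integrable: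
 assumes "f : sqint M" "g : sqint M"
 shows "integrable M (%x. f x \<bullet> g x)"
proof -
 note [measurable] = assms[THEN sqintD(1)]
 show ?thesis
  by (rule integrable_real_bound[OF sqint_mult_integrable[OF assms]]) (auto simp: Cauchy_Schwarz_ineq2)
qed

lemma l2norm_nonneg [simp]: "0 <= l2norm M f"
 by (simp add: l2norm_def)

lemma l2norm_sq: "(l2norm M f)\<^sup>2 = (LINT x|M. (norm (f x))\<^sup>2)"
 by (simp add: l2norm_def)

lemma l2norm_sq_inner: "(l2norm M f)\<^sup>2 = l2inner M f f"
 by (simp add: l2norm_sq l2inner_def power2_norm_eq_inner)

lemma l2inner_add_left:
 assumes "f : sqint M" "g : sqint M" "h : sqint M"
 shows "l2inner M (%x. f x + g x) h = l2inner M f h + l2inner M g h"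
 using assms by (simp add: l2inner_def inner_add_left inner_integrable)

lemma l2inner_diff_left:
 assumes "f : sqint M" "g : sqint M" "h : sqint M"
 shows "l2inner M (%x. f x - g x) h = l2inner M f h - l2inner M g h"
 using assms by (simp add: l2inner_def inner_diff_left inner_integrable)

lemma l2inner_scaleR_left: "l2inner M (%x. c *r f x) h = c * l2inner M f h"
 by (simp add: l2inner_def)

lemma l2inner_commute: "l2inner M f g = l2inner M g f"
 by (simp add: l2inner_def inner_commute)

lemma l2inner_add_right:
 assumes "f : sqint M" "g : sqint M" "h : sqint M"
 shows "l2inner M h (%x. f x + g x) = l2inner M h f + l2inner M h g"
 using l2inner_add_left[OF assms] by (simp add: l2inner_commute)

lemma l2inner_diff_right:
 assumes "f : sqint M" "g : sqint M" "h : sqint M"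
 shows "l2inner M h (%x. f x - g x) = l2inner M h f - l2inner M h g"
 using l2inner_diff_left[OF assms] by (simp add: l2inner_commute)

lemma l2inner_scaleR_right: "l2inner M h (%x. c *r f x) = c * l2inner M h f"
 by (simp add: l2inner_def)

text \<open>Cauchy-Schwarz in scalar form for forms that are only semidefinite, so c = 0 needs its
  own case. It serves the L2 product, the form in the Riesz argument, and there also the first
  variation at near-minimisers.\<close>

lemma quadratic_discriminant_le:
 fixes a b c :: real
 assumes "!!t. 0 <= a + 2 * t * b + t\<^sup>2 * c" "0 <= a" "0 <= c"
 shows "\<bar>b\<bar> <= sqrt a * sqrt c"
proof -
 have "b\<^sup>2 <= a * c"
 proof (cases "c = 0")
  case True
  have "b = 0"
  proof (rule ccontr)
   assume "b ~= 0"
   \<comment> \<open>With c = 0 the quadratic is affine in t, and this t gives it the value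
     -1.\<close>
   have "a + 2 * (- (a + 1) / (2 * b)) * b = -1" using \<open>b ~= 0\<close> by (simp add: field_simps)
   with assms(1)[of "- (a + 1) / (2 * b)"] True show False by simp
  qed
  with True show ?thesis by simp
 next
  case False
  then have c: "c > 0" using assms by simp
  have "0 <= c * (a + 2 * (- b / c) * b + (- b / c)\<^sup>2 * c)"
   using assms(1)[of "- b / c"] c by (simp add: mult_nonneg_nonneg)
  also have "... = a * c - b\<^sup>2" using c by (simp add: field_simps power2_eq_square)
  finally show ?thesis by simp
 qed
 then have "sqrt (b\<^sup>2) <= sqrt (a * c)" by (rule real_sqrt_le_mono)
 then show ?thesis by (simp add: real_sqrt_mult)
qed

lemma l2norm_sq_add:
 assumes "f : sqint M" "g : sqint M"
 shows "(l2norm M (%x. f x + g x))\<^sup>2 = (l2norm M f)\<^sup>2 + 2 * l2inner M f g + (l2norm M g)\<^sup>2"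
 using assms by (simp add: l2norm_sq_inner l2inner_add_left l2inner_add_right sqint_add l2inner_commute[of M g f])

lemma l2norm_scaleR: "l2norm M (%x. c *r f x) = \<bar>c\<bar> * l2norm M f"
 by (simp add: l2norm_def power_mult_distrib real_sqrt_mult)

lemma l2inner_le:
 assumes "f : sqint M" "g : sqint M"
 shows "\<bar>l2inner M f g\<bar> <= l2norm M f * l2norm M g"
proof -
 have "0 <= (l2norm M f)\<^sup>2 + 2 * t * l2inner M f g + t\<^sup>2 * (l2norm M g)\<^sup>2" for t
 proof -
  have "(l2norm M (%x. f x + t *r g x))\<^sup>2 = (l2norm M f)\<^sup>2 + 2 * t * l2inner M f g + t\<^sup>2 * (l2norm M g)\<^sup>2"
   using assms by (simp add: l2norm_sq_add sqint_scaleR l2inner_scaleR_right l2norm_scaleR power_mult_distrib)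
  then show ?thesis by (metis zero_le_power2)
 qed
 from quadratic_discriminant_le[OF this] show ?thesis by simp
qed

lemma l2norm_triangle:
 assumes "f : sqint M" "g : sqint M"
 shows "l2norm M (%x. f x + g x) <= l2norm M f + l2norm M g"
proof (rule power2_le_imp_le)
 show "(l2norm M (%x. f x + g x))\<^sup>2 <= (l2norm M f + l2norm M g)\<^sup>2"
  using l2inner_le[OF assms] by (simp add: l2norm_sq_add[OF assms] power2_sum)
qed simp

lemma l2norm_commute: "l2norm M (%x. f x - g x) = l2norm M (%x. g x - f x)"
 by (simp add: l2norm_def norm_minus_commute)

lemma l2norm_diff_triangle:
 assumes "f : sqint M" "g : sqint M" "h : sqint M"
 shows "l2norm M (%x. f x - h x) <= l2norm M (%x. f x - g x) + l2norm M (%x. g x - h x)"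
 using l2norm_triangle[OF sqint_diff[OF assms(1,2)] sqint_diff[OF assms(2,3)]] by simp

lemma l2norm_sum_le:
 assumes "!!i. i : I ==> f i : sqint M"
 shows "l2norm M (%x. \<Sum>i\<in>I. f i x) <= (\<Sum>i\<in>I. l2norm M (f i))"
 using assms
proof (induction I rule: infinite_finite_induct)
 case (insert i I)
 have "l2norm M (%x. \<Sum>i\<in>insert i I. f i x) = l2norm M (%x. f i x + (\<Sum>i\<in>I. f i x))"
  using insert by simp
 also have "... <= l2norm M (f i) + l2norm M (%x. \<Sum>i\<in>I. f i x)"
  using insert by (intro l2norm_triangle sqint_sum) auto
 finally show ?case using insert by simp
qed (auto simp: l2norm_def)

lemma l2norm_cong_AE:
 assumes "f : borel_measurable M" "g : borel_measurable M" "AE x in M. f x = g x"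
 shows "l2norm M f = l2norm M g"
 unfolding l2norm_def using assms by (intro arg_cong[where f=sqrt] integral_cong_AE) auto

lemma l2norm_eq_0_iff:
 assumes "f : sqint M"
 shows "l2norm M f = 0 \<longleftrightarrow> (AE x in M. f x = 0)"
 using integral_nonneg_eq_0_iff_AE[of M "%x. (norm (f x))\<^sup>2"] assms by (simp add: l2norm_def sqint_def)

lemma l2norm_dominated:
 assumes "f : sqint M" "g : borel_measurable M" "0 <= C" "!!x. norm (g x) <= C * norm (f x)"
 shows "l2norm M g <= C * l2norm M f"
proof -
 have g: "g : sqint M" by (rule sqint_dominated) (use assms in auto)
 have "(LINT x|M. (norm (g x))\<^sup>2) <= (LINT x|M. C\<^sup>2 * (norm (f x))\<^sup>2)"
  using g assms(1) power_mono[OF assms(4), where n=2]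
  by (intro integral_mono) (auto simp: sqint_def power_mult_distrib)
 then have "l2norm M g <= sqrt (C\<^sup>2 * (LINT x|M. (norm (f x))\<^sup>2))"
  unfolding l2norm_def by (intro real_sqrt_le_mono) simp
 also have "... = C * l2norm M f" using assms(3) by (simp add: l2norm_def real_sqrt_mult)
 finally show ?thesis .
qed

lemma l2inner_tendsto:
 assumes "!!k. f k : sqint M" "!!k. g k : sqint M" "f' : sqint M" "g' : sqint M"
  and f: "((%k. l2norm M (%x. f k x - f' x)) \<longlongrightarrow> 0) F"
  and g: "((%k. l2norm M (%x. g k x - g' x)) \<longlongrightarrow> 0) F"
 shows "((%k. l2inner M (f k) (g k)) \<longlongrightarrow> l2inner M f' g') F"
proof -
 let ?b = "%k. l2norm M (%x. f k x - f' x) * l2norm M (%x. g k x - g' x)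
   + l2norm M (%x. f k x - f' x) * l2norm M g' + l2norm M f' * l2norm M (%x. g k x - g' x)"
 have "\<bar>l2inner M (f k) (g k) - l2inner M f' g'\<bar> <= ?b k" for k
 proof -
  have 1: "l2inner M (f k) (g k) - l2inner M f' g'
   = l2inner M (%x. f k x - f' x) (%x. g k x - g' x)
    + l2inner M (%x. f k x - f' x) g' + l2inner M f' (%x. g k x - g' x)"
   using assms by (simp add: l2inner_diff_left l2inner_diff_right sqint_diff)
  show ?thesis
   unfolding 1
   using l2inner_le[OF sqint_diff[OF assms(1)[of k] assms(3)] sqint_diff[OF assms(2)[of k] assms(4)]]
    l2inner_le[OF sqint_diff[OF assms(1)[of k] assms(3)] assms(4)]
    l2inner_le[OF assms(3) sqint_diff[OF assms(2)[of k] assms(4)]] by linarith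
 qed
 then have bound: "\<forall>\<^sub>F k in F. norm (l2inner M (f k) (g k) - l2inner M f' g') <= ?b k"
  by (intro always_eventually allI) (simp only: real_norm_def)
 have "(?b \<longlongrightarrow> 0 * 0 + 0 * l2norm M g' + l2norm M f' * 0) F" by (intro tendsto_intros f g)
 then have "((%k. l2inner M (f k) (g k) - l2inner M f' g') \<longlongrightarrow> 0) F"
  by (intro Lim_null_comparison[OF bound]) simp
 then show ?thesis using Lim_null by blast
qed

lemma l2norm_tendsto:
 assumes "!!k. f k : sqint M" "f' : sqint M"
  and f: "((%k. l2norm M (%x. f k x - f' x)) \<longlongrightarrow> 0) F"
 shows "((%k. l2norm M (f k)) \<longlongrightarrow> l2norm M f') F"
proof -
 have "((%k. sqrt (l2inner M (f k) (f k))) \<longlongrightarrow> sqrt (l2inner M f' f')) F"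
  using l2inner_tendsto[OF assms(1,1,2,2) f f] by (rule tendsto_real_sqrt)
 then show ?thesis by (simp flip: l2norm_sq_inner)
qed

lemma l2norm_sq_tendsto_0_iff:
 "((%k. LINT x|M. (norm (f k x))\<^sup>2) \<longlongrightarrow> 0) F \<longleftrightarrow> ((%k. l2norm M (f k)) \<longlongrightarrow> 0) F"
proof
 assume "((%k. LINT x|M. (norm (f k x))\<^sup>2) \<longlongrightarrow> 0) F"
 from tendsto_real_sqrt[OF this] show "((%k. l2norm M (f k)) \<longlongrightarrow> 0) F" by (simp add: l2norm_def)
next
 assume "((%k. l2norm M (f k)) \<longlongrightarrow> 0) F"
 from tendsto_power[OF this, of 2] show "((%k. LINT x|M. (norm (f k x))\<^sup>2) \<longlongrightarrow> 0) F"
  by (simp add: l2norm_sq)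
qed

lemma L2_tendsto_iff:
 "L2_tendsto Om f g \<longleftrightarrow> (\<forall>k. f k : L2 Om) & g : L2 Om \<and>
  (%k. l2norm (lebesgue_on Om) (%x. f k x - g x)) ~> 0"
 by (simp add: L2_tendsto_def l2norm_sq_tendsto_0_iff)

lemma l2norm_AE_subseq:
 assumes "!!k. f k : sqint M" "(%k. l2norm M (f k)) ~> 0"
 shows "\<exists>r::nat=>nat. strict_mono r & (AE x in M. (%n. f (r n) x) ~> 0)"
proof -
 have "(%k. LINT x|M. norm ((norm (f k x))\<^sup>2)) ~> 0"
  using assms(2) by (simp flip: l2norm_sq_tendsto_0_iff)
 from tendsto_L1_AE_subseq[OF _ this] assms(1)
 obtain r :: "nat => nat" where r: "strict_mono r" "AE x in M. (%n. (norm (f (r n) x))\<^sup>2) ~> 0"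
  by (auto simp: sqint_def)
 have "(%n. f (r n) x) ~> 0" if "(%n. (norm (f (r n) x))\<^sup>2) ~> 0" for x
  using tendsto_real_sqrt[OF that] by (simp add: tendsto_norm_zero_iff)
 with r show ?thesis by (auto elim!: eventually_mono)
qed

section \<open>Fatou's lemma and completeness of L2\<close>

lemma Fatou_integral:
 fixes h :: "nat => 'a => real"
 assumes h: "!!k. integrable M (h k)" "!!k x. 0 <= h k x" and b: "!!k. (LINT x|M. h k x) <= C"
  and g: "g : borel_measurable M" and lim: "AE x in M. (%k. h k x) ~> g x"
 shows "integrable M g & (LINT x|M. g x) <= C"
proof -
 have g0: "AE x in M. 0 <= g x"
  using lim by eventually_elim (rule LIMSEQ_le_const, auto intro: h(2))
 have C: "0 <= C" using order_trans[OF integral_nonneg_AE[where M=M and f="h 0"] b[of 0]] h(2) by auto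
 have "(\<integral>\<^sup>+x. ennreal (g x) \<partial>M) = (\<integral>\<^sup>+x. liminf (%k. ennreal (h k x)) \<partial>M)"
 proof (rule nn_integral_cong_AE, use lim in eventually_elim)
  fix x assume "(%k. h k x) ~> g x"
  then have "(%k. ennreal (h k x)) ~> ennreal (g x)" by (rule tendsto_ennrealI)
  then show "ennreal (g x) = liminf (%k. ennreal (h k x))" by (simp add: lim_imp_Liminf trivial_limit_sequentially)
 qed
 also have "... <= liminf (%k. \<integral>\<^sup>+x. ennreal (h k x) \<partial>M)"
  using h by (intro nn_integral_liminf) auto
 also have "... <= ennreal C"
 proof (rule Liminf_le)
  show "\<forall>\<^sub>F k in sequentially. (\<integral>\<^sup>+x. ennreal (h k x) \<partial>M) <= ennreal C"
   using h b by (subst nn_integral_eq_integral) (auto intro!: always_eventually ennreal_leI)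
 qed simp
 finally have *: "(\<integral>\<^sup>+x. ennreal (g x) \<partial>M) <= ennreal C" .
 then have int: "integrable M g"
  using g g0 by (intro integrableI_nonneg) (auto intro: le_less_trans)
 with * have "ennreal (LINT x|M. g x) <= ennreal C"
  using g0 by (subst (asm) nn_integral_eq_integral) auto
 with C int show ?thesis by simp
qed

text \<open>Riesz-Fischer. A subsequence with summable increments converges almost everywhere;
  Fatou, applied in the second index of the Cauchy condition, makes the pointwise limit an L2
  limit.\<close>

proposition sqint_complete:
 fixes f :: "nat => 'a => 'b::euclidean_space"
 assumes f: "!!k. f k : sqint M"
  and cauchy: "!!e. 0 < e ==> \<exists>N. \<forall>m\<ge>N. \<forall>n\<ge>N. l2norm M (%x. f m x - f n x) < e"
 obtains g where "g : sqint M" "(%k. l2norm M (%x. f k x - g x)) ~> 0"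
proof -
 have "\<exists>r::nat=>nat. \<forall>k. (\<forall>m\<ge>r k. \<forall>n\<ge>r k. l2norm M (%x. f m x - f n x) < (1/2)^k) & r k < r (Suc k)"
 proof (rule dependent_nat_choice)
  show "\<exists>N. \<forall>m\<ge>N. \<forall>n\<ge>N. l2norm M (%x. f m x - f n x) < (1/2)^0"
   using cauchy[of "(1/2)^0"] by simp
 next
  fix x n
  obtain N where "\<forall>m\<ge>N. \<forall>k\<ge>N. l2norm M (%x. f m x - f k x) < (1/2)^(Suc n)"
   using cauchy[of "(1/2)^(Suc n)"] by auto
  then show "\<exists>y. (\<forall>m\<ge>y. \<forall>k\<ge>y. l2norm M (%x. f m x - f k x) < (1/2)^Suc n) & x < y"
   by (intro exI[of _ "max N (Suc x)"]) auto
 qed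
 then obtain r :: "nat => nat" where
  r: "!!k m n. m \<ge> r k ==> n \<ge> r k ==> l2norm M (%x. f m x - f n x) < (1/2)^k"
  and rs: "!!k. r k < r (Suc k)" by auto
 have rm: "strict_mono r" using rs by (simp add: strict_mono_Suc_iff)
 define d where "d k x = f (r (Suc k)) x - f (r k) x" for k x
 have d: "d k : sqint M" for k unfolding d_def by (intro sqint_diff f)
 have dn: "l2norm M (d k) <= (1/2)^k" for k
  unfolding d_def using r[of k "r (Suc k)" "r k"] rs[of k] by simp
 \<comment> \<open>Partial sums of the norms of the increments. Their L2 norms stay below the
   geometric sum 2, so the supremum of their squares is integrable, hence finite almost
   everywhere.\<close>
 define S where "S n x = (\<Sum>k<n. norm (d k x))" for n x
 have S: "S n : sqint M" for n
  unfolding S_def using d[THEN sqintD(1)] by (intro sqint_sum sqint_dominated[OF d, where C=1]) auto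
 have Sn: "l2norm M (S n) <= 2" for n
 proof -
  have "l2norm M (S n) <= (\<Sum>k<n. l2norm M (%x. norm (d k x)))"
   unfolding S_def using d[THEN sqintD(1)] by (intro l2norm_sum_le sqint_dominated[OF d, where C=1]) auto
  also have "... = (\<Sum>k<n. l2norm M (d k))" by (simp add: l2norm_def)
  also have "... <= (\<Sum>k<n. (1/2)^k)" using dn by (intro sum_mono) auto
  also have "... <= (\<Sum>k. (1/2)^k)" by (intro sum_le_suminf) (auto simp: summable_geometric)
  also have "... = 2" by (simp add: suminf_geometric)
  finally show ?thesis .
 qed
 have "AE x in M. summable (%k. norm (d k x))"
 proof -
  have "(\<integral>\<^sup>+x. (SUP n. ennreal ((S n x)\<^sup>2)) \<partial>M) = (SUP n. \<integral>\<^sup>+x. ennreal ((S n x)\<^sup>2) \<partial>M)"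
  proof (rule nn_integral_monotone_convergence_SUP)
   show "incseq (%n x. ennreal ((S n x)\<^sup>2))"
    by (auto simp: incseq_def le_fun_def S_def intro!: ennreal_leI power_mono sum_mono2 sum_nonneg)
   show "(%x. ennreal ((S n x)\<^sup>2)) : borel_measurable M" for n
    using S[of n] by (auto simp: sqint_def)
  qed
  also have "... <= ennreal 4"
  proof (rule SUP_least)
   fix n
   have "(\<integral>\<^sup>+x. ennreal ((S n x)\<^sup>2) \<partial>M) = ennreal ((l2norm M (S n))\<^sup>2)"
    unfolding l2norm_sq using S[of n] by (subst nn_integral_eq_integral) (auto simp: sqint_def)
   also have "... <= ennreal (2\<^sup>2)" by (intro ennreal_leI power_mono Sn) simp
   finally show "(\<integral>\<^sup>+x. ennreal ((S n x)\<^sup>2) \<partial>M) <= ennreal 4" by simp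
  qed
  finally have fin: "(\<integral>\<^sup>+x. (SUP n. ennreal ((S n x)\<^sup>2)) \<partial>M) ~= \<infinity>"
   by (metis ennreal_less_top infinity_ennreal_def leD)
  have meas: "(%x. SUP n. ennreal ((S n x)\<^sup>2)) : borel_measurable M"
  proof (rule borel_measurable_SUP)
   show "(%x. ennreal ((S n x)\<^sup>2)) : borel_measurable M" for n
    using S[of n] by (auto simp: sqint_def)
  qed simp
  have "AE x in M. (SUP n. ennreal ((S n x)\<^sup>2)) ~= \<infinity>"
   by (rule nn_integral_PInf_AE[OF meas]) (use fin in simp)
  then show ?thesis
  proof eventually_elim
   fix x assume *: "(SUP n. ennreal ((S n x)\<^sup>2)) ~= \<infinity>"
   then obtain c where c: "(SUP n. ennreal ((S n x)\<^sup>2)) = ennreal c" "0 <= c"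
    by (metis ennreal_cases infinity_ennreal_def)
   have "S n x <= sqrt c" for n
   proof -
    have "ennreal ((S n x)\<^sup>2) <= ennreal c" unfolding c(1)[symmetric] by (rule SUP_upper) simp
    then have "(S n x)\<^sup>2 <= c" using c by simp
    then show ?thesis by (rule real_le_rsqrt)
   qed
   then show "summable (%k. norm (d k x))"
    by (intro summableI_nonneg_bounded[where x="sqrt c"]) (auto simp: S_def)
  qed
 qed
 then have conv: "AE x in M. (%k. f (r k) x) ~> lim (%k. f (r k) x)"
 proof eventually_elim
  fix x assume "summable (%k. norm (d k x))"
  then have "summable (%k. d k x)" by (rule summable_norm_cancel)
  then have "convergent (%n. \<Sum>k<n. d k x)" by (simp add: summable_iff_convergent)
  moreover have "(\<Sum>k<n. d k x) = f (r n) x - f (r 0) x" for n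
   unfolding d_def by (rule sum_lessThan_telescope)
  ultimately obtain L where "(%n. f (r n) x - f (r 0) x) ~> L" by (auto simp: convergent_def)
  from tendsto_add[OF this tendsto_const[of "f (r 0) x"]]
  have "convergent (%n. f (r n) x)" by (auto simp: convergent_def)
  then show "(%k. f (r k) x) ~> lim (%k. f (r k) x)" by (simp add: convergent_LIMSEQ_iff)
 qed
 define g where "g x = lim (%k. f (r k) x)" for x
 have gm: "g : borel_measurable M"
  unfolding g_def by (rule borel_measurable_lim_metric) (use f in \<open>auto simp: sqint_def\<close>)
 \<comment> \<open>The shift \<open>j + k\<close> keeps every index of the subsequence at or beyond
   \<open>r k\<close>, so the Cauchy bound holds for all terms entering Fatou.\<close>
 have key: "(%x. f m x - g x) : sqint M & l2norm M (%x. f m x - g x) <= (1/2)^k" if "m \<ge> r k" for m k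
 proof -
  have "integrable M (%x. (norm (f m x - g x))\<^sup>2) & (LINT x|M. (norm (f m x - g x))\<^sup>2) <= ((1/2)^k)\<^sup>2"
  proof (rule Fatou_integral)
   show "integrable M (%x. (norm (f m x - f (r (j + k)) x))\<^sup>2)" for j
    using sqint_diff[OF f f] by (auto simp: sqint_def)
   have "l2norm M (%x. f m x - f (r (j + k)) x) <= (1/2)^k" for j
    using r[of k m "r (j+k)"] that strict_mono_mono[OF rm, THEN monoD, of k "j + k"] by simp
   then have "(l2norm M (%x. f m x - f (r (j + k)) x))\<^sup>2 <= ((1/2)^k)\<^sup>2" for j
    by (intro power_mono) auto
   then show "(LINT x|M. (norm (f m x - f (r (j + k)) x))\<^sup>2) <= ((1/2)^k)\<^sup>2" for j
    by (simp add: l2norm_sq)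
   show "(%x. (norm (f m x - g x))\<^sup>2) : borel_measurable M"
    using gm f[of m] by (auto simp: sqint_def)
   show "AE x in M. (%j. (norm (f m x - f (r (j + k)) x))\<^sup>2) ~> (norm (f m x - g x))\<^sup>2"
    using conv
   proof eventually_elim
    fix x assume "(%k. f (r k) x) ~> lim (%k. f (r k) x)"
    then have "(%j. f (r (j + k)) x) ~> g x"
     unfolding g_def by (rule LIMSEQ_ignore_initial_segment)
    then show "(%j. (norm (f m x - f (r (j + k)) x))\<^sup>2) ~> (norm (f m x - g x))\<^sup>2"
     by (intro tendsto_intros)
   qed
  qed auto
  then show ?thesis
   using gm f[of m] by (auto simp: sqint_def l2norm_def intro!: real_le_lsqrt)
 qed
 show ?thesis
 proof
  show "g : sqint M"
   using sqint_diff[OF f[of "r 0"] key[THEN conjunct1, of 0 "r 0"]] by simp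
  show "(%k. l2norm M (%x. f k x - g x)) ~> 0"
  proof (rule LIMSEQ_I)
   fix e :: real assume "e > 0"
   then obtain k where k: "(1/2)^k < e" using real_arch_pow_inv[of e "1/2"] by auto
   have "norm (l2norm M (%x. f m x - g x) - 0) < e" if "m \<ge> r k" for m
    using key[OF that] k by simp
   then show "\<exists>no. \<forall>n\<ge>no. norm (l2norm M (%x. f n x - g x) - 0) < e" by blast
  qed
 qed
qed

section \<open>Calculus of iterated differentiability\<close>

lemma C_diff_SucI:
 assumes "!!x. (f has_derivative f' x) (at x)" "!!h. C_diff k (%x. f' x h)"
 shows "C_diff (Suc k) f"
proof -
 have "frechet_derivative f (at x) = f' x" for x
  using frechet_derivative_at[OF assms(1)] by simp
 then show ?thesis using assms by (auto simp: differentiable_def)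
qed

lemma C_diff_SucD:
 assumes "C_diff (Suc k) f"
 shows "(f has_derivative frechet_derivative f (at x)) (at x)"
  and "C_diff k (%x. frechet_derivative f (at x) h)"
 using assms by (auto simp: frechet_derivative_works)

lemma C_diff_Suc_imp: "C_diff (Suc k) f ==> C_diff k f"
proof (induction k arbitrary: f)
 case 0
 then show ?case
  by (auto simp: continuous_on_eq_continuous_at intro!: differentiable_imp_continuous_within)
next
 case (Suc k)
 show ?case
  by (rule C_diff_SucI[OF C_diff_SucD(1)[OF Suc.prems]]) (rule Suc.IH, rule C_diff_SucD(2)[OF Suc.prems])
qed

lemma C_diff_const [simp]: "C_diff k (%x. c)"
proof (induction k arbitrary: c)
 case (Suc k)
 show ?case by (rule C_diff_SucI[where f'="%x h. 0"]) (auto simp: Suc)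
qed simp

lemma C_diff_bounded_linear_comp:
 assumes "bounded_linear L" "C_diff k f"
 shows "C_diff k (%x. L (f x))"
 using assms(2)
proof (induction k arbitrary: f)
 case 0
 then show ?case using assms(1) by (auto intro: linear_continuous_on_compose bounded_linear.continuous_on)
next
 case (Suc k)
 show ?case
 proof (rule C_diff_SucI)
  show "((%x. L (f x)) has_derivative (%h. L (frechet_derivative f (at x) h))) (at x)" for x
   by (rule bounded_linear.has_derivative[OF assms(1) C_diff_SucD(1)[OF Suc.prems]])
  show "C_diff k (%x. L (frechet_derivative f (at x) h))" for h
   by (rule Suc.IH, rule C_diff_SucD(2)[OF Suc.prems])
 qed
qed

lemma C_diff_id: "C_diff k (%x. x)"
 by (cases k) (auto intro!: C_diff_SucI[where f'="%x h. h"] simp del: C_diff.simps(2))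

lemma C_diff_add:
 assumes "C_diff k f" "C_diff k g"
 shows "C_diff k (%x. f x + g x)"
 using assms
proof (induction k arbitrary: f g)
 case 0
 then show ?case by (auto intro: continuous_intros)
next
 case (Suc k)
 show ?case
 proof (rule C_diff_SucI)
  show "((%x. f x + g x) has_derivative
    (%h. frechet_derivative f (at x) h + frechet_derivative g (at x) h)) (at x)" for x
   by (rule has_derivative_add[OF C_diff_SucD(1)[OF Suc.prems(1)] C_diff_SucD(1)[OF Suc.prems(2)]])
  show "C_diff k (%x. frechet_derivative f (at x) h + frechet_derivative g (at x) h)" for h
   by (rule Suc.IH[OF C_diff_SucD(2)[OF Suc.prems(1)] C_diff_SucD(2)[OF Suc.prems(2)]])
 qed
qed

lemma C_diff_bilinear:
 assumes "bounded_bilinear bop" "C_diff k f" "C_diff k g"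
 shows "C_diff k (%x. bop (f x) (g x))"
 using assms(2,3)
proof (induction k arbitrary: f g)
 case 0
 then show ?case using bounded_bilinear.continuous_on[OF assms(1)] by auto
next
 case (Suc k)
 show ?case
 proof (rule C_diff_SucI)
  show "((%x. bop (f x) (g x)) has_derivative
    (%h. bop (f x) (frechet_derivative g (at x) h) + bop (frechet_derivative f (at x) h) (g x))) (at x)" for x
   by (rule bounded_bilinear.FDERIV[OF assms(1) C_diff_SucD(1)[OF Suc.prems(1)] C_diff_SucD(1)[OF Suc.prems(2)]])
  show "C_diff k (%x. bop (f x) (frechet_derivative g (at x) h) + bop (frechet_derivative f (at x) h) (g x))" for h
   by (intro C_diff_add Suc.IH C_diff_SucD(2)[OF Suc.prems(1)] C_diff_SucD(2)[OF Suc.prems(2)]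
     C_diff_Suc_imp[OF Suc.prems(1)] C_diff_Suc_imp[OF Suc.prems(2)])
 qed
qed

lemma C_diff_affine_comp:
 assumes "bounded_linear L" "C_diff k f"
 shows "C_diff k (%x. f (L x + a))"
 using assms(2)
proof (induction k arbitrary: f)
 case 0
 have "continuous_on UNIV (%x. L x + a)"
  by (intro continuous_intros linear_continuous_on assms)
 with 0 show ?case by (auto intro: continuous_on_compose2)
next
 case (Suc k)
 show ?case
 proof (rule C_diff_SucI)
  have L: "((%x. L x + a) has_derivative L) (at x)" for x
   using bounded_linear_imp_has_derivative[OF assms(1)] by (auto intro!: derivative_eq_intros)
  show "((%x. f (L x + a)) has_derivative (%h. frechet_derivative f (at (L x + a)) (L h))) (at x)" for x
   using has_derivative_compose[OF L C_diff_SucD(1)[OF Suc.prems]] .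
  show "C_diff k (%x. frechet_derivative f (at (L x + a)) (L h))" for h
   by (rule Suc.IH[OF C_diff_SucD(2)[OF Suc.prems]])
 qed
qed

lemma smooth_const [simp]: "smooth (%x. c)"
 and smooth_id: "smooth (%x. x)"
 and smooth_add: "smooth f ==> smooth g ==> smooth (%x. f x + g x)"
 and smooth_bilinear: "bounded_bilinear bop ==> smooth f2 ==> smooth g2 ==> smooth (%x. bop (f2 x) (g2 x))"
 and smooth_linear_comp: "bounded_linear L ==> smooth f ==> smooth (%x. L (f x))"
 and smooth_affine_comp: "bounded_linear K ==> smooth f3 ==> smooth (%x. f3 (K x + a))"
 by (auto simp: smooth_def intro: C_diff_add C_diff_bilinear C_diff_bounded_linear_comp C_diff_affine_comp C_diff_id)

lemma smooth_scaleR: "smooth f ==> smooth g ==> smooth (%x. f x *r g x)"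
 by (rule smooth_bilinear[OF bounded_bilinear_scaleR])

lemma smooth_translate: "smooth f ==> smooth (%x. f (x + a))"
 using smooth_affine_comp[of "%x. x"] by simp

lemma smooth_minus: "smooth f ==> smooth (%x. - f x)"
 by (rule smooth_linear_comp[OF bounded_linear_minus[OF bounded_linear_ident]])

lemma smooth_diff: "smooth f ==> smooth g ==> smooth (%x. f x - g x)"
 using smooth_add[of f "%x. - g x"] smooth_minus[of g] by simp

lemma smooth_sum:
 assumes "!!i. i : I ==> smooth (f i)"
 shows "smooth (%x. \<Sum>i\<in>I. f i x)"
 using assms by (induction I rule: infinite_finite_induct) (auto intro!: smooth_add)

lemma smooth_derivative: "smooth f ==> (f has_derivative frechet_derivative f (at x)) (at x)"
 by (rule C_diff_SucD(1)) (auto simp: smooth_def)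

lemma smooth_frechet_derivative: "smooth f ==> smooth (%x. frechet_derivative f (at x) h)"
 unfolding smooth_def by (metis C_diff_SucD(2))

lemma smooth_partial: "smooth f ==> smooth (partial j f)"
 unfolding partial_def by (rule smooth_frechet_derivative)

lemma smooth_continuous_on: "smooth f ==> continuous_on S f"
 unfolding smooth_def by (metis C_diff.simps(1) continuous_on_subset subset_UNIV)

lemma smooth_grad_continuous: "smooth f ==> continuous_on S (classical_grad f)"
 unfolding classical_grad_def
 by (intro continuous_on_vec_lambda smooth_continuous_on smooth_partial)

lemma linear_derivative: "smooth f ==> bounded_linear (frechet_derivative f (at x))"
 using smooth_derivative has_derivative_bounded_linear by blast

subsection \<open>Smooth functions of compact support\<close>

text \<open>The functions t^(-n) exp(-1/t), extended by zero. The powers are included because the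
  family is then closed under differentiation (\<open>flat_has_derivative\<close>), so smoothness of
  exp(-1/t) needs no formula for higher derivatives.\<close>

definition flat :: "nat => real => real" where
 "flat n t = (if t > 0 then (inverse t)^n * exp (- inverse t) else 0)"

lemma flat_nonneg: "0 <= flat n t"
 by (simp add: flat_def)

lemma flat_tendsto_0: "(flat n \<longlongrightarrow> 0) (at 0)"
proof -
 have "((%t. (inverse t)^n / exp (inverse t)) \<longlongrightarrow> 0) (at_right (0::real))"
  by (rule filterlim_compose[OF tendsto_power_div_exp_0 filterlim_inverse_at_top_right])
 then have "(flat n \<longlongrightarrow> 0) (at_right 0)"
  by (rule Lim_transform_eventually)
   (auto simp: flat_def exp_minus divide_inverse eventually_at_filter)
 moreover have "(flat n \<longlongrightarrow> 0) (at_left 0)"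
  by (rule tendsto_eventually) (auto simp: flat_def eventually_at_filter)
 ultimately show ?thesis by (simp add: filterlim_split_at)
qed

lemma flat_has_derivative:
 "(flat n has_real_derivative (flat (n + 2) t - n * flat (n + 1) t)) (at t)"
proof -
 consider "t > 0" | "t < 0" | "t = 0" by linarith
 then show ?thesis
 proof cases
  case 1
  have "((%t. (inverse t)^n * exp (- inverse t)) has_real_derivative (flat (n + 2) t - n * flat (n + 1) t)) (at t)"
  proof -
   have "((%t. (inverse t)^n) has_real_derivative (- real n * (inverse t)^(n+1))) (at t)"
    using DERIV_power[OF DERIV_inverse[of t UNIV], of n] 1 by (cases n) (auto simp: algebra_simps)
   moreover have "((%t. exp (- inverse t)) has_real_derivative ((inverse t)^2 * exp (- inverse t))) (at t)"
    using 1 by (auto intro!: derivative_eq_intros simp: power2_eq_square)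
   ultimately have "((%t. (inverse t)^n * exp (- inverse t)) has_real_derivative
     - real n * (inverse t)^(n+1) * exp (- inverse t) + (inverse t)^2 * exp (- inverse t) * (inverse t)^n) (at t)"
    by (rule DERIV_mult)
   then show ?thesis using 1 by (simp add: flat_def algebra_simps power2_eq_square)
  qed
  then show ?thesis
   by (rule DERIV_cong_ev[THEN iffD1, rotated 3])
    (use 1 in \<open>auto simp: flat_def intro: eventually_nhds_in_open[of "{0<..}", THEN eventually_mono]\<close>)
 next
  case 2
  have "((%t. 0) has_real_derivative (flat (n + 2) t - n * flat (n + 1) t)) (at t)"
   using 2 by (simp add: flat_def)
  then show ?thesis
   by (rule DERIV_cong_ev[THEN iffD1, rotated 3])
    (use 2 in \<open>auto simp: flat_def intro: eventually_nhds_in_open[of "{..<0}", THEN eventually_mono]\<close>)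
 next
  case 3
  \<comment> \<open>At the origin the difference quotient of \<open>flat n\<close> is
    \<open>flat (Suc n)\<close>, which tends to zero.\<close>
  have "((%h. flat n h / h) \<longlongrightarrow> 0) (at 0)"
   by (rule Lim_transform_eventually[OF flat_tendsto_0[of "Suc n"]])
    (auto simp: flat_def field_simps eventually_at_filter)
  then show ?thesis using 3 by (simp add: DERIV_def flat_def)
 qed
qed

text \<open>The induction runs over all n at once, since one derivative of \<open>flat n\<close>
  involves \<open>flat (n + 1)\<close> and \<open>flat (n + 2)\<close>.\<close>

lemma smooth_flat_comp:
 assumes "smooth g"
 shows "smooth (%x. flat n (g x))"
proof -
 have "C_diff k (%x. flat n (g x))" for k
 proof (induction k arbitrary: n)
  case 0
  have "continuous_on UNIV (flat n)"
   using flat_has_derivative DERIV_isCont by (blast intro: continuous_at_imp_continuous_on)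
  then show ?case using smooth_continuous_on[OF assms] by (auto intro: continuous_on_compose2)
 next
  case (Suc k)
  show ?case
  proof (rule C_diff_SucI)
   show "((%x. flat n (g x)) has_derivative
     (%h. (flat (n + 2) (g x) + (- n) * flat (n + 1) (g x)) * frechet_derivative g (at x) h)) (at x)" for x
   proof -
    have "(flat n has_derivative (%h. (flat (n + 2) (g x) + (- n) * flat (n + 1) (g x)) * h)) (at (g x))"
     using flat_has_derivative[of n "g x"] by (simp add: has_field_derivative_def)
    from has_derivative_compose[OF smooth_derivative[OF assms] this] show ?thesis .
   qed
   show "C_diff k (%x. (flat (n + 2) (g x) + (- n) * flat (n + 1) (g x)) * frechet_derivative g (at x) h)" for h
    using smooth_frechet_derivative[OF assms]
    by (intro C_diff_bilinear[OF bounded_bilinear_mult] C_diff_add Suc.IH C_diff_const) (simp add: smooth_def)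
  qed
 qed
 then show ?thesis by (simp add: smooth_def)
qed

lemma test_functionsI:
 assumes "smooth fi" "!!x. fi x ~= 0 ==> x : K" "compact K" "K \<subseteq> Om"
 shows "fi : test_functions Om"
proof -
 have "closure {x. fi x ~= 0} \<subseteq> K"
  using assms(2) by (intro closure_minimal compact_imp_closed assms) auto
 moreover from this have "compact (closure {x. fi x ~= 0})"
  using assms(3) bounded_subset compact_imp_bounded by (simp add: compact_eq_bounded_closed) blast
 ultimately show ?thesis using assms by (auto simp: test_functions_def)
qed

lemma test_functionsE:
 assumes "fi : test_functions Om"
 obtains K where "compact K" "K \<subseteq> Om" "!!x. x ~: K ==> fi x = 0" "smooth fi"
proof (rule that[of "closure {x. fi x ~= 0}"])
 show "fi x = 0" if "x ~: closure {x. fi x ~= 0}" for x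
  using that closure_subset[of "{x. fi x ~= 0}"] by auto
qed (use assms in \<open>auto simp: test_functions_def\<close>)

lemma derivative_off_support:
 assumes "closed K" "!!x. x ~: K ==> fi x = 0" "x ~: K"
 shows "frechet_derivative fi (at x) = (%h. 0)"
proof -
 have "((%x. 0) has_derivative (%h. 0)) (at x)" by simp
 then have "(fi has_derivative (%h. 0)) (at x)"
  by (rule has_derivative_transform_within_open[where s="- K"]) (simp_all add: assms open_Compl)
 then show ?thesis by (rule frechet_derivative_at[symmetric])
qed

lemma test_derivative:
 assumes "fi : test_functions Om"
 shows "(%x. frechet_derivative fi (at x) h) : test_functions Om"
proof -
 from assms obtain K where K: "compact K" "K \<subseteq> Om" "!!x. x ~: K ==> fi x = 0" "smooth fi"
  by (rule test_functionsE) blast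
 show ?thesis
 proof (rule test_functionsI)
  show "x : K" if "frechet_derivative fi (at x) h ~= 0" for x
   using derivative_off_support[where K=K and fi=fi and x=x] compact_imp_closed[OF K(1)] K(3) that by metis
 qed (use K smooth_frechet_derivative in auto)
qed

lemma test_functions_bounded:
 fixes fi :: "'a::euclidean_space => 'b::euclidean_space"
 assumes "fi : test_functions Om"
 obtains C where "0 <= C" "!!x. norm (fi x) <= C"
proof -
 from assms obtain K where K: "compact K" "K \<subseteq> Om" "!!x. x ~: K ==> fi x = 0" "smooth fi"
  by (rule test_functionsE) blast
 have "bounded (fi ` K)"
  using K by (intro compact_imp_bounded compact_continuous_image smooth_continuous_on)
 then obtain C where C: "!!x. x : K ==> norm (fi x) <= C" by (auto simp: bounded_iff)
 show ?thesis
 proof (rule that[of "max 0 C"])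
  show "norm (fi x) <= max 0 C" for x
   using C[of x] K(3)[of x] by (cases "x : K") auto
 qed simp
qed

lemma continuous_measurable:
 "continuous_on UNIV f ==> f : borel_measurable lebesgue"
 by (rule measurable_completion) (simp add: borel_measurable_continuous_onI)

lemma compact_support_integrable:
 fixes fi :: "'a::euclidean_space => 'b::euclidean_space"
 assumes "continuous_on UNIV fi" "compact K" "!!x. x ~: K ==> fi x = 0"
 shows "integrable lebesgue fi"
proof -
 have "bounded (fi ` K)"
  using assms by (intro compact_imp_bounded compact_continuous_image) (auto intro: continuous_on_subset)
 then obtain C where C: "!!x. x : K ==> norm (fi x) <= C" by (auto simp: bounded_iff)
 have "integrable lebesgue (%x. max 0 C * indicator K x)"
  using assms(2) lmeasurable_compact[OF assms(2)]
  by (intro integrable_mult_right integrable_real_indicator) (auto simp: fmeasurable_def)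
 then show ?thesis
 proof (rule integrable_real_bound)
  show "norm (fi x) <= max 0 C * indicator K x" for x
   using C[of x] assms(3)[of x] by (cases "x : K") auto
 qed (rule continuous_measurable[OF assms(1)])
qed

lemma compact_support_sqint:
 fixes fi :: "'a::euclidean_space => 'b::euclidean_space"
 assumes "continuous_on UNIV fi" "compact K" "!!x. x ~: K ==> fi x = 0"
 shows "fi : sqint lebesgue"
proof -
 have "integrable lebesgue (%x. (norm (fi x))\<^sup>2)"
  using assms by (intro compact_support_integrable[of _ K] continuous_intros) auto
 then show ?thesis using continuous_measurable[OF assms(1)] by (simp add: sqint_def)
qed

lemma test_functions_integrable:
 fixes fi :: "'a::euclidean_space => 'b::euclidean_space"
 shows "fi : test_functions Om ==> integrable lebesgue fi"
 by (erule test_functionsE) (rule compact_support_integrable, auto intro: smooth_continuous_on)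

lemma test_functions_sqint:
 fixes fi :: "'a::euclidean_space => 'b::euclidean_space"
 shows "fi : test_functions Om ==> fi : sqint lebesgue"
 by (erule test_functionsE) (rule compact_support_sqint, auto intro: smooth_continuous_on)

lemma test_functions_mono: "fi : test_functions Om ==> Om \<subseteq> Om' ==> fi : test_functions Om'"
 by (auto simp: test_functions_def)

section \<open>Mollifiers\<close>

definition mollifier :: "real => ('a::euclidean_space => real) => bool" where
 "mollifier \<epsilon> rh \<longleftrightarrow> rh : test_functions UNIV & (\<forall>x. 0 <= rh x) & (\<forall>x. rh x ~= 0 --> norm x < \<epsilon>) \<and>
  (LINT x|lebesgue. rh x) = 1"

lemma mollifier_exists:
 assumes "0 < \<epsilon>"
 shows "\<exists>rh :: 'a::euclidean_space => real. mollifier \<epsilon> rh"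
proof -
 \<comment> \<open>Using \<open>x \<bullet> x\<close> instead of the norm keeps the argument of
   \<open>flat\<close> smooth at the origin; it is positive exactly where norm x <
   \<epsilon>.\<close>
 define \<eta> :: "'a => real" where "\<eta> x = flat 0 (\<epsilon>\<^sup>2 - x \<bullet> x)" for x
 have sm: "smooth \<eta>"
  unfolding \<eta>_def by (intro smooth_flat_comp smooth_diff smooth_const smooth_bilinear[OF bounded_bilinear_inner] smooth_id)
 have supp: "norm x < \<epsilon>" if "\<eta> x ~= 0" for x
 proof -
  have "x \<bullet> x < \<epsilon>\<^sup>2" using that by (auto simp: \<eta>_def flat_def split: if_splits)
  then show ?thesis using assms by (simp add: norm_lt_square)
 qed
 have test: "\<eta> : test_functions UNIV"
  using supp by (intro test_functionsI[where K="cball 0 \<epsilon>"] sm) (auto simp: less_imp_le)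
 have pos: "0 <= \<eta> x" for x by (simp add: \<eta>_def flat_nonneg)
 have "(LINT x|lebesgue. \<eta> x) ~= 0"
 proof
  assume "(LINT x|lebesgue. \<eta> x) = 0"
  then have "AE x in lebesgue. \<eta> x = 0"
   using integral_nonneg_eq_0_iff_AE[OF test_functions_integrable[OF test]] pos by auto
  then have "AE x in lebesgue. x ~: ball (0::'a) \<epsilon>"
  proof eventually_elim
   fix x assume "\<eta> x = 0"
   then have "\<not> x \<bullet> x < \<epsilon>\<^sup>2" by (auto simp: \<eta>_def flat_def split: if_splits)
   then show "x ~: ball (0::'a) \<epsilon>" using assms by (simp add: norm_lt_square)
  qed
  then have "ball 0 \<epsilon> : null_sets (lebesgue :: 'a measure)"
   by (subst AE_iff_null_sets) auto
  then show False
   using open_not_negligible[of "ball (0::'a) \<epsilon>"] assms by (simp add: negligible_iff_null_sets)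
 qed
 moreover have "0 <= (LINT x|lebesgue. \<eta> x)" using pos by simp
 ultimately have I: "0 < (LINT x|lebesgue. \<eta> x)" by simp
 define rh :: "'a => real" where "rh x = inverse (LINT x|lebesgue. \<eta> x) *r \<eta> x" for x
 have "rh : test_functions UNIV"
  unfolding rh_def using supp
  by (intro test_functionsI[where K="cball 0 \<epsilon>"] smooth_scaleR smooth_const sm) (auto simp: less_imp_le)
 moreover have "(LINT x|lebesgue. rh x) = 1"
  unfolding rh_def using I by simp
 moreover have "0 <= rh x" for x unfolding rh_def using I pos[of x] by simp
 moreover have "norm x < \<epsilon>" if "rh x ~= 0" for x using that supp[of x] by (auto simp: rh_def)
 ultimately have "mollifier \<epsilon> rh" unfolding mollifier_def by (intro conjI allI impI)
 then show "\<exists>rh :: 'a => real. mollifier \<epsilon> rh" by blast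
qed

section \<open>Translations and reflections of Lebesgue measure\<close>

text \<open>Translation and reflection in one statement, since convolutions need y -> x - y as well.
  For the completed measure the measurability of the map is a claim of its own.\<close>

lemma affine_invariant:
 fixes t :: "'a::euclidean_space"
 assumes "s = 1 \<or> s = -1"
 shows "distr lebesgue lebesgue (%x. t + s *r x) = lebesgue"
  and "(%x. t + s *r x) : lebesgue \<rightarrow>\<^sub>M lebesgue"
proof -
 have T: "(%x. t + (\<Sum>j\<in>Basis. (s * (x \<bullet> j)) *r j)) = (%x. t + s *r x)"
  by (simp add: fun_eq_iff scaleR_sum_right[symmetric] scaleR_scaleR[symmetric] euclidean_representation
    del: scaleR_scaleR)
 have s: "s ~= 0" using assms by auto
 have "(\<Prod>j\<in>(Basis::'a set). \<bar>s\<bar>) = 1" using assms by auto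
 then show "distr lebesgue lebesgue (%x. t + s *r x) = lebesgue"
  using lebesgue_affine_euclidean[of "%_. s" t] s by (simp add: T density_1)
 show "(%x. t + s *r x) : lebesgue \<rightarrow>\<^sub>M lebesgue"
  using lebesgue_affine_measurable[of "%_. s" t] s by (simp add: T)
qed

lemma measurable_affine:
 fixes f :: "'a::euclidean_space => 'b::topological_space" and t :: 'a
 assumes "f : borel_measurable lebesgue"
 shows "(%x. f (x + t)) : borel_measurable lebesgue"
  and "(%x. f (t - x)) : borel_measurable lebesgue"
  and "(%x. f (x - t)) : borel_measurable lebesgue"
 using measurable_compose[OF affine_invariant(2)[of 1 t] assms]
  measurable_compose[OF affine_invariant(2)[of "-1" t] assms]
  measurable_compose[OF affine_invariant(2)[of 1 "-t"] assms]
 by (simp_all add: add.commute)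

lemma AE_affine:
 fixes t :: "'a::euclidean_space"
 assumes "AE x in lebesgue. P x"
 shows "AE x in lebesgue. P (x + t)" and "AE x in lebesgue. P (t - x)"
proof -
 have "AE x in distr lebesgue lebesgue (%x. t + 1 *r x). P x"
  using assms by (subst affine_invariant(1)) auto
 from AE_distrD[OF affine_invariant(2)[of 1 t] this]
 show "AE x in lebesgue. P (x + t)" by (simp add: add.commute)
 have "AE x in distr lebesgue lebesgue (%x. t + (-1) *r x). P x"
  using assms by (subst affine_invariant(1)) auto
 from AE_distrD[OF affine_invariant(2)[of "-1" t] this]
 show "AE x in lebesgue. P (t - x)" by simp
qed

lemma integrable_affine:
 fixes f :: "'a::euclidean_space => 'b::{banach, second_countable_topology}" and t :: 'a
 assumes "integrable lebesgue f"
 shows "integrable lebesgue (%x. f (x + t))" and "integrable lebesgue (%x. f (t - x))"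
proof -
 have "integrable lebesgue (%x. f (t + s *r x))" if "s = 1 \<or> s = -1" for s
  using integrable_distr[OF affine_invariant(2)[OF that, of t], of f] assms
   affine_invariant(1)[OF that, of t] by simp
 from this[of 1] this[of "-1"]
 show "integrable lebesgue (%x. f (x + t))" "integrable lebesgue (%x. f (t - x))"
  by (simp_all add: add.commute)
qed

lemma integral_affine:
 fixes f :: "'a::euclidean_space => 'b::{banach, second_countable_topology}" and t :: 'a
 shows "(LINT x|lebesgue. f (x + t)) = (LINT x|lebesgue. f x)"
  and "(LINT x|lebesgue. f (t - x)) = (LINT x|lebesgue. f x)"
proof -
 have meas: "(LINT x|lebesgue. f (t + s *r x)) = (LINT x|lebesgue. f x)"
  if f: "f : borel_measurable lebesgue" and s: "s = 1 \<or> s = -1" for f :: "'a => 'b" and s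
  using integral_distr[OF affine_invariant(2)[OF s, of t] f] affine_invariant(1)[OF s, of t] by simp
 show "(LINT x|lebesgue. f (x + t)) = (LINT x|lebesgue. f x)"
 proof (cases "integrable lebesgue f")
  case True
  then show ?thesis using meas[of f 1] by (simp add: add.commute)
 next
  \<comment> \<open>If f is not integrable, neither is its translate, and both integrals take the
    default value 0.\<close>
  case False
  then have "\<not> integrable lebesgue (%x. f (x + t))" using integrable_affine(1)[of "%x. f (x + t)" "-t"] by auto
  with False show ?thesis by (simp add: not_integrable_integral_eq)
 qed
 show "(LINT x|lebesgue. f (t - x)) = (LINT x|lebesgue. f x)"
 proof (cases "integrable lebesgue f")
  case True
  then show ?thesis using meas[of f "-1"] by simp
 next
  case False
  then have "\<not> integrable lebesgue (%x. f (t - x))" using integrable_affine(2)[of "%x. f (t - x)" "t"] by auto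
  with False show ?thesis by (simp add: not_integrable_integral_eq)
 qed
qed

lemma sqint_affine:
 fixes f :: "'a::euclidean_space => 'b::euclidean_space" and t :: 'a
 assumes "f : sqint lebesgue"
 shows "(%x. f (x + t)) : sqint lebesgue" "(%x. f (t - x)) : sqint lebesgue"
  "(%x. f (x - t)) : sqint lebesgue"
 using sqintD[OF assms] integrable_affine[of "%x. (norm (f x))\<^sup>2" t] integrable_affine(1)[of "%x. (norm (f x))\<^sup>2" "-t"]
  measurable_affine[of f t]
 by (auto simp: sqint_def)

lemma l2norm_affine:
 fixes f :: "'a::euclidean_space => 'b::euclidean_space" and t :: 'a
 shows "l2norm lebesgue (%x. f (x + t)) = l2norm lebesgue f"
  "l2norm lebesgue (%x. f (x - t)) = l2norm lebesgue f"
 using integral_affine(1)[of "%x. (norm (f x))\<^sup>2" t] integral_affine(1)[of "%x. (norm (f x))\<^sup>2" "-t"]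
 by (auto simp: l2norm_def)

section \<open>Density of continuous functions and continuity of translations in L2\<close>

lemma l2_dominated_convergence:
 fixes f :: "nat => 'a => 'b::euclidean_space"
 assumes f: "!!k. f k : borel_measurable M" and g: "g : borel_measurable M"
  and w: "integrable M (%x. (w x)\<^sup>2)"
  and lim: "AE x in M. (%k. f k x) ~> g x"
  and bnd: "!!k x. norm (f k x) <= w x"
 shows "g : sqint M" "(%k. l2norm M (%x. f k x - g x)) ~> 0"
proof -
 have gb: "AE x in M. norm (g x) <= w x"
  using lim by eventually_elim (rule LIMSEQ_le_const2[OF tendsto_norm], auto intro: bnd)
 have "integrable M (%x. (norm (g x))\<^sup>2)"
 proof (rule Bochner_Integration.integrable_bound[OF w])
  show "AE x in M. norm ((norm (g x))\<^sup>2) <= norm ((w x)\<^sup>2)"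
   using gb by eventually_elim (simp add: power_mono)
 qed (use g in measurable)
 then show "g : sqint M" using g by (simp add: sqint_def)
 have "(%k. LINT x|M. (norm (f k x - g x))\<^sup>2) ~> (LINT x|M. 0)"
 proof (rule integral_dominated_convergence[where w="%x. 4 * (w x)\<^sup>2"])
  show "AE x in M. (%k. (norm (f k x - g x))\<^sup>2) ~> 0"
   using lim
  proof eventually_elim
   fix x assume "(%k. f k x) ~> g x"
   then have "(%k. (norm (f k x - g x))\<^sup>2) ~> (norm (g x - g x))\<^sup>2" by (intro tendsto_intros)
   then show "(%k. (norm (f k x - g x))\<^sup>2) ~> 0" by simp
  qed
  show "AE x in M. norm ((norm (f k x - g x))\<^sup>2) <= 4 * (w x)\<^sup>2" for k
   using gb
  proof eventually_elim
   fix x assume "norm (g x) <= w x"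
   then have "norm (f k x - g x) <= 2 * w x"
    using bnd[of k x] norm_triangle_ineq4[of "f k x" "g x"] by linarith
   then have "(norm (f k x - g x))\<^sup>2 <= (2 * w x)\<^sup>2" by (rule power_mono) simp
   then show "norm ((norm (f k x - g x))\<^sup>2) <= 4 * (w x)\<^sup>2" by (simp add: power_mult_distrib)
  qed
 qed (use f g w in \<open>simp_all add: borel_measurable_diff\<close>)
 then show "(%k. l2norm M (%x. f k x - g x)) ~> 0"
  by (simp add: l2norm_sq_tendsto_0_iff)
qed

lemma integrable_cball:
 fixes a :: "'a::euclidean_space" and C :: real
 shows "integrable lebesgue (%x. C * indicator (cball a R) x)"
  and "integrable lebesgue (%x. (C * indicator (cball a R) x)\<^sup>2)"
proof -
 have *: "integrable lebesgue (%x. c * indicator (cball a R) x)" for c :: real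
 proof (rule integrable_mult_right)
  show "integrable lebesgue (indicat_real (cball a R))"
   by (rule integrable_real_indicator) (use lmeasurable_cball[of a R] in \<open>auto simp: fmeasurable_def\<close>)
 qed
 then show "integrable lebesgue (%x. C * indicator (cball a R) x)" .
 have "(%x. (C * indicator (cball a R) x)\<^sup>2) = (%x. C\<^sup>2 * indicator (cball a R) x)"
  by (auto simp: indicator_def)
 then show "integrable lebesgue (%x. (C * indicator (cball a R) x)\<^sup>2)" using * by simp
qed

text \<open>Truncate in the domain and in the range, approximate the truncation almost everywhere by
  continuous functions, and force the approximants into the same bounds.\<close>

lemma continuous_dense:
 fixes f :: "'a::euclidean_space => 'b::euclidean_space"
 assumes f: "f : sqint lebesgue" and e: "0 < e"
 shows "\<exists>g R. continuous_on UNIV g & (\<forall>x. x ~: cball 0 R --> g x = 0) & g : sqint lebesgue \<and>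
  l2norm lebesgue (%x. f x - g x) < e"
proof -
 note fm = sqintD(1)[OF f]
 define T where "T n = {x. norm x <= real n & norm (f x) <= real n}" for n
 have T: "T n : sets lebesgue" for n
 proof -
  have "(%x::'a. norm x) : borel_measurable lebesgue"
   by (intro continuous_measurable continuous_intros)
  then have a: "{x : space lebesgue. norm (x::'a) <= real n} : sets lebesgue" by measurable
  have b: "{x : space lebesgue. norm (f x) <= real n} : sets lebesgue" using fm by measurable
  have "T n = {x : space lebesgue. norm x <= real n} \<inter> {x : space lebesgue. norm (f x) <= real n}"
   by (auto simp: T_def)
  then show ?thesis using sets.Int[OF a b] by (simp only:)
 qed
 define F where "F n x = indicator (T n) x *r f x" for n x
 have Fm: "F n : borel_measurable lebesgue" for n
  unfolding F_def using T fm by (intro borel_measurable_scaleR borel_measurable_indicator) auto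
 have "(%n. l2norm lebesgue (%x. F n x - f x)) ~> 0"
 proof (rule l2_dominated_convergence(2)[where w="%x. norm (f x)"])
  show "AE x in lebesgue. (%k. F k x) ~> f x"
  proof (rule AE_I2)
   fix x
   obtain N :: nat where "max (norm x) (norm (f x)) <= N" using real_arch_simple by blast
   then have "\<forall>n\<ge>N. F n x = f x" by (auto simp: F_def T_def indicator_def)
   then show "(%k. F k x) ~> f x"
    by (intro tendsto_eventually) (auto simp: eventually_sequentially)
  qed
  show "norm (F k x) <= norm (f x)" for k x by (auto simp: F_def indicator_def)
 qed (use Fm fm sqintD(2)[OF f] in auto)
 from LIMSEQ_D[OF this, of "e/2"] e obtain n where n: "l2norm lebesgue (%x. F n x - f x) < e / 2" by auto
 have Fs: "F n : sqint lebesgue" by (rule sqint_dominated[OF f Fm, where C=1]) (auto simp: F_def indicator_def)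
 have Fb: "norm (F n x) <= n" for x by (auto simp: F_def T_def indicator_def)
 have Fz: "F n x = 0" if "norm x > n" for x using that by (auto simp: F_def T_def indicator_def)
 have "F n measurable_on UNIV" using Fm by (intro lebesgue_measurable_imp_measurable_on) auto
 then obtain N g where N: "negligible N" and g: "!!k. continuous_on UNIV (g k)"
  and lim: "!!x. x ~: N ==> (%k. g k x) ~> F n x"
  unfolding measurable_on_def by auto
 \<comment> \<open>The approximants converge only pointwise off a null set. Projecting their values
   to the ball of radius n and multiplying with a cut-off gives them a common bound of compact
   support; the limit is unchanged because \<open>F n\<close> has norm at most n and vanishes
   outside the ball of radius n, where c is 1.\<close>
 define c where "c x = max 0 (min 1 (real n + 1 - norm x))" for x :: 'a
 define G where "G k x = c x *r closest_point (cball 0 (real n)) (g k x)" for k x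
 have Gc: "continuous_on UNIV (G k)" for k
 proof -
  have "continuous_on UNIV (%x. closest_point (cball 0 (real n)) (g k x))"
   by (rule continuous_on_compose2[OF continuous_on_closest_point g]) auto
  then show ?thesis unfolding G_def c_def by (intro continuous_intros)
 qed
 have cpn: "norm (closest_point (cball 0 (real n)) y) <= n" for y :: 'b
  using closest_point_in_set[of "cball 0 (real n)" y] by (simp add: dist_norm)
 have cb: "0 <= c x" "c x <= 1" for x by (auto simp: c_def)
 have Gz: "G k x = 0" if "x ~: cball 0 (real n + 1)" for k x using that by (simp add: G_def c_def)
 have Gb: "norm (G k x) <= real n * indicator (cball 0 (real n + 1)) x" for k x
 proof (cases "x : cball 0 (real n + 1)")
  case True
  have "norm (G k x) <= 1 * real n"
   unfolding G_def norm_scaleR using cb cpn by (intro mult_mono) auto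
  with True show ?thesis by simp
 qed (use Gz in simp)
 have "(%k. l2norm lebesgue (%x. G k x - F n x)) ~> 0"
 proof (rule l2_dominated_convergence(2)[where w="%x. real n * indicator (cball 0 (real n + 1)) x"])
  show "integrable lebesgue (%x::'a. (real n * indicator (cball 0 (real n + 1)) x)\<^sup>2)"
   by (rule integrable_cball)
  have "AE x in lebesgue. x ~: N" using N by (simp add: AE_not_in negligible_iff_null_sets)
  then show "AE x in lebesgue. (%k. G k x) ~> F n x"
  proof eventually_elim
   fix x assume "x ~: N"
   from lim[OF this] have "(%k. closest_point (cball 0 (real n)) (g k x)) ~> closest_point (cball 0 (real n)) (F n x)"
    by (rule isCont_tendsto_compose[rotated]) (intro continuous_at_closest_point, auto)
   moreover have "closest_point (cball 0 (real n)) (F n x) = F n x"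
    by (rule closest_point_self) (use Fb[of x] in simp)
   moreover have "c x *r F n x = F n x"
    by (cases "norm x > n") (auto simp: Fz c_def)
   ultimately show "(%k. G k x) ~> F n x"
    unfolding G_def using tendsto_scaleR[OF tendsto_const[of "c x"], of "%k. closest_point (cball 0 (real n)) (g k x)" "F n x"] by simp
  qed
 qed (use Gc continuous_measurable Fm Gb in blast)+
 from LIMSEQ_D[OF this, of "e/2"] e obtain k where k: "l2norm lebesgue (%x. G k x - F n x) < e / 2" by auto
 have Gs: "G k : sqint lebesgue"
  by (rule compact_support_sqint[OF Gc compact_cball Gz])
 have "l2norm lebesgue (%x. f x - G k x) <= l2norm lebesgue (%x. f x - F n x) + l2norm lebesgue (%x. F n x - G k x)"
  by (rule l2norm_diff_triangle[OF f Fs Gs])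
 also have "... < e" using n k l2norm_commute[of lebesgue "F n" f] l2norm_commute[of lebesgue "F n" "G k"] by linarith
 finally show ?thesis using Gc Gz Gs by blast
qed

text \<open>By density it suffices to shift a continuous g of compact support. A null sequence of
  shifts is bounded, so all shifted copies live in one ball and are dominated there.\<close>

lemma l2_translation_continuous:
 fixes f :: "'a::euclidean_space => 'b::euclidean_space"
 assumes f: "f : sqint lebesgue"
 shows "((%h. l2norm lebesgue (%x. f (x - h) - f x)) \<longlongrightarrow> 0) (at 0)"
 unfolding tendsto_at_iff_sequentially o_def
proof (intro allI impI)
 fix H :: "nat => 'a" assume "\<forall>i. H i : UNIV - {0}" and H: "H ~> 0"
 show "(%k. l2norm lebesgue (%x. f (x - H k) - f x)) ~> 0"
 proof (rule LIMSEQ_I)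
  fix e :: real assume e: "0 < e"
  then obtain g R where g: "continuous_on UNIV g" "!!x. x ~: cball 0 R ==> g x = 0" "g : sqint lebesgue"
   and fg: "l2norm lebesgue (%x. f x - g x) < e / 3"
   using continuous_dense[OF f, of "e/3"] by auto
  have "bounded (range H)" using H convergent_imp_bounded by blast
  then obtain r where r: "!!k. norm (H k) <= r" by (auto simp: bounded_iff)
  have "bounded (g ` cball 0 R)"
   by (intro compact_imp_bounded compact_continuous_image continuous_on_subset[OF g(1)]) auto
  then obtain C0 where C0: "!!x. x : cball 0 R ==> norm (g x) <= C0" unfolding bounded_iff by blast
  define C where "C = max 0 C0"
  have C: "norm (g x) <= C" for x using C0[of x] g(2)[of x] by (cases "x : cball 0 R") (auto simp: C_def)
  have C_nonneg: "0 <= C" by (simp add: C_def)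
  have "(%k. l2norm lebesgue (%x. g (x - H k) - g x)) ~> 0"
  proof (rule l2_dominated_convergence(2)[where w="%x. C * indicator (cball 0 (R + r)) x"])
   show "norm (g (x - H k)) <= C * indicator (cball 0 (R + r)) x" for k x
   proof (cases "x : cball 0 (R + r)")
    case False
    then have "norm x > R + r" by simp
    then have "norm (x - H k) > R" using r[of k] norm_triangle_ineq2[of x "H k"] by linarith
    then show ?thesis using g(2) C_nonneg by simp
   qed (use C in simp)
   show "integrable lebesgue (%x::'a. (C * indicator (cball 0 (R + r)) x)\<^sup>2)"
    by (rule integrable_cball)
   show "AE x in lebesgue. (%k. g (x - H k)) ~> g x"
   proof (rule AE_I2)
    fix x
    have "(%k. x - H k) ~> x - 0" by (intro tendsto_intros H)
    then show "(%k. g (x - H k)) ~> g x"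
     using g(1) by (intro isCont_tendsto_compose[of x g]) (auto simp: continuous_on_eq_continuous_at)
   qed
   show "(%x. g (x - H k)) : borel_measurable lebesgue" for k
    using continuous_measurable[OF g(1)] by (rule measurable_affine(3))
  qed (use continuous_measurable[OF g(1)] in simp)
  from LIMSEQ_D[OF this, of "e/3"] e obtain N where
   N: "!!k. k \<ge> N ==> l2norm lebesgue (%x. g (x - H k) - g x) < e / 3" by auto
  have "l2norm lebesgue (%x. f (x - H k) - f x) < e" if "k \<ge> N" for k
  proof -
   have "l2norm lebesgue (%x. f (x - H k) - f x)
     <= l2norm lebesgue (%x. f (x - H k) - g (x - H k)) + l2norm lebesgue (%x. g (x - H k) - f x)"
    by (rule l2norm_diff_triangle) (intro sqint_affine f g(3))+
   also have "l2norm lebesgue (%x. f (x - H k) - g (x - H k)) = l2norm lebesgue (%x. f x - g x)"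
    by (rule l2norm_affine(2)[of "%x. f x - g x"])
   also have "l2norm lebesgue (%x. g (x - H k) - f x)
     <= l2norm lebesgue (%x. g (x - H k) - g x) + l2norm lebesgue (%x. g x - f x)"
    by (rule l2norm_diff_triangle) (intro sqint_affine f g(3))+
   finally show ?thesis using N[OF that] fg by (simp add: l2norm_commute[of lebesgue g f])
  qed
  then show "\<exists>no. \<forall>n\<ge>no. norm (l2norm lebesgue (%x. f (x - H n) - f x) - 0) < e" by auto
 qed
qed

section \<open>Convolution with test functions\<close>

text \<open>Wide enough for square integrable functions and for the constant 1, whose convolution
  yields that derivatives of test functions integrate to zero.\<close>

definition locally_integrable :: "('a::euclidean_space => 'b::euclidean_space) => bool" where
 "locally_integrable f \<longleftrightarrow> f : borel_measurable lebesgue \<and>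
  (\<forall>R. integrable lebesgue (%x. indicator (cball 0 R) x *r f x))"

definition conv :: "('a::euclidean_space => real) => ('a => 'b::euclidean_space) => 'a => 'b" where
 "conv rh f x = (LINT y|lebesgue. rh (x - y) *r f y)"

lemma sqint_locally:
 assumes "f : sqint lebesgue"
 shows "locally_integrable f"
 unfolding locally_integrable_def
proof (intro conjI allI)
 show fm: "f : borel_measurable lebesgue" by (rule sqintD[OF assms])
 fix R
 have "integrable lebesgue (%x. 1 * indicator (cball 0 R) x + (norm (f x))\<^sup>2)"
  by (intro Bochner_Integration.integrable_add integrable_cball sqintD[OF assms])
 then show "integrable lebesgue (%x. indicator (cball 0 R) x *r f x)"
 proof (rule integrable_real_bound)
  have "t <= 1 + t\<^sup>2" for t :: real
   using zero_le_power2[of "t - 1/2"] by (simp add: power2_eq_square algebra_simps)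
  then show "norm (indicator (cball 0 R) x *r f x) <= 1 * indicator (cball 0 R) x + (norm (f x))\<^sup>2" for x
   by (auto simp: indicator_def)
 qed (intro borel_measurable_scaleR borel_measurable_indicator fm, simp)
qed

lemma locally_integrable_mult:
 fixes f :: "'a::euclidean_space => 'b::euclidean_space"
 assumes f: "locally_integrable f" and g: "g : borel_measurable lebesgue"
  and b: "!!y. \<bar>g y\<bar> <= C * indicator (cball 0 R) y"
 shows "integrable lebesgue (%y. g y *r f y)"
proof (rule integrable_real_bound)
 show "integrable lebesgue (%y. C * norm (indicator (cball 0 R) y *r f y))"
  using f by (intro integrable_mult_right integrable_norm) (simp add: locally_integrable_def)
 show "norm (g y *r f y) <= C * norm (indicator (cball 0 R) y *r f y)" for y
  using mult_right_mono[OF b[of y] norm_ge_zero[of "f y"]] by (simp add: mult.assoc)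
 show "(%y. g y *r f y) : borel_measurable lebesgue"
  using f g by (intro borel_measurable_scaleR) (simp_all add: locally_integrable_def)
qed

lemma test_function_reflect_bound:
 fixes rh :: "'a::euclidean_space => real"
 assumes "rh : test_functions UNIV"
 obtains C R where "0 <= C" "0 <= R" "!!x y r. norm x <= r ==> \<bar>rh (x - y)\<bar> <= C * indicator (cball 0 (r + R)) y"
proof -
 obtain C where C: "0 <= C" "!!x. norm (rh x) <= C" using test_functions_bounded[OF assms] by blast
 obtain K where K: "compact K" "!!x. x ~: K ==> rh x = 0" using test_functionsE[OF assms] by metis
 obtain R where R: "!!x. x : K ==> norm x <= R" using compact_imp_bounded[OF K(1)] by (auto simp: bounded_iff)
 have "\<bar>rh (x - y)\<bar> <= C * indicator (cball 0 (r + max 0 R)) y" if "norm x <= r" for x y r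
 proof (cases "x - y : K")
  case True
  have "norm y <= norm x + norm (x - y)" using norm_triangle_ineq4[of x "x - y"] by simp
  then have "norm y <= r + max 0 R" using R[OF True] that by linarith
  then show ?thesis using C(2)[of "x - y"] by simp
 next
  case False
  with K(2) C(1) show ?thesis by simp
 qed
 with C(1) show ?thesis by (intro that[of C "max 0 R"]) auto
qed

lemma conv_integrable:
 assumes "rh : test_functions UNIV" "locally_integrable f"
 shows "integrable lebesgue (%y. rh (x - y) *r f y)"
proof -
 obtain C R where *: "!!x y r. norm x <= r ==> \<bar>rh (x - y)\<bar> <= C * indicator (cball 0 (r + R)) y"
  using test_function_reflect_bound[OF assms(1)] by metis
 show ?thesis
 proof (rule locally_integrable_mult[OF assms(2)])
  show "\<bar>rh (x - y)\<bar> <= C * indicator (cball 0 (norm x + R)) y" for y by (rule *) simp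
  have "continuous_on UNIV rh" using assms(1) by (auto simp: test_functions_def smooth_continuous_on)
  then show "(%y. rh (x - y)) : borel_measurable lebesgue"
   by (rule measurable_affine[OF continuous_measurable])
 qed
qed

lemma test_functions_lipschitz:
 fixes rh :: "'a::euclidean_space => real"
 assumes "rh : test_functions UNIV"
 obtains C where "0 <= C" "!!x h. \<bar>frechet_derivative rh (at x) h\<bar> <= C * norm h"
  "!!x y. \<bar>rh y - rh x\<bar> <= C * norm (y - x)"
proof -
 have sm: "smooth rh" using assms by (simp add: test_functions_def)
 have "\<exists>c. \<forall>x. \<bar>frechet_derivative rh (at x) b\<bar> <= c" for b
  using test_functions_bounded[OF test_derivative[OF assms, of b]] real_norm_def by metis
 then obtain c where c: "!!b x. \<bar>frechet_derivative rh (at x) b\<bar> <= c b" by metis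
 define C where "C = (\<Sum>b\<in>Basis. c b)"
 have c0: "0 <= c b" for b using c[of 0 b] abs_ge_zero order_trans by blast
 have C: "\<bar>frechet_derivative rh (at x) h\<bar> <= C * norm h" for x h
 proof -
  interpret D: bounded_linear "frechet_derivative rh (at x)" by (rule linear_derivative[OF sm])
  have "frechet_derivative rh (at x) h = frechet_derivative rh (at x) (\<Sum>b\<in>Basis. (h \<bullet> b) *r b)"
   by (simp add: euclidean_representation)
  also have "... = (\<Sum>b\<in>Basis. (h \<bullet> b) * frechet_derivative rh (at x) b)"
   by (simp add: D.sum D.scaleR)
  also have "\<bar>...\<bar> <= (\<Sum>b\<in>Basis. norm h * c b)"
   by (rule order_trans[OF sum_abs], rule sum_mono)
    (auto simp: abs_mult intro!: mult_mono c norm_ge_zero Basis_le_norm)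
  finally show ?thesis by (simp add: C_def sum_distrib_left mult.commute)
 qed
 show ?thesis
 proof (rule that[OF _ C])
  show "0 <= C" unfolding C_def by (intro sum_nonneg c0)
  show "\<bar>rh y - rh x\<bar> <= C * norm (y - x)" for x y
  proof -
   have "norm (rh y - rh x) <= C * norm (y - x)"
   proof (rule differentiable_bound[of UNIV rh "%x. frechet_derivative rh (at x)"])
    show "onorm (frechet_derivative rh (at x)) <= C" for x
     using C[of x] by (intro onorm_le) simp
   qed (use smooth_derivative[OF sm] in auto)
   then show ?thesis by simp
  qed
 qed
qed

text \<open>The derivative falls on the test function. The normalised remainders of its first-order
  expansion are bounded by twice a Lipschitz constant and vanish outside one ball, so dominated
  convergence applies to merely locally integrable f.\<close>

lemma conv_has_derivative:
 fixes f :: "'a::euclidean_space => 'b::euclidean_space"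
 assumes rh: "rh : test_functions UNIV" and f: "locally_integrable f"
 shows "(conv rh f has_derivative (%h. conv (%z. frechet_derivative rh (at z) h) f x)) (at x)"
 unfolding has_derivative_iff_norm
proof
 have sm: "smooth rh" using rh by (simp add: test_functions_def)
 define D where "D z h = frechet_derivative rh (at z) h" for z h
 have Dt: "(%z. D z h) : test_functions UNIV" for h
  unfolding D_def by (rule test_derivative[OF rh])
 have Dlin: "bounded_linear (D z)" for z unfolding D_def by (rule linear_derivative[OF sm])
 note int_D = conv_integrable[OF Dt f]
 have "linear (%h. conv (%z. D z h) f x)"
 proof (rule linearI)
  fix b1 b2 :: 'a and r :: real
  interpret bounded_linear "D z" for z by (rule Dlin)
  show "conv (%z. D z (b1 + b2)) f x = conv (%z. D z b1) f x + conv (%z. D z b2) f x"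
   unfolding conv_def by (simp add: add scaleR_add_left int_D)
  show "conv (%z. D z (r *r b1)) f x = r *r conv (%z. D z b1) f x"
   unfolding conv_def by (simp add: scaleR flip: integral_scaleR_right scaleR_scaleR)
 qed
 then show "bounded_linear (%h. conv (%z. frechet_derivative rh (at z) h) f x)"
  unfolding D_def by (simp add: linear_conv_bounded_linear)
 obtain C where C: "0 <= C" "!!x h. \<bar>D x h\<bar> <= C * norm h" "!!x y. \<bar>rh y - rh x\<bar> <= C * norm (y - x)"
  using test_functions_lipschitz[OF rh] unfolding D_def by metis
 obtain K where K: "compact K" "!!x. x ~: K ==> rh x = 0" using test_functionsE[OF rh] by metis
 obtain R where R: "!!x. x : K ==> norm x <= R" using compact_imp_bounded[OF K(1)] by (auto simp: bounded_iff)
 have Dz: "D z h = 0" if "z ~: K" for z h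
  unfolding D_def using derivative_off_support[where K=K and fi=rh and x=z] K compact_imp_closed that
  by metis
 have "((%y. norm (conv rh f y - conv rh f x - conv (%z. D z (y - x)) f x) / norm (y - x)) \<longlongrightarrow> 0) (at x)"
  unfolding tendsto_at_iff_sequentially o_def
 proof (intro allI impI)
  fix Y :: "nat => 'a" assume Yx: "\<forall>i. Y i : UNIV - {x}" and Y: "Y ~> x"
  obtain r where r: "!!k. norm (Y k) <= r" using convergent_imp_bounded[OF Y] by (auto simp: bounded_iff)
  have rx: "norm x <= r" by (rule LIMSEQ_le_const2[OF tendsto_norm[OF Y]]) (auto intro: r)
  define q where "q k y = (rh (Y k - y) - rh (x - y) - D (x - y) (Y k - x)) / norm (Y k - x)" for k y
  have qb: "\<bar>q k y\<bar> <= (2 * C) * indicator (cball 0 (r + R)) y" for k y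
  proof (cases "y : cball 0 (r + R)")
   case True
   have "\<bar>rh (Y k - y) - rh (x - y) - D (x - y) (Y k - x)\<bar> <= 2 * C * norm (Y k - x)"
   proof -
    have "\<bar>rh (Y k - y) - rh (x - y)\<bar> <= C * norm (Y k - x)" using C(3)[of "Y k - y" "x - y"] by simp
    then show ?thesis using C(2)[of "x - y" "Y k - x"] by linarith
   qed
   then show ?thesis using True Yx by (simp add: q_def field_simps)
  next
   case False
   then have "r + R < norm y" by simp
   then have "norm (Y k - y) > R" "norm (x - y) > R"
    using r[of k] rx norm_triangle_ineq2[of y "Y k"] norm_triangle_ineq2[of y x]
    by (auto simp: norm_minus_commute)
   then have "Y k - y ~: K" "x - y ~: K" using R by (meson not_le)+
   then show ?thesis using K(2) Dz False by (simp add: q_def)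
  qed
  have rhm: "rh : borel_measurable lebesgue" by (intro continuous_measurable smooth_continuous_on sm)
  have Dm: "(%z. D z h) : borel_measurable lebesgue" for h
   using Dt by (intro continuous_measurable smooth_continuous_on) (simp add: test_functions_def)
  have qm: "q k : borel_measurable lebesgue" for k
   unfolding q_def
   by (intro borel_measurable_divide borel_measurable_diff measurable_affine(2)[OF rhm]
     measurable_affine(2)[OF Dm] borel_measurable_const)
  have ql: "(%k. q k y) ~> 0" for y
  proof -
   have "((%z. \<bar>rh z - rh (x - y) - D (x - y) (z - (x - y))\<bar> / norm (z - (x - y))) \<longlongrightarrow> 0) (at (x - y))"
    using smooth_derivative[OF sm, of "x - y"] by (simp add: has_derivative_iff_norm D_def)
   moreover have "filterlim (%k. Y k - y) (at (x - y)) sequentially"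
    unfolding filterlim_at using Yx Y by (auto intro!: tendsto_intros always_eventually)
   ultimately have "(%k. \<bar>rh (Y k - y) - rh (x - y) - D (x - y) (Y k - y - (x - y))\<bar> / norm (Y k - y - (x - y))) ~> 0"
    by (rule filterlim_compose)
   then have "(%k. \<bar>q k y\<bar>) ~> 0" by (simp add: q_def abs_divide)
   then show ?thesis by (rule tendsto_rabs_zero_cancel)
  qed
  have "(%k. LINT y|lebesgue. q k y *r f y) ~> (LINT y::'a|lebesgue. 0)"
  proof (rule integral_dominated_convergence[where w="%y. 2 * C * norm (indicator (cball 0 (r + R)) y *r f y)"])
   show "integrable lebesgue (%y. 2 * C * norm (indicator (cball 0 (r + R)) y *r f y))"
    using f by (intro integrable_mult_right integrable_norm) (simp add: locally_integrable_def)
   show "AE y in lebesgue. norm (q k y *r f y) <= 2 * C * norm (indicator (cball 0 (r + R)) y *r f y)" for k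
   proof (rule AE_I2)
    fix y show "norm (q k y *r f y) <= 2 * C * norm (indicator (cball 0 (r + R)) y *r f y)"
     using mult_right_mono[OF qb[of k y] norm_ge_zero[of "f y"]] by (simp add: mult.assoc)
   qed
   show "AE y in lebesgue. (%k. q k y *r f y) ~> 0"
    using tendsto_scaleR[OF ql tendsto_const] by (intro AE_I2) simp
   show "(%y. q k y *r f y) : borel_measurable lebesgue" for k
    using qm f by (intro borel_measurable_scaleR) (simp_all add: locally_integrable_def)
  qed simp
  then have "(%k. norm (LINT y|lebesgue. q k y *r f y)) ~> 0" by (simp add: tendsto_norm_zero_iff)
  moreover have "norm (LINT y|lebesgue. q k y *r f y)
    = norm (conv rh f (Y k) - conv rh f x - conv (%z. D z (Y k - x)) f x) / norm (Y k - x)" for k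
  proof -
   have "(%y. q k y *r f y) = (%y. inverse (norm (Y k - x)) *\<^sub>R
     (rh (Y k - y) *r f y - rh (x - y) *r f y - D (x - y) (Y k - x) *r f y))"
    by (simp add: q_def fun_eq_iff divide_inverse scaleR_diff_left mult.commute flip: scaleR_scaleR)
   then show ?thesis
    by (simp add: conv_def conv_integrable[OF rh f] int_D divide_inverse)
  qed
  ultimately show "(%k. norm (conv rh f (Y k) - conv rh f x - conv (%z. D z (Y k - x)) f x) / norm (Y k - x)) ~> 0"
   by simp
 qed
 then show "((%y. norm (conv rh f y - conv rh f x - conv (%z. frechet_derivative rh (at z) (y - x)) f x) / norm (y - x)) \<longlongrightarrow> 0) (at x)"
  by (simp add: D_def)
qed

lemma frechet_derivative_conv:
 assumes "rh : test_functions UNIV" "locally_integrable f"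
 shows "frechet_derivative (conv rh f) (at x) h = conv (%z. frechet_derivative rh (at z) h) f x"
 using frechet_derivative_at[OF conv_has_derivative[OF assms]] by metis

text \<open>A derivative of a convolution is again a convolution with a test function, so the
  induction runs with \<open>rh\<close> arbitrary.\<close>

lemma smooth_conv:
 assumes "rh : test_functions UNIV" "locally_integrable f"
 shows "smooth (conv rh f)"
proof -
 have "C_diff k (conv rh f)" for k
  using assms(1)
 proof (induction k arbitrary: rh)
  case 0
  have "isCont (conv rh f) x" for x
   by (rule has_derivative_continuous[OF conv_has_derivative[OF 0 assms(2)]])
  then show ?case by (simp add: continuous_at_imp_continuous_on)
 next
  case (Suc k)
  show ?case
   by (rule C_diff_SucI[OF conv_has_derivative[OF Suc.prems assms(2)]])
    (rule Suc.IH[OF test_derivative[OF Suc.prems]])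
 qed
 then show ?thesis by (simp add: smooth_def)
qed

section \<open>Restriction of Lebesgue measure to subsets\<close>

lemma lebesgue_on_Int: "Om : sets lebesgue ==> Om \<inter> space lebesgue : sets lebesgue"
 by simp

lemmas integral_leb_on = integral_restrict_space[OF lebesgue_on_Int]

lemmas integrable_leb_on = integrable_restrict_space[OF lebesgue_on_Int]

lemmas measurable_leb_on = borel_measurable_restrict_space_iff[OF lebesgue_on_Int]

lemmas AE_leb_on = AE_restrict_space_iff[OF lebesgue_on_Int]

lemma indicator_norm_sq: "indicator Om x *r (norm v)\<^sup>2 = (norm (indicator Om x *r v))\<^sup>2"
 by (auto simp: indicator_def)

lemma sqint_restrict_iff:
 assumes "Om : sets lebesgue"
 shows "f : sqint (lebesgue_on Om) \<longleftrightarrow> (%x. indicator Om x *r f x) : sqint lebesgue"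
 by (simp only: sqint_def mem_Collect_eq integrable_leb_on[OF assms] measurable_leb_on[OF assms]
   indicator_norm_sq)

lemma l2norm_restrict:
 assumes "Om : sets lebesgue"
 shows "l2norm (lebesgue_on Om) f = l2norm lebesgue (%x. indicator Om x *r f x)"
 by (simp only: l2norm_def integral_leb_on[OF assms] indicator_norm_sq)

lemma l2inner_restrict:
 assumes "Om : sets lebesgue"
 shows "l2inner (lebesgue_on Om) f g = l2inner lebesgue (%x. indicator Om x *r f x) g"
 by (simp add: l2inner_def integral_leb_on[OF assms])

lemma sqint_subset:
 assumes "f : sqint (lebesgue_on Om)" "Om : sets lebesgue" "Om' : sets lebesgue" "Om' \<subseteq> Om"
 shows "f : sqint (lebesgue_on Om')" "l2norm (lebesgue_on Om') f <= l2norm (lebesgue_on Om) f"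
proof -
 let ?F = "%Om x. indicator Om x *r f x"
 have F: "?F Om : sqint lebesgue" using assms by (simp add: sqint_restrict_iff)
 have eq: "?F Om' = (%x. indicator Om' x *r ?F Om x)" using assms(4) by (auto simp: indicator_def fun_eq_iff)
 have m: "?F Om' : borel_measurable lebesgue"
  unfolding eq by (rule borel_measurable_scaleR[OF borel_measurable_indicator[OF assms(3)] sqintD(1)[OF F]])
 have b: "norm (?F Om' x) <= 1 * norm (?F Om x)" for x using assms(4) by (auto simp: indicator_def)
 show "f : sqint (lebesgue_on Om')"
  using sqint_dominated[OF F m b] assms by (simp add: sqint_restrict_iff)
 show "l2norm (lebesgue_on Om') f <= l2norm (lebesgue_on Om) f"
  using l2norm_dominated[OF F m _ b] assms by (simp add: l2norm_restrict)
qed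

lemma sqint_leb_on:
 assumes "f : sqint lebesgue" "Om : sets lebesgue"
 shows "f : sqint (lebesgue_on Om)" "l2norm (lebesgue_on Om) f <= l2norm lebesgue f"
 using sqint_subset[of f UNIV Om] assms by (simp_all add: lebesgue_on_UNIV_eq)

section \<open>Borel representatives and L2 convergence of mollifications\<close>

text \<open>Exchanging integrals over products of \<open>lborel\<close> needs Borel integrands; this
  lemma is the passage to them from the completed measure.\<close>

lemma borel_representative:
 fixes f :: "'a::euclidean_space => 'b::euclidean_space"
 assumes "f : borel_measurable lebesgue"
 obtains g where "g : borel_measurable borel" "AE x in lebesgue. f x = g x"
proof -
 have "f measurable_on UNIV" using assms by (intro lebesgue_measurable_imp_measurable_on) auto
 then obtain N g where N: "negligible N" and g: "!!k. continuous_on UNIV (g k)"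
  and lim: "!!x. x ~: N ==> (%k. g k x) ~> f x"
  unfolding measurable_on_def by auto
 \<comment> \<open>The exceptional set is enlarged to a Borel null set, so that cutting it out keeps
   the limit Borel.\<close>
 from N have "N : null_sets (completion lborel)" by (simp add: negligible_iff_null_sets)
 then obtain N' where N': "N' : null_sets lborel" "N \<subseteq> N'"
  by (auto simp: null_sets_completion_iff2)
 define h where "h x = indicator (- N') x *r f x" for x
 have "h : borel_measurable borel"
 proof (rule borel_measurable_LIMSEQ_metric)
  show "(%x. indicator (- N') x *r g k x) : borel_measurable borel" for k
   using N' g by (intro borel_measurable_scaleR borel_measurable_indicator borel_measurable_continuous_onI)
    (auto simp: null_sets_def)
  show "(%k. indicator (- N') x *r g k x) ~> h x" for x
  proof (cases "x : N'")
   case False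
   then have "x ~: N" using N' by auto
   from tendsto_scaleR[OF tendsto_const[of "indicator (- N') x"] lim[OF this]] show ?thesis by (simp add: h_def)
  qed (simp add: h_def)
 qed
 moreover have "AE x in lebesgue. f x = h x"
 proof -
  have "AE x in lebesgue. x ~: N'"
   using N' by (intro AE_completion AE_not_in)
  then show ?thesis by eventually_elim (simp add: h_def)
 qed
 ultimately show ?thesis by (rule that)
qed

lemma conv_cong_AE:
 fixes f :: "'a::euclidean_space => 'b::euclidean_space"
 assumes "rh : borel_measurable lebesgue" "f : borel_measurable lebesgue" "g : borel_measurable lebesgue"
  "AE x in lebesgue. f x = g x"
 shows "conv rh f x = conv rh g x"
 unfolding conv_def
proof (rule integral_cong_AE)
 show "AE y in lebesgue. rh (x - y) *r f y = rh (x - y) *r g y"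
  using assms(4) by eventually_elim simp
qed (intro borel_measurable_scaleR measurable_affine assms)+

lemma mollifierD:
 assumes "mollifier \<epsilon> rh"
 shows "rh : test_functions UNIV" "!!x. 0 <= rh x" "!!x. rh x ~= 0 ==> norm x < \<epsilon>" "(LINT x|lebesgue. rh x) = 1"
  "rh : borel_measurable borel" "rh : borel_measurable lebesgue" "integrable lebesgue rh"
proof -
 show *: "rh : test_functions UNIV" "!!x. 0 <= rh x" "!!x. rh x ~= 0 ==> norm x < \<epsilon>" "(LINT x|lebesgue. rh x) = 1"
  using assms by (simp_all add: mollifier_def)
 then have c: "continuous_on UNIV rh" by (simp add: test_functions_def smooth_continuous_on)
 show "rh : borel_measurable borel" "rh : borel_measurable lebesgue"
  using borel_measurable_continuous_onI[OF c] continuous_measurable[OF c] by auto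
 show "integrable lebesgue rh" by (rule test_functions_integrable[OF *(1)])
qed

text \<open>Jensen's inequality for the probability density \<open>rh\<close>: with s = sqrt rh, the
  difference is the integral of s times s (f(x - h) - f(x)), and s has L2 norm one.\<close>

lemma conv_diff_pointwise:
 fixes f :: "'a::euclidean_space => 'b::euclidean_space"
 assumes rh: "mollifier \<epsilon> rh" and f: "f : sqint lebesgue"
 shows "integrable lebesgue (%h. rh h * (norm (f (x - h) - f x))\<^sup>2)"
  and "(norm (conv rh f x - f x))\<^sup>2 <= (LINT h|lebesgue. rh h * (norm (f (x - h) - f x))\<^sup>2)"
proof -
 note rhD = mollifierD[OF rh]
 obtain C where C: "0 <= C" "!!x. norm (rh x) <= C" using test_functions_bounded[OF rhD(1)] by blast
 define s where "s h = sqrt (rh h)" for h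
 have sm: "s : borel_measurable lebesgue" unfolding s_def using rhD(6) by measurable
 have s2: "(s h)\<^sup>2 = rh h" "0 <= s h" for h using rhD(2) by (auto simp: s_def)
 have sb: "s h <= sqrt C" for h unfolding s_def using C(2)[of h] by simp
 have s: "s : sqint lebesgue" using sm rhD(7) by (simp add: sqint_def s2)
 have fx: "(%h. f (x - h)) : sqint lebesgue" by (rule sqint_affine[OF f])
 have v1: "(%h. s h *r f (x - h)) : sqint lebesgue"
  by (rule sqint_dominated[OF fx, where C="sqrt C"])
   (use sm sqintD(1)[OF fx] sb s2 in \<open>auto intro: mult_right_mono borel_measurable_scaleR\<close>)
 have v2: "(%h. s h *r f x) : sqint lebesgue"
  by (rule sqint_dominated[OF s, where C="norm (f x)"]) (use sm s2 in \<open>auto simp: mult.commute\<close>)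
 define v where "v h = s h *r (f (x - h) - f x)" for h
 have v: "v : sqint lebesgue"
  using sqint_diff[OF v1 v2] unfolding v_def by (simp add: scaleR_diff_right)
 have nv: "(norm (v h))\<^sup>2 = rh h * (norm (f (x - h) - f x))\<^sup>2" for h
  by (simp add: v_def power_mult_distrib s2)
 show "integrable lebesgue (%h. rh h * (norm (f (x - h) - f x))\<^sup>2)"
  using sqintD(2)[OF v] by (simp add: nv)
 have nvs: "(%h. norm (v h)) : sqint lebesgue"
  by (rule sqint_dominated[OF v, where C=1]) (use sqintD(1)[OF v] in auto)
 have "conv rh f x = (LINT h|lebesgue. rh h *r f (x - h))"
  unfolding conv_def using integral_affine(2)[of "%y. rh (x - y) *r f y" x] by simp
 moreover have "f x = (LINT h|lebesgue. rh h *r f x)" using rhD(4,7) by simp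
 moreover have "integrable lebesgue (%h. rh h *r f (x - h))"
  using integrable_affine(2)[OF conv_integrable[OF rhD(1) sqint_locally[OF f], of x], of x] by simp
 ultimately have "conv rh f x - f x = (LINT h|lebesgue. rh h *r (f (x - h) - f x))"
  using rhD(7) by (simp add: scaleR_diff_right)
 also have "... = (LINT h|lebesgue. s h *r v h)"
  by (simp add: v_def s2 flip: power2_eq_square)
 also have "norm ... <= (LINT h|lebesgue. norm (s h *r v h))" by (rule integral_norm_bound)
 also have "... = l2inner lebesgue s (%h. norm (v h))" using s2 by (simp add: l2inner_def)
 also have "... <= l2norm lebesgue s * l2norm lebesgue (%h. norm (v h))"
  using l2inner_le[OF s nvs] by simp
 also have "... = l2norm lebesgue v" using rhD(4) by (simp add: l2norm_def s2)
 finally have "(norm (conv rh f x - f x))\<^sup>2 <= (l2norm lebesgue v)\<^sup>2" by (intro power_mono) auto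
 then show "(norm (conv rh f x - f x))\<^sup>2 <= (LINT h|lebesgue. rh h * (norm (f (x - h) - f x))\<^sup>2)"
  by (simp add: l2norm_sq nv)
qed

lemma conv_measurable:
 assumes "rh : test_functions UNIV" "f : sqint lebesgue"
 shows "conv rh f : borel_measurable lebesgue"
 by (intro continuous_measurable smooth_continuous_on smooth_conv sqint_locally assms)

text \<open>The squared pointwise bound is integrated in x and the integrals are exchanged;
  \<open>rh\<close> then restricts the shifts to norm h < \<epsilon>, where the translation bound d
  applies.\<close>

lemma conv_l2_diff:
 fixes f :: "'a::euclidean_space => 'b::euclidean_space"
 assumes rh: "mollifier \<epsilon> rh" and f: "f : sqint lebesgue" and d: "0 <= d"
  and tr: "!!h. norm h < \<epsilon> ==> l2norm lebesgue (%x. f (x - h) - f x) <= d"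
 shows "conv rh f : sqint lebesgue" "l2norm lebesgue (%x. conv rh f x - f x) <= d"
proof -
 note rhD = mollifierD[OF rh]
 \<comment> \<open>The exchange is carried out for a Borel representative g, whose shifted
   differences are jointly measurable; the convolution does not see the change.\<close>
 obtain g where gm[measurable]: "g : borel_measurable borel" and fg: "AE x in lebesgue. f x = g x"
  using borel_representative[OF sqintD(1)[OF f]] by blast
 have gl: "g : borel_measurable lebesgue" by (rule measurable_completion) (simp add: gm)
 have g: "g : sqint lebesgue"
 proof -
  have "integrable lebesgue (%x. (norm (g x))\<^sup>2)"
  proof (rule integrable_cong_AE_imp[OF sqintD(2)[OF f]])
   show "AE x in lebesgue. (norm (f x))\<^sup>2 = (norm (g x))\<^sup>2" using fg by eventually_elim simp
  qed (use gl in measurable)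
  then show ?thesis using gl by (simp add: sqint_def)
 qed
 have cfg: "conv rh f = conv rh g"
  using conv_cong_AE[OF rhD(6) sqintD(1)[OF f] gl fg] by (simp add: fun_eq_iff)
 have trg: "(\<integral>\<^sup>+x. ennreal ((norm (g (x - h) - g x))\<^sup>2) \<partial>lborel) <= ennreal (d\<^sup>2)" if "norm h < \<epsilon>" for h
 proof -
  have "AE x in lebesgue. f (x - h) = g (x - h)" using AE_affine(1)[OF fg, of "-h"] by simp
  with fg have "AE x in lebesgue. f (x - h) - f x = g (x - h) - g x" by eventually_elim simp
  then have "l2norm lebesgue (%x. g (x - h) - g x) = l2norm lebesgue (%x. f (x - h) - f x)"
   by (intro l2norm_cong_AE sqintD(1)[OF sqint_diff] sqint_affine f g) auto
  then have "(l2norm lebesgue (%x. g (x - h) - g x))\<^sup>2 <= d\<^sup>2" using tr[OF that] by (simp add: power_mono)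
  moreover have "(\<integral>\<^sup>+x. ennreal ((norm (g (x - h) - g x))\<^sup>2) \<partial>lebesgue)
    = ennreal ((l2norm lebesgue (%x. g (x - h) - g x))\<^sup>2)"
   unfolding l2norm_sq
   by (rule nn_integral_eq_integral) (use sqintD(2)[OF sqint_diff[OF sqint_affine(3)[OF g] g]] in auto)
  ultimately show ?thesis by (simp add: nn_integral_completion ennreal_leI)
 qed
 note [measurable] = rhD(5)
 have "(\<integral>\<^sup>+x. ennreal ((norm (conv rh g x - g x))\<^sup>2) \<partial>lborel)
   <= (\<integral>\<^sup>+x. (\<integral>\<^sup>+h. ennreal (rh h * (norm (g (x - h) - g x))\<^sup>2) \<partial>lborel) \<partial>lborel)"
 proof (rule nn_integral_mono)
  fix x
  have "(\<integral>\<^sup>+h. ennreal (rh h * (norm (g (x - h) - g x))\<^sup>2) \<partial>lebesgue)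
    = ennreal (LINT h|lebesgue. rh h * (norm (g (x - h) - g x))\<^sup>2)"
   by (rule nn_integral_eq_integral) (use conv_diff_pointwise(1)[OF rh g] rhD(2) in auto)
  then show "ennreal ((norm (conv rh g x - g x))\<^sup>2)
    <= (\<integral>\<^sup>+h. ennreal (rh h * (norm (g (x - h) - g x))\<^sup>2) \<partial>lborel)"
   using conv_diff_pointwise(2)[OF rh g, of x] by (simp add: nn_integral_completion ennreal_leI)
 qed
 also have "... = (\<integral>\<^sup>+h. (\<integral>\<^sup>+x. ennreal (rh h * (norm (g (x - h) - g x))\<^sup>2) \<partial>lborel) \<partial>lborel)"
  by (rule lborel_pair.Fubini') measurable
 also have "... <= (\<integral>\<^sup>+h. ennreal (rh h) * ennreal (d\<^sup>2) \<partial>lborel)"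
 proof (rule nn_integral_mono)
  fix h
  have "(\<integral>\<^sup>+x. ennreal (rh h * (norm (g (x - h) - g x))\<^sup>2) \<partial>lborel)
    = ennreal (rh h) * (\<integral>\<^sup>+x. ennreal ((norm (g (x - h) - g x))\<^sup>2) \<partial>lborel)"
   using rhD(2) by (simp add: ennreal_mult' nn_integral_cmult)
  also have "... <= ennreal (rh h) * ennreal (d\<^sup>2)"
   using trg rhD(3)[of h] by (cases "rh h = 0") (auto intro: mult_left_mono)
  finally show "(\<integral>\<^sup>+x. ennreal (rh h * (norm (g (x - h) - g x))\<^sup>2) \<partial>lborel) <= ennreal (rh h) * ennreal (d\<^sup>2)" .
 qed
 also have "... = ennreal (d\<^sup>2)"
 proof -
  have "(\<integral>\<^sup>+h. ennreal (rh h) \<partial>lebesgue) = ennreal 1"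
   using nn_integral_eq_integral[OF rhD(7)] rhD(2,4) by auto
  then show ?thesis by (simp add: nn_integral_multc nn_integral_completion)
 qed
 finally have *: "(\<integral>\<^sup>+x. ennreal ((norm (conv rh g x - g x))\<^sup>2) \<partial>lebesgue) <= ennreal (d\<^sup>2)"
  by (simp add: nn_integral_completion)
 have m: "(%x. conv rh g x - g x) : borel_measurable lebesgue"
  using conv_measurable[OF rhD(1) g] gl by (rule borel_measurable_diff)
 have int: "integrable lebesgue (%x. (norm (conv rh g x - g x))\<^sup>2)"
  by (rule integrableI_nonneg) (use m * in \<open>auto intro: le_less_trans\<close>)
 then have sq: "(%x. conv rh g x - g x) : sqint lebesgue" using m by (simp add: sqint_def)
 from sqint_add[OF this g] show cs: "conv rh f : sqint lebesgue" by (simp add: cfg)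
 have "ennreal ((l2norm lebesgue (%x. conv rh g x - g x))\<^sup>2) <= ennreal (d\<^sup>2)"
  using * unfolding l2norm_sq using nn_integral_eq_integral[OF int] by simp
 then have "l2norm lebesgue (%x. conv rh g x - g x) <= d"
  using d by (simp add: power2_le_iff_abs_le abs_le_square_iff)
 moreover have "l2norm lebesgue (%x. conv rh f x - f x) = l2norm lebesgue (%x. conv rh g x - g x)"
 proof (rule l2norm_cong_AE)
  show "AE x in lebesgue. conv rh f x - f x = conv rh g x - g x"
   using fg by eventually_elim (simp add: cfg)
 qed (use m sqintD(1)[OF cs] sqintD(1)[OF f] in auto)
 ultimately show "l2norm lebesgue (%x. conv rh f x - f x) <= d" by simp
qed

definition std_mollifier :: "nat => 'a::euclidean_space => real" where
 "std_mollifier k = (SOME rh. mollifier (1 / Suc k) rh)"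

lemma std_mollifier: "mollifier (1 / Suc k) (std_mollifier k :: 'a::euclidean_space => real)"
proof -
 have "\<exists>rh :: 'a => real. mollifier (1 / Suc k) rh" by (rule mollifier_exists) simp
 then show ?thesis unfolding std_mollifier_def by (rule someI_ex)
qed

definition mollify :: "nat => ('a::euclidean_space => 'b::euclidean_space) => 'a => 'b" where
 "mollify k f = conv (std_mollifier k) f"

lemma mollify_sqint:
 assumes f: "f : sqint lebesgue"
 shows "mollify k f : sqint lebesgue"
 unfolding mollify_def
proof (rule conv_l2_diff(1)[OF std_mollifier f])
 fix h :: 'a
 have "l2norm lebesgue (%x. f (x - h) - f x) <= l2norm lebesgue (%x. f (x - h)) + l2norm lebesgue (%x. - f x)"
  using l2norm_triangle[OF sqint_affine(3)[OF f] sqint_minus[OF f]] by simp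
 then show "l2norm lebesgue (%x. f (x - h) - f x) <= 2 * l2norm lebesgue f"
  by (simp add: l2norm_affine) (simp add: l2norm_def)
qed simp

lemma mollify_tendsto:
 assumes f: "f : sqint lebesgue"
 shows "(%k. l2norm lebesgue (%x. mollify k f x - f x)) ~> 0"
proof (rule LIMSEQ_I)
 fix e :: real assume e: "0 < e"
 have "\<forall>\<^sub>F h in at 0. l2norm lebesgue (%x. f (x - h) - f x) < e / 2"
  by (rule order_tendstoD(2)[OF l2_translation_continuous[OF f]]) (use e in simp)
 then obtain d where d: "0 < d" "!!h. h ~= 0 ==> norm h < d ==> l2norm lebesgue (%x. f (x - h) - f x) < e / 2"
  by (auto simp: eventually_at)
 obtain N :: nat where N: "1 / Suc N < d" using nat_approx_posE[OF d(1)] by blast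
 have "norm (l2norm lebesgue (%x. mollify k f x - f x) - 0) < e" if k: "k \<ge> N" for k
 proof -
  have "1 / real (Suc k) <= 1 / Suc N" using k by (simp add: frac_le)
  then have dk: "1 / real (Suc k) < d" using N by linarith
  have "l2norm lebesgue (%x. mollify k f x - f x) <= e / 2"
   unfolding mollify_def
  proof (rule conv_l2_diff(2)[OF std_mollifier f])
   fix h :: 'a assume h: "norm h < 1 / real (Suc k)"
   show "l2norm lebesgue (%x. f (x - h) - f x) <= e / 2"
    using d(2)[of h] h dk e by (cases "h = 0") (auto simp: l2norm_def)
  qed (use e in simp)
  then show ?thesis using e by simp
 qed
 then show "\<exists>no. \<forall>k\<ge>no. norm (l2norm lebesgue (%x. mollify k f x - f x) - 0) < e" by blast
qed

lemma smooth_mollify: "f : sqint lebesgue ==> smooth (mollify k f)"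
 unfolding mollify_def by (intro smooth_conv mollifierD(1)[OF std_mollifier] sqint_locally)

lemma mollify_zero:
 assumes "!!y. norm (x - y) < 1 / Suc k ==> f y = 0"
 shows "mollify k f x = 0"
proof -
 have "(%y. std_mollifier k (x - y) *r f y) = (%y. 0)"
  using assms mollifierD(3)[OF std_mollifier, of k] by (fastforce simp: fun_eq_iff)
 then show ?thesis by (simp add: mollify_def conv_def)
qed

lemma test_functions_dense:
 fixes f :: "'a::euclidean_space => 'b::euclidean_space"
 assumes f: "f : sqint lebesgue" and e: "0 < e"
 shows "\<exists>fi\<in>test_functions UNIV. l2norm lebesgue (%x. fi x - f x) < e"
proof -
 obtain g R where g: "continuous_on UNIV g" "!!x. x ~: cball 0 R ==> g x = 0" "g : sqint lebesgue"
  and fg: "l2norm lebesgue (%x. f x - g x) < e / 2"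
  using continuous_dense[OF f, of "e/2"] e by auto
 obtain k where k: "l2norm lebesgue (%x. mollify k g x - g x) < e / 2"
  using LIMSEQ_D[OF mollify_tendsto[OF g(3)], of "e/2"] e by auto
 have "mollify k g x = 0" if x: "x ~: cball 0 (R + 1)" for x
 proof (rule mollify_zero)
  fix y assume "norm (x - y) < 1 / Suc k"
  also have "... <= 1" by simp
  finally have "norm y > R" using x norm_triangle_ineq2[of x "x - y"] by simp
  then show "g y = 0" using g(2) by simp
 qed
 then have "mollify k g : test_functions UNIV"
  by (intro test_functionsI[where K="cball 0 (R + 1)"] smooth_mollify g) auto
 moreover have "l2norm lebesgue (%x. mollify k g x - f x)
   <= l2norm lebesgue (%x. mollify k g x - g x) + l2norm lebesgue (%x. g x - f x)"
  by (intro l2norm_diff_triangle mollify_sqint f g)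
 ultimately show ?thesis using k fg l2norm_commute[of lebesgue f g] by (intro bexI) auto
qed

section \<open>Reflected mollifiers as test functions, and the fundamental lemma\<close>

text \<open>Testing a weak gradient with y -> rh (x - y) turns it into a convolution; the sign from
  the reflection cancels the one in \<open>weak_gradient\<close>.\<close>

lemma reflect_test_function:
 assumes rh: "rh : test_functions UNIV" and K: "compact K" "K \<subseteq> Om" "!!y. rh (x - y) ~= 0 ==> y : K"
 shows "(%y. rh (x - y)) : test_functions Om"
  and "frechet_derivative (%y. rh (x - y)) (at y) h = - frechet_derivative rh (at (x - y)) h"
proof -
 have sm: "smooth rh" using rh by (simp add: test_functions_def)
 have "smooth (%y. rh (- y + x))"
  by (rule smooth_affine_comp[OF bounded_linear_minus[OF bounded_linear_ident] sm])
 then show "(%y. rh (x - y)) : test_functions Om"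
  by (intro test_functionsI[OF _ K(3,1,2)]) simp_all
 interpret D: bounded_linear "frechet_derivative rh (at (x - y))" by (rule linear_derivative[OF sm])
 have "((%y. x - y) has_derivative (%h. - h)) (at y)" by (auto intro!: derivative_eq_intros)
 from has_derivative_compose[OF this smooth_derivative[OF sm]]
 have "((%y. rh (x - y)) has_derivative (%h. frechet_derivative rh (at (x - y)) (- h))) (at y)" .
 from frechet_derivative_at[OF this]
 show "frechet_derivative (%y. rh (x - y)) (at y) h = - frechet_derivative rh (at (x - y)) h"
  by (metis D.neg)
qed

lemma std_mollifier_support:
 "std_mollifier k (x - y) ~= 0 ==> y : cball x (1 / Suc k)"
 using mollifierD(3)[OF std_mollifier, of k "x - y"] by (simp add: dist_norm)

lemma open_leb: "open S ==> S : sets lebesgue"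
 by auto

text \<open>The reflected mollifiers centred at x are eventually supported in \<open>Om\<close>, so
  at each point of \<open>Om\<close> the mollified zero extension of g vanishes eventually, while a
  subsequence converges to g almost everywhere.\<close>

lemma fundamental_lemma:
 fixes g :: "'a::euclidean_space => 'b::euclidean_space"
 assumes Om: "open Om" and g: "g : sqint (lebesgue_on Om)"
  and orth: "!!fi::'a => real. fi : test_functions Om ==> (LINT x|lebesgue_on Om. fi x *r g x) = 0"
 shows "AE x in lebesgue_on Om. g x = 0"
proof -
 note Oms = open_leb[OF Om]
 define G where "G x = indicator Om x *r g x" for x
 have G: "G : sqint lebesgue" unfolding G_def using g Oms by (simp add: sqint_restrict_iff)
 obtain r :: "nat => nat" where r: "strict_mono r"
  and lim: "AE x in lebesgue. (%n. mollify (r n) G x - G x) ~> 0"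
  using l2norm_AE_subseq[OF sqint_diff[OF mollify_sqint[OF G] G] mollify_tendsto[OF G]] by blast
 have "AE x in lebesgue. x : Om --> g x = 0"
  using lim
 proof eventually_elim
  fix x assume lim: "(%n. mollify (r n) G x - G x) ~> 0"
  show "x : Om --> g x = 0"
  proof
   assume x: "x : Om"
   then obtain e where e: "0 < e" "cball x e \<subseteq> Om" using Om open_contains_cball by blast
   obtain N :: nat where N: "1 / Suc N < e" using nat_approx_posE[OF e(1)] by blast
   have "mollify k G x = 0" if k: "k \<ge> N" for k
   proof -
    have "1 / real (Suc k) <= 1 / Suc N" using k by (simp add: frac_le)
    then have "cball x (1 / Suc k) \<subseteq> Om" using N e(2) by (meson order_less_imp_le order_trans subset_cball)
    from reflect_test_function(1)[OF mollifierD(1)[OF std_mollifier] compact_cball this std_mollifier_support]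
    have "(LINT y|lebesgue_on Om. std_mollifier k (x - y) *r g y) = 0" by (rule orth)
    then show ?thesis
     by (simp add: mollify_def conv_def G_def integral_leb_on[OF Oms] mult.commute)
   qed
   then have "\<forall>\<^sub>F n in sequentially. mollify (r n) G x - G x = - G x"
    unfolding eventually_sequentially using seq_suble[OF r] by (metis diff_0 order_trans)
   then have "(%n. mollify (r n) G x - G x) ~> - G x" by (rule tendsto_eventually)
   from LIMSEQ_unique[OF this lim] show "g x = 0" using x by (simp add: G_def)
  qed
 qed
 then show ?thesis by (simp add: AE_leb_on[OF Oms])
qed

section \<open>Weak gradients\<close>

lemma norm_integral_scaleR_le:
 fixes psi :: "'a => real" and f :: "'a => 'b::euclidean_space"
 assumes "psi : sqint M" "f : sqint M"
 shows "integrable M (%x. psi x *r f x)" "norm (LINT x|M. psi x *r f x) <= l2norm M psi * l2norm M f"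
proof -
 note [measurable] = assms[THEN sqintD(1)]
 have 1: "integrable M (%x. norm (psi x) * norm (f x))" by (rule sqint_mult_integrable[OF assms])
 then show "integrable M (%x. psi x *r f x)"
 proof (rule integrable_real_bound)
  show "(%x. psi x *r f x) : borel_measurable M" by measurable
 qed simp
 have n: "(%x. norm (f x)) : sqint M" "(%x. \<bar>psi x\<bar>) : sqint M"
  by (rule sqint_dominated[OF assms(2), where C=1]; simp)
   (rule sqint_dominated[OF assms(1), where C=1]; simp)
 have "norm (LINT x|M. psi x *r f x) <= (LINT x|M. norm (psi x *r f x))" by (rule integral_norm_bound)
 also have "... = l2inner M (%x. \<bar>psi x\<bar>) (%x. norm (f x))" by (simp add: l2inner_def)
 also have "... <= l2norm M (%x. \<bar>psi x\<bar>) * l2norm M (%x. norm (f x))" using l2inner_le[OF n(2,1)] by simp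
 also have "... = l2norm M psi * l2norm M f" by (simp add: l2norm_def)
 finally show "norm (LINT x|M. psi x *r f x) <= l2norm M psi * l2norm M f" .
qed

lemma integral_scaleR_tendsto:
 fixes psi :: "'a => real" and f :: "nat => 'a => 'b::euclidean_space"
 assumes "psi : sqint M" "!!k. f k : sqint M" "g : sqint M"
  and lim: "(%k. l2norm M (%x. f k x - g x)) ~> 0"
 shows "(%k. LINT x|M. psi x *r f k x) ~> (LINT x|M. psi x *r g x)"
proof -
 have "norm ((LINT x|M. psi x *r f k x) - (LINT x|M. psi x *r g x)) <= l2norm M psi * l2norm M (%x. f k x - g x)" for k
 proof -
  have "(LINT x|M. psi x *r f k x) - (LINT x|M. psi x *r g x) = (LINT x|M. psi x *r (f k x - g x))"
   by (simp add: scaleR_diff_right norm_integral_scaleR_le(1)[OF assms(1)] assms)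
  then show ?thesis using norm_integral_scaleR_le(2)[OF assms(1) sqint_diff[OF assms(2,3)]] by simp
 qed
 then have b: "\<forall>\<^sub>F k in sequentially. norm ((LINT x|M. psi x *r f k x) - (LINT x|M. psi x *r g x))
   <= l2norm M psi * l2norm M (%x. f k x - g x)"
  by (intro always_eventually allI)
 have "(%k. l2norm M psi * l2norm M (%x. f k x - g x)) ~> l2norm M psi * 0" by (intro tendsto_intros lim)
 then have "(%k. (LINT x|M. psi x *r f k x) - (LINT x|M. psi x *r g x)) ~> 0"
  by (intro Lim_null_comparison[OF b]) simp
 then show ?thesis using Lim_null by blast
qed

lemma sqint_linear:
 assumes "bounded_linear L" "f : sqint M"
 shows "(%x. L (f x)) : sqint M"
proof -
 obtain C where "!!x. norm (L x) <= norm x * C" using bounded_linear.bounded[OF assms(1)] by blast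
 moreover have "L : borel_measurable borel"
  by (intro borel_measurable_continuous_onI linear_continuous_on assms)
 ultimately show ?thesis
  by (intro sqint_dominated[OF assms(2), where C=C] measurable_compose[OF sqintD(1)[OF assms(2)]])
   (simp_all add: mult.commute)
qed

lemma sqint_nth: "G : sqint M ==> (%x. G x $ j) : sqint M"
 by (rule sqint_linear[OF bounded_linear_vec_nth])

lemma l2norm_nth_le: "G : sqint M ==> l2norm M (%x. G x $ j) <= l2norm M G"
 using l2norm_dominated[of G M "%x. G x $ j" 1] sqintD(1)[OF sqint_nth, of G M j]
  Finite_Cartesian_Product.norm_nth_le[where x="G _" and i=j] by auto

lemma test_function_facts:
 fixes fi :: "real^'n => real"
 assumes "fi : test_functions Om" "Om : sets lebesgue"
 shows "fi : sqint (lebesgue_on Om)" "partial j fi : sqint (lebesgue_on Om)"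
 using test_functions_sqint[OF assms(1)] test_functions_sqint[OF test_derivative[OF assms(1), of "axis j 1"]]
  assms(2) by (simp_all add: sqint_leb_on partial_def[abs_def])

lemma weak_gradient_limit:
 fixes Om :: "(real^'n) set"
 assumes Om: "Om : sets lebesgue" and wg: "!!k. weak_gradient Om (u k) (G k)"
  and s: "!!k. u k : L2 Om" "!!k. G k : L2 Om" "v : L2 Om" "H : L2 Om"
  and lim: "(%k. l2norm (lebesgue_on Om) (%x. u k x - v x)) ~> 0"
   "(%k. l2norm (lebesgue_on Om) (%x. G k x - H x)) ~> 0"
 shows "weak_gradient Om v H"
 unfolding weak_gradient_def
proof (intro allI impI)
 fix fi :: "real^'n => real" and j assume fi: "fi : test_functions Om"
 note fis = test_function_facts[OF fi Om] and s' = s[unfolded L2_eq_sqint]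
 have "(%k. LINT x|lebesgue_on Om. partial j fi x *r u k x) ~> (LINT x|lebesgue_on Om. partial j fi x *r v x)"
  by (rule integral_scaleR_tendsto[OF fis(2) s'(1,3) lim(1)])
 moreover have "(%k. LINT x|lebesgue_on Om. fi x *r G k x $ j) ~> (LINT x|lebesgue_on Om. fi x *r H x $ j)"
 proof (rule integral_scaleR_tendsto[OF fis(1)])
  show "(%k. l2norm (lebesgue_on Om) (%x. G k x $ j - H x $ j)) ~> 0"
  proof (rule Lim_null_comparison[OF always_eventually lim(2)], rule allI)
   fix k
   show "norm (l2norm (lebesgue_on Om) (%x. G k x $ j - H x $ j)) <= l2norm (lebesgue_on Om) (%x. G k x - H x)"
    using l2norm_nth_le[OF sqint_diff[OF s'(2,4)], of k j] by simp
  qed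
 qed (intro sqint_nth s')+
 moreover have "(LINT x|lebesgue_on Om. partial j fi x *r u k x) = - (LINT x|lebesgue_on Om. fi x *r G k x $ j)" for k
  using wg[of k] fi by (simp add: weak_gradient_def)
 ultimately show "(LINT x|lebesgue_on Om. partial j fi x *r v x) = - (LINT x|lebesgue_on Om. fi x *r H x $ j)"
 proof -
  assume a: "(%k. LINT x|lebesgue_on Om. partial j fi x *r u k x) ~> (LINT x|lebesgue_on Om. partial j fi x *r v x)"
   and b: "(%k. LINT x|lebesgue_on Om. fi x *r G k x $ j) ~> (LINT x|lebesgue_on Om. fi x *r H x $ j)"
   and c: "!!k. (LINT x|lebesgue_on Om. partial j fi x *r u k x) = - (LINT x|lebesgue_on Om. fi x *r G k x $ j)"
  from LIMSEQ_unique[OF a[unfolded c] tendsto_minus[OF b]] show ?thesis .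
 qed
qed

lemma weak_gradient_unique:
 fixes G H :: "real^'n => complex^'m^'n"
 assumes Om: "open Om" and G: "G : L2 Om" "weak_gradient Om u G" and H: "H : L2 Om" "weak_gradient Om u H"
 shows "AE x in lebesgue_on Om. G x = H x"
proof -
 note s = G(1)[unfolded L2_eq_sqint] H(1)[unfolded L2_eq_sqint]
 have "AE x in lebesgue_on Om. G x $ j - H x $ j = 0" for j
 proof (rule fundamental_lemma[OF Om])
  show "(%x. G x $ j - H x $ j) : sqint (lebesgue_on Om)" by (intro sqint_diff sqint_nth s)
  fix fi :: "real^'n => real" assume fi: "fi : test_functions Om"
  note fis = test_function_facts(1)[OF fi open_leb[OF Om]]
  have "(LINT x|lebesgue_on Om. fi x *r (G x $ j)) = (LINT x|lebesgue_on Om. fi x *r (H x $ j))"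
  proof -
   have "(LINT x|lebesgue_on Om. partial j fi x *r u x) = - (LINT x|lebesgue_on Om. fi x *r (G x $ j))"
    "(LINT x|lebesgue_on Om. partial j fi x *r u x) = - (LINT x|lebesgue_on Om. fi x *r (H x $ j))"
    using G(2) H(2) fi by (simp_all add: weak_gradient_def)
   then show ?thesis by (simp only: neg_equal_iff_equal)
  qed
  then show "(LINT x|lebesgue_on Om. fi x *r (G x $ j - H x $ j)) = 0"
   by (simp add: scaleR_diff_right norm_integral_scaleR_le(1)[OF fis sqint_nth] s)
 qed
 then have "AE x in lebesgue_on Om. \<forall>j\<in>UNIV. G x $ j - H x $ j = 0"
  by (intro AE_finite_allI) auto
 then show ?thesis by eventually_elim (simp add: vec_eq_iff)
qed

text \<open>\<open>grad\<close> is an arbitrary choice, so its values become known only in this way: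
  exhibit some square integrable weak gradient and compare almost everywhere.\<close>

lemma grad_eqI:
 fixes G :: "real^'n => complex^'m^'n"
 assumes Om: "open Om" and G: "G : L2 Om" "weak_gradient Om u G"
 shows "AE x in lebesgue_on Om. grad Om u x = G x" "grad Om u : L2 Om" "weak_gradient Om u (grad Om u)"
proof -
 have "grad Om u : L2 Om & weak_gradient Om u (grad Om u)"
  unfolding grad_def by (rule someI[where P="%G. G : L2 Om & weak_gradient Om u G"]) (use G in simp)
 then show "grad Om u : L2 Om" "weak_gradient Om u (grad Om u)" by auto
 from weak_gradient_unique[OF Om this G] show "AE x in lebesgue_on Om. grad Om u x = G x" .
qed

lemma H1_grad:
 assumes "u : H1 Om"
 shows "u : L2 Om" "grad Om u : L2 Om" "weak_gradient Om u (grad Om u)"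
proof -
 from assms obtain G where G: "G : L2 Om & weak_gradient Om u G" by (auto simp: H1_def)
 have "grad Om u : L2 Om & weak_gradient Om u (grad Om u)"
  unfolding grad_def by (rule someI[where P="%G. G : L2 Om & weak_gradient Om u G", OF G])
 then show "grad Om u : L2 Om" "weak_gradient Om u (grad Om u)" by auto
 show "u : L2 Om" using assms by (simp add: H1_def)
qed

lemma H1I: "u : L2 Om ==> G : L2 Om ==> weak_gradient Om u G ==> u : H1 Om"
 by (auto simp: H1_def)

lemma partial_outside_support:
 assumes "fi : test_functions Om" "x ~: Om"
 shows "fi x = 0" "partial j fi x = 0"
proof -
 obtain K where K: "compact K" "K \<subseteq> Om" "!!x. x ~: K ==> fi x = 0" using test_functionsE[OF assms(1)] by metis
 then have xK: "x ~: K" using assms(2) by auto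
 then show "fi x = 0" using K by blast
 show "partial j fi x = 0" unfolding partial_def
  using derivative_off_support[OF compact_imp_closed[OF K(1)] K(3) xK] by simp
qed

lemma weak_gradient_subset:
 fixes Om :: "(real^'n) set"
 assumes "weak_gradient Om u G" "Om : sets lebesgue" "Om' : sets lebesgue" "Om' \<subseteq> Om"
 shows "weak_gradient Om' u G"
 unfolding weak_gradient_def
proof (intro allI impI)
 fix fi :: "real^'n => real" and j assume fi: "fi : test_functions Om'"
 note out = partial_outside_support[OF fi]
 have eq: "(%x. indicator Om' x *r partial j fi x *r u x) = (%x. indicator Om x *r partial j fi x *r u x)"
  "(%x. indicator Om' x *r fi x *r G x $ j) = (%x. indicator Om x *r fi x *r G x $ j)"
  using assms(4) out by (auto simp: fun_eq_iff indicator_def)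
 have "fi : test_functions Om" using test_functions_mono[OF fi assms(4)] .
 then have "(LINT x|lebesgue_on Om. partial j fi x *r u x) = - (LINT x|lebesgue_on Om. fi x *r G x $ j)"
  using assms(1) by (simp add: weak_gradient_def)
 then show "(LINT x|lebesgue_on Om'. partial j fi x *r u x) = - (LINT x|lebesgue_on Om'. fi x *r G x $ j)"
  unfolding integral_leb_on[OF assms(2)] integral_leb_on[OF assms(3)] eq .
qed

lemma weak_gradient_cong_AE:
 fixes Om :: "(real^'n) set"
 assumes "AE x in lebesgue_on Om. u x = v x" "AE x in lebesgue_on Om. G x = H x" "Om : sets lebesgue"
  "u : L2 Om" "v : L2 Om" "G : L2 Om" "H : L2 Om"
  and wg: "weak_gradient Om u G"
 shows "weak_gradient Om v H"
 unfolding weak_gradient_def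
proof (intro allI impI)
 fix fi :: "real^'n => real" and j assume fi: "fi : test_functions Om"
 note s = assms(4-7)[unfolded L2_eq_sqint, THEN sqintD(1)] and s' = assms(6-7)[unfolded L2_eq_sqint, THEN sqint_nth, THEN sqintD(1)]
 note fis = test_function_facts[OF fi assms(3), THEN sqintD(1)]
 have "(LINT x|lebesgue_on Om. partial j fi x *r v x) = (LINT x|lebesgue_on Om. partial j fi x *r u x)"
 proof (rule integral_cong_AE)
  show "AE x in lebesgue_on Om. partial j fi x *r v x = partial j fi x *r u x"
   using assms(1) by eventually_elim simp
 qed (intro borel_measurable_scaleR fis s)+
 also have "... = - (LINT x|lebesgue_on Om. fi x *r G x $ j)"
  using wg fi by (simp add: weak_gradient_def)
 also have "(LINT x|lebesgue_on Om. fi x *r G x $ j) = (LINT x|lebesgue_on Om. fi x *r H x $ j)"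
 proof (rule integral_cong_AE)
  show "AE x in lebesgue_on Om. fi x *r G x $ j = fi x *r H x $ j"
   using assms(2) by eventually_elim simp
 qed (intro borel_measurable_scaleR fis s')+
 finally show "(LINT x|lebesgue_on Om. partial j fi x *r v x) = - (LINT x|lebesgue_on Om. fi x *r H x $ j)" .
qed

lemma weak_gradient_add:
 fixes Om :: "(real^'n) set"
 assumes "weak_gradient Om u G" "weak_gradient Om v H" "Om : sets lebesgue"
  "u : L2 Om" "v : L2 Om" "G : L2 Om" "H : L2 Om"
 shows "weak_gradient Om (%x. u x + v x) (%x. G x + H x)"
 unfolding weak_gradient_def
proof (intro allI impI)
 fix fi :: "real^'n => real" and j assume fi: "fi : test_functions Om"
 note fis = test_function_facts[OF fi assms(3)] and s = assms(4-7)[unfolded L2_eq_sqint]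
 show "(LINT x|lebesgue_on Om. partial j fi x *r (u x + v x)) = - (LINT x|lebesgue_on Om. fi x *r (G x + H x) $ j)"
  using assms(1,2) fi
  by (simp add: scaleR_add_right norm_integral_scaleR_le(1) fis s sqint_nth weak_gradient_def)
qed

lemma weak_gradient_linear:
 fixes L :: "complex^'m => complex^'m" and u :: "real^'n => complex^'m"
 assumes wg: "weak_gradient Om u G" and L: "bounded_linear L" and Om: "Om : sets lebesgue" and s: "u : L2 Om" "G : L2 Om"
  and LG: "!!x j. H x $ j = L (G x $ j)"
 shows "weak_gradient Om (%x. L (u x)) H"
 unfolding weak_gradient_def
proof (intro allI impI)
 fix fi :: "real^'n => real" and j assume fi: "fi : test_functions Om"
 note fis = test_function_facts[OF fi Om] and s' = s[unfolded L2_eq_sqint]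
 interpret bounded_linear L by (rule L)
 have "(LINT x|lebesgue_on Om. partial j fi x *r L (u x)) = L (LINT x|lebesgue_on Om. partial j fi x *r u x)"
  using integral_bounded_linear[OF L norm_integral_scaleR_le(1)[OF fis(2) s'(1)]] by (simp add: scaleR)
 also have "... = - L (LINT x|lebesgue_on Om. fi x *r G x $ j)"
  using wg fi by (simp add: weak_gradient_def neg)
 also have "L (LINT x|lebesgue_on Om. fi x *r G x $ j) = (LINT x|lebesgue_on Om. fi x *r H x $ j)"
  using integral_bounded_linear[OF L norm_integral_scaleR_le(1)[OF fis(1) sqint_nth[OF s'(2), of j]]] by (simp add: scaleR LG)
 finally show "(LINT x|lebesgue_on Om. partial j fi x *r L (u x)) = - (LINT x|lebesgue_on Om. fi x *r H x $ j)" .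
qed

lemma weak_gradient_translate:
 fixes u :: "real^'n => complex^'m"
 assumes "weak_gradient UNIV u G"
 shows "weak_gradient UNIV (%x. u (x + t)) (%x. G (x + t))"
 unfolding weak_gradient_def
proof (intro allI impI)
 fix fi :: "real^'n => real" and j assume fi: "fi : test_functions UNIV"
 define psi where "psi x = fi (x + (- t))" for x
 have sm: "smooth fi" using fi by (simp add: test_functions_def)
 obtain K where K: "compact K" "!!x. x ~: K ==> fi x = 0" using test_functionsE[OF fi] by metis
 have psi: "psi : test_functions UNIV"
 proof (rule test_functionsI)
  show "smooth psi" unfolding psi_def by (rule smooth_translate[OF sm])
  show "compact ((%x. x + t) ` K)" by (intro compact_continuous_image continuous_intros K)
  show "x : (%x. x + t) ` K" if "psi x ~= 0" for x
   using that K(2)[of "x - t"] by (intro image_eqI[of _ _ "x - t"]) (auto simp: psi_def)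
 qed simp
 have p: "partial j psi x = partial j fi (x - t)" for x
 proof -
  have "((%x. x + (-t)) has_derivative (%h. h)) (at x)" by (auto intro!: derivative_eq_intros)
  from has_derivative_compose[OF this smooth_derivative[OF sm]]
  have "(psi has_derivative frechet_derivative fi (at (x - t))) (at x)" by (simp add: psi_def[abs_def])
  from frechet_derivative_at[OF this] show ?thesis by (simp add: partial_def)
 qed
 have "(LINT x|lebesgue. partial j psi x *r u x) = - (LINT x|lebesgue. psi x *r G x $ j)"
  using assms psi by (simp add: weak_gradient_def lebesgue_on_UNIV_eq)
 then show "(LINT x|lebesgue_on UNIV. partial j fi x *r u (x + t)) = - (LINT x|lebesgue_on UNIV. fi x *r G (x + t) $ j)"
  using integral_affine(1)[of "%x. partial j psi x *r u x" t] integral_affine(1)[of "%x. psi x *r G x $ j" t]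
  by (simp add: lebesgue_on_UNIV_eq p) (simp add: psi_def)
qed

text \<open>Convolution with the constant 1 is constant, so its derivative vanishes.\<close>

lemma integral_frechet_derivative_real:
 fixes g :: "'a::euclidean_space => real"
 assumes g: "g : test_functions UNIV"
 shows "(LINT x|lebesgue. frechet_derivative g (at x) h) = 0"
proof -
 have l: "locally_integrable (%x::'a. 1 :: real)"
  unfolding locally_integrable_def using integrable_cball(1)[where C=1 and a="0::'a"] by simp
 have "conv g (%x. 1::real) x = (LINT y|lebesgue. g y)" for x
  unfolding conv_def using integral_affine(2)[of g x] by simp
 then have "conv g (%x. 1::real) = (%x. LINT y|lebesgue. g y)" by (simp add: fun_eq_iff)
 then have "frechet_derivative (conv g (%x. 1::real)) (at 0) h = 0"
  using frechet_derivative_const by simp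
 then have "conv (%z. frechet_derivative g (at z) h) (%x. 1::real) 0 = 0"
  using frechet_derivative_conv[OF g l] by simp
 then show ?thesis
  unfolding conv_def using integral_affine(2)[of "%y. frechet_derivative g (at y) h" 0] by simp
qed

lemma integral_frechet_derivative:
 fixes g :: "'a::euclidean_space => 'b::euclidean_space"
 assumes g: "g : test_functions UNIV"
 shows "(LINT x|lebesgue. frechet_derivative g (at x) h) = 0"
proof (rule euclidean_eqI)
 fix b :: 'b assume "b : Basis"
 have sm: "smooth g" using g by (simp add: test_functions_def)
 obtain K where K: "compact K" "!!x. x ~: K ==> g x = 0" using test_functionsE[OF g] by metis
 have t: "(%x. g x \<bullet> b) : test_functions UNIV"
  by (rule test_functionsI[OF smooth_linear_comp[OF bounded_linear_inner_left sm] _ K(1)]) (use K(2) in force)+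
 have "((%x. g x \<bullet> b) has_derivative (%h. frechet_derivative g (at x) h \<bullet> b)) (at x)" for x
  by (rule bounded_linear.has_derivative[OF bounded_linear_inner_left smooth_derivative[OF sm]])
 then have "frechet_derivative (%x. g x \<bullet> b) (at x) h = frechet_derivative g (at x) h \<bullet> b" for x
  using frechet_derivative_at by metis
 then have "(LINT x|lebesgue. frechet_derivative g (at x) h \<bullet> b) = 0"
  using integral_frechet_derivative_real[OF t, of h] by simp
 moreover have "integrable lebesgue (%x. frechet_derivative g (at x) h)"
  by (rule test_functions_integrable[OF test_derivative[OF g]])
 ultimately show "(LINT x|lebesgue. frechet_derivative g (at x) h) \<bullet> b = 0 \<bullet> b"
  by simp
qed

lemma partial_scaleR:
 assumes "smooth fi" "smooth f"
 shows "partial j (%x. fi x *r f x) x = fi x *r partial j f x + partial j fi x *r f x"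
proof -
 have "((%x. fi x *r f x) has_derivative (%h. fi x *r frechet_derivative f (at x) h
   + frechet_derivative fi (at x) h *r f x)) (at x)"
  by (rule has_derivative_scaleR[OF smooth_derivative[OF assms(1)] smooth_derivative[OF assms(2)]])
 from frechet_derivative_at[OF this, symmetric] show ?thesis by (simp add: partial_def)
qed

lemma test_functions_scaleR:
 assumes "fi : test_functions Om" "smooth f"
 shows "(%x. fi x *r f x) : test_functions Om"
proof -
 obtain K where K: "compact K" "K \<subseteq> Om" "!!x. x ~: K ==> fi x = 0" "smooth fi" using test_functionsE[OF assms(1)] by metis
 show ?thesis by (rule test_functionsI[OF smooth_scaleR[OF K(4) assms(2)] _ K(1,2)]) (use K(3) in force)
qed

text \<open>Since f is smooth on the whole space, its product with a test function is again a test
  function, and the integral of the derivative of the product vanishes.\<close>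

lemma weak_gradient_classical:
 fixes f :: "real^'n => complex^'m"
 assumes f: "smooth f" and Om: "Om : sets lebesgue"
 shows "weak_gradient Om f (classical_grad f)"
 unfolding weak_gradient_def
proof (intro allI impI)
 fix fi :: "real^'n => real" and j assume fi: "fi : test_functions Om"
 note out = partial_outside_support[OF fi]
 have fiU: "fi : test_functions UNIV" using test_functions_mono[OF fi] by simp
 then have sm: "smooth fi" by (simp add: test_functions_def)
 note p = partial_scaleR[OF sm f, of j]
 have pfi: "partial j fi : test_functions UNIV"
  unfolding partial_def[abs_def] by (rule test_derivative[OF fiU])
 have int: "integrable lebesgue (%x. fi x *r partial j f x)" "integrable lebesgue (%x. partial j fi x *r f x)"
  by (rule test_functions_integrable[OF test_functions_scaleR[OF fiU smooth_partial[OF f]]])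
   (rule test_functions_integrable[OF test_functions_scaleR[OF pfi f]])
 have "0 = (LINT x|lebesgue. partial j (%x. fi x *r f x) x)"
  using integral_frechet_derivative[OF test_functions_scaleR[OF fiU f]] by (simp add: partial_def)
 also have "... = (LINT x|lebesgue. fi x *r partial j f x) + (LINT x|lebesgue. partial j fi x *r f x)"
  using int by (simp add: p)
 finally have *: "(LINT x|lebesgue. partial j fi x *r f x) = - (LINT x|lebesgue. fi x *r partial j f x)"
  by (simp add: eq_neg_iff_add_eq_0 add.commute)
 have eq: "(%x. indicator Om x *r partial j fi x *r f x) = (%x. partial j fi x *r f x)"
  "(%x. indicator Om x *r fi x *r partial j f x) = (%x. fi x *r partial j f x)"
  using out by (auto simp: indicator_def fun_eq_iff)
 show "(LINT x|lebesgue_on Om. partial j fi x *r f x) = - (LINT x|lebesgue_on Om. fi x *r classical_grad f x $ j)"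
  by (simp only: integral_leb_on[OF Om] classical_grad_def vec_lambda_beta eq *)
qed

section \<open>Mollification of weak gradients\<close>

text \<open>The condition on K says that the kernel around x stays inside \<open>Om\<close>. At such
  points the zero extension of u, which in general has no weak gradient across the boundary, behaves
  like u itself.\<close>

lemma conv_weak_gradient:
 fixes u :: "real^'n => complex^'m"
 assumes Om: "Om : sets lebesgue" and wg: "weak_gradient Om u G"
  and rh: "rh : test_functions UNIV" and K: "compact K" "K \<subseteq> Om" "!!y. rh (x - y) ~= 0 ==> y : K"
 shows "conv (%z. frechet_derivative rh (at z) (axis j 1)) (%y. indicator Om y *r u y) x
  = conv rh (%y. indicator Om y *r (G y $ j)) x"
proof -
 define psi where "psi y = rh (x - y)" for y
 note r = reflect_test_function[OF rh K]
 have "psi : test_functions Om" unfolding psi_def by (rule r(1))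
 then have "(LINT y|lebesgue_on Om. partial j psi y *r u y) = - (LINT y|lebesgue_on Om. psi y *r G y $ j)"
  using wg by (simp add: weak_gradient_def)
 moreover have "partial j psi y = - frechet_derivative rh (at (x - y)) (axis j 1)" for y
  unfolding partial_def psi_def by (rule r(2))
 ultimately have "(LINT y|lebesgue_on Om. frechet_derivative rh (at (x - y)) (axis j 1) *r u y)
   = (LINT y|lebesgue_on Om. rh (x - y) *r G y $ j)"
  by (simp add: psi_def)
 then show ?thesis
  by (simp add: conv_def integral_leb_on[OF Om] mult.commute)
qed

lemma mollify_nth:
 fixes G :: "real^'n => complex^'m^'k"
 assumes "G : sqint lebesgue"
 shows "mollify k G x $ j = mollify k (%y. G y $ j) x"
 using integral_bounded_linear[OF bounded_linear_vec_nth
   conv_integrable[OF mollifierD(1)[OF std_mollifier] sqint_locally[OF assms], of k x], of j]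
 by (simp add: mollify_def conv_def)

lemma classical_grad_mollify:
 fixes u :: "real^'n => complex^'m"
 assumes u: "u : L2 UNIV" and G: "G : L2 UNIV" and wg: "weak_gradient UNIV u G"
 shows "classical_grad (mollify k u) x = mollify k G x"
proof -
 have us: "u : sqint lebesgue" "G : sqint lebesgue" using u G by (simp_all add: L2_eq_sqint lebesgue_on_UNIV_eq)
 note rh = mollifierD(1)[OF std_mollifier[of k]]
 have "partial j (mollify k u) x = mollify k (%y. G y $ j) x" for j
 proof -
  have "partial j (mollify k u) x = conv (%z. frechet_derivative (std_mollifier k) (at z) (axis j 1)) u x"
   unfolding partial_def mollify_def by (rule frechet_derivative_conv[OF rh sqint_locally[OF us(1)]])
  also have "... = mollify k (%y. G y $ j) x"
   unfolding mollify_def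
   using conv_weak_gradient[OF _ wg rh compact_cball _ std_mollifier_support, where x=x and j=j] by simp
  finally show ?thesis .
 qed
 then show ?thesis by (simp add: classical_grad_def vec_eq_iff mollify_nth[OF us(2)])
qed

text \<open>The kernel has mass one and sees only a ball. This one computation gives the plateaus
  and the supports of all cut-offs.\<close>

lemma mollify_const:
 fixes x :: "'a::euclidean_space"
 assumes "!!y. y : cball x (1 / Suc k) ==> f y = c"
 shows "mollify k f x = c"
proof -
 have "std_mollifier k (x - y) *r f y = std_mollifier k (x - y) *r c" for y
  using assms std_mollifier_support[of k x y] by (cases "std_mollifier k (x - y) = 0") auto
 then have "mollify k f x = (LINT y|lebesgue. std_mollifier k (x - y) *r c)"
  unfolding mollify_def conv_def by (simp only:)
 also have "... = (LINT y::'a|lebesgue. std_mollifier k y *r c)"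
  by (rule integral_affine(2)[of "%y. std_mollifier k y *r c"])
 also have "... = c" using mollifierD(4,7)[OF std_mollifier[of k, where 'a='a]] by simp
 finally show ?thesis .
qed

lemma indicator_sqint:
 assumes "S : lmeasurable"
 shows "(indicator S :: 'a::euclidean_space => real) : sqint lebesgue"
proof -
 have "integrable lebesgue (indicat_real S)"
  using assms by (intro integrable_real_indicator) (auto simp: fmeasurable_def)
 moreover have "(%x. (norm (indicat_real S x))\<^sup>2) = indicat_real S" by (auto simp: indicator_def)
 ultimately show ?thesis using assms by (auto simp: sqint_def)
qed

lemma mollify_indicator_bounds:
 assumes "S : lmeasurable"
 shows "0 <= mollify k (indicat_real S) x" "mollify k (indicat_real S) x <= 1"
proof -
 note m = mollifierD[OF std_mollifier[of k]]
 show "0 <= mollify k (indicat_real S) x"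
  unfolding mollify_def conv_def by (intro integral_nonneg_AE AE_I2) (simp add: m(2))
 have "mollify k (indicat_real S) x <= (LINT y|lebesgue. std_mollifier k (x - y))"
  unfolding mollify_def conv_def
 proof (rule integral_mono)
  show "integrable lebesgue (%y. std_mollifier k (x - y) *r indicat_real S y)"
   by (rule conv_integrable[OF m(1) sqint_locally[OF indicator_sqint[OF assms]]])
  show "integrable lebesgue (%y. std_mollifier k (x - y))" by (rule integrable_affine(2)[OF m(7)])
 qed (use m(2) in \<open>auto simp: indicator_def\<close>)
 also have "... = 1" using integral_affine(2)[of "std_mollifier k" x] m(4) by simp
 finally show "mollify k (indicat_real S) x <= 1" .
qed

section \<open>Cut-offs and density of test functions in H1\<close>

lemma cutoff_exists:
 obtains \<zeta> :: "'a::euclidean_space => real" where "\<zeta> : test_functions UNIV"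
  "!!x. 0 <= \<zeta> x" "!!x. \<zeta> x <= 1" "!!x. x : cball 0 1 ==> \<zeta> x = 1"
proof
 \<comment> \<open>Index 0 means mollification radius 1, so the ball of radius 2 yields the value 1
   on the unit ball and 0 outside the ball of radius 3.\<close>
 let ?\<zeta> = "mollify 0 (indicat_real (cball 0 2)) :: 'a => real"
 have l: "cball 0 2 : lmeasurable" by simp
 show "?\<zeta> : test_functions UNIV"
 proof (rule test_functionsI)
  show "smooth ?\<zeta>" by (rule smooth_mollify[OF indicator_sqint[OF l]])
  show "x : cball 0 3" if "?\<zeta> x ~= 0" for x
  proof (rule ccontr)
   assume x: "x ~: cball 0 3"
   have "?\<zeta> x = 0"
   proof (rule mollify_const)
    fix y assume "y : cball x (1 / Suc 0)"
    then have "norm (x - y) <= 1" by (simp add: dist_norm)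
    then have "norm y > 2" using x norm_triangle_ineq2[of x "x - y"] by simp
    then show "indicat_real (cball 0 2) y = 0" by simp
   qed
   with that show False by simp
  qed
 qed auto
 show "?\<zeta> x = 1" if "x : cball 0 1" for x
 proof (rule mollify_const)
  fix y assume "y : cball x (1 / Suc 0)"
  then have "norm (x - y) <= 1" by (simp add: dist_norm)
  then have "norm y <= 2" using that norm_triangle_ineq4[of x "x - y"] by simp
  then show "indicat_real (cball 0 2) y = 1" by simp
 qed
qed (use mollify_indicator_bounds[where S="cball 0 2"] in auto)

lemma sqint_square_integrable: "w : sqint M ==> integrable M (%x. (w x :: real)\<^sup>2)"
 by (simp add: sqint_def)

lemma classical_grad_scaleR:
 assumes "smooth fi" "smooth f"
 shows "classical_grad (%x. fi x *r f x) x = fi x *r classical_grad f x + (\<chi> j. partial j fi x *r f x)"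
 by (simp add: classical_grad_def vec_eq_iff partial_scaleR[OF assms])

lemma norm_vec_scaleR_le:
 fixes v :: "complex^'m" and a :: "'n::finite => real"
 assumes "!!j. \<bar>a j\<bar> <= C"
 shows "norm (\<chi> j. a j *r v) <= real CARD('n) * C * norm v"
proof -
 have "norm (\<chi> j. a j *r v) <= (\<Sum>j\<in>UNIV. norm ((\<chi> j. a j *r v) $ j))"
  unfolding norm_vec_def by (rule L2_set_le_sum) simp
 also have "... <= (\<Sum>j\<in>(UNIV::'n set). C * norm v)"
  by (intro sum_mono) (simp add: mult_right_mono assms)
 finally show ?thesis by simp
qed

text \<open>Cut off at a radius growing like k: each partial derivative of the cut-off is at most
  C/(k + 1), so the extra term in the product rule tends to zero.\<close>

lemma smooth_H1_cutoff:
 fixes v :: "real^'n => complex^'m"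
 assumes v: "smooth v" and vs: "v : sqint lebesgue" and gs: "classical_grad v : sqint lebesgue" and e: "0 < e"
 shows "\<exists>fi\<in>test_functions UNIV. l2norm lebesgue (%x. fi x - v x) < e \<and>
  l2norm lebesgue (%x. classical_grad fi x - classical_grad v x) < e"
proof -
 obtain \<zeta> :: "real^'n => real" where \<zeta>: "\<zeta> : test_functions UNIV"
  "!!x. 0 <= \<zeta> x" "!!x. \<zeta> x <= 1" "!!x. x : cball 0 1 ==> \<zeta> x = 1" by (rule cutoff_exists) blast
 have \<zeta>sm: "smooth \<zeta>" using \<zeta>(1) by (simp add: test_functions_def)
 obtain C where C: "0 <= C" "!!x h. \<bar>frechet_derivative \<zeta> (at x) h\<bar> <= C * norm h"
  using test_functions_lipschitz[OF \<zeta>(1)] by metis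
 define c where "c k = 1 / real (Suc k)" for k
 have c: "0 < c k" "c k <= 1" for k by (auto simp: c_def)
 \<comment> \<open>The summand 0 matches the form of \<open>smooth_affine_comp\<close>.\<close>
 define X where "X k x = \<zeta> (c k *r x + 0)" for k x
 have Xsm: "smooth (X k)" for k
  unfolding X_def by (rule smooth_affine_comp[OF bounded_linear_scaleR_right \<zeta>sm])
 have Xp: "partial j (X k) x = c k * frechet_derivative \<zeta> (at (c k *r x)) (axis j 1)" for j k x
 proof -
  interpret D: bounded_linear "frechet_derivative \<zeta> (at (c k *r x))" by (rule linear_derivative[OF \<zeta>sm])
  have "((%x. c k *r x) has_derivative (%h. c k *r h)) (at x)" by (auto intro!: derivative_eq_intros)
  from has_derivative_compose[OF this smooth_derivative[OF \<zeta>sm]]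
  have "(X k has_derivative (%h. frechet_derivative \<zeta> (at (c k *r x)) (c k *r h))) (at x)"
   by (simp add: X_def[abs_def])
  from frechet_derivative_at[OF this, symmetric] show ?thesis by (simp add: partial_def D.scaleR)
 qed
 have Xpb: "\<bar>partial j (X k) x\<bar> <= c k * C" for j k x
  using C(2)[of "c k *r x" "axis j 1"] c[of k] by (simp add: Xp abs_mult mult_left_mono norm_axis_1)
 have Xpb': "\<bar>partial j (X k) x\<bar> <= C" for j k x
  using Xpb[of j k x] c(2)[of k] C(1) mult_left_le_one_le[of C "c k"] c(1)[of k] by linarith
 have X1: "\<forall>\<^sub>F k in sequentially. X k x = 1" for x
 proof -
  obtain N :: nat where N: "norm x <= N" using real_arch_simple by blast
  have "X k x = 1" if "k \<ge> N" for k
  proof -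
   have "norm x <= real (Suc k)" using N that by simp
   then have "norm (c k *r x) <= 1" by (simp add: c_def field_simps)
   then show ?thesis using \<zeta>(4) by (simp add: X_def)
  qed
  then show ?thesis by (auto simp: eventually_sequentially)
 qed
 define f where "f k x = X k x *r v x" for k x
 have fsm: "smooth (f k)" for k unfolding f_def by (intro smooth_scaleR Xsm v)
 have fg: "classical_grad (f k) x = X k x *r classical_grad v x + (\<chi> j. partial j (X k) x *r v x)" for k x
  unfolding f_def by (rule classical_grad_scaleR[OF Xsm v])
 have ft: "f k : test_functions UNIV" for k
 proof -
  obtain K where K: "compact K" "!!x. x ~: K ==> \<zeta> x = 0" using test_functionsE[OF \<zeta>(1)] by metis
  show ?thesis
  proof (rule test_functionsI[OF fsm])
   show "compact ((%x. (1 / c k) *r x) ` K)" by (intro compact_continuous_image continuous_intros K)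
   show "x : (%x. (1 / c k) *r x) ` K" if "f k x ~= 0" for x
    using that K(2)[of "c k *r x"] c(1)[of k] by (intro image_eqI[of _ _ "c k *r x"]) (auto simp: f_def X_def)
  qed simp
 qed
 have lim1: "(%k. l2norm lebesgue (%x. f k x - v x)) ~> 0"
 proof (rule l2_dominated_convergence(2)[where w="%x. norm (v x)"])
  show "AE x in lebesgue. (%k. f k x) ~> v x"
  proof (rule AE_I2)
   fix x show "(%k. f k x) ~> v x"
    by (rule tendsto_eventually, rule eventually_mono[OF X1[of x]]) (simp add: f_def)
  qed
  show "norm (f k x) <= norm (v x)" for k x
   using \<zeta>(2,3) by (simp add: f_def X_def mult_left_le_one_le)
  show "f k : borel_measurable lebesgue" for k by (intro continuous_measurable smooth_continuous_on fsm)
 qed (use sqintD[OF vs] in auto)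
 let ?w = "%x. norm (classical_grad v x) + real CARD('n) * C * norm (v x)"
 have lim2: "(%k. l2norm lebesgue (%x. classical_grad (f k) x - classical_grad v x)) ~> 0"
 proof (rule l2_dominated_convergence(2)[where w="?w"])
  have n1: "(%x. norm (classical_grad v x)) : sqint lebesgue"
   by (rule sqint_dominated[OF gs, where C=1]) (use sqintD(1)[OF gs] in auto)
  have n2: "(%x. norm (v x)) : sqint lebesgue"
   by (rule sqint_dominated[OF vs, where C=1]) (use sqintD(1)[OF vs] in auto)
  have "?w : sqint lebesgue"
   using sqint_add[OF n1 sqint_scaleR[OF n2, of "real CARD('n) * C"]] by simp
  then show "integrable lebesgue (%x. (?w x)\<^sup>2)" by (rule sqint_square_integrable)
  show "AE x in lebesgue. (%k. classical_grad (f k) x) ~> classical_grad v x"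
  proof (rule AE_I2)
   fix x
   have "(%k. X k x) ~> 1" by (rule tendsto_eventually[OF X1])
   then have 1: "(%k. X k x *r classical_grad v x) ~> 1 *r classical_grad v x" by (intro tendsto_intros)
   have "(%k. c k * C) ~> 0 * C"
    unfolding c_def by (intro tendsto_mult tendsto_const LIMSEQ_Suc[OF lim_1_over_n])
   then have "(%k. c k * C) ~> 0" by simp
   then have "(%k. partial j (X k) x) ~> 0" for j
    by (rule Lim_null_comparison[rotated]) (use Xpb in \<open>auto intro!: always_eventually\<close>)
   then have "(%k. partial j (X k) x *r v x) ~> 0 *r v x" for j by (intro tendsto_intros)
   then have 2: "(%k. \<chi> j. partial j (X k) x *r v x) ~> (\<chi> j. 0)"
    by (intro tendsto_vec_lambda) simp
   show "(%k. classical_grad (f k) x) ~> classical_grad v x"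
    using tendsto_add[OF 1 2] by (simp add: fg zero_vec_def[symmetric])
  qed
  show "norm (classical_grad (f k) x) <= ?w x" for k x
  proof -
   have "norm (X k x *r classical_grad v x) <= norm (classical_grad v x)"
    using \<zeta>(2,3) by (simp add: X_def mult_left_le_one_le)
   moreover have "norm (\<chi> j. partial j (X k) x *r v x) <= real CARD('n) * C * norm (v x)"
    by (rule norm_vec_scaleR_le) (rule Xpb')
   ultimately show ?thesis unfolding fg by (rule norm_triangle_mono)
  qed
  show "classical_grad (f k) : borel_measurable lebesgue" for k
   by (intro continuous_measurable smooth_grad_continuous fsm)
 qed (rule sqintD(1)[OF gs])
 obtain N1 where N1: "!!k. k \<ge> N1 ==> norm (l2norm lebesgue (%x. f k x - v x) - 0) < e"
  using LIMSEQ_D[OF lim1 e] by blast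
 obtain N2 where N2: "!!k. k \<ge> N2 ==> norm (l2norm lebesgue (%x. classical_grad (f k) x - classical_grad v x) - 0) < e"
  using LIMSEQ_D[OF lim2 e] by blast
 show ?thesis
  using ft[of "max N1 N2"] N1[of "max N1 N2"] N2[of "max N1 N2"] by (intro bexI[of _ "f (max N1 N2)"]) auto
qed

text \<open>Mollify, then cut off. On the whole space mollification commutes with the weak gradient,
  so function and gradient are approximated together.\<close>

lemma test_functions_dense_H1:
 fixes u :: "real^'n => complex^'m"
 assumes u: "u : L2 UNIV" and G: "G : L2 UNIV" and wg: "weak_gradient UNIV u G"
 shows "\<exists>Ph. (\<forall>k. Ph k : test_functions UNIV) & (%k. l2norm lebesgue (%x. Ph k x - u x)) ~> 0 \<and>
  (%k. l2norm lebesgue (%x. classical_grad (Ph k) x - G x)) ~> 0"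
proof -
 have us: "u : sqint lebesgue" and Gs: "G : sqint lebesgue" using u G by (simp_all add: L2_eq_sqint lebesgue_on_UNIV_eq)
 have g: "classical_grad (mollify k u) = mollify k G" for k
  using classical_grad_mollify[OF assms] by (simp add: fun_eq_iff)
 have "\<forall>k. \<exists>fi. fi : test_functions UNIV & l2norm lebesgue (%x. fi x - mollify k u x) < 1 / Suc k \<and>
   l2norm lebesgue (%x. classical_grad fi x - mollify k G x) < 1 / Suc k"
 proof
  fix k show "\<exists>fi. fi : test_functions UNIV & l2norm lebesgue (%x. fi x - mollify k u x) < 1 / Suc k \<and>
   l2norm lebesgue (%x. classical_grad fi x - mollify k G x) < 1 / Suc k"
  using smooth_H1_cutoff[OF smooth_mollify[OF us] mollify_sqint[OF us], of k "1 / Suc k"] g[of k]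
   mollify_sqint[OF Gs, of k] by auto
 qed
 from choice[OF this] obtain Ph where Ph: "!!k. Ph k : test_functions UNIV"
  "!!k. l2norm lebesgue (%x. Ph k x - mollify k u x) < 1 / Suc k"
  "!!k. l2norm lebesgue (%x. classical_grad (Ph k) x - mollify k G x) < 1 / Suc k" by auto
 have Phs: "Ph k : sqint lebesgue" for k by (rule test_functions_sqint[OF Ph(1)])
 have gm: "classical_grad (Ph k) : borel_measurable lebesgue" for k
  using Ph(1)[of k] by (intro continuous_measurable smooth_grad_continuous) (simp add: test_functions_def)
 have Phgs: "classical_grad (Ph k) : sqint lebesgue" for k
 proof -
  obtain K where K: "compact K" "!!x. x ~: K ==> Ph k x = 0" "smooth (Ph k)" using test_functionsE[OF Ph(1)] by metis
  show ?thesis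
  proof (rule compact_support_sqint[OF smooth_grad_continuous[OF K(3)] K(1)])
   fix x assume "x ~: K"
   then show "classical_grad (Ph k) x = 0"
    using derivative_off_support[OF compact_imp_closed[OF K(1)] K(2)]
    by (simp add: classical_grad_def partial_def vec_eq_iff)
  qed
 qed
 have lim: "(%k. 1 / real (Suc k) + a k) ~> 0" if "a ~> 0" for a
  using tendsto_add[OF LIMSEQ_Suc[OF lim_1_over_n] that] by simp
 have "(%k. l2norm lebesgue (%x. Ph k x - u x)) ~> 0"
 proof (rule Lim_null_comparison[OF always_eventually lim[OF mollify_tendsto[OF us]]], rule allI)
  fix k show "norm (l2norm lebesgue (%x. Ph k x - u x)) <= 1 / real (Suc k) + l2norm lebesgue (%x. mollify k u x - u x)"
   using l2norm_diff_triangle[OF Phs[of k] mollify_sqint[OF us, of k] us] Ph(2)[of k] by simp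
 qed
 moreover have "(%k. l2norm lebesgue (%x. classical_grad (Ph k) x - G x)) ~> 0"
 proof (rule Lim_null_comparison[OF always_eventually lim[OF mollify_tendsto[OF Gs]]], rule allI)
  fix k show "norm (l2norm lebesgue (%x. classical_grad (Ph k) x - G x)) <= 1 / real (Suc k) + l2norm lebesgue (%x. mollify k G x - G x)"
   using l2norm_diff_triangle[OF Phgs[of k] mollify_sqint[OF Gs, of k] Gs] Ph(3)[of k] by simp
 qed
 ultimately show ?thesis using Ph(1) by blast
qed

section \<open>Functions with vanishing gradient\<close>

text \<open>Mollifications are constant on balls that stay inside \<open>Om\<close> with a margin,
  hence u is almost everywhere constant near each point. The local values form a locally constant
  function, and connectedness finishes.\<close>

lemma zero_gradient_constant:
 fixes u :: "real^'n => complex^'m"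
 assumes Om: "open Om" "connected Om" and u: "u : L2 Om" and G: "G : L2 Om" and wg: "weak_gradient Om u G"
  and z: "AE x in lebesgue_on Om. G x = 0"
 shows "\<exists>c. AE x in lebesgue_on Om. u x = c"
proof -
 note Oms = open_leb[OF Om(1)]
 define U where "U x = indicator Om x *r u x" for x
 have U: "U : sqint lebesgue" unfolding U_def using u Oms by (simp add: sqint_restrict_iff L2_eq_sqint)
 obtain r :: "nat => nat" where r: "strict_mono r"
  and lim: "AE x in lebesgue. (%n. mollify (r n) U x - U x) ~> 0"
  using l2norm_AE_subseq[OF sqint_diff[OF mollify_sqint[OF U] U] mollify_tendsto[OF U]] by blast
 have z': "AE y in lebesgue. indicator Om y *r (G y $ j) = 0" for j
  using z unfolding AE_leb_on[OF Oms] by eventually_elim (auto simp: indicator_def)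
 have loc: "\<exists>c e. 0 < e & ball a e \<subseteq> Om & (AE x in lebesgue. x : ball a e --> u x = c)" if a: "a : Om" for a
 proof -
  obtain e where e: "0 < e" "cball a e \<subseteq> Om" using Om(1) a open_contains_cball by blast
  obtain N :: nat where N: "1 / Suc N < e / 2" using nat_approx_posE[of "e/2"] e(1) by auto
  have cst: "\<exists>c. \<forall>x\<in>ball a (e/2). mollify k U x = c" if k: "k \<ge> N" for k
  proof (rule has_derivative_zero_constant)
   fix x assume x: "x : ball a (e/2)"
   note rh = mollifierD(1)[OF std_mollifier[of k]]
   have Usm: "smooth (mollify k U)" by (rule smooth_mollify[OF U])
   have "1 / real (Suc k) <= 1 / Suc N" using k by (simp add: frac_le)
   then have "1 / real (Suc k) < e / 2" using N by linarith
   then have "cball x (1 / Suc k) \<subseteq> cball a e" 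
   proof -
    assume k2: "1 / real (Suc k) < e / 2"
    show ?thesis
    proof
     fix y assume "y : cball x (1 / Suc k)"
     then have "dist a y <= dist a x + dist x y" "dist x y <= 1 / Suc k" using dist_triangle by auto
     then show "y : cball a e" using x k2 by simp
    qed
   qed
   then have sub: "cball x (1 / Suc k) \<subseteq> Om" using e by auto
   have "partial j (mollify k U) x = 0" for j
   proof -
    have "partial j (mollify k U) x = conv (%z. frechet_derivative (std_mollifier k) (at z) (axis j 1)) U x"
     unfolding partial_def mollify_def by (rule frechet_derivative_conv[OF rh sqint_locally[OF U]])
    also have "... = conv (std_mollifier k) (%y. indicator Om y *r (G y $ j)) x"
     unfolding U_def by (rule conv_weak_gradient[OF Oms wg rh compact_cball sub std_mollifier_support])
    also have "... = conv (std_mollifier k) (%y. 0) x"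
    proof (rule conv_cong_AE[OF mollifierD(6)[OF std_mollifier] _ _ z'])
     show "(%y. indicator Om y *r (G y $ j)) : borel_measurable lebesgue"
      using sqintD(1)[OF sqint_nth[OF G[unfolded L2_eq_sqint]]] by (simp add: measurable_leb_on[OF Oms])
    qed simp
    finally show ?thesis by (simp add: conv_def)
   qed
   moreover interpret D: bounded_linear "frechet_derivative (mollify k U) (at x)" by (rule linear_derivative[OF Usm])
   have "frechet_derivative (mollify k U) (at x) h = (\<Sum>j\<in>UNIV. (h $ j) *r partial j (mollify k U) x)" for h
   proof -
    have "h = (\<Sum>j\<in>UNIV. (h $ j) *r axis j 1)" using basis_expansion[of h] by (simp add: scalar_mult_eq_scaleR)
    then have "frechet_derivative (mollify k U) (at x) h = frechet_derivative (mollify k U) (at x) (\<Sum>j\<in>UNIV. (h $ j) *r axis j 1)" by simp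
    then show ?thesis by (simp add: D.sum D.scaleR partial_def)
   qed
   ultimately have "frechet_derivative (mollify k U) (at x) = (%h. 0)" by (simp add: fun_eq_iff)
   then show "(mollify k U has_derivative (%h. 0)) (at x within ball a (e/2))"
    using has_derivative_at_withinI[OF smooth_derivative[OF Usm, of x]] by simp
  qed simp
  obtain W where W: "W : null_sets lebesgue" "!!x. x ~: W ==> (%n. mollify (r n) U x - U x) ~> 0"
   using lim by (auto elim!: AE_E3)
  have "ball a (e/2) ~: null_sets lebesgue"
   using open_not_negligible[of "ball a (e/2)"] e(1) by (simp add: negligible_iff_null_sets)
  then have "\<not> ball a (e/2) \<subseteq> W" using W(1) null_sets_completion_subset by blast
  \<comment> \<open>A reference point at which the mollifications converge exists because the ball
    is not null; all other such points are compared with it.\<close>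
  then obtain x0 where x0: "x0 : ball a (e/2)" "x0 ~: W" by blast
  have "U x = U x0" if x: "x : ball a (e/2)" "x ~: W" for x
  proof -
   have "(%n. (mollify (r n) U x - U x) - (mollify (r n) U x0 - U x0)) ~> 0 - 0"
    by (intro tendsto_diff W x x0)
   moreover have "\<forall>\<^sub>F n in sequentially. (mollify (r n) U x - U x) - (mollify (r n) U x0 - U x0) = U x0 - U x"
    unfolding eventually_sequentially
   proof (intro exI allI impI)
    fix n assume "N <= n"
    then have "N <= r n" using seq_suble[OF r, of n] by simp
    from cst[OF this] x x0 have "mollify (r n) U x = mollify (r n) U x0" by metis
    then show "(mollify (r n) U x - U x) - (mollify (r n) U x0 - U x0) = U x0 - U x" by simp
   qed
   ultimately have "(%n. U x0 - U x) ~> 0" by (simp add: tendsto_cong)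
   then show ?thesis by (simp add: LIMSEQ_const_iff)
  qed
  moreover have "ball a (e/2) \<subseteq> Om" 
  proof -
   have "ball a (e/2) \<subseteq> ball a e" using e(1) by (intro subset_ball) simp
   then show ?thesis using e(2) ball_subset_cball[of a e] by blast
  qed
  ultimately have "u x = U x0" if "x : ball a (e/2)" "x ~: W" for x
  proof -
   assume eq: "!!x. x : ball a (e/2) ==> x ~: W ==> U x = U x0" and sub: "ball a (e/2) \<subseteq> Om"
   have "U x = u x" using that sub by (auto simp: U_def)
   then show ?thesis using eq[OF that] by simp
  qed
  moreover have "AE x in lebesgue. x ~: W" by (rule AE_not_in[OF W(1)])
  ultimately have "AE x in lebesgue. x : ball a (e/2) --> u x = U x0" by (auto elim!: eventually_mono)
  with e \<open>ball a (e/2) \<subseteq> Om\<close> show ?thesis by (intro exI[of _ "U x0"] exI[of _ "e/2"]) auto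
 qed
 then have "\<forall>a. \<exists>p. a : Om --> 0 < snd p & ball a (snd p) \<subseteq> Om \<and>
   (AE x in lebesgue. x : ball a (snd p) --> u x = fst p)"
  by simp
 from choice[OF this] obtain p where p: "\<forall>a. a : Om --> 0 < snd (p a) & ball a (snd (p a)) \<subseteq> Om \<and>
   (AE x in lebesgue. x : ball a (snd (p a)) --> u x = fst (p a))" ..
 define c where "c a = fst (p a)" for a
 define e where "e a = snd (p a)" for a
 have ce: "!!a. a : Om ==> 0 < e a" "!!a. a : Om ==> ball a (e a) \<subseteq> Om"
  "!!a. a : Om ==> AE x in lebesgue. x : ball a (e a) --> u x = c a"
  using p by (simp_all add: c_def e_def)
 have "c constant_on Om"
 proof (rule locally_constant_imp_constant[OF Om(2)])
  fix a assume a: "a : Om"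
  have "c x = c a" if x: "x : ball a (e a)" for x
  proof (rule ccontr)
   assume ne: "c x ~= c a"
   have xO: "x : Om" using x ce(2)[OF a] by auto
   \<comment> \<open>On the overlap of the two balls u would equal both constants almost everywhere,
     although the overlap is open and nonempty, hence not null.\<close>
   let ?S = "ball a (e a) \<inter> ball x (e x)"
   have "AE y in lebesgue. y ~: ?S"
    using ce(3)[OF a] ce(3)[OF xO] by eventually_elim (use ne in auto)
   then have "?S : null_sets lebesgue" by (subst AE_iff_null_sets) auto
   moreover have "open ?S" "x : ?S" using x ce(1)[OF xO] by auto
   ultimately show False using open_not_negligible[of ?S] unfolding negligible_iff_null_sets by blast
  qed
  note const = this
  show "\<exists>T. openin (top_of_set Om) T & a : T & (\<forall>x\<in>T. c x = c a)"
  proof (intro exI conjI ballI)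
   show "openin (top_of_set Om) (ball a (e a))"
    using ce(2)[OF a] by (simp add: openin_open_eq[OF Om(1)])
   show "a : ball a (e a)" using ce(1)[OF a] by simp
  qed (rule const)
 qed
 then obtain d where d: "!!a. a : Om ==> c a = d" by (auto simp: constant_on_def)
 \<comment> \<open>Each point has a neighbourhood in which the exceptional set is null; the local
   characterisation of negligible sets replaces a countable subcover.\<close>
 have "negligible {x : Om. u x ~= d}"
  unfolding locally_negligible_alt[of "{x : Om. u x ~= d}"]
 proof
  fix a assume a: "a : {x : Om. u x ~= d}"
  let ?V = "{x : Om. u x ~= d} \<inter> ball a (e a)"
  obtain W where W: "W : null_sets lebesgue" "!!x. x ~: W ==> x : ball a (e a) --> u x = c a"
   using ce(3)[of a] a by (auto elim!: AE_E3)
  have ca: "c a = d" using d a by blast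
  have "?V \<subseteq> W"
  proof
   fix x assume "x : ?V"
   then have "x : ball a (e a)" "u x ~= d" by auto
   then show "x : W" using W(2)[of x] ca by argo
  qed
  moreover have "negligible W" using W(1) by (simp add: negligible_iff_null_sets)
  ultimately have n: "negligible ?V" by (rule negligible_subset[rotated])
  show "\<exists>W. openin (top_of_set {x : Om. u x ~= d}) W & a : W & negligible W"
  proof (intro exI conjI)
   show "openin (top_of_set {x : Om. u x ~= d}) ?V" by (rule openin_open_Int) simp
   show "a : ?V" using a ce(1)[of a] by simp
  qed (rule n)
 qed
 then have "{x : Om. u x ~= d} : null_sets lebesgue" by (simp add: negligible_iff_null_sets)
 from AE_not_in[OF this] have "AE x in lebesgue. x : Om --> u x = d" by (auto elim!: eventually_mono)
 then show ?thesis by (intro exI[of _ d]) (simp add: AE_leb_on[OF Oms])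
qed

section \<open>Complex structures on Euclidean spaces\<close>

text \<open>A real Euclidean space with an isometric square root of -1. The transform has to act
  alike on \<open>complex^'m\<close> (functions) and \<open>complex^'m^'n\<close> (gradients); this
  class lets it be treated once, keeping the real inner product.\<close>

class complex_structure = euclidean_space +
 fixes imul :: "'a => 'a"
 assumes imul_add: "imul (x + y) = imul x + imul y"
  and imul_scaleR: "imul (r *r x) = r *r imul x"
  and imul_imul: "imul (imul x) = - x"
  and inner_imul_imul: "imul x \<bullet> imul y = x \<bullet> y"

instantiation complex :: complex_structure
begin
definition imul_complex :: "complex => complex" where "imul_complex x = \<i> * x"
instance
 by standard (simp_all add: imul_complex_def algebra_simps inner_complex_def)
end

instantiation vec :: (complex_structure, finite) complex_structure
begin
definition imul_vec :: "'a^'b => 'a^'b" where "imul_vec x = (\<chi> i. imul (x $ i))"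
instance
 by standard (simp_all add: imul_vec_def vec_eq_iff imul_add imul_scaleR imul_imul inner_imul_imul inner_vec_def)
end

lemma imul_vec_nth: "imul x $ i = imul (x $ i)"
 by (simp add: imul_vec_def)

definition cmul :: "complex => 'a::complex_structure => 'a" where
 "cmul c x = Re c *r x + Im c *r imul x"

lemma imul_zero: "imul (0 :: 'a::complex_structure) = 0"
 using imul_scaleR[of 0 "0::'a"] by simp

lemma imul_minus: "imul (- x :: 'a::complex_structure) = - imul x"
 using imul_scaleR[of "-1" x] by simp

lemma inner_imul_left: "imul x \<bullet> y = - (x \<bullet> imul y)"
 using inner_imul_imul[of x "imul y"] by (simp add: imul_imul)

lemma cmul_add_right: "cmul c (x + y) = cmul c x + cmul c y"
 by (simp add: cmul_def imul_add algebra_simps)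

lemma cmul_scaleR_right: "cmul c (r *r x) = r *r cmul c x"
 by (simp add: cmul_def imul_scaleR algebra_simps)

lemma cmul_assoc: "cmul a (cmul b x) = cmul (a * b) x"
 by (simp add: cmul_def imul_add imul_scaleR imul_imul algebra_simps)

lemma cmul_one: "cmul 1 x = x"
 by (simp add: cmul_def)

lemma cmul_of_real: "cmul (of_real r) x = r *r x"
 by (simp add: cmul_def)

lemma cmul_zero [simp]: "cmul c 0 = 0"
 by (simp add: cmul_def imul_zero)

lemma cmul_add_left: "cmul (a + b) x = cmul a x + cmul b x"
 by (simp add: cmul_def algebra_simps)

lemma cmul_ii: "cmul \<i> x = imul x"
 by (simp add: cmul_def)

lemma inner_cmul_left: "cmul c x \<bullet> y = x \<bullet> cmul (cnj c) y"
 by (simp add: cmul_def inner_add_left inner_diff_right inner_imul_left)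

lemma norm_cmul: "norm (cmul c x) = cmod c * norm x"
proof -
 have "(norm (cmul c x))\<^sup>2 = (cmod c * norm x)\<^sup>2"
 proof -
  have "cnj c * c = of_real ((cmod c)\<^sup>2)" by (simp add: complex_norm_square mult.commute del: of_real_power)
  then have "cmul c x \<bullet> cmul c x = (cmod c)\<^sup>2 * (x \<bullet> x)"
   by (simp only: inner_cmul_left cmul_assoc cmul_of_real inner_scaleR_right)
  then show ?thesis by (simp only: power2_norm_eq_inner power_mult_distrib)
 qed
 then show ?thesis by (simp add: power2_eq_iff_nonneg)
qed

lemma bounded_bilinear_cmul: "bounded_bilinear cmul"
proof
 show "\<exists>K. \<forall>a b. norm (cmul a b :: 'a) <= norm a * norm b * K"
  by (rule exI[of _ 1]) (simp add: norm_cmul)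
qed (simp_all add: cmul_add_left cmul_add_right cmul_scaleR_right, simp add: cmul_def algebra_simps)

lemmas bounded_linear_cmul = bounded_bilinear.bounded_linear_right[OF bounded_bilinear_cmul]

lemmas continuous_on_cmul = bounded_bilinear.continuous_on[OF bounded_bilinear_cmul]

text \<open>Separates phases from values: in the norm of a lattice sum \<theta> enters only through
  the cosine and sine of a phase difference.\<close>

lemma inner_cmul_cis: "cmul (cis a) x \<bullet> cmul (cis b) y = cos (a - b) * (x \<bullet> y) + sin (a - b) * (imul x \<bullet> y)"
proof -
 have "cmul (cis a) x \<bullet> cmul (cis b) y = cmul (cis (a - b)) x \<bullet> y"
 proof -
  have "cnj (cis (a - b)) = cnj (cis a) * cis b" by (simp add: cis_cnj cis_mult)
  then show ?thesis by (simp add: inner_cmul_left cmul_assoc)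
 qed
 then show ?thesis by (simp add: cmul_def inner_add_left)
qed

lemma cmul_nth: "cmul c x $ i = cmul c (x $ i)"
 by (simp add: cmul_def imul_vec_def)

lemma cmul_complex: "cmul c (z::complex) = c * z"
 by (simp add: cmul_def imul_complex_def complex_eq_iff)

lemma cmul_eq_smult: "cmul c (v :: complex^'m) = c *s v"
 by (simp add: vec_eq_iff cmul_nth cmul_complex)

lemma cmul_eq_cscale: "cmul c (v :: complex^'m^'n) = cscale c v"
 by (simp add: vec_eq_iff cmul_nth cmul_complex cscale_def)

section \<open>Fubini for the completed product measure\<close>

lemma AE_section:
 fixes Q :: "'a::euclidean_space \<times> 'b::euclidean_space => bool"
 assumes "AE p in lebesgue. Q p"
 shows "AE x in lebesgue. AE y in lebesgue. Q (x, y)"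
proof -
 have "AE p in (lborel \<Otimes>\<^sub>M lborel). Q p" using assms unfolding lborel_prod by (simp add: AE_completion_iff)
 then have "AE x in lborel. AE y in lborel. Q (x, y)" by (rule lborel_pair.AE_pair)
 then show ?thesis by (simp add: AE_completion_iff)
qed

lemma AE_snd:
 assumes "AE y in lebesgue. Q (y :: 'b::euclidean_space)"
 shows "AE p in (lebesgue :: ('a::euclidean_space \<times> 'b) measure). Q (snd p)"
proof -
 have "AE y in lborel. Q y" using assms by (simp add: AE_completion_iff)
 then obtain N where N: "N : null_sets lborel" "{y : space lborel. \<not> Q y} \<subseteq> N"
  unfolding eventually_ae_filter by blast
 have "emeasure (lborel \<Otimes>\<^sub>M lborel) ((UNIV :: 'a set) \<times> N) = emeasure lborel (UNIV :: 'a set) * emeasure lborel N"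
  using N by (intro lborel.emeasure_pair_measure_Times) auto
 then have "UNIV \<times> N : null_sets (lborel :: ('a \<times> 'b) measure)"
  using N by (auto simp: null_sets_def lborel_prod[symmetric] simp del: lborel_prod)
 then have "AE p in (lborel :: ('a \<times> 'b) measure). p ~: UNIV \<times> N" by (rule AE_not_in)
 then have "AE p in (lborel :: ('a \<times> 'b) measure). Q (snd p)"
  by eventually_elim (use N in auto)
 then show ?thesis by (simp add: AE_completion_iff)
qed

lemma borel_measurable_snd_lebesgue:
 fixes f :: "'b::euclidean_space => 'c::euclidean_space"
 assumes "f : borel_measurable lebesgue"
 shows "(%p. f (snd p)) : borel_measurable (lebesgue :: ('a::euclidean_space \<times> 'b) measure)"
proof -
 obtain g where g: "g : borel_measurable borel" "AE x in lebesgue. f x = g x"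
  using borel_representative[OF assms] by blast
 have "(%p. g (snd p)) : borel_measurable (lborel :: ('a \<times> 'b) measure)"
  using g(1) measurable_snd[of "borel :: 'a measure" "borel :: 'b measure"] by (simp add: borel_prod)
 then have "(%p. g (snd p)) : borel_measurable (lebesgue :: ('a \<times> 'b) measure)" by (rule measurable_completion)
 moreover have "AE p in (lebesgue :: ('a \<times> 'b) measure). g (snd p) = f (snd p)"
  by (rule AE_snd) (use g(2) in \<open>auto elim!: eventually_mono\<close>)
 ultimately show ?thesis by (rule borel_measurable_AE)
qed

text \<open>Sections of a function that is measurable for the completed product are measurable only
  for almost every x; a Borel representative carries the classical theorem over.\<close>

lemma lebesgue_Fubini:
 fixes w :: "'a::euclidean_space \<times> 'b::euclidean_space => 'c::euclidean_space"
 assumes "integrable lebesgue w"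
 shows "AE x in lebesgue. integrable lebesgue (%y. w (x, y))"
  and "integrable lebesgue (%x. LINT y|lebesgue. w (x, y))"
  and "(LINT x|lebesgue. LINT y|lebesgue. w (x, y)) = integral\<^sup>L lebesgue w"
proof -
 note wm = borel_measurable_integrable[OF assms]
 obtain g where g: "g : borel_measurable borel" "AE p in lebesgue. w p = g p"
  using borel_representative[OF wm] by blast
 have gl: "g : borel_measurable lebesgue" by (rule measurable_completion) (simp add: g)
 have "integrable lebesgue g" by (rule integrable_cong_AE_imp[OF assms gl]) (use g(2) in \<open>auto elim!: eventually_mono\<close>)
 then have gi: "integrable (lborel \<Otimes>\<^sub>M lborel) g" using g(1) by (simp add: lborel_prod integrable_completion)
 have gs: "AE x in lebesgue. AE y in lebesgue. w (x, y) = g (x, y)" by (rule AE_section[OF g(2)])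
 have gpair: "(%p. g p) : borel_measurable (lborel \<Otimes>\<^sub>M lborel)" using g(1) by (simp add: lborel_prod)
 have gsm: "(%y. g (x, y)) : borel_measurable lborel" for x
  by (rule measurable_compose[OF measurable_Pair1' gpair]) simp
 have gsl: "(%y. g (x, y)) : borel_measurable lebesgue" for x by (rule measurable_completion[OF gsm])
 have wsm: "AE x in lebesgue. (%y. w (x, y)) : borel_measurable lebesgue"
  using gs
 proof eventually_elim
  fix x assume "AE y in lebesgue. w (x, y) = g (x, y)"
  then have "AE y in lebesgue. g (x, y) = w (x, y)" by eventually_elim simp
  then show "(%y. w (x, y)) : borel_measurable lebesgue" by (rule borel_measurable_AE[OF gsl])
 qed
 have "AE x in lborel. integrable lborel (%y. g (x, y))" by (rule lborel_pair.AE_integrable_fst'[OF gi])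
 then have gsi: "AE x in lebesgue. integrable lebesgue (%y. g (x, y))"
  using gsm by (simp add: AE_completion_iff integrable_completion)
 show "AE x in lebesgue. integrable lebesgue (%y. w (x, y))"
  using gsi gs wsm
 proof eventually_elim
  fix x assume i: "integrable lebesgue (%y. g (x, y))" and e: "AE y in lebesgue. w (x, y) = g (x, y)"
   and m: "(%y. w (x, y)) : borel_measurable lebesgue"
  show "integrable lebesgue (%y. w (x, y))"
   by (rule integrable_cong_AE_imp[OF i m]) (use e in \<open>auto elim!: eventually_mono\<close>)
 qed
 have eq: "AE x in lebesgue. (LINT y|lebesgue. g (x, y)) = (LINT y|lebesgue. w (x, y))"
  using gs wsm
 proof eventually_elim
  fix x assume e: "AE y in lebesgue. w (x, y) = g (x, y)" and m: "(%y. w (x, y)) : borel_measurable lebesgue"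
  show "(LINT y|lebesgue. g (x, y)) = (LINT y|lebesgue. w (x, y))"
   by (rule integral_cong_AE[OF gsl m]) (use e in \<open>auto elim!: eventually_mono\<close>)
 qed
 have gint: "integrable lborel (%x. LINT y|lborel. g (x, y))" by (rule lborel_pair.integrable_fst'[OF gi])
 have gint': "integrable lebesgue (%x. LINT y|lebesgue. g (x, y))"
  using gint borel_measurable_integrable[OF gint] by (simp add: integral_completion[OF gsm] integrable_completion)
 have mw: "(%x. LINT y|lebesgue. w (x, y)) : borel_measurable lebesgue"
  by (rule borel_measurable_AE[OF borel_measurable_integrable[OF gint'] eq])
 show "integrable lebesgue (%x. LINT y|lebesgue. w (x, y))"
  by (rule integrable_cong_AE_imp[OF gint' mw]) (use eq in \<open>auto elim!: eventually_mono\<close>)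
 have "(LINT x|lebesgue. LINT y|lebesgue. w (x, y)) = (LINT x|lebesgue. LINT y|lebesgue. g (x, y))"
  by (rule integral_cong_AE[OF mw borel_measurable_integrable[OF gint']]) (use eq in \<open>auto elim!: eventually_mono\<close>)
 also have "... = (LINT x|lborel. LINT y|lborel. g (x, y))"
  unfolding integral_completion[OF gsm] by (rule integral_completion[OF borel_measurable_integrable[OF gint]])
 also have "... = integral\<^sup>L (lborel \<Otimes>\<^sub>M lborel) g" by (rule lborel_pair.integral_fst'[OF gi])
 also have "... = integral\<^sup>L lebesgue g" using g(1) by (simp add: lborel_prod integral_completion)
 also have "... = integral\<^sup>L lebesgue w"
  by (rule integral_cong_AE[OF gl wm]) (use g(2) in \<open>auto elim!: eventually_mono\<close>)
 finally show "(LINT x|lebesgue. LINT y|lebesgue. w (x, y)) = integral\<^sup>L lebesgue w" .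
qed

lemma lebesgue_on_Fubini:
 fixes w :: "'a::euclidean_space \<times> 'b::euclidean_space => 'c::euclidean_space"
 assumes S: "closed S" and T: "closed T" and w: "integrable (lebesgue_on (S \<times> T)) w"
 shows "AE x in lebesgue_on S. integrable (lebesgue_on T) (%y. w (x, y))"
  and "integrable (lebesgue_on S) (%x. LINT y|lebesgue_on T. w (x, y))"
  and "(LINT x|lebesgue_on S. LINT y|lebesgue_on T. w (x, y)) = integral\<^sup>L (lebesgue_on (S \<times> T)) w"
proof -
 have s: "S : sets lebesgue" "T : sets lebesgue" "S \<times> T : sets lebesgue"
  using S T closed_Times[OF S T] by auto
 define W where "W p = indicator (S \<times> T) p *r w p" for p
 have W: "integrable lebesgue W" using w unfolding W_def by (simp add: integrable_leb_on[OF s(3)])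
 have Wxy: "W (x, y) = indicator S x *r indicator T y *r w (x, y)" for x y
  by (simp add: W_def indicator_times)
 note F = lebesgue_Fubini[OF W]
 have "AE x in lebesgue. x : S --> integrable (lebesgue_on T) (%y. w (x, y))"
  using F(1) by eventually_elim (intro impI, simp add: integrable_leb_on[OF s(2)] Wxy)
 then show "AE x in lebesgue_on S. integrable (lebesgue_on T) (%y. w (x, y))"
  by (simp add: AE_leb_on[OF s(1)])
 have eq: "(LINT y|lebesgue. W (x, y)) = indicator S x *r (LINT y|lebesgue_on T. w (x, y))" for x
  unfolding Wxy by (simp only: integral_scaleR_right integral_leb_on[OF s(2)])
 show "integrable (lebesgue_on S) (%x. LINT y|lebesgue_on T. w (x, y))"
  using F(2) unfolding eq by (simp only: integrable_leb_on[OF s(1)])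
 show "(LINT x|lebesgue_on S. LINT y|lebesgue_on T. w (x, y)) = integral\<^sup>L (lebesgue_on (S \<times> T)) w"
  using F(3) unfolding eq by (simp only: integral_leb_on[OF s(1)] integral_leb_on[OF s(3)] W_def[abs_def])
qed

lemma AE_section_on:
 fixes S :: "'a::euclidean_space set" and T :: "'b::euclidean_space set"
 assumes S: "closed S" and T: "closed T" and "AE p in lebesgue_on (S \<times> T). Q p"
 shows "AE x in lebesgue_on S. AE y in lebesgue_on T. Q (x, y)"
proof -
 have s: "S : sets lebesgue" "T : sets lebesgue" "S \<times> T : sets lebesgue"
  using S T closed_Times[OF S T] by auto
 have "AE p in lebesgue. p : S \<times> T --> Q p" using assms(3) by (simp only: AE_leb_on[OF s(3)])
 from AE_section[OF this] show ?thesis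
  unfolding AE_leb_on[OF s(1)] AE_leb_on[OF s(2)] by eventually_elim auto
qed

text \<open>Integrability of the squared norm of a section says nothing about the measurability of
  the section itself, which is obtained separately from a Borel representative.\<close>

lemma sqint_section:
 fixes w :: "'a::euclidean_space \<times> 'b::euclidean_space => 'c::euclidean_space"
 assumes S: "closed S" and T: "closed T" and w: "w : sqint (lebesgue_on (S \<times> T))"
 shows "AE x in lebesgue_on S. (%y. w (x, y)) : sqint (lebesgue_on T)"
proof -
 have s: "S : sets lebesgue" "T : sets lebesgue" "S \<times> T : sets lebesgue"
  using S T closed_Times[OF S T] by auto
 define W where "W p = indicator (S \<times> T) p *r w p" for p
 have Wm: "W : borel_measurable lebesgue"
  using sqintD(1)[OF w] unfolding W_def by (simp add: measurable_leb_on[OF s(3)])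
 obtain g where g: "g : borel_measurable borel" "AE p in lebesgue. W p = g p"
  using borel_representative[OF Wm] by blast
 have gpair: "(%p. g p) : borel_measurable (lborel \<Otimes>\<^sub>M lborel)" using g(1) by (simp add: lborel_prod)
 have gsm: "(%y. g (x, y)) : borel_measurable lborel" for x
  by (rule measurable_compose[OF measurable_Pair1' gpair]) simp
 have gsl: "(%y. g (x, y)) : borel_measurable lebesgue" for x by (rule measurable_completion[OF gsm])
 have "AE x in lebesgue. (%y. W (x, y)) : borel_measurable lebesgue"
  using AE_section[OF g(2)]
 proof eventually_elim
  fix x assume "AE y in lebesgue. W (x, y) = g (x, y)"
  then have "AE y in lebesgue. g (x, y) = W (x, y)" by eventually_elim simp
  then show "(%y. W (x, y)) : borel_measurable lebesgue" by (rule borel_measurable_AE[OF gsl])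
 qed
 then have m: "AE x in lebesgue_on S. (%y. w (x, y)) : borel_measurable (lebesgue_on T)"
  unfolding AE_leb_on[OF s(1)] measurable_leb_on[OF s(2)]
  by eventually_elim (intro impI, simp add: W_def indicator_times)
 from m lebesgue_on_Fubini(1)[OF S T sqintD(2)[OF w]] show ?thesis
  by eventually_elim (simp add: sqint_def)
qed

section \<open>Tilings and characters\<close>

lemma lattice_zero: "0 : lattice"
 and lattice_add: "k : lattice ==> l : lattice ==> k + l : lattice"
 and lattice_uminus: "k : lattice ==> - k : lattice"
 and lattice_diff: "k : lattice ==> l : lattice ==> k - l : lattice"
 by (auto simp: lattice_def)

text \<open>Half-open, so that the integer translates of \<open>hcube (1/2)\<close> partition the
  space; \<open>cell\<close> and \<open>dual_cell\<close> are closed and differ from the cubes by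
  null sets.\<close>

definition hcube :: "real => (real^'n) set" where
 "hcube c = {x. \<forall>i. - c <= x $ i & x $ i < c}"

lemma cell_iff: "x : cell \<longleftrightarrow> (\<forall>i. - 1/2 <= x $ i & x $ i <= 1/2)"
 by (auto simp: cell_def mem_box_cart)

lemma hcube_sets: "(hcube c :: (real^'n) set) : sets lebesgue"
proof -
 have "(hcube c :: (real^'n) set) = (\<Inter>i\<in>UNIV. {x. - c <= x $ i} \<inter> {x. x $ i < c})" by (auto simp: hcube_def)
 also have "... : sets borel"
 proof (rule sets.finite_INT)
  fix i :: 'n
  have "closed {x :: real^'n. - c <= x $ i}" "open {x :: real^'n. x $ i < c}"
   by (auto intro!: closed_Collect_le open_Collect_less continuous_intros)
  then show "{x. - c <= x $ i} \<inter> {x. x $ i < c} : sets borel" by auto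
 qed auto
 finally show ?thesis by (intro sets_completionI_sets) simp
qed

lemma hcube_subset: "hcube c \<subseteq> cbox (\<chi> i. - c) (\<chi> i. c)"
 by (auto simp: hcube_def mem_box_cart less_imp_le)

lemma hcube_lmeasurable: "hcube c : lmeasurable"
 using bounded_set_imp_lmeasurable[OF bounded_subset[OF bounded_cbox hcube_subset] hcube_sets] .

lemma AE_cube_boundary:
 "AE x in lebesgue. x : cbox (\<chi> i. - c) (\<chi> i. c) \<longleftrightarrow> x : (hcube c :: (real^'n) set)"
proof -
 have "negligible {x :: real^'n. x $ i = c}" for i
  using negligible_standard_hyperplane[of "axis i (1::real)" c] by (simp add: inner_axis axis_in_Basis_iff)
 then have "negligible (\<Union>i\<in>(UNIV :: 'n set). {x :: real^'n. x $ i = c})"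
  by (intro negligible_Union) auto
 then have "AE x in lebesgue. x ~: (\<Union>i\<in>(UNIV :: 'n set). {x :: real^'n. x $ i = c})"
  by (intro AE_not_in) (simp add: negligible_iff_null_sets)
 then show ?thesis
 proof eventually_elim
  fix x :: "real^'n" assume "x ~: (\<Union>i\<in>UNIV. {x. x $ i = c})"
  then have "x $ i ~= c" for i by auto
  then show "x : cbox (\<chi> i. - c) (\<chi> i. c) \<longleftrightarrow> x : hcube c"
   by (auto simp: hcube_def mem_box_cart less_le)
 qed
qed

lemma integral_cbox_hcube:
 fixes f :: "real^'n => 'b::euclidean_space"
 shows "(LINT x|lebesgue_on (cbox (\<chi> i. - c) (\<chi> i. c)). f x) = (LINT x|lebesgue. indicator (hcube c) x *r f x)"
proof -
 let ?C = "cbox (\<chi> i. - c) (\<chi> i. c) :: (real^'n) set"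
 have e: "AE x in lebesgue. indicator ?C x *r f x = indicator (hcube c) x *r f x"
  using AE_cube_boundary[of c] by eventually_elim (auto simp: indicator_def)
 have "(LINT x|lebesgue. indicator ?C x *r f x) = (LINT x|lebesgue. indicator (hcube c) x *r f x)"
 proof (cases "(%x. indicator ?C x *r f x) : borel_measurable lebesgue")
  case True
  from integral_cong_AE[OF True borel_measurable_AE[OF True e] e] show ?thesis .
 next
  \<comment> \<open>Without measurability neither integrand is integrable, and both integrals are 0
    by default.\<close>
  case False
  have "AE x in lebesgue. indicator (hcube c) x *r f x = indicator ?C x *r f x" using e by eventually_elim (rule sym)
  note e' = this
  have na: "\<not> integrable lebesgue (%x. indicator (hcube c) x *r f x)"
  proof
   assume "integrable lebesgue (%x. indicator (hcube c) x *r f x)"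
   from borel_measurable_AE[OF borel_measurable_integrable[OF this] e'] False show False by (rule notE[rotated])
  qed
  have nb: "\<not> integrable lebesgue (%x. indicator ?C x *r f x)"
   using False borel_measurable_integrable[of lebesgue "%x. indicator ?C x *r f x"] by argo
  show ?thesis unfolding not_integrable_integral_eq[OF na] not_integrable_integral_eq[OF nb] by (rule refl)
 qed
 then show ?thesis by (simp add: integral_leb_on)
qed

lemma cell_sets: "cell : sets lebesgue" "closed cell" "compact cell" "cell : lmeasurable"
 unfolding cell_def by (rule lmeasurable_cbox[THEN fmeasurableD] closed_cbox compact_cbox lmeasurable_cbox)+

lemma dual_cell_sets: "dual_cell : sets lebesgue" "closed dual_cell" "compact dual_cell" "dual_cell : lmeasurable"
 unfolding dual_cell_def by (rule lmeasurable_cbox[THEN fmeasurableD] closed_cbox compact_cbox lmeasurable_cbox)+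

lemma bounded_continuous_integrable:
 fixes f :: "'a::euclidean_space => 'b::euclidean_space"
 assumes "continuous_on UNIV f" "!!x. norm (f x) <= C" "S : lmeasurable"
 shows "integrable lebesgue (%x. indicator S x *r f x)"
proof (rule integrable_real_bound)
 have "integrable lebesgue (indicat_real S)"
  using assms(3) by (intro integrable_real_indicator) (auto simp: fmeasurable_def)
 then show "integrable lebesgue (%x. C * indicat_real S x)" by (rule integrable_mult_right)
 have "0 <= C" using order_trans[OF norm_ge_zero assms(2)] .
 then show "norm (indicator S x *r f x) <= C * indicat_real S x" for x
  using assms(2)[of x] by (auto simp: indicator_def)
 show "(%x. indicator S x *r f x) : borel_measurable lebesgue"
  using assms(3) by (intro borel_measurable_scaleR borel_measurable_indicator continuous_measurable assms(1)) (auto simp: fmeasurable_def)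
qed

text \<open>Translating by half a period in a direction in which the character is not constant
 changes its sign.\<close>

lemma dual_cell_character_integral:
 fixes l :: "real^'n"
 assumes l: "l : lattice" "l ~= 0"
 shows "(LINT th|dualM. cis (th \<bullet> l)) = 0"
proof -
 obtain j where j: "l $ j ~= 0" using l(2) by (auto simp: vec_eq_iff)
 obtain m :: int where m: "l $ j = real_of_int m" using l(1) by (auto simp: lattice_def Ints_def)
 define t where "t = pi / \<bar>l $ j\<bar>"
 have m1: "1 <= \<bar>l $ j\<bar>" using j m by simp
 have t: "0 < t" "t <= pi" using m1 by (auto simp: t_def field_simps)
 define e where "e = (axis j 1 :: real^'n)"
 have ei: "e $ i = (if i = j then 1 else 0)" for i by (simp add: e_def axis_def)
 define f where "f th = cis (th \<bullet> l)" for th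
 have el: "e \<bullet> l = l $ j" by (simp add: e_def inner_axis' )
 have f1: "f (th + t *r e) = - f th" for th
 proof -
  have "t * l $ j = pi \<or> t * l $ j = - pi" using m1 by (cases "l $ j > 0") (auto simp: t_def field_simps)
  then have "cis (t * l $ j) = -1" by (auto simp: cis.ctr complex_eq_iff)
  then show ?thesis by (simp add: f_def inner_add_left el flip: cis_mult)
 qed
 have f2: "f (th + (2 * pi) *r e) = f th" for th
 proof -
  have "cis (2 * pi * l $ j) = 1" using cis_multiple_2pi[of "l $ j"] l(1) by (simp add: lattice_def mult.commute)
  then show ?thesis by (simp add: f_def inner_add_left el flip: cis_mult)
 qed
 define Q where "Q = (hcube pi :: (real^'n) set)"
 define L where "L = Q \<inter> {th. th $ j < - pi + t}"
 have Qm: "Q : lmeasurable" unfolding Q_def by (rule hcube_lmeasurable)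
 have Lm: "L : lmeasurable"
 proof -
  have "open {th :: real^'n. th $ j < - pi + t}" by (intro open_Collect_less continuous_intros)
  then show ?thesis unfolding L_def using fmeasurable_Int_fmeasurable[OF Qm] by simp
 qed
 \<comment> \<open>Shifting the cube by t in direction j removes the slab L at its lower face and
   adds, beyond the upper face, the copy of L moved by a full period.\<close>
 have ind: "indicat_real Q (th - t *r e) = indicat_real Q th - indicat_real L th + indicat_real L (th - (2 * pi) *r e)" for th
 proof -
  define R where "R \<longleftrightarrow> (\<forall>i. i ~= j --> - pi <= th $ i & th $ i < pi)"
  define a where "a = th $ j"
  have iffQ: "th - s *r e : Q \<longleftrightarrow> R & - pi <= a - s & a - s < pi" for s
   unfolding R_def a_def by (auto simp: Q_def hcube_def ei)
  have Lj: "th - s *r e : L \<longleftrightarrow> (R & - pi <= a - s & a - s < pi) & a - s < - pi + t" for s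
   using iffQ[of s] by (auto simp: L_def ei a_def)
  have i0: "th : Q \<longleftrightarrow> R & - pi <= a & a < pi" "th : L \<longleftrightarrow> (R & - pi <= a & a < pi) & a < - pi + t"
   using iffQ[of 0] Lj[of 0] by simp_all
  have p: "0 < pi" by (rule pi_gt_zero)
  show ?thesis
  proof (cases R)
   case False
   then show ?thesis by (simp add: indicator_def iffQ Lj i0)
  next
   case True
   then show ?thesis unfolding indicator_def iffQ Lj i0 using t p by (simp only: of_bool_def simp_thms split: if_split) linarith
  qed
 qed
 have fc: "continuous_on UNIV f" unfolding f_def by (intro continuous_intros)
 have fb: "norm (f th) <= 1" for th by (simp add: f_def)
 have iQ: "integrable lebesgue (%th. indicator Q th *r f th)" and iL: "integrable lebesgue (%th. indicator L th *r f th)"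
  using bounded_continuous_integrable[OF fc fb] Qm Lm by blast+
 define IQ where "IQ = (LINT th|lebesgue. indicator Q th *r f th)"
 define IL where "IL = (LINT th|lebesgue. indicator L th *r f th)"
 have iL2: "integrable lebesgue (%th. indicator L (th - (2 * pi) *r e) *r f th)"
  and IL2: "(LINT th|lebesgue. indicator L (th - (2 * pi) *r e) *r f th) = IL"
 proof -
  have s: "(%th. indicator L (th - (2 * pi) *r e) *r f th)
    = (%th. indicator L (th + - ((2 * pi) *r e)) *r f (th + - ((2 * pi) *r e)))"
   using f2[of "_ - (2 * pi) *r e"] by (simp add: fun_eq_iff)
  show "integrable lebesgue (%th. indicator L (th - (2 * pi) *r e) *r f th)"
   unfolding s by (rule integrable_affine(1)[OF iL])
  show "(LINT th|lebesgue. indicator L (th - (2 * pi) *r e) *r f th) = IL"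
   unfolding s IL_def by (rule integral_affine(1))
 qed
 have "(LINT th|lebesgue. indicator Q (th - t *r e) *r f th) = IQ - IL + IL"
  unfolding ind using iQ iL iL2 IL2 by (simp add: scaleR_add_left scaleR_diff_left IQ_def IL_def)
 moreover have "(LINT th|lebesgue. indicator Q (th - t *r e) *r f th) = - IQ"
  using integral_affine(1)[of "%th. indicator Q (th - t *r e) *r f th" "t *r e"] by (simp add: f1 IQ_def)
 ultimately have "IQ = 0" by simp
 then show ?thesis
  unfolding dual_cell_def integral_cbox_hcube by (simp add: IQ_def Q_def f_def)
qed

lemma dual_cell_integrable:
 fixes f :: "real^'n => 'b::euclidean_space"
 assumes "continuous_on UNIV f" "!!x. norm (f x) <= C"
 shows "integrable (dualM) f"
 using bounded_continuous_integrable[OF assms dual_cell_sets(4)] by (simp add: integrable_leb_on dual_cell_sets)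

lemma dual_cell_trig_integral:
 fixes l :: "real^'n"
 assumes "l : lattice"
 shows "(LINT th|dualM. cos (th \<bullet> l)) = (if l = 0 then (2 * pi) ^ CARD('n) else 0)"
  and "(LINT th|dualM. sin (th \<bullet> l)) = 0"
proof -
 have i: "integrable (dualM) (%th. cis (th \<bullet> l))"
  by (rule dual_cell_integrable[where C=1]) (auto intro!: continuous_intros)
 have "(LINT th|dualM. cos (th \<bullet> l)) = (2 * pi) ^ CARD('n)" if "l = 0"
 proof -
  have "measure lebesgue (dual_cell :: (real^'n) set) = (2 * pi) ^ CARD('n)"
   unfolding dual_cell_def
   by (subst measure_completion, simp, subst content_cbox_cart) (auto simp: interval_eq_empty_cart not_less)
  then show ?thesis using that using measure_restrict_space[of dual_cell lebesgue "dual_cell :: (real^'n) set"] dual_cell_sets(1) by simp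
 qed
 moreover have "(LINT th|dualM. cos (th \<bullet> l)) = 0" "(LINT th|dualM. sin (th \<bullet> l)) = 0" if "l ~= 0"
  using dual_cell_character_integral[OF assms that] integral_Re[OF i] integral_Im[OF i] by simp_all
 ultimately show "(LINT th|dualM. cos (th \<bullet> l)) = (if l = 0 then (2 * pi) ^ CARD('n) else 0)"
  "(LINT th|dualM. sin (th \<bullet> l)) = 0"
  by (cases "l = 0"; simp)+
qed

text \<open>Joint measurability comes from cylinders over Borel null sets, integrability from
  Tonelli for a Borel representative of the product.\<close>

lemma integrable_tensor_product:
 fixes f :: "'a::euclidean_space => real" and h :: "'b::euclidean_space => real"
 assumes f: "integrable lebesgue f" and h: "integrable lebesgue h"
 shows "integrable lebesgue (%p. f (fst p) * h (snd p))"
proof -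
 have m: "(%p :: 'a \<times> 'b. f (fst p) * h (snd p)) : borel_measurable lebesgue"
 proof (intro borel_measurable_times borel_measurable_snd_lebesgue borel_measurable_integrable[OF h])
  have "(%p :: 'b \<times> 'a. f (snd p)) : borel_measurable lebesgue"
   by (rule borel_measurable_snd_lebesgue[OF borel_measurable_integrable[OF f]])
  obtain g where g: "g : borel_measurable borel" "AE x in lebesgue. f x = g x"
   using borel_representative[OF borel_measurable_integrable[OF f]] by blast
  have "AE x in lborel. f x = g x" using g(2) by (simp add: AE_completion_iff)
  then obtain N where N: "N : null_sets lborel" "{x : space lborel. f x ~= g x} \<subseteq> N"
   unfolding eventually_ae_filter by blast
  have "emeasure (lborel \<Otimes>\<^sub>M lborel) (N \<times> (UNIV :: 'b set)) = emeasure lborel N * emeasure lborel (UNIV :: 'b set)"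
   using N by (intro lborel.emeasure_pair_measure_Times) auto
  then have "N \<times> UNIV : null_sets (lborel :: ('a \<times> 'b) measure)"
   using N by (auto simp: null_sets_def lborel_prod[symmetric] simp del: lborel_prod)
  then have "AE p in (lborel :: ('a \<times> 'b) measure). p ~: N \<times> UNIV" by (rule AE_not_in)
  then have "AE p in (lborel :: ('a \<times> 'b) measure). g (fst p) = f (fst p)"
   by eventually_elim (use N in auto)
  then have ae: "AE p in (lebesgue :: ('a \<times> 'b) measure). g (fst p) = f (fst p)" by (simp add: AE_completion_iff)
  have "(%p. g (fst p)) : borel_measurable (lborel :: ('a \<times> 'b) measure)"
   using g(1) measurable_fst[of "borel :: 'a measure" "borel :: 'b measure"] by (simp add: borel_prod)
  then show "(%p :: 'a \<times> 'b. f (fst p)) : borel_measurable lebesgue"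
   by (intro borel_measurable_AE[OF _ ae] measurable_completion)
 qed
 obtain F where F: "F : borel_measurable borel" "AE p in (lebesgue :: ('a \<times> 'b) measure). f (fst p) * h (snd p) = F p"
  using borel_representative[OF m] by blast
 have FP: "F : borel_measurable (lborel \<Otimes>\<^sub>M lborel)" using F(1) by (simp add: lborel_prod)
 have Fx: "(%y. F (x, y)) : borel_measurable lborel" for x
  by (rule measurable_compose[OF measurable_Pair1' FP]) simp
 have sec: "AE x in lebesgue. AE y in lebesgue. f x * h y = F (x, y)"
  using AE_section[OF F(2)] by simp
 have key: "AE x in lebesgue. integrable lebesgue (%y. F (x, y)) & (LINT y|lebesgue. norm (F (x, y))) = \<bar>f x\<bar> * (LINT y|lebesgue. \<bar>h y\<bar>)"
  using sec
 proof eventually_elim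
  fix x assume e: "AE y in lebesgue. f x * h y = F (x, y)"
  have Fm: "(%y. F (x, y)) : borel_measurable lebesgue" by (rule measurable_completion[OF Fx])
  have i: "integrable lebesgue (%y. F (x, y))"
   by (rule integrable_cong_AE_imp[OF integrable_mult_right[OF h, of "f x"] Fm]) (use e in \<open>auto elim!: eventually_mono\<close>)
  have "(LINT y|lebesgue. norm (F (x, y))) = (LINT y|lebesgue. norm (f x * h y))"
   by (rule integral_cong_AE) (use e Fm borel_measurable_integrable[OF h] in \<open>auto elim!: eventually_mono\<close>)
  then show "integrable lebesgue (%y. F (x, y)) & (LINT y|lebesgue. norm (F (x, y))) = \<bar>f x\<bar> * (LINT y|lebesgue. \<bar>h y\<bar>)"
   using i by (simp add: abs_mult)
 qed
 have "integrable (lborel \<Otimes>\<^sub>M lborel) F"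
 proof (rule lborel_pair.Fubini_integrable[OF FP])
  show "AE x in lborel. integrable lborel (%y. F (x, y))"
   using key Fx by (auto simp: AE_completion_iff integrable_completion elim!: eventually_mono)
  have mm: "(%x. LINT y|lborel. norm (F (x, y))) : borel_measurable lborel"
   using FP by (intro lborel.borel_measurable_lebesgue_integral) (simp add: case_prod_beta')
  have "integrable lebesgue (%x. \<bar>f x\<bar> * (LINT y|lebesgue. \<bar>h y\<bar>))" using f by simp
  then have "integrable lebesgue (%x. LINT y|lborel. norm (F (x, y)))"
  proof (rule integrable_cong_AE_imp)
   show "AE x in lebesgue. \<bar>f x\<bar> * (LINT y|lebesgue. \<bar>h y\<bar>) = (LINT y|lborel. norm (F (x, y)))"
    using key by eventually_elim (use Fx in \<open>simp add: integral_completion\<close>)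
  qed (rule measurable_completion[OF mm])
  then show "integrable lborel (%x. LINT y|lborel. norm (F (x, y)))" using mm by (simp add: integrable_completion)
 qed
 then have "integrable lebesgue F" using F(1) by (simp add: lborel_prod integrable_completion)
 then show ?thesis by (rule integrable_cong_AE_imp[OF _ m]) (use F(2) in \<open>auto elim!: eventually_mono\<close>)
qed

lemma tensor_product_integral:
 fixes f :: "'a::euclidean_space => real" and h :: "'b::euclidean_space => real"
 assumes S: "closed S" and T: "closed T"
  and f: "integrable (lebesgue_on S) f" and h: "integrable (lebesgue_on T) h"
 shows "integrable (lebesgue_on (S \<times> T)) (%p. f (fst p) * h (snd p))"
  and "(LINT p|lebesgue_on (S \<times> T). f (fst p) * h (snd p)) = (LINT x|lebesgue_on S. f x) * (LINT y|lebesgue_on T. h y)"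
proof -
 have s: "S : sets lebesgue" "T : sets lebesgue" "S \<times> T : sets lebesgue"
  using S T closed_Times[OF S T] by auto
 have "integrable lebesgue (%p. (indicator S (fst p) *r f (fst p)) * (indicator T (snd p) *r h (snd p)))"
  using f h by (intro integrable_tensor_product[where f="%x. indicator S x *r f x" and h="%y. indicator T y *r h y"])
   (simp_all only: integrable_leb_on[OF s(1)] integrable_leb_on[OF s(2)])
 moreover have "(%p. (indicator S (fst p) *r f (fst p)) * (indicator T (snd p) *r h (snd p)))
   = (%p. indicator (S \<times> T) p *r (f (fst p) * h (snd p)))"
  by (auto simp: fun_eq_iff indicator_def)
 ultimately show i: "integrable (lebesgue_on (S \<times> T)) (%p. f (fst p) * h (snd p))"
  by (simp only: integrable_leb_on[OF s(3)])
 show "(LINT p|lebesgue_on (S \<times> T). f (fst p) * h (snd p)) = (LINT x|lebesgue_on S. f x) * (LINT y|lebesgue_on T. h y)"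
  using lebesgue_on_Fubini(3)[OF S T i] by simp
qed

section \<open>The Floquet--Bloch--Gelfand transform\<close>

abbreviation MDC :: "((real^'n) \<times> (real^'n)) measure" where
 "MDC \<equiv> lebesgue_on (dual_cell \<times> cell)"

lemma cmul_minus_one: "cmul (- 1) x = - x"
 by (simp add: cmul_def)

text \<open>The normalisation in \<open>gelfand_smooth\<close>; its square cancels the volume of the
  dual cell, which makes the transform isometric.\<close>

definition zak_const :: "'n::finite itself => real" where
 "zak_const _ = (2 * pi) powr (- real CARD('n) / 2)"

lemma zak_const: "0 < zak_const TYPE('n::finite)" "(zak_const TYPE('n))\<^sup>2 * (2 * pi) ^ CARD('n) = 1"
proof -
 show "0 < zak_const TYPE('n)" by (simp add: zak_const_def)
 have "(zak_const TYPE('n))\<^sup>2 = (2 * pi) powr (- real CARD('n) / 2 + - real CARD('n) / 2)"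
  unfolding zak_const_def power2_eq_square by (rule powr_add[symmetric])
 also have "- real CARD('n) / 2 + - real CARD('n) / 2 = - real CARD('n)" by (rule field_sum_of_halves)
 finally have "(zak_const TYPE('n))\<^sup>2 = inverse ((2 * pi) ^ CARD('n))"
  by (simp add: powr_minus powr_realpow)
 then show "(zak_const TYPE('n))\<^sup>2 * (2 * pi) ^ CARD('n) = 1"
  by (simp only:) (rule left_inverse, simp)
qed

text \<open>A finite part of the transform, evaluated at a pair (\<theta>, y). The index set is
  arbitrary because pairing with the cut-off later shifts it by lattice vectors, and the codomain is
  any complex structure so that gradients are covered.\<close>

definition zsum :: "(real^'n) set => (real^'n => 'b::complex_structure) => (real^'n) \<times> (real^'n) => 'b" where
 "zsum K P p = zak_const TYPE('n) *r (\<Sum>l\<in>K. cmul (cis (- (fst p \<bullet> (snd p + l)))) (P (snd p + l)))"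

definition tile :: "(real^'n) set => (real^'n) set" where
 "tile K = {x. \<exists>l\<in>K. x - l : hcube (1/2)}"

lemma hcube_lattice_unique:
 assumes "x - k : hcube (1/2)" "x - l : hcube (1/2)" "k : lattice" "l : lattice"
 shows "k = l"
proof -
 have "k $ i = l $ i" for i
 proof -
  obtain a :: int where a: "k $ i = a" using assms(3) by (auto simp: lattice_def Ints_def)
  obtain b :: int where b: "l $ i = b" using assms(4) by (auto simp: lattice_def Ints_def)
  have "\<bar>k $ i - l $ i\<bar> < 1"
   using assms(1,2)[unfolded hcube_def, simplified, THEN spec[of _ i]] by (auto simp: abs_if)
  then have "\<bar>real_of_int a - real_of_int b\<bar> < 1" by (simp only: a b)
  then have "a = b" by linarith
  then show ?thesis by (simp only: a b)
 qed
 then show ?thesis by (simp add: vec_eq_iff)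
qed

lemma indicator_tile:
 assumes "finite K" "K \<subseteq> lattice"
 shows "indicat_real (tile K) x = (\<Sum>l\<in>K. indicat_real (hcube (1/2)) (x - l))"
proof (cases "x : tile K")
 case True
 then obtain k where k: "k : K" "x - k : hcube (1/2)" by (auto simp: tile_def)
 have "indicat_real (hcube (1/2)) (x - l) = (if l = k then 1 else 0)" if "l : K" for l
  using hcube_lattice_unique[OF _ k(2), of l] k that assms(2) by (auto simp: indicator_def)
 then have "(\<Sum>l\<in>K. indicat_real (hcube (1/2)) (x - l)) = (\<Sum>l\<in>K. if l = k then 1 else 0)" by (intro sum.cong) auto
 then show ?thesis using True k assms by simp
next
 case False
 then have "indicat_real (hcube (1/2)) (x - l) = 0" if "l : K" for l using that by (auto simp: tile_def)
 then show ?thesis using False by simp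
qed

lemma tile_sets: "finite K ==> K \<subseteq> lattice ==> tile K : sets lebesgue"
proof -
 assume K: "finite K" "K \<subseteq> lattice"
 have "(%x. indicat_real (tile K) x) : borel_measurable lebesgue"
  unfolding indicator_tile[OF K]
  by (intro borel_measurable_sum measurable_affine(3) borel_measurable_indicator hcube_sets)
 then show ?thesis by (simp add: borel_measurable_indicator_iff)
qed

lemma sum_cell_integrals:
 fixes h :: "real^'n => real"
 assumes K: "finite K" "K \<subseteq> lattice" and h: "integrable lebesgue h"
 shows "(\<Sum>l\<in>K. LINT y|cellM. h (y + l)) = (LINT x|lebesgue. indicator (tile K) x * h x)"
proof -
 have c: "cell = cbox (\<chi> i. - (1/2)) (\<chi> i. 1/2)" by (simp add: cell_def)
 have "(LINT y|cellM. h (y + l)) = (LINT x|lebesgue. indicat_real (hcube (1/2)) (x - l) * h x)" for l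
 proof -
  have "(LINT y|cellM. h (y + l)) = (LINT y|lebesgue. indicat_real (hcube (1/2)) y * h (y + l))"
   unfolding c integral_cbox_hcube by simp
  also have "... = (LINT x|lebesgue. indicat_real (hcube (1/2)) (x - l) * h x)"
   using integral_affine(1)[of "%x. indicat_real (hcube (1/2)) (x - l) * h x" l] by simp
  finally show ?thesis .
 qed
 then have "(\<Sum>l\<in>K. LINT y|cellM. h (y + l)) = (\<Sum>l\<in>K. LINT x|lebesgue. indicat_real (hcube (1/2)) (x - l) * h x)" by simp
 also have "... = (LINT x|lebesgue. (\<Sum>l\<in>K. indicat_real (hcube (1/2)) (x - l) * h x))"
 proof (rule Bochner_Integration.integral_sum[symmetric])
  fix l
  show "integrable lebesgue (%x. indicat_real (hcube (1/2)) (x - l) * h x)"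
  proof (rule integrable_real_bound[OF integrable_norm[OF h]])
   show "(%x. indicat_real (hcube (1/2)) (x - l) * h x) : borel_measurable lebesgue"
    by (intro borel_measurable_times borel_measurable_integrable[OF h] measurable_affine(3) borel_measurable_indicator hcube_sets)
  qed (auto simp: indicator_def)
 qed
 finally show ?thesis by (simp add: indicator_tile[OF K] sum_distrib_right)
qed

lemma borel_measurable_MDC_snd:
 fixes P :: "real^'n => 'b::euclidean_space"
 assumes "P : borel_measurable lebesgue"
 shows "(%p. P (snd p + l)) : borel_measurable MDC"
 by (rule measurable_restrict_space1) (rule borel_measurable_snd_lebesgue[OF measurable_affine(1)[OF assms]])

lemma borel_measurable_cmul:
 assumes "c : borel_measurable M" "f : borel_measurable M"
 shows "(%x. cmul (c x) (f x)) : borel_measurable M"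
 by (rule borel_measurable_continuous_Pair[OF assms]) (intro continuous_on_cmul continuous_intros)

lemma zsum_term:
 fixes P :: "real^'n => 'b::complex_structure"
 assumes P: "P : sqint lebesgue"
 shows "(%p. cmul (cis (- (fst p \<bullet> (snd p + l)))) (P (snd p + l))) : sqint MDC"
proof -
 have "(%y. P (y + l)) : sqint (cellM)"
  by (rule sqint_leb_on(1)[OF sqint_affine(1)[OF P] cell_sets(1)])
 then have h: "integrable (cellM) (%y. (norm (P (y + l)))\<^sup>2)" by (rule sqintD)
 have f: "integrable (dualM) (%th::real^'n. 1 :: real)"
  by (rule dual_cell_integrable[where C=1]) auto
 from tensor_product_integral(1)[OF dual_cell_sets(2) cell_sets(2) f h]
 have i: "integrable MDC (%p :: (real^'n) \<times> (real^'n). (norm (P (snd p + l)))\<^sup>2)" by simp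
 have cm: "(%p :: (real^'n) \<times> (real^'n). cis (- (fst p \<bullet> (snd p + l)))) : borel_measurable MDC"
  by (intro measurable_restrict_space1 continuous_measurable continuous_intros)
 show ?thesis
  unfolding sqint_def
  using i borel_measurable_cmul[OF cm borel_measurable_MDC_snd[OF sqintD(1)[OF P]]] by (simp add: norm_cmul)
qed

lemma zsum_sqint:
 assumes "P : sqint lebesgue"
 shows "zsum K P : sqint MDC"
proof -
 have "(%p. zak_const TYPE('a) *r (\<Sum>l\<in>K. cmul (cis (- (fst p \<bullet> (snd p + l)))) (P (snd p + l)))) : sqint MDC"
  by (intro sqint_scaleR sqint_sum zsum_term assms)
 then show ?thesis by (simp add: zsum_def[abs_def])
qed

text \<open>Plancherel for finite sums. When the square is expanded, characters of distinct lattice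
  points are orthogonal over the dual cell; the diagonal terms are the squared norms over the cells
  that make up \<open>tile K\<close>.\<close>

lemma zsum_norm:
 fixes P :: "real^'n => 'b::complex_structure"
 assumes K: "finite K" "K \<subseteq> lattice" and P: "P : sqint lebesgue"
 shows "l2norm MDC (zsum K P) = l2norm lebesgue (%x. indicator (tile K) x *r P x)"
proof -
 define \<kappa> where "\<kappa> = zak_const TYPE('n)"
 have Pl: "(%y. P (y + l)) : sqint (cellM)" for l
  by (rule sqint_leb_on(1)[OF sqint_affine(1)[OF P] cell_sets(1)])
 have iPl: "(%y. imul (P (y + l))) : sqint (cellM)" for l
  using sqint_linear[OF bounded_linear_cmul[of \<i>] Pl] by (simp add: cmul_ii)
 have h1: "integrable (cellM) (%y. P (y + l) \<bullet> P (y + m))" for l m by (rule inner_integrable[OF Pl Pl])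
 have h2: "integrable (cellM) (%y. imul (P (y + l)) \<bullet> P (y + m))" for l m by (rule inner_integrable[OF iPl Pl])
 have f1: "integrable (dualM) (%th::real^'n. cos (th \<bullet> l))"
  and f2: "integrable (dualM) (%th::real^'n. sin (th \<bullet> l))" for l
  by (rule dual_cell_integrable[where C=1]; auto intro!: continuous_intros)+
 note T = tensor_product_integral[OF dual_cell_sets(2) cell_sets(2)]
 define q where "q l m p = cos (fst p \<bullet> (m - l)) * (P (snd p + l) \<bullet> P (snd p + m))
   + sin (fst p \<bullet> (m - l)) * (imul (P (snd p + l)) \<bullet> P (snd p + m))" for l m p
 have q: "integrable MDC (q l m)" for l m
  unfolding q_def by (intro Bochner_Integration.integrable_add T(1)[OF f1 h1] T(1)[OF f2 h2])
 have Iq: "(LINT p|MDC. q l m p) = (if l = m then (2 * pi) ^ CARD('n) * (LINT y|cellM. (norm (P (y + l)))\<^sup>2) else 0)"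
  if "l : K" "m : K" for l m
 proof -
  have lm: "m - l : lattice" using that K(2) by (auto intro: lattice_diff)
  have "(LINT p|MDC. q l m p) = (LINT th|dualM. cos (th \<bullet> (m - l))) * (LINT y|cellM. P (y + l) \<bullet> P (y + m))
    + (LINT th|dualM. sin (th \<bullet> (m - l))) * (LINT y|cellM. imul (P (y + l)) \<bullet> P (y + m))"
   unfolding q_def using T(1)[OF f1 h1, of "m - l" l m] T(1)[OF f2 h2, of "m - l" l m] T(2)[OF f1 h1, of "m - l" l m] T(2)[OF f2 h2, of "m - l" l m]
   by simp
  then show ?thesis by (simp add: dual_cell_trig_integral[OF lm] power2_norm_eq_inner)
 qed
 have e: "(norm (zsum K P p))\<^sup>2 = \<kappa>\<^sup>2 * (\<Sum>l\<in>K. \<Sum>m\<in>K. q l m p)" for p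
 proof -
  let ?e = "%l. cmul (cis (- (fst p \<bullet> (snd p + l)))) (P (snd p + l))"
  have "?e l \<bullet> ?e m = q l m p" for l m
   by (simp add: inner_cmul_cis q_def inner_add_right inner_diff_right)
  then have "(norm (\<Sum>l\<in>K. ?e l))\<^sup>2 = (\<Sum>l\<in>K. \<Sum>m\<in>K. q l m p)"
   unfolding power2_norm_eq_inner inner_sum_left inner_sum_right by (subst sum.swap) (simp only:)
  then show ?thesis by (simp add: zsum_def \<kappa>_def power_mult_distrib)
 qed
 have "(l2norm MDC (zsum K P))\<^sup>2 = \<kappa>\<^sup>2 * (\<Sum>l\<in>K. \<Sum>m\<in>K. LINT p|MDC. q l m p)"
  unfolding l2norm_sq e using q by simp
 also have "... = \<kappa>\<^sup>2 * (\<Sum>l\<in>K. (2 * pi) ^ CARD('n) * (LINT y|cellM. (norm (P (y + l)))\<^sup>2))"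
  using K(1) by (simp add: Iq)
 also have "... = (\<kappa>\<^sup>2 * (2 * pi) ^ CARD('n)) * (\<Sum>l\<in>K. LINT y|cellM. (norm (P (y + l)))\<^sup>2)"
  by (simp add: sum_distrib_left mult.assoc)
 also have "... = (LINT x|lebesgue. indicator (tile K) x * (norm (P x))\<^sup>2)"
  using sum_cell_integrals[OF K sqintD(2)[OF P]] zak_const(2)[where 'n='n] by (simp add: \<kappa>_def)
 also have "... = (l2norm lebesgue (%x. indicator (tile K) x *r P x))\<^sup>2"
  unfolding l2norm_sq using indicator_norm_sq[of "tile K" _ "P _"] by simp
 finally show ?thesis by (simp add: power2_eq_iff_nonneg)
qed

definition lat :: "nat => (real^'n) set" where
 "lat N = {l : lattice. \<forall>i. \<bar>l $ i\<bar> <= real N}"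

lemma lat_subset: "lat N \<subseteq> lattice"
 by (auto simp: lat_def)

lemma lat_mono: "M <= N ==> lat M \<subseteq> lat N"
 by (auto simp: lat_def intro: order_trans)

lemma lat_exhaust: "finite K ==> K \<subseteq> lattice ==> \<exists>N. K \<subseteq> lat N"
proof (induction K rule: finite_induct)
 case (insert l K)
 then obtain N where N: "K \<subseteq> lat N" by auto
 obtain M :: nat where "norm l <= M" using real_arch_simple by blast
 then have "\<bar>l $ i\<bar> <= real M" for i using component_le_norm_cart[of l i] by linarith
 then have "l : lat M" using insert by (auto simp: lat_def)
 then have "insert l K \<subseteq> lat (max M N)" using N lat_mono[of M "max M N"] lat_mono[of N "max M N"] by auto
 then show ?case by blast
qed simp

lemma finite_lat: "finite (lat N :: (real^'n) set)"
proof -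
 let ?S = "PiE (UNIV :: 'n set) (%_. real_of_int ` {- int N..int N})"
 have "lat N \<subseteq> vec_lambda ` ?S"
 proof
  fix l :: "real^'n" assume l: "l : lat N"
  have "l $ i : real_of_int ` {- int N..int N}" for i
  proof -
   obtain a :: int where a: "l $ i = a" using l by (auto simp: lat_def lattice_def Ints_def)
   have "\<bar>l $ i\<bar> <= real N" using l by (simp add: lat_def)
   then have "\<bar>a\<bar> <= int N" using a by linarith
   then have "a : {- int N..int N}" by auto
   then show ?thesis unfolding a by (rule imageI)
  qed
  then have "vec_nth l : ?S" by auto
  then show "l : vec_lambda ` ?S" by (intro image_eqI[of _ _ "vec_nth l"]) (auto simp: vec_lambda_eta)
 qed
 moreover have "finite ?S" by (intro finite_PiE) auto
 ultimately show ?thesis using finite_surj by blast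
qed

lemma tile_exhausts: "\<exists>N0. \<forall>N\<ge>N0. x : tile (lat N)"
proof -
 define l :: "real^'a" where "l = (\<chi> i. of_int \<lfloor>x $ i + 1/2\<rfloor>)"
 have "x - l : hcube (1/2)" unfolding hcube_def l_def by (auto; linarith)
 moreover have "l : lattice" by (simp add: lattice_def l_def)
 moreover from lat_exhaust[of "{l}"] this obtain N0 where "l : lat N0" by auto
 ultimately show ?thesis unfolding tile_def using lat_mono by blast
qed

definition ztail :: "(real^'n => 'b::complex_structure) => nat => real" where
 "ztail P N = l2norm lebesgue (%x. indicator (- tile (lat N)) x *r P x)"

lemma ztail_tendsto:
 fixes P :: "real^'n => 'b::complex_structure"
 assumes P: "P : sqint lebesgue"
 shows "ztail P ~> 0"
proof -
 have "(%N. l2norm lebesgue (%x. indicator (- tile (lat N)) x *r P x - 0)) ~> 0"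
 proof (rule l2_dominated_convergence(2)[where w="%x. norm (P x)"])
  show "AE x in lebesgue. (%N. indicator (- tile (lat N)) x *r P x) ~> 0"
  proof (rule AE_I2)
   fix x :: "real^'n"
   obtain N0 where N0: "\<forall>N\<ge>N0. x : tile (lat N)" using tile_exhausts by blast
   then have "\<forall>\<^sub>F N in sequentially. indicator (- tile (lat N)) x *r P x = 0"
    unfolding eventually_sequentially by (intro exI[of _ N0]) auto
   then show "(%N. indicator (- tile (lat N)) x *r P x) ~> 0" by (rule tendsto_eventually)
  qed
  show "(%x. indicator (- tile (lat N)) x *r P x) : borel_measurable lebesgue" for N
   by (intro borel_measurable_scaleR borel_measurable_indicator sqintD(1)[OF P])
    (use sets.compl_sets[OF tile_sets[OF finite_lat lat_subset, of N]] in \<open>simp add: Compl_eq_Diff_UNIV\<close>)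
  show "norm (indicator (- tile (lat N)) x *r P x) <= norm (P x)" for N x by (simp add: indicator_def)
 qed (use sqintD[OF P] in simp_all)
 then show ?thesis by (simp add: ztail_def[abs_def])
qed

lemma zsum_diff:
 assumes "finite K" "L \<subseteq> K"
 shows "zsum K P p - zsum L P p = zsum (K - L) P p"
 using assms sum_diff[of K L "%l. cmul (cis (- (fst p \<bullet> (snd p + l)))) (P (snd p + l))"]
 by (simp add: zsum_def scaleR_diff_right)

text \<open>The difference of nested sums is a sum over cells outside the box; by the isometry it is
  bounded by the mass of P there, uniformly in K.\<close>

lemma zsum_tail:
 fixes P :: "real^'n => 'b::complex_structure"
 assumes K: "finite K" "K \<subseteq> lattice" "lat N \<subseteq> K" and P: "P : sqint lebesgue"
 shows "l2norm MDC (%p. zsum K P p - zsum (lat N) P p) <= ztail P N"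
proof -
 have f: "finite (K - lat N)" "K - lat N \<subseteq> lattice" using K by auto
 have s: "tile (lat N) : sets lebesgue" "tile (K - lat N) : sets lebesgue"
  by (rule tile_sets[OF finite_lat lat_subset], rule tile_sets[OF f])
 have sub: "tile (K - lat N) \<subseteq> - tile (lat N)"
  using hcube_lattice_unique K(2) lat_subset unfolding tile_def by blast
 have s': "- tile (lat N) : sets lebesgue" using s(1) sets.compl_sets[OF s(1)] by (simp add: Compl_eq_Diff_UNIV)
 have m: "(%x. indicator A x *r P x) : borel_measurable lebesgue" if "A : sets lebesgue" for A
  by (intro borel_measurable_scaleR borel_measurable_indicator sqintD(1)[OF P] that)
 have i: "(%x. indicator (- tile (lat N)) x *r P x) : sqint lebesgue"
  by (rule sqint_dominated[OF P m[OF s'], where C=1]) (simp add: indicator_def)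
 have "l2norm MDC (%p. zsum K P p - zsum (lat N) P p) = l2norm lebesgue (%x. indicator (tile (K - lat N)) x *r P x)"
  using zsum_norm[OF f P] by (simp add: zsum_diff[OF K(1,3)])
 also have "... <= 1 * ztail P N"
  unfolding ztail_def using sub by (intro l2norm_dominated[OF i m[OF s(2)]]) (auto simp: indicator_def)
 finally show ?thesis by simp
qed

section \<open>The transform as an L2 limit of lattice sums\<close>

text \<open>Says that w is the transform of P without choosing it. Unlike \<open>gelfand\<close>,
  the relation also applies to gradients and fluxes, and it determines w up to null sets.\<close>

definition glim :: "(real^'n => 'b::complex_structure) => ((real^'n) \<times> (real^'n) => 'b) => bool" where
 "glim P w \<longleftrightarrow> P : sqint lebesgue & w : sqint MDC & (%N. l2norm MDC (%p. zsum (lat N) P p - w p)) ~> 0"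

lemma glimD:
 assumes "glim P w"
 shows "P : sqint lebesgue" "w : sqint MDC" "(%N. l2norm MDC (%p. zsum (lat N) P p - w p)) ~> 0"
 using assms by (simp_all add: glim_def)

text \<open>Any two large partial sums differ from a common smaller one by a tail, so they form a
  Cauchy sequence.\<close>

lemma glim_exists:
 fixes P :: "real^'n => 'b::complex_structure"
 assumes P: "P : sqint lebesgue"
 shows "\<exists>w. glim P w"
proof -
 have "\<exists>N. \<forall>m\<ge>N. \<forall>n\<ge>N. l2norm MDC (%p. zsum (lat m) P p - zsum (lat n) P p) < e" if "0 < e" for e
 proof -
  from LIMSEQ_D[OF ztail_tendsto[OF P], of "e/2"] that
  obtain N where N: "!!n. n \<ge> N ==> \<bar>ztail P n\<bar> < e / 2" by auto
  have "l2norm MDC (%p. zsum (lat m) P p - zsum (lat n) P p) < e" if mn: "m \<ge> N" "n \<ge> N" for m n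
  proof -
   have "l2norm MDC (%p. zsum (lat k) P p - zsum (lat N) P p) < e / 2" if "k \<ge> N" for k
    using zsum_tail[OF finite_lat lat_subset lat_mono[OF that] P] N[of N] by linarith
   from this[OF mn(1)] this[OF mn(2)] show ?thesis
    using l2norm_diff_triangle[OF zsum_sqint[OF P] zsum_sqint[OF P] zsum_sqint[OF P], of "lat m" "lat n" "lat N"]
     l2norm_commute[of MDC "zsum (lat N) P" "zsum (lat n) P"] by argo
  qed
  then show ?thesis by blast
 qed
 from sqint_complete[of "%N. zsum (lat N) P" MDC, OF zsum_sqint[OF P] this]
 show ?thesis using P unfolding glim_def by blast
qed

text \<open>The limit does not depend on the exhaustion. The offset m admits index sets that contain
  the box \<open>lat N\<close> only with a delay, as boxes shifted by a fixed lattice vector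
  do.\<close>

lemma glim_seq:
 fixes P :: "real^'n => 'b::complex_structure"
 assumes w: "glim P w" and K: "!!N. finite (K N)" "!!N. K N \<subseteq> lattice" "!!N. lat N \<subseteq> K (N + m)"
 shows "(%N. l2norm MDC (%p. zsum (K N) P p - w p)) ~> 0"
proof -
 note wD = glimD[OF w]
 have "(%N. l2norm MDC (%p. zsum (K (N + m)) P p - w p)) ~> 0"
 proof (rule Lim_null_comparison[OF always_eventually], rule allI)
  show "(%N. ztail P N + l2norm MDC (%p. zsum (lat N) P p - w p)) ~> 0"
   using tendsto_add[OF ztail_tendsto[OF wD(1)] wD(3)] by simp
  fix N
  show "norm (l2norm MDC (%p. zsum (K (N + m)) P p - w p)) <= ztail P N + l2norm MDC (%p. zsum (lat N) P p - w p)"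
   using l2norm_diff_triangle[OF zsum_sqint[OF wD(1)] zsum_sqint[OF wD(1)] wD(2), of "K (N + m)" "lat N"]
    zsum_tail[OF K(1,2,3) wD(1), of N] by simp
 qed
 then show ?thesis by (rule LIMSEQ_offset)
qed

lemma glim_norm:
 assumes w: "glim P w"
 shows "l2norm MDC w = l2norm lebesgue P"
proof -
 note wD = glimD[OF w]
 have 1: "(%N. l2norm MDC (zsum (lat N) P)) ~> l2norm MDC w"
  by (rule l2norm_tendsto[OF zsum_sqint[OF wD(1)] wD(2,3)])
 have s: "tile (lat N) : sets lebesgue" for N by (rule tile_sets[OF finite_lat lat_subset])
 have i: "(%x. indicator (tile (lat N)) x *r P x) : sqint lebesgue" for N
  by (rule sqint_dominated[OF wD(1), where C=1])
   (intro borel_measurable_scaleR borel_measurable_indicator sqintD(1)[OF wD(1)] s, simp add: indicator_def)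
 have "(%N. l2norm lebesgue (%x. indicator (tile (lat N)) x *r P x)) ~> l2norm lebesgue P"
 proof (rule l2norm_tendsto[OF i wD(1)])
  have "l2norm lebesgue (%x. indicator (tile (lat N)) x *r P x - P x) = ztail P N" for N
  proof -
   have "norm (indicator (tile (lat N)) x *r P x - P x) = norm (indicator (- tile (lat N)) x *r P x)" for x
    by (auto simp: indicator_def)
   then show ?thesis by (simp add: l2norm_def ztail_def)
  qed
  then show "(%N. l2norm lebesgue (%x. indicator (tile (lat N)) x *r P x - P x)) ~> 0"
   using ztail_tendsto[OF wD(1)] by simp
 qed
 then have "(%N. l2norm MDC (zsum (lat N) P)) ~> l2norm lebesgue P"
  using zsum_norm[OF finite_lat lat_subset wD(1)] by simp
 with 1 show ?thesis by (rule LIMSEQ_unique)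
qed

lemma glim_add:
 assumes "glim P v" "glim Q w"
 shows "glim (%x. P x + Q x) (%p. v p + w p)"
proof -
 note v = glimD[OF assms(1)] and w = glimD[OF assms(2)]
 have z: "zsum K (%x. P x + Q x) p = zsum K P p + zsum K Q p" for K p
  by (simp add: zsum_def cmul_add_right sum.distrib scaleR_add_right)
 have "(%N. l2norm MDC (%p. zsum (lat N) (%x. P x + Q x) p - (v p + w p))) ~> 0"
 proof (rule Lim_null_comparison[OF always_eventually], rule allI)
  show "(%N. l2norm MDC (%p. zsum (lat N) P p - v p) + l2norm MDC (%p. zsum (lat N) Q p - w p)) ~> 0"
   using tendsto_add[OF v(3) w(3)] by simp
  fix N
  have "l2norm MDC (%p. zsum (lat N) (%x. P x + Q x) p - (v p + w p))
    = l2norm MDC (%p. (zsum (lat N) P p - v p) + (zsum (lat N) Q p - w p))" by (simp add: z algebra_simps)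
  then show "norm (l2norm MDC (%p. zsum (lat N) (%x. P x + Q x) p - (v p + w p)))
    <= l2norm MDC (%p. zsum (lat N) P p - v p) + l2norm MDC (%p. zsum (lat N) Q p - w p)"
   using l2norm_triangle[OF sqint_diff[OF zsum_sqint[OF v(1)] v(2)] sqint_diff[OF zsum_sqint[OF w(1)] w(2)], of "lat N" "lat N"] by simp
 qed
 then show ?thesis using v w by (simp add: glim_def sqint_add)
qed

text \<open>Lattice periodic, complex linear operators commute with every partial sum. Through this
  lemma the coefficients and the indicator of the inclusions act fibrewise. The measurability
  conditions are left to the instances, because A is a field of operators rather than of
  matrices.\<close>

lemma glim_op:
 fixes A :: "real^'n => 'b::complex_structure => 'c::complex_structure"
 assumes w: "glim P w"
  and lin: "!!y. linear (A y)" and cm: "!!y c x. A y (cmul c x) = cmul c (A y x)" and per: "periodic A"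
  and bd: "!!y x. norm (A y x) <= C * norm x"
  and mR: "!!f. f : borel_measurable lebesgue ==> (%x. A x (f x)) : borel_measurable lebesgue"
  and mM: "!!f. f : borel_measurable MDC ==> (%p. A (snd p) (f p)) : borel_measurable MDC"
 shows "glim (%x. A x (P x)) (%p. A (snd p) (w p))"
proof -
 note wD = glimD[OF w]
 have C: "norm (A y x) <= max 0 C * norm x" for y x
  using bd[of y x] mult_right_mono[of C "max 0 C" "norm x"] by simp
 have AP: "(%x. A x (P x)) : sqint lebesgue" by (rule sqint_dominated[OF wD(1) mR[OF sqintD(1)[OF wD(1)]] bd])
 have Aw: "(%p. A (snd p) (w p)) : sqint MDC" by (rule sqint_dominated[OF wD(2) mM[OF sqintD(1)[OF wD(2)]] bd])
 have z: "zsum (lat N) (%x. A x (P x)) p = A (snd p) (zsum (lat N) P p)" for N p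
 proof -
  have "A (snd p + l) = A (snd p)" if "l : lat N" for l using per that by (auto simp: periodic_def lat_def)
  then show ?thesis
   by (simp add: zsum_def linear_cmul[OF lin] linear_sum[OF lin] cm)
 qed
 have "(%N. l2norm MDC (%p. zsum (lat N) (%x. A x (P x)) p - A (snd p) (w p))) ~> 0"
 proof (rule Lim_null_comparison[OF always_eventually], rule allI)
  show "(%N. max 0 C * l2norm MDC (%p. zsum (lat N) P p - w p)) ~> 0"
   using tendsto_mult_right_zero[OF wD(3)] .
  fix N
  have s: "(%p. zsum (lat N) P p - w p) : sqint MDC" by (rule sqint_diff[OF zsum_sqint[OF wD(1)] wD(2)])
  have "l2norm MDC (%p. A (snd p) (zsum (lat N) P p - w p)) <= max 0 C * l2norm MDC (%p. zsum (lat N) P p - w p)"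
   by (rule l2norm_dominated[OF s mM[OF sqintD(1)[OF s]] _ C]) simp
  then show "norm (l2norm MDC (%p. zsum (lat N) (%x. A x (P x)) p - A (snd p) (w p)))
    <= max 0 C * l2norm MDC (%p. zsum (lat N) P p - w p)"
   by (simp add: z linear_diff[OF lin])
 qed
 then show ?thesis using AP Aw by (simp add: glim_def)
qed

lemma glim_cmul:
 assumes "glim P w"
 shows "glim (%x. cmul c (P x)) (%p. cmul c (w p))"
 by (rule glim_op[OF assms, where A="%y. cmul c" and C="cmod c"])
  (auto simp: periodic_def norm_cmul cmul_assoc mult.commute intro: bounded_linear.linear[OF bounded_linear_cmul] borel_measurable_cmul)

lemma glim_diff:
 assumes "glim P v" "glim Q w"
 shows "glim (%x. P x - Q x) (%p. v p - w p)"
 using glim_add[OF assms(1) glim_cmul[OF assms(2), of "-1"]] by (simp add: cmul_minus_one)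

text \<open>Polarisation: \<open>glim_norm\<close> is applied to P, to Q and to their sum.\<close>

lemma glim_inner:
 assumes "glim P v" "glim Q w"
 shows "l2inner MDC v w = l2inner lebesgue P Q"
proof -
 note v = glimD[OF assms(1)] and w = glimD[OF assms(2)]
 show ?thesis
  using l2norm_sq_add[OF v(1) w(1)] l2norm_sq_add[OF v(2) w(2)] glim_norm[OF glim_add[OF assms]]
   glim_norm[OF assms(1)] glim_norm[OF assms(2)] by simp
qed

lemma glim_inj:
 assumes "glim P v" "glim Q w" "AE p in MDC. v p = w p"
 shows "AE x in lebesgue. P x = Q x"
proof -
 note d = glim_diff[OF assms(1,2)]
 have "AE p in MDC. v p - w p = 0" using assms(3) by eventually_elim simp
 then have "l2norm lebesgue (%x. P x - Q x) = 0"
  using l2norm_eq_0_iff[OF glimD(2)[OF d]] glim_norm[OF d] by simp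
 then show ?thesis using l2norm_eq_0_iff[OF glimD(1)[OF d]] by simp
qed

section \<open>Transforms of test functions\<close>

text \<open>Used for the infinite lattice sum of a test function, which is a finite sum only
  locally, with an index set depending on the point.\<close>

lemma smooth_local:
 assumes "!!x. \<exists>U g. open U & x : U & smooth g & (\<forall>y\<in>U. f y = g y)"
 shows "smooth f"
proof -
 have "C_diff k f" if "!!x. \<exists>U g. open U & x : U & smooth g & (\<forall>y\<in>U. f y = g y)" for k and f :: "'a => 'b"
  using that
 proof (induction k arbitrary: f)
  case 0
  have "isCont f x" for x
  proof -
   obtain U g where U: "open U" "x : U" "smooth g" "\<forall>y\<in>U. f y = g y" using 0 by blast
   have "continuous_on U g" by (rule smooth_continuous_on[OF U(3)])
   then have "continuous_on U f" using U(4) by (metis continuous_on_cong)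
   then show ?thesis using U(1,2) continuous_on_eq_continuous_at by blast
  qed
  then show ?case by (simp add: continuous_at_imp_continuous_on)
 next
  case (Suc k)
  have d: "(f has_derivative frechet_derivative g (at x)) (at x)"
   if U: "open U" "x : U" "smooth g" "\<forall>y\<in>U. f y = g y" for U g x
   by (rule has_derivative_transform_within_open[OF smooth_derivative[OF U(3)] U(1,2)]) (use U(4) in simp)
  have D: "(f has_derivative frechet_derivative f (at x)) (at x)" for x
   using Suc.prems[of x] d frechet_derivative_at by metis
  show ?case
  proof (rule C_diff_SucI[OF D], rule Suc.IH)
   fix h x
   obtain U g where U: "open U" "x : U" "smooth g" "\<forall>y\<in>U. f y = g y" using Suc.prems by blast
   have "frechet_derivative f (at y) h = frechet_derivative g (at y) h" if "y : U" for y
    using frechet_derivative_at[OF d[OF U(1) that U(3,4)]] by simp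
   then show "\<exists>U g. open U & x : U & smooth g & (\<forall>y\<in>U. frechet_derivative f (at y) h = g y)"
    using U smooth_frechet_derivative[OF U(3), of h] by blast
  qed
 qed
 then show ?thesis using assms by (simp add: smooth_def)
qed

text \<open>Multiplication by the imaginary unit is written as a phase shift by pi/2. The derivative
  is then again \<open>cis\<close> of an affine function, and smoothness follows by induction with c
  arbitrary.\<close>

lemma cis_affine_has_derivative:
 "((%x. cis (a \<bullet> x + c)) has_derivative (%h. (a \<bullet> h) *r cis (a \<bullet> x + (c + pi/2)))) (at x)"
proof -
 have e: "cis t = cos t *r 1 + sin t *r \<i>" for t by (simp add: complex_eq_iff)
 have "cis (a \<bullet> x + (c + pi/2)) = (- sin (a \<bullet> x + c)) *r 1 + cos (a \<bullet> x + c) *r \<i>"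
  using cos_add[of "a \<bullet> x + c" "pi/2"] sin_add[of "a \<bullet> x + c" "pi/2"] by (simp add: complex_eq_iff add.assoc)
 note e2 = this
 have "((%x. cos (a \<bullet> x + c) *r 1 + sin (a \<bullet> x + c) *r \<i>) has_derivative
   (%h. (a \<bullet> h) *r ((- sin (a \<bullet> x + c)) *r 1 + cos (a \<bullet> x + c) *r \<i>))) (at x)"
  by (auto intro!: derivative_eq_intros simp: fun_eq_iff complex_eq_iff)
 then show ?thesis unfolding e2 by (simp only: e[of "a \<bullet> _ + c"])
qed

lemma smooth_cis_affine: "smooth (%x. cis (a \<bullet> x + c))"
proof -
 have "C_diff k (%x. cis (a \<bullet> x + c))" for k
 proof (induction k arbitrary: c)
  case 0
  then show ?case by (auto intro!: continuous_intros)
 next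
  case (Suc k)
  show ?case
  proof (rule C_diff_SucI[OF cis_affine_has_derivative])
   show "C_diff k (%x. (a \<bullet> h) *r cis (a \<bullet> x + (c + pi/2)))" for h
    by (rule C_diff_bounded_linear_comp[OF bounded_linear_scaleR_right Suc])
  qed
 qed
 then show ?thesis by (simp add: smooth_def)
qed

lemma imul_cmul: "imul (cmul c x) = cmul c (imul x)"
 by (simp add: cmul_ii[symmetric] cmul_assoc mult.commute)

lemma cmul_diff_right: "cmul c (x - y) = cmul c x - cmul c y"
 by (rule bounded_bilinear.diff_right[OF bounded_bilinear_cmul])

lemma smooth_cmul: "smooth f ==> smooth g ==> smooth (%x. cmul (f x) (g x))"
 by (rule smooth_bilinear[OF bounded_bilinear_cmul])

lemma partial_cmul_cis:
 fixes f :: "real^'n => complex^'m"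
 assumes f: "smooth f"
 shows "partial j (%y. cmul (cis (a \<bullet> y + c)) (f y)) y
  = cmul (cis (a \<bullet> y + c)) (partial j f y + (a $ j) *r imul (f y))"
proof -
 have "((%y. cmul (cis (a \<bullet> y + c)) (f y)) has_derivative
  (%h. cmul (cis (a \<bullet> y + c)) (frechet_derivative f (at y) h) + cmul ((a \<bullet> h) *r cis (a \<bullet> y + (c + pi/2))) (f y))) (at y)"
  by (rule bounded_bilinear.FDERIV[OF bounded_bilinear_cmul cis_affine_has_derivative smooth_derivative[OF f]])
 from frechet_derivative_at[OF this, symmetric]
 have "partial j (%y. cmul (cis (a \<bullet> y + c)) (f y)) y
   = cmul (cis (a \<bullet> y + c)) (partial j f y) + cmul ((a $ j) *r cis (a \<bullet> y + (c + pi/2))) (f y)"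
  by (simp add: partial_def inner_axis)
 moreover have "cis (a \<bullet> y + (c + pi/2)) = cis (a \<bullet> y + c) * \<i>" by (simp add: add.assoc[symmetric] cis_mult[symmetric])
 moreover have "cmul (r *r z) v = r *r cmul z v" for r z and v :: "complex^'m"
  by (simp add: cmul_def algebra_simps)
 ultimately show ?thesis
  by (simp only: cmul_add_right cmul_scaleR_right cmul_ii[symmetric] cmul_assoc)
qed

lemma tensor_nth: "tensor th u $ j = th $ j *r u"
 by (simp add: tensor_def vec_eq_iff) (simp add: scaleR_conv_of_real)

lemma classical_grad_cmul_cis:
 fixes f :: "real^'n => complex^'m"
 assumes f: "smooth f"
 shows "classical_grad (%y. cmul (cis (a \<bullet> y + c)) (f y)) y = cmul (cis (a \<bullet> y + c)) (classical_grad f y + imul (tensor a (f y)))"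
 by (simp add: vec_eq_iff[where 'b='n] classical_grad_def partial_cmul_cis[OF f] cmul_nth imul_vec_nth[where 'b='n] tensor_nth imul_scaleR)

lemma classical_grad_translate:
 fixes f :: "real^'n => complex^'m"
 assumes f: "smooth f"
 shows "classical_grad (%y. f (y + l)) y = classical_grad f (y + l)"
proof -
 have "((%x. x + l) has_derivative (%h. h)) (at y)" by (auto intro!: derivative_eq_intros)
 from has_derivative_compose[OF this smooth_derivative[OF f]]
 have "((%y. f (y + l)) has_derivative frechet_derivative f (at (y + l))) (at y)" by simp
 from frechet_derivative_at[OF this, symmetric] show ?thesis by (simp add: classical_grad_def partial_def)
qed

lemma classical_grad_sum:
 fixes f :: "'i => real^'n => complex^'m"
 assumes f: "!!i. i : I ==> smooth (f i)"
 shows "classical_grad (%y. r *r (\<Sum>i\<in>I. f i y)) y = r *r (\<Sum>i\<in>I. classical_grad (f i) y)"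
proof -
 have "((%y. r *r (\<Sum>i\<in>I. f i y)) has_derivative (%h. r *r (\<Sum>i\<in>I. frechet_derivative (f i) (at y) h))) (at y)"
  by (intro has_derivative_scaleR_right has_derivative_sum smooth_derivative f)
 from frechet_derivative_at[OF this, symmetric] show ?thesis
  by (simp add: classical_grad_def partial_def vec_eq_iff[where 'b='n] sum_component)
qed

text \<open>Differentiating the phase produces -i \<theta> \<otimes>, so the Bloch gradient of a
  partial sum is the partial sum of the gradients. This is why gradients are transformed into Bloch
  gradients.\<close>

lemma zsum_smooth:
 fixes f :: "real^'n => complex^'m"
 assumes f: "smooth f"
 shows "smooth (%y. zsum K f (th, y))"
  and "classical_grad (%y. zsum K f (th, y)) y = zsum K (classical_grad f) (th, y) - imul (tensor th (zsum K f (th, y)))"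
proof -
 define g where "g l y = cmul (cis ((- th) \<bullet> y + - (th \<bullet> l))) (f (y + l))" for l y
 have z: "zsum K f (th, y) = zak_const TYPE('n) *r (\<Sum>l\<in>K. g l y)" for y
  by (simp add: zsum_def g_def inner_add_right)
 have gs: "smooth (g l)" for l
  unfolding g_def by (intro smooth_cmul smooth_cis_affine smooth_translate f)
 show "smooth (%y. zsum K f (th, y))" unfolding z by (intro smooth_scaleR smooth_const smooth_sum gs)
 have gg: "classical_grad (g l) y = cmul (cis (- (th \<bullet> (y + l)))) (classical_grad f (y + l)) - imul (tensor th (g l y))" for l
 proof -
  have t: "tensor (- th) v = - tensor th v" for v :: "complex^'m" by (simp add: tensor_def vec_eq_iff)
  have tc: "tensor th (cmul c v) = cmul c (tensor th v)" for c and v :: "complex^'m"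
   by (simp add: vec_eq_iff[where 'b='n] tensor_nth cmul_nth cmul_scaleR_right)
  have "classical_grad (g l) y = cmul (cis ((- th) \<bullet> y + - (th \<bullet> l))) (classical_grad f (y + l) + imul (tensor (- th) (f (y + l))))"
   unfolding g_def by (simp only: classical_grad_cmul_cis[OF smooth_translate[OF f]] classical_grad_translate[OF f])
  also have "... = cmul (cis (- (th \<bullet> (y + l)))) (classical_grad f (y + l)) - imul (tensor th (g l y))"
  proof -
   have ex: "(- th) \<bullet> y + - (th \<bullet> l) = - (th \<bullet> (y + l))" by (simp add: inner_add_right)
   show ?thesis
    unfolding g_def ex t by (simp only: tc imul_minus add_uminus_conv_diff cmul_diff_right imul_cmul)
  qed
  finally show ?thesis .
 qed
 have ts: "tensor th (r *r (\<Sum>l\<in>K. v l)) = r *r (\<Sum>l\<in>K. tensor th (v l))" for r and v :: "real^'n => complex^'m"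
  by (simp add: vec_eq_iff[where 'b='n] tensor_nth sum_component scaleR_sum_right mult.commute)
 have iss: "imul (r *r (\<Sum>l\<in>K. v l)) = r *r (\<Sum>l\<in>K. imul (v l))" for r and v :: "real^'n => complex^'m^'n"
  using linear_sum[OF bounded_linear.linear[OF bounded_linear_cmul[of \<i>]], of v K] by (simp add: imul_scaleR cmul_ii)
 show "classical_grad (%y. zsum K f (th, y)) y = zsum K (classical_grad f) (th, y) - imul (tensor th (zsum K f (th, y)))"
 proof -
  have cg: "classical_grad (%y. zak_const TYPE('n) *r (\<Sum>l\<in>K. g l y)) y
    = zak_const TYPE('n) *r (\<Sum>l\<in>K. classical_grad (g l) y)"
   by (rule classical_grad_sum) (rule gs)
  show ?thesis unfolding z cg gg ts iss by (simp add: zsum_def sum_subtractf scaleR_diff_right)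
 qed
qed

text \<open>The box contains every lattice point that moves y into the support, uniformly for y in a
  ball, so the infinite sum is finite there.\<close>

lemma gelfand_smooth_eq_zsum:
 fixes Ph :: "real^'n => complex^'m"
 assumes z: "!!x. x ~: cball 0 R ==> Ph x = 0" and y: "norm y <= r" and N: "R + r <= real N"
 shows "gelfand_smooth Ph th y = zsum (lat N) Ph (th, y)"
proof -
 let ?f = "%l. exp (- \<i> * complex_of_real (th \<bullet> (y + l))) *s Ph (y + l)"
 have "Ph (y + l) = 0" if l: "l : lattice - lat N" for l
 proof (rule z)
  obtain i where "\<bar>l $ i\<bar> > real N" using l by (auto simp: lat_def not_le)
  then have "norm l > R + r" using component_le_norm_cart[of l i] N by linarith
  then show "y + l ~: cball 0 R" using y norm_triangle_ineq4[of "y + l" y] by simp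
 qed
 then have "(\<Sum>\<^sub>\<infinity>l\<in>lattice. ?f l) = (\<Sum>\<^sub>\<infinity>l\<in>lat N. ?f l)"
  using lat_subset[of N] by (intro infsum_cong_neutral) auto
 also have "... = (\<Sum>l\<in>lat N. ?f l)" by (rule infsum_finite[OF finite_lat])
 also have "... = (\<Sum>l\<in>lat N. cmul (cis (- (th \<bullet> (y + l)))) (Ph (y + l)))"
  by (simp add: cmul_eq_smult cis_conv_exp)
 finally show ?thesis by (simp add: gelfand_smooth_def zsum_def zak_const_def)
qed

lemma test_ball_support:
 assumes "Ph : test_functions UNIV"
 obtains R where "!!x. x ~: cball 0 R ==> Ph x = 0" "smooth Ph"
proof -
 obtain K where K: "compact K" "!!x. x ~: K ==> Ph x = 0" "smooth Ph" using test_functionsE[OF assms] by metis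
 obtain R where R: "\<forall>x\<in>K. norm x <= R" using compact_imp_bounded[OF K(1)] unfolding bounded_iff by blast
 have "Ph x = 0" if "x ~: cball 0 R" for x using that R by (intro K(2)) auto
 then show ?thesis using K(3) by (rule that)
qed

lemma gelfand_smooth_smooth:
 fixes Ph :: "real^'n => complex^'m"
 assumes Ph: "Ph : test_functions UNIV"
 shows "smooth (gelfand_smooth Ph th)" "periodic (gelfand_smooth Ph th)"
proof -
 obtain R where R: "!!x. x ~: cball 0 R ==> Ph x = 0" "smooth Ph" using test_ball_support[OF Ph] by blast
 show "smooth (gelfand_smooth Ph th)"
 proof (rule smooth_local)
  fix x :: "real^'n"
  obtain N :: nat where N: "R + (norm x + 1) <= real N" using real_arch_simple by blast
  have "gelfand_smooth Ph th y = zsum (lat N) Ph (th, y)" if "y : ball 0 (norm x + 1)" for y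
   by (rule gelfand_smooth_eq_zsum[OF R(1) _ N]) (use that in auto)
  then show "\<exists>U g. open U & x : U & smooth g & (\<forall>y\<in>U. gelfand_smooth Ph th y = g y)"
   by (intro exI[of _ "ball 0 (norm x + 1)"] exI[of _ "%y. zsum (lat N) Ph (th, y)"]) (simp add: zsum_smooth(1)[OF R(2)])
 qed
 show "periodic (gelfand_smooth Ph th)"
  unfolding periodic_def
 proof (intro ballI allI)
  fix m y :: "real^'n" assume m: "m : lattice"
  let ?f = "%y l. exp (- \<i> * complex_of_real (th \<bullet> (y + l))) *s Ph (y + l)"
  have b: "bij_betw (%l. m + l) lattice lattice"
   by (rule bij_betwI[where g="%l. l - m"]) (auto intro: lattice_add lattice_diff m)
  have "(\<Sum>\<^sub>\<infinity>l\<in>lattice. ?f y (m + l)) = (\<Sum>\<^sub>\<infinity>l\<in>lattice. ?f y l)"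
   by (rule infsum_reindex_bij_betw[OF b])
  then show "gelfand_smooth Ph th (y + m) = gelfand_smooth Ph th y"
   by (simp add: gelfand_smooth_def add.assoc)
 qed
qed

lemma cell_bounded: obtains r where "!!y. y : cell ==> norm y <= r"
 using compact_imp_bounded[OF cell_sets(3)] unfolding bounded_iff by blast

lemma space_MDC: "space MDC = dual_cell \<times> cell"
 by (simp add: space_restrict_space)

lemma sqint_cong: "(!!x. x : space M ==> f x = g x) ==> f : sqint M \<longleftrightarrow> g : sqint M"
 unfolding sqint_def
 by (simp cong: measurable_cong Bochner_Integration.integrable_cong)

lemma l2norm_cong: "(!!x. x : space M ==> f x = g x) ==> l2norm M f = l2norm M g"
 unfolding l2norm_def by (simp cong: Bochner_Integration.integral_cong)

text \<open>On the cell the partial sums of a test function become stationary, so the limit in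
  \<open>glim\<close> is attained.\<close>

lemma glim_smooth:
 fixes Ph :: "real^'n => complex^'m"
 assumes Ph: "Ph : test_functions UNIV"
 shows "glim Ph (case_prod (gelfand_smooth Ph))"
proof -
 obtain R where R: "!!x. x ~: cball 0 R ==> Ph x = 0" "smooth Ph" using test_ball_support[OF Ph] by blast
 obtain r where r: "!!y :: real^'n. y : cell ==> norm y <= r" using cell_bounded by blast
 obtain N0 :: nat where N0: "R + r <= real N0" using real_arch_simple by blast
 have eq: "case_prod (gelfand_smooth Ph) p = zsum (lat N) Ph p" if "p : space MDC" "N \<ge> N0" for p N
 proof (cases p)
  case (Pair th y)
  have "gelfand_smooth Ph th y = zsum (lat N) Ph (th, y)"
   by (rule gelfand_smooth_eq_zsum[OF R(1), where r=r]) (use that r N0 Pair in \<open>auto simp: space_MDC\<close>)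
  then show ?thesis using Pair by simp
 qed
 have s: "Ph : sqint lebesgue" by (rule test_functions_sqint[OF Ph])
 have "case_prod (gelfand_smooth Ph) : sqint MDC"
 proof -
  have "case_prod (gelfand_smooth Ph) : sqint MDC \<longleftrightarrow> zsum (lat N0) Ph : sqint MDC"
   by (rule sqint_cong) (rule eq, simp_all)
  then show ?thesis using zsum_sqint[OF s] by simp
 qed
 moreover have "(%N. l2norm MDC (%p. zsum (lat N) Ph p - case_prod (gelfand_smooth Ph) p)) ~> 0"
 proof (rule tendsto_eventually, unfold eventually_sequentially, intro exI allI impI)
  fix N assume "N0 <= N"
  then have "l2norm MDC (%p. zsum (lat N) Ph p - case_prod (gelfand_smooth Ph) p) = l2norm MDC (%p :: (real^'n) \<times> (real^'n). 0 :: complex^'m)"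
   by (intro l2norm_cong) (simp add: eq)
  then show "l2norm MDC (%p. zsum (lat N) Ph p - case_prod (gelfand_smooth Ph) p) = 0" by (simp add: l2norm_def)
 qed
 ultimately show ?thesis using s by (simp add: glim_def)
qed

text \<open>\<open>gelfand\<close> picks an arbitrary limit along an arbitrary approximating
  sequence. One admissible candidate is exhibited first; the isometry on test functions then shows
  that whatever was picked agrees with it almost everywhere.\<close>

lemma gelfand_glim:
 fixes F :: "real^'n => complex^'m"
 assumes F: "F : L2 UNIV"
 shows "glim F (case_prod (gelfand F))"
proof -
 have Fs: "F : sqint lebesgue" using F by (simp add: L2_eq_sqint lebesgue_on_UNIV_eq)
 define Q where "Q w \<longleftrightarrow> (\<exists>Ph. (\<forall>k. Ph k : test_functions UNIV) & L2_tendsto UNIV Ph F \<and>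
  L2_tendsto (dual_cell \<times> cell) (%k. case_prod (gelfand_smooth (Ph k))) (case_prod w))" for w :: "real^'n => real^'n => complex^'m"
 obtain w where w: "glim F w" using glim_exists[OF Fs] by blast
 have nrm: "l2norm MDC (%p. case_prod (gelfand_smooth Ph) p - w p) = l2norm lebesgue (%x. Ph x - F x)"
  if "Ph : test_functions UNIV" for Ph
  by (rule glim_norm[OF glim_diff[OF glim_smooth[OF that] w]])
 have "\<forall>k::nat. \<exists>fi. fi : test_functions UNIV & l2norm lebesgue (%x. fi x - F x) < 1 / Suc k"
  using test_functions_dense[OF Fs, of "1 / Suc _"] by auto
 from choice[OF this] obtain Ph where Ph: "\<forall>k. Ph k : test_functions UNIV & l2norm lebesgue (%x. Ph k x - F x) < 1 / Suc k" ..
 have lim: "(%k. l2norm lebesgue (%x. Ph k x - F x)) ~> 0"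
 proof (rule Lim_null_comparison[OF always_eventually LIMSEQ_Suc[OF lim_1_over_n]], rule allI)
  show "norm (l2norm lebesgue (%x. Ph k x - F x)) <= 1 / real (Suc k)" for k using Ph[THEN spec[of _ k]] by simp
 qed
 have "Q (curry w)"
  unfolding Q_def
 proof (intro exI conjI allI)
  show t: "Ph k : test_functions UNIV" for k using Ph by blast
  then show "L2_tendsto UNIV Ph F"
   using lim F test_functions_sqint by (auto simp: L2_tendsto_iff L2_eq_sqint lebesgue_on_UNIV_eq)
  show "L2_tendsto (dual_cell \<times> cell) (%k. case_prod (gelfand_smooth (Ph k))) (case_prod (curry w))"
   unfolding L2_tendsto_iff L2_eq_sqint case_prod_curry nrm[OF t]
   using lim glimD(2)[OF w] glimD(2)[OF glim_smooth[OF t]] by blast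
 qed
 then have "Q (SOME w. Q w)" by (rule someI[of Q])
 then have "Q (gelfand F)" unfolding gelfand_def Q_def .
 then obtain \<Psi> where \<Psi>: "\<forall>k. \<Psi> k : test_functions UNIV" "L2_tendsto UNIV \<Psi> F"
  "L2_tendsto (dual_cell \<times> cell) (%k. case_prod (gelfand_smooth (\<Psi> k))) (case_prod (gelfand F))" unfolding Q_def by blast
 let ?g = "case_prod (gelfand F)"
 let ?s = "%k. case_prod (gelfand_smooth (\<Psi> k))"
 have gs: "?g : sqint MDC" and l1: "(%k. l2norm MDC (%p. ?s k p - ?g p)) ~> 0"
  and l2: "(%k. l2norm MDC (%p. ?s k p - w p)) ~> 0"
  using \<Psi> by (simp_all add: L2_tendsto_iff L2_eq_sqint nrm lebesgue_on_UNIV_eq)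
 have ss: "?s k : sqint MDC" for k using glimD(2)[OF glim_smooth] \<Psi>(1) by blast
 have "l2norm MDC (%p. w p - ?g p) <= 0"
 proof (rule LIMSEQ_le_const)
  show "(%k. l2norm MDC (%p. ?s k p - w p) + l2norm MDC (%p. ?s k p - ?g p)) ~> 0"
   using tendsto_add[OF l2 l1] by simp
  show "\<exists>N. \<forall>n\<ge>N. l2norm MDC (%p. w p - ?g p) <= l2norm MDC (%p. ?s n p - w p) + l2norm MDC (%p. ?s n p - ?g p)"
  proof (intro exI allI impI)
   fix n
   have "l2norm MDC (%p. w p - ?s n p) = l2norm MDC (%p. ?s n p - w p)" by (rule l2norm_commute)
   then show "l2norm MDC (%p. w p - ?g p) <= l2norm MDC (%p. ?s n p - w p) + l2norm MDC (%p. ?s n p - ?g p)"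
    using l2norm_diff_triangle[OF glimD(2)[OF w] ss[of n] gs] by argo
  qed
 qed
 then have z: "l2norm MDC (%p. w p - ?g p) = 0" by (simp add: antisym)
 have "(%N. l2norm MDC (%p. zsum (lat N) F p - ?g p)) ~> 0"
 proof (rule Lim_null_comparison[OF always_eventually glimD(3)[OF w]], rule allI)
  show "norm (l2norm MDC (%p. zsum (lat N) F p - ?g p)) <= l2norm MDC (%p. zsum (lat N) F p - w p)" for N
   using l2norm_diff_triangle[OF zsum_sqint[OF Fs] glimD(2)[OF w] gs, of "lat N"] z by simp
 qed
 then show ?thesis using Fs gs by (simp add: glim_def)
qed

text \<open>One subsequence and one null set of x serve the whole sequence; this is what later
  permits testing with all elements of a fibre space at once.\<close>

lemma section_subsequence:
 fixes h :: "nat => 'a::euclidean_space \<times> 'b::euclidean_space => real"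
 assumes S: "closed S" and T: "closed T" and h: "!!k. integrable (lebesgue_on (S \<times> T)) (h k)" "!!k p. 0 <= h k p"
  and lim: "(%k. integral\<^sup>L (lebesgue_on (S \<times> T)) (h k)) ~> 0"
 shows "\<exists>r. strict_mono r & (AE x in lebesgue_on S. (\<forall>k. integrable (lebesgue_on T) (%y. h (r k) (x, y))) \<and>
  (%k. LINT y|lebesgue_on T. h (r k) (x, y)) ~> 0)"
proof -
 note F = lebesgue_on_Fubini[OF S T h(1)]
 have n: "norm (LINT y|lebesgue_on T. h k (x, y)) = (LINT y|lebesgue_on T. h k (x, y))" for k x
  using h(2) by simp
 have "(%k. LINT x|lebesgue_on S. norm (LINT y|lebesgue_on T. h k (x, y))) ~> 0"
  unfolding n F(3) by (rule lim)
 from tendsto_L1_AE_subseq[OF F(2) this]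
 obtain r :: "nat => nat" where r: "strict_mono r"
  "AE x in lebesgue_on S. (%k. LINT y|lebesgue_on T. h (r k) (x, y)) ~> 0" by blast
 have "AE x in lebesgue_on S. \<forall>k. integrable (lebesgue_on T) (%y. h (r k) (x, y))"
  unfolding AE_all_countable using F(1) by blast
 with r show ?thesis by (intro exI[of _ r]) auto
qed

section \<open>Fibres of Sobolev functions\<close>

lemma imul_eq_cscale: "imul (M :: complex^'m^'n) = cscale \<i> M"
 by (simp add: cmul_ii[symmetric] cmul_eq_cscale)

lemma bounded_linear_tensor: "bounded_linear (tensor th :: complex^'m => complex^'m^'n)"
proof -
 have "linear (tensor th :: complex^'m => complex^'m^'n)"
  by (rule linearI) (simp_all add: vec_eq_iff[where 'b='n] tensor_nth scaleR_add_right mult.commute)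
 then show ?thesis by (simp add: linear_conv_bounded_linear)
qed

lemma interior_cell_sets: "interior cell : sets lebesgue" "open (interior cell)" "interior cell \<subseteq> cell"
 by (auto simp: interior_subset)

text \<open>Sobolev functions of the fibres live on the open cell, transforms on the closed one; the
  boundary of a box is null.\<close>

lemma interior_cell_AE:
 "(AE y in lebesgue_on (interior cell). Q y) \<longleftrightarrow> (AE y in lebesgue_on (cell :: (real^'n) set). Q y)"
proof -
 have "negligible (cell - interior cell :: (real^'n) set)"
  using negligible_frontier_interval[of "(\<chi> i. - 1/2) :: real^'n" "(\<chi> i. 1/2) :: real^'n"]
  by (simp add: cell_def interior_cbox)
 then have "AE y in lebesgue. y ~: (cell - interior cell :: (real^'n) set)" by (intro AE_not_in) (simp add: negligible_iff_null_sets)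
 then have e: "AE y in lebesgue. (y : interior cell --> Q y) \<longleftrightarrow> (y : cell --> Q y)"
  by eventually_elim (use interior_subset in auto)
 show ?thesis
  unfolding AE_leb_on[OF interior_cell_sets(1)] AE_leb_on[OF cell_sets(1)]
  using e by (auto elim!: eventually_elim2)
qed

lemma bloch_grad_lebesgue:
 fixes u :: "real^'n => complex^'m"
 assumes "u : L2 (interior cell)" "G : L2 (interior cell)" "weak_gradient (interior cell) u G"
 shows "AE y in cellM. bloch_grad th u y = G y + imul (tensor th (u y))"
 using grad_eqI(1)[OF interior_cell_sets(2) assms(2,3)] unfolding interior_cell_AE
 by eventually_elim (simp add: bloch_grad_def imul_eq_cscale)

lemma sqint_AE_tendsto_helper:
 assumes "!!k. integrable M (%y. (norm (f k y))\<^sup>2)" "(%k. LINT y|M. (norm (f k y))\<^sup>2 + (norm (g k y))\<^sup>2) ~> 0"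
  "!!k. integrable M (%y. (norm (g k y))\<^sup>2)"
 shows "(%k. l2norm M (f k)) ~> 0" "(%k. l2norm M (g k)) ~> 0"
proof -
 have e: "(LINT y|M. (norm (f k y))\<^sup>2 + (norm (g k y))\<^sup>2) = (l2norm M (f k))\<^sup>2 + (l2norm M (g k))\<^sup>2" for k
  using assms(1,3) by (simp add: l2norm_sq)
 have lim: "(%k. (l2norm M (f k))\<^sup>2 + (l2norm M (g k))\<^sup>2) ~> 0" using assms(2) unfolding e .
 have "(%k. (l2norm M (f k))\<^sup>2) ~> 0" by (rule Lim_null_comparison[OF _ lim]) simp
 from tendsto_real_sqrt[OF this] show "(%k. l2norm M (f k)) ~> 0" by simp
 have "(%k. (l2norm M (g k))\<^sup>2) ~> 0" by (rule Lim_null_comparison[OF _ lim]) simp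
 from tendsto_real_sqrt[OF this] show "(%k. l2norm M (g k)) ~> 0" by simp
qed

lemma sections_subsequence2:
 fixes f :: "nat => (real^'n) \<times> (real^'n) => 'b::euclidean_space" and g :: "nat => (real^'n) \<times> (real^'n) => 'c::euclidean_space"
 assumes f: "!!k. f k : sqint MDC" "(%k. l2norm MDC (f k)) ~> 0"
  and g: "!!k. g k : sqint MDC" "(%k. l2norm MDC (g k)) ~> 0"
 shows "\<exists>r. strict_mono r & (AE th in dualM.
  (\<forall>k. (%y. f k (th, y)) : sqint (cellM)) & (\<forall>k. (%y. g k (th, y)) : sqint (cellM)) \<and>
  (%k. l2norm (cellM) (%y. f (r k) (th, y))) ~> 0 \<and>
  (%k. l2norm (cellM) (%y. g (r k) (th, y))) ~> 0)"
proof -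
 define h where "h k p = (norm (f k p))\<^sup>2 + (norm (g k p))\<^sup>2" for k p
 have h: "integrable MDC (h k)" "0 <= h k p" for k p
  unfolding h_def using sqintD(2)[OF f(1)] sqintD(2)[OF g(1)] by auto
 have "integral\<^sup>L MDC (h k) = (l2norm MDC (f k))\<^sup>2 + (l2norm MDC (g k))\<^sup>2" for k
  unfolding h_def l2norm_sq using sqintD(2)[OF f(1)] sqintD(2)[OF g(1)] by simp
 moreover have "(%k. (l2norm MDC (f k))\<^sup>2 + (l2norm MDC (g k))\<^sup>2) ~> 0\<^sup>2 + 0\<^sup>2"
  by (intro tendsto_intros f g)
 ultimately have "(%k. integral\<^sup>L MDC (h k)) ~> 0" by simp
 from section_subsequence[OF dual_cell_sets(2) cell_sets(2) h this]
 obtain r where r: "strict_mono r" "AE th in dualM. (\<forall>k. integrable (cellM) (%y. h (r k) (th, y))) \<and>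
  (%k. LINT y|cellM. h (r k) (th, y)) ~> 0" by blast
 have sf: "AE th in dualM. \<forall>k. (%y. f k (th, y)) : sqint (cellM)"
  and sg: "AE th in dualM. \<forall>k. (%y. g k (th, y)) : sqint (cellM)"
  unfolding AE_all_countable using sqint_section[OF dual_cell_sets(2) cell_sets(2)] f(1) g(1) by blast+
 from r(2) sf sg have "AE th in dualM.
  (\<forall>k. (%y. f k (th, y)) : sqint (cellM)) & (\<forall>k. (%y. g k (th, y)) : sqint (cellM)) \<and>
  (%k. l2norm (cellM) (%y. f (r k) (th, y))) ~> 0 \<and>
  (%k. l2norm (cellM) (%y. g (r k) (th, y))) ~> 0"
 proof eventually_elim
  case (elim th)
  have 1: "(%k. LINT y|cellM. (norm (f (r k) (th, y)))\<^sup>2 + (norm (g (r k) (th, y)))\<^sup>2) ~> 0"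
   using elim(1) by (simp add: h_def)
  have 2: "integrable (cellM) (%y. (norm (f (r k) (th, y)))\<^sup>2)"
   "integrable (cellM) (%y. (norm (g (r k) (th, y)))\<^sup>2)" for k
   using elim(2,3) by (auto dest: sqintD)
  show ?case
   using elim(2,3) sqint_AE_tendsto_helper[OF 2(1) 1 2(2)] by blast
 qed
 with r(1) show ?thesis by blast
qed

text \<open>u is approximated in H1 by test functions. Their transforms are smooth and periodic in y
  and, by the isometry, converge together with their Bloch gradients on the product, hence along a
  subsequence in almost every fibre. This is the approximation that \<open>H1per\<close> asks
  for.\<close>

proposition glim_H1per:
 fixes u :: "real^'n => complex^'m"
 assumes wg: "weak_gradient UNIV u G" and w: "glim u w" and W: "glim G W"
 shows "AE th in dualM. (%y. w (th, y)) : H1per & (%y. W (th, y)) : sqint (cellM) \<and>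
  (AE y in cellM. bloch_grad th (%y. w (th, y)) y = W (th, y)) \<and>
  weak_gradient (interior cell) (%y. w (th, y)) (%y. W (th, y) - imul (tensor th (w (th, y))))"
proof -
 note us = glimD(1)[OF w] and Gs = glimD(1)[OF W]
 have uL: "u : L2 UNIV" "G : L2 UNIV" using us Gs by (simp_all add: L2_eq_sqint lebesgue_on_UNIV_eq)
 obtain Ph where Ph: "!!k. Ph k : test_functions UNIV" "(%k. l2norm lebesgue (%x. Ph k x - u x)) ~> 0"
  "(%k. l2norm lebesgue (%x. classical_grad (Ph k) x - G x)) ~> 0"
  using test_functions_dense_H1[OF uL wg] by blast
 \<comment> \<open>The transform of the classical gradient is produced with its pointwise formula on
   all of \<open>dual_cell \<times> cell\<close>, so that it may be restricted to any single
   fibre.\<close>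
 have gS: "\<exists>Z. glim (classical_grad (Ph k)) Z & (\<forall>p\<in>dual_cell \<times> cell. Z p = classical_grad (gelfand_smooth (Ph k) (fst p)) (snd p)
   + imul (tensor (fst p) (gelfand_smooth (Ph k) (fst p) (snd p))))" for k
 proof -
  obtain R where R: "!!x. x ~: cball 0 R ==> Ph k x = 0" "smooth (Ph k)" using test_ball_support[OF Ph(1)] by blast
  have g0: "classical_grad (Ph k) x = 0" if "x ~: cball 0 R" for x
   using derivative_off_support[OF closed_cball R(1) that]
   by (simp add: classical_grad_def partial_def vec_eq_iff)
  have gs: "classical_grad (Ph k) : sqint lebesgue"
   by (rule compact_support_sqint[OF smooth_grad_continuous[OF R(2)] compact_cball g0])
  obtain r where r: "!!y :: real^'n. y : cell ==> norm y <= r" using cell_bounded by blast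
  \<comment> \<open>The margin \<open>r + 1\<close> gives an open neighbourhood of the cell on which
    the finite sum represents the transform, so derivatives agree up to the boundary of the
    cell.\<close>
  obtain N0 :: nat where N0: "R + (r + 1) <= real N0" using real_arch_simple by blast
  have eq: "zsum (lat N) (classical_grad (Ph k)) (th, y) = classical_grad (gelfand_smooth (Ph k) th) y
    + imul (tensor th (gelfand_smooth (Ph k) th y))" if "y : cell" "N \<ge> N0" for th y N
  proof -
   have e: "gelfand_smooth (Ph k) th z = zsum (lat N) (Ph k) (th, z)" if "z : ball 0 (r + 1)" for z
    by (rule gelfand_smooth_eq_zsum[OF R(1), where r="r + 1"]) (use that \<open>N \<ge> N0\<close> N0 in auto)
   have yb: "y : ball 0 (r + 1)" using r[OF that(1)] by simp
   note sm = zsum_smooth[OF R(2), of "lat N" th]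
   have "(gelfand_smooth (Ph k) th has_derivative frechet_derivative (%y. zsum (lat N) (Ph k) (th, y)) (at y)) (at y)"
    by (rule has_derivative_transform_within_open[OF smooth_derivative[OF sm(1)] open_ball yb]) (simp add: e)
   from frechet_derivative_at[OF this, symmetric]
   have "classical_grad (gelfand_smooth (Ph k) th) y = classical_grad (%y. zsum (lat N) (Ph k) (th, y)) y"
    by (simp add: classical_grad_def partial_def)
   then show ?thesis unfolding sm(2) e[OF yb] by simp
  qed
  obtain Z where Z: "glim (classical_grad (Ph k)) Z" using glim_exists[OF gs] by blast
  have s0: "zsum (lat N0) (classical_grad (Ph k)) : sqint MDC" by (rule zsum_sqint[OF gs])
  have "glim (classical_grad (Ph k)) (zsum (lat N0) (classical_grad (Ph k)))"
   unfolding glim_def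
  proof (intro conjI gs s0 tendsto_eventually, unfold eventually_sequentially, intro exI allI impI)
   fix N assume N: "N0 <= N"
   have "zsum (lat N) (classical_grad (Ph k)) p = zsum (lat N0) (classical_grad (Ph k)) p" if "p : space MDC" for p
    using eq[OF _ N, of "snd p" "fst p"] eq[OF _ order_refl, of "snd p" "fst p"] that by (simp add: space_MDC mem_Times_iff)
   then have "l2norm MDC (%p. zsum (lat N) (classical_grad (Ph k)) p - zsum (lat N0) (classical_grad (Ph k)) p) = l2norm MDC (%p :: (real^'n) \<times> (real^'n). 0 :: complex^'m^'n)"
    by (intro l2norm_cong) simp
   then show "l2norm MDC (%p. zsum (lat N) (classical_grad (Ph k)) p - zsum (lat N0) (classical_grad (Ph k)) p) = 0"
    by (simp add: l2norm_def)
  qed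
  then show ?thesis using eq[OF _ order_refl] by (intro exI[of _ "zsum (lat N0) (classical_grad (Ph k))"]) (auto simp: mem_Times_iff)
 qed
 define Z where "Z k = (SOME Z. glim (classical_grad (Ph k)) Z & (\<forall>p\<in>dual_cell \<times> cell. Z p = classical_grad (gelfand_smooth (Ph k) (fst p)) (snd p)
   + imul (tensor (fst p) (gelfand_smooth (Ph k) (fst p) (snd p)))))" for k
 have Z: "glim (classical_grad (Ph k)) (Z k)" and Ze: "!!th y. th : dual_cell ==> y : cell ==> Z k (th, y) =
   classical_grad (gelfand_smooth (Ph k) th) y + imul (tensor th (gelfand_smooth (Ph k) th y))" for k
  using someI_ex[OF gS[of k], folded Z_def] by auto
 let ?g = "%k. case_prod (gelfand_smooth (Ph k))"
 note gl = glim_smooth[OF Ph(1)]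
 have f1: "(%p. ?g k p - w p) : sqint MDC" and f2: "(%p. Z k p - W p) : sqint MDC" for k
  by (intro sqint_diff glimD(2)[OF gl] glimD(2)[OF w] glimD(2)[OF Z] glimD(2)[OF W])+
 have "(%k. l2norm MDC (%p. ?g k p - w p)) ~> 0" "(%k. l2norm MDC (%p. Z k p - W p)) ~> 0"
  using Ph(2,3) by (simp_all add: glim_norm[OF glim_diff[OF gl w]] glim_norm[OF glim_diff[OF Z W]])
 from sections_subsequence2[OF f1 this(1) f2 this(2)]
 obtain r where r: "AE th in dualM.
  (\<forall>k. (%y. ?g k (th, y) - w (th, y)) : sqint (cellM)) & (\<forall>k. (%y. Z k (th, y) - W (th, y)) : sqint (cellM)) \<and>
  (%k. l2norm (cellM) (%y. ?g (r k) (th, y) - w (th, y))) ~> 0 \<and>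
  (%k. l2norm (cellM) (%y. Z (r k) (th, y) - W (th, y))) ~> 0" by blast
 have sw: "AE th in dualM. (%y. w (th, y)) : sqint (cellM)"
  and sW: "AE th in dualM. (%y. W (th, y)) : sqint (cellM)"
  by (rule sqint_section[OF dual_cell_sets(2) cell_sets(2)], rule glimD(2)[OF w] glimD(2)[OF W])+
 have dc: "AE th in dualM. th : dual_cell"
  by (simp add: AE_leb_on[OF dual_cell_sets(1)])
 from r sw sW dc show ?thesis
 proof eventually_elim
  case (elim th)
  let ?I = "interior cell :: (real^'n) set"
  define v where "v k = gelfand_smooth (Ph (r k)) th" for k
  define wth where "wth y = w (th, y)" for y
  define Wth where "Wth y = W (th, y)" for y
  define H where "H y = Wth y - imul (tensor th (wth y))" for y
  have vsm: "smooth (v k)" "periodic (v k)" for k unfolding v_def by (rule gelfand_smooth_smooth[OF Ph(1)])+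
  have sub: "f : sqint (lebesgue_on ?I)" "l2norm (lebesgue_on ?I) f <= l2norm (cellM) f"
   if "f : sqint (cellM)" for f :: "real^'n => 'e::euclidean_space"
   using sqint_subset[OF that cell_sets(1) interior_cell_sets(1,3)] by auto
  have L: "bounded_linear (%x. imul (tensor th (x :: complex^'m)))"
   using bounded_linear_compose[OF bounded_linear_cmul[of \<i>] bounded_linear_tensor] by (simp add: cmul_ii)
  interpret L: bounded_linear "%x. imul (tensor th (x :: complex^'m))" by (rule L)
  have wc: "wth : sqint (cellM)" "Wth : sqint (cellM)"
   using elim(2,3) by (simp_all add: wth_def[abs_def] Wth_def[abs_def])
  have Hc: "H : sqint (cellM)" unfolding H_def by (intro sqint_diff wc sqint_linear[OF L])
  have dv: "(%y. v k y - wth y) : sqint (cellM)" for k using elim(1) by (simp add: v_def wth_def)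
  have vc: "v k : sqint (cellM)" for k using sqint_add[OF dv wc(1)] by simp
  have lv: "(%k. l2norm (cellM) (%y. v k y - wth y)) ~> 0" using elim(1) by (simp add: v_def wth_def)
  \<comment> \<open>Passing from Bloch gradients back to gradients costs a bounded multiple of the
    L2 error of the functions, hence D tends to zero as well.\<close>
  define D where "D k y = (Z (r k) (th, y) - Wth y) - imul (tensor th (v k y - wth y))" for k y
  have Zs: "(%y. Z (r k) (th, y) - Wth y) : sqint (cellM)" for k using elim(1) by (simp add: Wth_def)
  have Ds: "D k : sqint (cellM)" for k unfolding D_def by (intro sqint_diff[OF Zs] sqint_linear[OF L dv])
  have De: "classical_grad (v k) y - H y = D k y" if "y : cell" for k y
   using Ze[OF elim(4) that, of "r k"] by (simp add: D_def H_def v_def L.diff)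
  have Dlim: "(%k. l2norm (cellM) (D k)) ~> 0"
  proof -
   obtain C where C: "0 <= C" "!!x :: complex^'m. norm (imul (tensor th x)) <= norm x * C" using L.nonneg_bounded by blast
   have b: "l2norm (cellM) (D k) <= l2norm (cellM) (%y. Z (r k) (th, y) - Wth y) + C * l2norm (cellM) (%y. v k y - wth y)" for k
   proof -
    have "l2norm (cellM) (D k) <= l2norm (cellM) (%y. Z (r k) (th, y) - Wth y) + l2norm (cellM) (%y. - imul (tensor th (v k y - wth y)))"
     using l2norm_triangle[OF Zs sqint_minus[OF sqint_linear[OF L dv]], of k k] by (simp add: D_def[abs_def])
    moreover have "l2norm (cellM) (%y. - imul (tensor th (v k y - wth y))) <= C * l2norm (cellM) (%y. v k y - wth y)"
     by (rule l2norm_dominated[OF dv sqintD(1)[OF sqint_minus[OF sqint_linear[OF L dv]]] C(1)]) (subst mult.commute, simp only: norm_minus_cancel, rule C(2))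
    ultimately show ?thesis by linarith
   qed
   have limA: "(%k. l2norm (cellM) (%y. Z (r k) (th, y) - Wth y)) ~> 0" using elim(1) by (simp add: Wth_def)
   have lim2: "(%k. l2norm (cellM) (%y. Z (r k) (th, y) - Wth y) + C * l2norm (cellM) (%y. v k y - wth y)) ~> 0"
    by (rule tendsto_add_zero[OF limA tendsto_mult_right_zero[OF lv]])
   show ?thesis
   proof (rule Lim_null_comparison[OF always_eventually lim2], rule allI)
    fix k
    show "norm (l2norm (cellM) (D k)) <= l2norm (cellM) (%y. Z (r k) (th, y) - Wth y) + C * l2norm (cellM) (%y. v k y - wth y)"
     using b[of k] by (simp only: real_norm_def abs_of_nonneg[OF l2norm_nonneg])
   qed
  qed
  have cgs: "classical_grad (v k) : sqint (cellM)" for k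
  proof -
   have "classical_grad (v k) : sqint (cellM) \<longleftrightarrow> (%y. D k y + H y) : sqint (cellM)"
    by (rule sqint_cong) (simp add: De[symmetric])
   then show ?thesis using sqint_add[OF Ds Hc] by simp
  qed
  have cgl: "(%k. l2norm (cellM) (%y. classical_grad (v k) y - H y)) ~> 0"
  proof -
   have "l2norm (cellM) (%y. classical_grad (v k) y - H y) = l2norm (cellM) (D k)" for k
    by (rule l2norm_cong) (simp add: De)
   then show ?thesis using Dlim by simp
  qed
  have lvI: "(%k. l2norm (lebesgue_on ?I) (%y. v k y - wth y)) ~> 0"
   by (rule Lim_null_comparison[OF always_eventually lv]) (use sub(2)[OF dv] in simp)
  have cglI: "(%k. l2norm (lebesgue_on ?I) (%y. classical_grad (v k) y - H y)) ~> 0"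
   by (rule Lim_null_comparison[OF always_eventually cgl]) (use sub(2)[OF sqint_diff[OF cgs Hc]] in simp)
  have wgH: "weak_gradient ?I wth H"
  proof (rule weak_gradient_limit[OF interior_cell_sets(1) _ _ _ _ _ lvI cglI])
   show "weak_gradient ?I (v k) (classical_grad (v k))" for k
    by (rule weak_gradient_classical[OF vsm(1) interior_cell_sets(1)])
  qed (simp_all add: L2_eq_sqint sub(1) vc cgs wc Hc)
  have wL: "wth : L2 ?I" "H : L2 ?I" by (simp_all add: L2_eq_sqint sub(1) wc Hc)
  note gr = grad_eqI[OF interior_cell_sets(2) wL(2) wgH]
  have gl2: "(%k. l2norm (lebesgue_on ?I) (%y. classical_grad (v k) y - grad ?I wth y)) ~> 0"
  proof -
   have "l2norm (lebesgue_on ?I) (%y. classical_grad (v k) y - grad ?I wth y) = l2norm (lebesgue_on ?I) (%y. classical_grad (v k) y - H y)" for k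
   proof (rule l2norm_cong_AE)
    show "AE y in lebesgue_on ?I. classical_grad (v k) y - grad ?I wth y = classical_grad (v k) y - H y"
     using gr(1) by eventually_elim simp
   qed (intro sqintD(1)[OF sqint_diff] sub(1) cgs Hc gr(2)[unfolded L2_eq_sqint])+
   then show ?thesis using cglI by simp
  qed
  have "wth : H1per"
   unfolding H1per_def
  proof (intro CollectI conjI exI allI)
   show "wth : H1 ?I" by (rule H1I[OF wL wgH])
   show "smooth (v k)" "periodic (v k)" for k by (rule vsm)+
   show "L2_tendsto ?I v wth" unfolding L2_tendsto_iff using wL(1) lvI by (simp add: L2_eq_sqint sub(1) vc)
   show "L2_tendsto ?I (%k. classical_grad (v k)) (grad ?I wth)"
    unfolding L2_tendsto_iff using gr(2) gl2 by (simp add: L2_eq_sqint sub(1) cgs)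
  qed
  moreover have "AE y in cellM. bloch_grad th wth y = Wth y"
   using bloch_grad_lebesgue[OF wL wgH, of th] by eventually_elim (simp add: H_def)
  ultimately show ?case using wc(2) wgH unfolding wth_def[abs_def] Wth_def[abs_def] H_def[abs_def] by simp
 qed
qed

section \<open>Testing the fibre problems\<close>

lemma lebesgue_on_cong_set:
 fixes f :: "'a::euclidean_space => 'b::euclidean_space"
 assumes S: "S : sets lebesgue" and T: "T : sets lebesgue" and e: "AE x in lebesgue. x : S \<longleftrightarrow> x : T"
 shows "f : borel_measurable (lebesgue_on S) ==> f : borel_measurable (lebesgue_on T)"
  and "f : sqint (lebesgue_on S) ==> f : sqint (lebesgue_on T)"
  and "f : sqint (lebesgue_on S) ==> l2norm (lebesgue_on T) f = l2norm (lebesgue_on S) f"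
proof -
 have ae: "AE x in lebesgue. indicator S x *r f x = indicator T x *r f x" for f :: "'a => 'c::euclidean_space"
  using e by eventually_elim (simp add: indicator_def)
 have m: "g : borel_measurable (lebesgue_on T)" if "g : borel_measurable (lebesgue_on S)" for g :: "'a => 'c::euclidean_space"
 proof -
  have "(%x. indicator S x *r g x) : borel_measurable lebesgue" using that by (simp only: measurable_leb_on[OF S])
  from borel_measurable_AE[OF this ae] show ?thesis by (simp only: measurable_leb_on[OF T])
 qed
 show "f : borel_measurable (lebesgue_on S) ==> f : borel_measurable (lebesgue_on T)" by (rule m)
 have i: "integrable (lebesgue_on T) g" if "integrable (lebesgue_on S) g" for g :: "'a => real"
 proof -
  have 1: "integrable lebesgue (%x. indicator S x *r g x)" using that by (simp only: integrable_leb_on[OF S])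
  have "integrable lebesgue (%x. indicator T x *r g x)"
   by (rule integrable_cong_AE_imp[OF 1 borel_measurable_AE[OF borel_measurable_integrable[OF 1] ae] ae])
  then show ?thesis by (simp only: integrable_leb_on[OF T])
 qed
 show "f : sqint (lebesgue_on T)" if f: "f : sqint (lebesgue_on S)"
  unfolding sqint_def using m[OF sqintD(1)[OF f]] i[OF sqintD(2)[OF f]] by blast
 show "l2norm (lebesgue_on T) f = l2norm (lebesgue_on S) f" if f: "f : sqint (lebesgue_on S)"
 proof -
  have "f : borel_measurable (lebesgue_on T)" by (rule m[OF sqintD(1)[OF f]])
  then have m1: "(%x. indicator T x *r f x) : borel_measurable lebesgue" by (simp only: measurable_leb_on[OF T])
  have m2: "(%x. indicator S x *r f x) : borel_measurable lebesgue"
   using sqintD(1)[OF f] by (simp only: measurable_leb_on[OF S])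
  show ?thesis
   unfolding l2norm_restrict[OF S] l2norm_restrict[OF T] by (rule l2norm_cong_AE[OF m2 m1 ae, symmetric])
 qed
qed

lemma interior_cell_eq_AE: "AE x in lebesgue. x : interior cell \<longleftrightarrow> x : (cell :: (real^'n) set)"
 using interior_cell_AE[of "%y. y : interior (cell :: (real^'n) set)"] interior_subset[of "cell :: (real^'n) set"]
 unfolding AE_leb_on[OF interior_cell_sets(1)] AE_leb_on[OF cell_sets(1)]
 by (auto elim!: eventually_mono)

lemmas interior_cell_cong = lebesgue_on_cong_set[OF interior_cell_sets(1) cell_sets(1) interior_cell_eq_AE]

section \<open>A periodic partition of unity that is constant near the inclusions\<close>

lemma tile_lat_1:
 assumes "!!i. - 3/2 <= x $ i & x $ i < 3/2"
 shows "x : tile (lat 1)"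
proof -
 define l :: "real^'a" where "l = (\<chi> i. of_int \<lfloor>x $ i + 1/2\<rfloor>)"
 have "x - l : hcube (1/2)" unfolding hcube_def l_def by (auto; linarith)
 moreover have "\<bar>\<lfloor>x $ i + 1/2\<rfloor>\<bar> <= 1" for i using assms[of i] by linarith
 then have "\<bar>l $ i\<bar> <= real 1" for i unfolding l_def by (simp del: of_nat_1) (metis of_int_1_le_iff of_int_abs of_int_le_1_iff of_nat_1)
 then have "l : lat 1" by (simp add: lat_def lattice_def l_def)
 ultimately show ?thesis by (auto simp: tile_def)
qed

lemma mollify_translate: "mollify k f (y - l) = mollify k (%z. f (z - l)) y"
 using integral_affine(1)[of "%z. std_mollifier k (y - z) *r f (z - l)" l]
 by (simp add: mollify_def conv_def algebra_simps)

lemma translates_lattice: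
 "l : lattice ==> x + l : translates B \<longleftrightarrow> x : translates B"
proof -
 have imp: "x + l : translates B" if "x : translates B" "l : lattice" for x l :: "real^'a"
 proof -
  obtain m b where mb: "m : lattice" "b : B" "x = b + m" using \<open>x : translates B\<close> by (auto simp: translates_def)
  then have "x + l = b + (m + l)" by (simp add: add.assoc)
  moreover have "m + l : lattice" by (rule lattice_add[OF mb(1) \<open>l : lattice\<close>])
  ultimately show ?thesis using mb(2) unfolding translates_def by blast
 qed
 show "l : lattice ==> x + l : translates B \<longleftrightarrow> x : translates B"
  using imp[of x l] imp[of "x + l" "- l"] lattice_uminus[of l] by auto
qed

text \<open>The translates of the indicator of the half-open cube sum to 1, and mollification
  preserves this. At a scale below the distance from B to the boundary of the cell, all copies of B
  lie where the mollification changes nothing, so there \<eta> is locally constant: 1 on B and 0 on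
  the other copies.\<close>

lemma periodic_partition:
 fixes B :: "(real^'n) set"
 assumes B: "open B" "closure B \<subseteq> interior cell"
 shows "\<exists>\<eta> :: real^'n => real. \<eta> : test_functions UNIV & (\<forall>x. x ~: tile (lat 1) --> \<eta> x = 0 & (\<forall>j. partial j \<eta> x = 0)) \<and>
  (\<forall>y\<in>cell. (\<Sum>l\<in>lat 1. \<eta> (y + l)) = 1) & (\<forall>y\<in>cell. \<forall>j. (\<Sum>l\<in>lat 1. partial j \<eta> (y + l)) = 0) \<and>
  (\<forall>x\<in>translates B. (\<forall>j. partial j \<eta> x = 0) & \<eta> x = indicator B x)"
proof -
 let ?Q = "hcube (1/2) :: (real^'n) set"
 have "bounded (closure B)" by (rule bounded_subset[OF bounded_subset[OF compact_imp_bounded[OF cell_sets(3)] interior_subset] B(2)])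
 then have "compact (closure B)" by (simp add: compact_eq_bounded_closed)
 \<comment> \<open>Compactness of the closure gives a margin e that is uniform over B.\<close>
 from compact_subset_open_imp_cball_epsilon_subset[OF this open_interior B(2)]
 obtain e where e0: "0 < e" "(\<Union>x\<in>closure B. cball x e) \<subseteq> interior cell" by blast
 have e: "0 < e" "cball y e \<subseteq> interior cell" if "y : B" for y
  using e0(1) UN_upper[of y "closure B" "%x. cball x e"] e0(2) that closure_subset by (simp, meson order_trans subsetD)
 note e = e0(1) e(2)
 \<comment> \<open>Two bounds on the scale: below e for the inclusions, below 1/2 so that \<eta>
   vanishes off the neighbouring cells.\<close>
 obtain k :: nat where k: "1 / Suc k < min e (1/2)" using nat_approx_posE[of "min e (1/2)"] e(1) by auto
 define d where "d = 1 / real (Suc k)"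
 have d: "0 < d" "d < e" "d < 1/2" using k by (auto simp: d_def)
 define \<eta> where "\<eta> = mollify k (indicat_real ?Q)"
 have sm: "smooth \<eta>" unfolding \<eta>_def by (rule smooth_mollify[OF indicator_sqint[OF hcube_lmeasurable]])
 have cmp: "\<bar>z $ i - x $ i\<bar> <= d" if "z : cball x d" for x z :: "real^'n" and i
  using component_le_norm_cart[of "z - x" i] that by (simp add: dist_norm norm_minus_commute)
 have intQ: "interior cell \<subseteq> ?Q" by (auto simp: cell_def interior_cbox mem_box_cart hcube_def less_imp_le)
 have out: "\<eta> x = 0" if x: "\<not> (\<forall>i. \<bar>x $ i\<bar> <= 1)" for x
  unfolding \<eta>_def
 proof (rule mollify_const)
  fix z assume "z : cball x (1 / Suc k)"
  then have z: "!!i. \<bar>z $ i - x $ i\<bar> <= d" using cmp unfolding d_def by blast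
  obtain i where "\<bar>x $ i\<bar> > 1" using x by (auto simp: not_le)
  then have "\<bar>z $ i\<bar> > 1/2" using z[of i] d by linarith
  then have "z ~: ?Q" unfolding hcube_def by (auto intro!: exI[of _ i])
  then show "indicat_real ?Q z = 0" by simp
 qed
 have one: "\<eta> y = 1" if "y : B" for y
  unfolding \<eta>_def
 proof (rule mollify_const)
  fix z assume "z : cball y (1 / Suc k)"
  then have "z : cball y e" using d by (auto simp: d_def)
  then have "z : ?Q" using e(2)[OF that] intQ by blast
  then show "indicat_real ?Q z = 1" by simp
 qed
 have zero: "\<eta> (y + l) = 0" if "y : B" "l : lattice" "l ~= 0" for y l
  unfolding \<eta>_def
 proof (rule mollify_const)
  fix z assume "z : cball (y + l) (1 / Suc k)"
  then have "z - l : cball y e" using d by (auto simp: d_def dist_norm algebra_simps)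
  then have "z - l : ?Q" using e(2)[OF that(1)] intQ by blast
  then have "z ~: ?Q" using hcube_lattice_unique[of z l 0] that lattice_zero by auto
  then show "indicat_real ?Q z = 0" by simp
 qed
 have eta_ind: "\<eta> x = indicator B x" if x: "x : translates B" for x
 proof -
  obtain l b where lb: "l : lattice" "b : B" "x = b + l" using x by (auto simp: translates_def)
  show ?thesis
  proof (cases "l = 0")
   case True
   then show ?thesis using lb one by simp
  next
   case False
   have "b + l ~: B"
   proof
    assume "b + l : B"
    then have "\<eta> (b + l) = 1" by (rule one)
    with zero[OF lb(2,1) False] show False by simp
   qed
   then show ?thesis using lb zero False by simp
  qed
 qed
 have part: "partial j \<eta> x = 0" if x: "x : translates B" for j x
 proof -
  obtain l b where lb: "l : lattice" "b : B" "x = b + l" using x by (auto simp: translates_def)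
  define c :: real where "c = (if l = 0 then 1 else 0)"
  have op: "open ((%y. l + y) ` B)" by (rule open_translation[OF B(1)])
  have ec: "c = \<eta> z" if "z : (%y. l + y) ` B" for z
   using that one zero[OF _ lb(1)] by (auto simp: c_def add.commute)
  have "x : (%y. l + y) ` B" using lb by (auto simp: add.commute)
  from has_derivative_transform_within_open[OF has_derivative_const op this ec]
  have "(\<eta> has_derivative (%h. 0)) (at x)" by simp
  from frechet_derivative_at[OF this, symmetric] show ?thesis by (simp add: partial_def)
 qed
 \<comment> \<open>Proved on the open cube of half-width 1, which contains the closed cell, so that
   the identity can be differentiated at every point of the cell.\<close>
 have sum1: "(\<Sum>l\<in>lat 1. \<eta> (y + l)) = 1" if y: "!!i. \<bar>y $ i\<bar> < 1" for y
 proof -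
  have i: "integrable lebesgue (%z. std_mollifier k (y - z) *r indicat_real ?Q (z - l))" for l
   by (rule conv_integrable[OF mollifierD(1)[OF std_mollifier] sqint_locally[OF sqint_affine(3)[OF indicator_sqint[OF hcube_lmeasurable]]]])
  have "(\<Sum>l\<in>lat 1. \<eta> (y + l)) = (\<Sum>l\<in>lat 1. \<eta> (y - l))"
   by (rule sum.reindex_bij_witness[of _ uminus uminus]) (auto simp: lat_def lattice_uminus)
  also have "... = (\<Sum>l\<in>lat 1. mollify k (%z. indicat_real ?Q (z - l)) y)"
   unfolding \<eta>_def mollify_translate ..
  also have "... = mollify k (%z. \<Sum>l\<in>lat 1. indicat_real ?Q (z - l)) y"
   unfolding mollify_def conv_def scaleR_sum_right by (rule Bochner_Integration.integral_sum[symmetric]) (rule i)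
  also have "... = 1"
  proof (rule mollify_const)
   fix z assume "z : cball y (1 / Suc k)"
   then have z: "!!i. \<bar>z $ i - y $ i\<bar> <= d" using cmp unfolding d_def by blast
   have "- 3/2 <= z $ i & z $ i < 3/2" for i using z[of i] y[of i] d by linarith
   then have "z : tile (lat 1)" by (rule tile_lat_1)
   then show "(\<Sum>l\<in>lat 1. indicat_real ?Q (z - l)) = 1"
    using indicator_tile[OF finite_lat lat_subset, of 1 z] by simp
  qed
  finally show ?thesis .
 qed
 have cl1: "\<bar>y $ i\<bar> < 1" if "y : cell" for y :: "real^'n" and i
 proof -
  have "- 1/2 <= y $ i & y $ i <= 1/2" using that unfolding cell_iff by blast
  then show ?thesis by linarith
 qed
 have sumd: "(\<Sum>l\<in>lat 1. partial j \<eta> (y + l)) = 0" if y: "y : cell" for y j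
 proof -
  let ?U = "\<Inter>i\<in>(UNIV :: 'n set). {z :: real^'n. \<bar>z $ i\<bar> < 1}"
  have op: "open ?U" by (intro open_INT ballI open_Collect_less continuous_intros) auto
  have d1: "((%y. \<Sum>l\<in>lat 1. \<eta> (y + l)) has_derivative (%h. \<Sum>l\<in>lat 1. frechet_derivative \<eta> (at (y + l)) h)) (at y)"
  proof (rule has_derivative_sum)
   fix l
   have "((%x. x + l) has_derivative (%h. h)) (at y)" by (auto intro!: derivative_eq_intros)
   from has_derivative_compose[OF this smooth_derivative[OF sm]]
   show "((%y. \<eta> (y + l)) has_derivative frechet_derivative \<eta> (at (y + l))) (at y)" by simp
  qed
  have "((%y. \<Sum>l\<in>lat 1. \<eta> (y + l)) has_derivative (%h. 0)) (at y)"
  proof (rule has_derivative_transform_within_open[OF has_derivative_const op])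
   show "y : ?U" using cl1[OF y] by simp
   show "1 = (\<Sum>l\<in>lat 1. \<eta> (z + l))" if "z : ?U" for z using sum1[of z] that by simp
  qed
  from has_derivative_unique[OF d1 this] show ?thesis unfolding partial_def by (rule fun_cong)
 qed
 have "\<eta> : test_functions UNIV"
 proof (rule test_functionsI[OF sm])
  show "x : cbox (\<chi> i. - 1) (\<chi> i. 1)" if "\<eta> x ~= 0" for x
  proof -
   have "\<forall>i. \<bar>x $ i\<bar> <= 1" using out that by blast
   then show ?thesis by (auto simp: mem_box_cart abs_le_iff minus_le_iff)
  qed
 qed auto
 moreover have "\<eta> x = 0 & (\<forall>j. partial j \<eta> x = 0)" if x: "x ~: tile (lat 1)" for x
 proof -
  let ?K = "cbox (\<chi> i. - 1) (\<chi> i. 1) :: (real^'n) set"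
  have z: "\<eta> z = 0" if "z ~: ?K" for z
   by (rule out) (use that in \<open>auto simp: mem_box_cart abs_le_iff minus_le_iff\<close>)
  have "x ~: ?K"
  proof
   assume "x : ?K"
   then have a: "\<forall>i. - 1 <= x $ i & x $ i <= 1" by (simp add: mem_box_cart)
   have "- 3/2 <= x $ i & x $ i < 3/2" for i using a[THEN spec[of _ i]] by linarith
   with x show False using tile_lat_1 by blast
  qed
  with z derivative_off_support[of ?K \<eta> x, OF closed_cbox z] show ?thesis by (simp add: partial_def)
 qed
 ultimately show ?thesis using sum1 cl1 sumd part eta_ind by (intro exI[of _ \<eta>] conjI ballI allI impI) blast+
qed

section \<open>Folding whole-space integrals into the cell\<close>

lemma fold_norm:
 fixes D :: "real^'n => 'b::complex_structure"
 assumes D: "D : sqint lebesgue" and z: "!!x. x ~: tile (lat 1) ==> D x = 0"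
 shows "l2norm lebesgue D <= (\<Sum>l\<in>lat 1. l2norm (cellM) (%y. D (y + l)))"
proof -
 have "(l2norm lebesgue D)\<^sup>2 = (LINT x|lebesgue. indicator (tile (lat 1)) x * (norm (D x))\<^sup>2)"
  unfolding l2norm_sq by (rule Bochner_Integration.integral_cong) (use z in \<open>auto simp: indicator_def\<close>)
 also have "... = (\<Sum>l\<in>lat 1. (l2norm (cellM) (%y. D (y + l)))\<^sup>2)"
  unfolding l2norm_sq by (rule sum_cell_integrals[OF finite_lat lat_subset sqintD(2)[OF D], symmetric])
 finally have "l2norm lebesgue D = L2_set (%l. l2norm (cellM) (%y. D (y + l))) (lat 1)"
  unfolding L2_set_def by (metis abs_of_nonneg l2norm_nonneg real_sqrt_abs)
 then show ?thesis using L2_set_le_sum[of "lat 1" "%l. l2norm (cellM) (%y. D (y + l))"] by simp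
qed

text \<open>D is cut into its cells l and each piece is moved into the base cell. Piece l meets the
  translates of P by m + l, so the index set of the partial transform becomes K + l; the remaining
  phase, that of y + l, is carried by D.\<close>

lemma fold_pairing:
 fixes P D :: "real^'n => 'b::complex_structure"
 assumes P: "P : sqint lebesgue" and D: "D : sqint lebesgue" and z: "!!x. x ~: tile (lat 1) ==> D x = 0"
  and K: "finite K" "K \<subseteq> lattice"
 shows "zak_const TYPE('n) * (\<Sum>m\<in>K. l2inner lebesgue (%x. cmul (cis (- (th \<bullet> m))) (P (x + m))) D)
  = (\<Sum>l\<in>lat 1. l2inner (cellM) (%y. zsum ((%m. m + l) ` K) P (th, y)) (%y. cmul (cis (- (th \<bullet> (y + l)))) (D (y + l))))"
proof -
 define h where "h m x = cmul (cis (- (th \<bullet> m))) (P (x + m)) \<bullet> D x" for m x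
 have hi: "integrable lebesgue (h m)" for m
  unfolding h_def by (intro inner_integrable D sqint_linear[OF bounded_linear_cmul] sqint_affine P)
 have hc: "integrable (cellM) (%y. h m (y + l))" for m l
 proof -
  have "integrable lebesgue (%y. indicator cell y *r h m (y + l))"
   by (rule integrable_mult_indicator[OF cell_sets(1) integrable_affine(1)[OF hi]])
  then show ?thesis by (simp only: integrable_leb_on[OF cell_sets(1)])
 qed
 have e: "zsum ((%m. m + l) ` K) P (th, y) \<bullet> cmul (cis (- (th \<bullet> (y + l)))) (D (y + l)) = zak_const TYPE('n) * (\<Sum>m\<in>K. h m (y + l))" for l y
 proof -
  have "cmul (cis (- (th \<bullet> (y + (m + l))))) (P (y + (m + l))) \<bullet> cmul (cis (- (th \<bullet> (y + l)))) (D (y + l)) = h m (y + l)" for m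
  proof -
   have "cnj (cis (- (th \<bullet> (y + (m + l))))) * cis (- (th \<bullet> (y + l))) = cnj (cis (- (th \<bullet> m)))"
    by (simp add: cis_cnj cis_mult inner_add_right)
   then show ?thesis by (simp add: h_def inner_cmul_left cmul_assoc add_ac)
  qed
  then show ?thesis
   by (simp add: zsum_def sum.reindex inner_sum_left inj_on_def)
 qed
 have "l2inner lebesgue (%x. cmul (cis (- (th \<bullet> m))) (P (x + m))) D = (\<Sum>l\<in>lat 1. LINT y|cellM. h m (y + l))" for m
 proof -
  have "l2inner lebesgue (%x. cmul (cis (- (th \<bullet> m))) (P (x + m))) D = (LINT x|lebesgue. indicator (tile (lat 1)) x * h m x)"
   unfolding l2inner_def h_def by (rule Bochner_Integration.integral_cong) (use z in \<open>auto simp: indicator_def\<close>)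
  then show ?thesis using sum_cell_integrals[OF finite_lat lat_subset hi] by simp
 qed
 then have "zak_const TYPE('n) * (\<Sum>m\<in>K. l2inner lebesgue (%x. cmul (cis (- (th \<bullet> m))) (P (x + m))) D)
   = (\<Sum>l\<in>lat 1. zak_const TYPE('n) * (\<Sum>m\<in>K. LINT y|cellM. h m (y + l)))"
  by (simp add: sum_distrib_left) (rule sum.swap)
 also have "... = (\<Sum>l\<in>lat 1. l2inner (cellM) (%y. zsum ((%m. m + l) ` K) P (th, y)) (%y. cmul (cis (- (th \<bullet> (y + l)))) (D (y + l))))"
  unfolding l2inner_def e using hc by simp
 finally show ?thesis .
qed

lemma H1perD:
 fixes fi :: "real^'n => complex^'m"
 assumes "fi : H1per"
 shows "fi : sqint (lebesgue_on (interior cell))" "grad (interior cell) fi : sqint (lebesgue_on (interior cell))"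
  "weak_gradient (interior cell) fi (grad (interior cell) fi)"
  "fi : sqint (cellM)" "grad (interior cell) fi : sqint (cellM)"
proof -
 have h: "fi : H1 (interior cell)" using assms by (simp add: H1per_def)
 note H1_grad[OF h]
 then show 1: "fi : sqint (lebesgue_on (interior cell))" "grad (interior cell) fi : sqint (lebesgue_on (interior cell))"
  "weak_gradient (interior cell) fi (grad (interior cell) fi)" by (simp_all add: L2_eq_sqint)
 show "fi : sqint (cellM)" "grad (interior cell) fi : sqint (cellM)"
  by (rule interior_cell_cong(2)[OF 1(1)], rule interior_cell_cong(2)[OF 1(2)])
qed

lemma bloch_grad_sqint:
 fixes fi :: "real^'n => complex^'m"
 assumes "fi : H1per"
 shows "bloch_grad th fi : sqint (cellM)"
proof -
 have L: "bounded_linear (%x. imul (tensor th (x :: complex^'m)))"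
  using bounded_linear_compose[OF bounded_linear_cmul[of \<i>] bounded_linear_tensor] by (simp add: cmul_ii)
 have "(%y. grad (interior cell) fi y + imul (tensor th (fi y))) : sqint (cellM)"
  by (intro sqint_add H1perD assms sqint_linear[OF L])
 then show ?thesis by (simp add: bloch_grad_def[abs_def] imul_eq_cscale)
qed

text \<open>On B the element is a constant vector times exp(-i \<theta> . y), which the Bloch
  gradient annihilates; uniqueness of weak gradients on the open set B transfers this to the chosen
  gradient.\<close>

lemma V_space_bloch_grad:
 fixes fi :: "real^'n => complex^'m"
 assumes B: "open B" "B \<subseteq> interior cell" and fi: "fi : V_space B th"
 shows "AE y in lebesgue_on B. bloch_grad th fi y = 0"
proof -
 have h: "fi : H1per" using fi by (simp add: V_space_def)
 obtain c where c: "AE y in lebesgue_on B. fi y = exp (- \<i> * complex_of_real (th \<bullet> y)) *s c"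
  using fi by (auto simp: V_space_def)
 note Bs = open_leb[OF B(1)]
 define g where "g y = cmul (cis ((- th) \<bullet> y + 0)) c" for y
 have gs: "smooth g" unfolding g_def by (intro smooth_cmul smooth_cis_affine smooth_const)
 have cz: "classical_grad (%y. c) y = 0" for y
  by (simp add: classical_grad_def partial_def zero_vec_def)
 have gg: "classical_grad g y = - imul (tensor th (g y))" for y
 proof -
  have t: "tensor (- th) v = - tensor th v" for v :: "complex^'m" by (simp add: tensor_def vec_eq_iff)
  have tc: "tensor th (cmul z v) = cmul z (tensor th v)" for z and v :: "complex^'m"
   by (simp add: vec_eq_iff[where 'b='n] tensor_nth cmul_nth cmul_scaleR_right)
  have "cmul z (- v) = - cmul z v" for z and v :: "complex^'m^'n" using cmul_diff_right[of z 0 v] by simp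
  then show ?thesis
   unfolding g_def classical_grad_cmul_cis[OF smooth_const] cz t tc by (simp add: imul_minus imul_cmul)
 qed
 have cg: "classical_grad g = (%y. - imul (tensor th (g y)))" by (rule ext) (rule gg)
 have c': "AE y in lebesgue_on B. fi y = g y"
  using c by eventually_elim (simp add: g_def cmul_eq_smult cis_conv_exp)
 have L: "bounded_linear (%x. imul (tensor th (x :: complex^'m)))"
  using bounded_linear_compose[OF bounded_linear_cmul[of \<i>] bounded_linear_tensor] by (simp add: cmul_ii)
 have fis: "fi : sqint (lebesgue_on B)" "grad (interior cell) fi : sqint (lebesgue_on B)"
  by (rule sqint_subset(1)[OF _ interior_cell_sets(1) Bs B(2)], rule H1perD[OF h])+
 have bB: "B \<subseteq> cell" "bounded B"
  using B(2) interior_subset[of "cell :: (real^'n) set"] bounded_subset[OF compact_imp_bounded[OF cell_sets(3)]] by blast+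
 have gB: "g : sqint (lebesgue_on B)"
 proof -
  have "indicat_real B : sqint lebesgue" by (rule indicator_sqint[OF bounded_set_imp_lmeasurable[OF bB(2) Bs]])
  then have "(%x. indicator B x *r g x) : sqint lebesgue"
   by (rule sqint_dominated[where C="norm c"])
    (intro borel_measurable_scaleR borel_measurable_indicator Bs continuous_measurable smooth_continuous_on gs,
     simp add: g_def norm_cmul indicator_def)
  then show ?thesis by (simp add: sqint_restrict_iff[OF Bs])
 qed
 have cgB: "classical_grad g : sqint (lebesgue_on B)" unfolding cg by (rule sqint_minus[OF sqint_linear[OF L gB]])
 have "weak_gradient B fi (classical_grad g)"
 proof (rule weak_gradient_cong_AE[OF _ _ Bs _ _ _ _ weak_gradient_classical[OF gs Bs]])
  show "AE y in lebesgue_on B. g y = fi y" using c' by eventually_elim simp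
 qed (simp_all add: L2_eq_sqint gB fis cgB)
 moreover have "weak_gradient B fi (grad (interior cell) fi)"
  by (rule weak_gradient_subset[OF H1perD(3)[OF h] interior_cell_sets(1) Bs B(2)])
 ultimately have "AE y in lebesgue_on B. grad (interior cell) fi y = classical_grad g y"
  using weak_gradient_unique[OF B(1)] fis(2) cgB unfolding L2_eq_sqint by blast
 with c' show ?thesis by eventually_elim (simp add: bloch_grad_def gg imul_eq_cscale[symmetric])
qed

text \<open>The form of completeness met below: both the cut-off construction and the minimising
  sequence in the Riesz argument bound their increments by a null sequence at either index.\<close>

lemma sqint_Cauchy_limit:
 fixes f :: "nat => 'a => 'b::euclidean_space"
 assumes "!!k. f k : sqint M" "s ~> 0" "!!m n. l2norm M (%x. f m x - f n x) <= s m + s n"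
 shows "\<exists>g. g : sqint M & (%k. l2norm M (%x. f k x - g x)) ~> 0"
proof -
 have "\<exists>N. \<forall>m\<ge>N. \<forall>n\<ge>N. l2norm M (%x. f m x - f n x) < e" if "0 < e" for e
 proof -
  from \<open>0 < e\<close> have "0 < e / 2" by simp
  from LIMSEQ_D[OF assms(2) this] obtain N where N: "!!n. n \<ge> N ==> norm (s n - 0) < e / 2" by blast
  have "l2norm M (%x. f m x - f n x) < e" if "m \<ge> N" "n \<ge> N" for m n
   using assms(3)[of m n] N[OF that(1)] N[OF that(2)] by simp
  then show ?thesis by blast
 qed
 from sqint_complete[of f M, OF assms(1) this] show ?thesis by blast
qed

lemma l2inner_shift:
 fixes P G :: "real^'n => 'b::complex_structure"
 shows "l2inner lebesgue (%x. cmul c (P (x + m))) G = l2inner lebesgue P (%x. cmul (cnj c) (G (x - m)))"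
 using integral_affine(1)[of "%x. P x \<bullet> cmul (cnj c) (G (x - m))" m] by (simp add: l2inner_def inner_cmul_left)

lemma weak_gradient_cmul:
 fixes u :: "real^'n => complex^'m"
 assumes "weak_gradient Om u G" "Om : sets lebesgue" "u : L2 Om" "G : L2 Om"
 shows "weak_gradient Om (%x. cmul c (u x)) (%x. cmul c (G x))"
 by (rule weak_gradient_linear[OF assms(1) bounded_linear_cmul assms(2,3,4)]) (simp add: cmul_nth)

lemma borel_measurable_vec_lambda:
 fixes f :: "'n::finite => 'a => 'b::euclidean_space"
 assumes "!!j. f j : borel_measurable M"
 shows "(%x. \<chi> j. f j x) : borel_measurable M"
 by (subst borel_measurable_euclidean_space) (auto simp: Basis_vec_def inner_axis assms intro!: borel_measurable_inner)

text \<open>The cut-off \<open>\<eta>\<close> is constant on every cell of the inclusions, so multiplying the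
 quasi-periodic extension of an element of the fibre space by it gives an admissible test function;
 summing its translates over the lattice recovers the element.\<close>

locale inclusion_cutoff =
 fixes B :: "(real^'n) set" and \<eta> :: "real^'n => real"
 assumes open_B: "open B" and B_cell: "closure B \<subseteq> interior cell"
  and eta_test: "\<eta> : test_functions UNIV" and eta_tile: "!!x. x ~: tile (lat 1) ==> \<eta> x = 0"
  and eta_tile_partial: "!!x j. x ~: tile (lat 1) ==> partial j \<eta> x = 0"
  and eta_sum: "!!y. y : cell ==> (\<Sum>l\<in>lat 1. \<eta> (y + l)) = 1"
  and eta_sum_partial: "!!y j. y : cell ==> (\<Sum>l\<in>lat 1. partial j \<eta> (y + l)) = 0"
  and eta_partial_B: "!!x j. x : translates B ==> partial j \<eta> x = 0"
  and eta_B: "!!x. x : translates B ==> \<eta> x = indicator B x"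

begin

lemma eta_smooth: "smooth \<eta>"
 using eta_test by (simp add: test_functions_def)

lemma B_subset: "B \<subseteq> interior cell" "B \<subseteq> cell" "B : sets lebesgue"
 using B_cell closure_subset[of B] interior_subset[of cell] open_leb[OF open_B] by auto

lemma B_translates: "B \<subseteq> translates B"
 unfolding translates_def using lattice_zero by force

lemma translates_sets: "open (translates B)" "translates B : sets lebesgue"
proof -
 show "open (translates B)"
  unfolding translates_def by (intro open_UN ballI) (simp add: open_translation[OF open_B] add.commute[of _ "_ :: real^'n"])
 then show "translates B : sets lebesgue" by (rule open_leb)
qed

text \<open>For periodic f the factor \<open>cis\<close> makes the product quasi-periodic, and the
  cut-off localises it to the neighbouring cells. The summand 0 matches
  \<open>smooth_cis_affine\<close>.\<close>

definition ext :: "real^'n => (real^'n => complex^'m) => real^'n => complex^'m" where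
 "ext th f x = \<eta> x *r cmul (cis (th \<bullet> x + 0)) (f x)"

text \<open>The gradient of \<open>ext th f\<close> on the cell shifted by l, with the phase taken
  out (\<open>sgrad_eq\<close>). The Bloch gradient enters as a separate argument g, so that the
  formula still makes sense for L2 limits of smooth functions.\<close>

definition sgrad :: "real^'n => (real^'n => complex^'m) => (real^'n => complex^'m^'n) => real^'n => real^'n => complex^'m^'n" where
 "sgrad th f g l y = \<eta> (y + l) *r (g y) + (\<chi> j. partial j \<eta> (y + l) *r f y)"

lemma ext_smooth: "smooth f ==> smooth (ext th f)"
 unfolding ext_def[abs_def] by (rule smooth_scaleR[OF eta_smooth smooth_cmul[OF smooth_cis_affine]])

lemma ext_test: "smooth f ==> ext th f : test_functions UNIV"
 unfolding ext_def[abs_def] by (rule test_functions_scaleR[OF eta_test smooth_cmul[OF smooth_cis_affine]])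

lemma classical_grad_ext:
 assumes "smooth f"
 shows "classical_grad (ext th f) x = \<eta> x *r cmul (cis (th \<bullet> x)) (classical_grad f x + imul (tensor th (f x)))
  + (\<chi> j. partial j \<eta> x *r cmul (cis (th \<bullet> x)) (f x))"
 unfolding ext_def[abs_def] classical_grad_scaleR[OF eta_smooth smooth_cmul[OF smooth_cis_affine assms]]
  classical_grad_cmul_cis[OF assms] by (simp only: add_0_right)

text \<open>By periodicity of f and of its gradient, the phase of \<open>ext\<close> at y + l
  cancels against its inverse, leaving an expression on the base cell.\<close>

lemma sgrad_eq:
 assumes f: "smooth f" "periodic f" and l: "l : lattice"
 shows "cmul (cis (- (th \<bullet> (y + l)))) (classical_grad (ext th f) (y + l))
   = sgrad th f (%y. classical_grad f y + imul (tensor th (f y))) l y"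
  and "cmul (cis (- (th \<bullet> (y + l)))) (ext th f (y + l)) = \<eta> (y + l) *r f y"
proof -
 have pf: "f (z + l) = f z" for z using f(2) l by (simp add: periodic_def)
 then have "(%z. f (z + l)) = f" by (simp add: fun_eq_iff)
 then have pg: "classical_grad f (y + l) = classical_grad f y" using classical_grad_translate[OF f(1), of l y] by simp
 have cc: "cis (- (th \<bullet> (y + l))) * cis (th \<bullet> (y + l)) = 1" by (simp add: cis_mult)
 have cv: "cmul z (\<chi> j. a j *r v) = (\<chi> j. a j *r cmul z v)" for z and a :: "'n => real" and v :: "complex^'m"
  by (simp add: vec_eq_iff[where 'b='n] cmul_nth cmul_scaleR_right)
 show "cmul (cis (- (th \<bullet> (y + l)))) (classical_grad (ext th f) (y + l))
   = sgrad th f (%y. classical_grad f y + imul (tensor th (f y))) l y"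
  unfolding classical_grad_ext[OF f(1)] pf pg
  by (simp only: cmul_add_right[of _ "_ *r _"] cmul_scaleR_right cv cmul_assoc cc cmul_one sgrad_def)
 show "cmul (cis (- (th \<bullet> (y + l)))) (ext th f (y + l)) = \<eta> (y + l) *r f y"
  unfolding ext_def pf add_0_right by (simp only: cmul_scaleR_right cmul_assoc cc cmul_one)
qed

lemma eta_bounds: obtains C where "0 <= C" "!!x. \<bar>\<eta> x\<bar> <= C" "!!x j. \<bar>partial j \<eta> x\<bar> <= C"
proof -
 obtain C1 where C1: "0 <= C1" "!!x. norm (\<eta> x) <= C1"
  using that by (rule test_functions_bounded[OF eta_test])
 obtain C2 where C2: "0 <= C2" "!!x h. \<bar>frechet_derivative \<eta> (at x) h\<bar> <= C2 * norm h"
  "!!x y. \<bar>\<eta> y - \<eta> x\<bar> <= C2 * norm (y - x)"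
  using that by (rule test_functions_lipschitz[OF eta_test])
 have "\<bar>partial j \<eta> x\<bar> <= max C1 C2" for x j
  using C2(2)[of x "axis j 1"] by (simp add: partial_def norm_axis_1)
 moreover have "\<bar>\<eta> x\<bar> <= max C1 C2" for x using C1(2)[of x] by simp
 ultimately show ?thesis using C1(1) by (intro that[of "max C1 C2"]) auto
qed

lemma eta_measurable: "(%y. \<eta> (y + l)) : borel_measurable (cellM)"
 and partial_eta_measurable: "(%y. partial j \<eta> (y + l)) : borel_measurable (cellM)"
 by (intro measurable_restrict_space1 measurable_affine(1) continuous_measurable
   smooth_continuous_on smooth_partial eta_smooth)+

lemma mult_estimates:
 assumes f: "f : sqint (cellM)" and g: "g : sqint (cellM)"
  and C: "0 <= C" "!!x. \<bar>\<eta> x\<bar> <= C" "!!x j. \<bar>partial j \<eta> x\<bar> <= C"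
 shows "(%y. \<eta> (y + l) *r f y) : sqint (cellM)"
  "l2norm (cellM) (%y. \<eta> (y + l) *r f y) <= C * l2norm (cellM) f"
  "sgrad th f g l : sqint (cellM)"
  "l2norm (cellM) (sgrad th f g l) <= C * l2norm (cellM) g + real CARD('n) * C * l2norm (cellM) f"
proof -
 have m1: "(%y. \<eta> (y + l) *r f y) : borel_measurable (cellM)"
  if "f : sqint (cellM)" for f :: "real^'n => 'c::euclidean_space"
  by (rule borel_measurable_scaleR[OF eta_measurable sqintD(1)[OF that]])
 have b1: "norm (\<eta> (y + l) *r v) <= C * norm v" for y and v :: "'b::euclidean_space" by (simp add: mult_right_mono C)
 show "(%y. \<eta> (y + l) *r f y) : sqint (cellM)" by (rule sqint_dominated[OF f m1[OF f] b1])
 show "l2norm (cellM) (%y. \<eta> (y + l) *r f y) <= C * l2norm (cellM) f"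
  by (rule l2norm_dominated[OF f m1[OF f] C(1) b1])
 have g1: "(%y. \<eta> (y + l) *r g y) : sqint (cellM)" by (rule sqint_dominated[OF g m1[OF g] b1])
 have b2: "norm (\<chi> j. partial j \<eta> (y + l) *r v) <= real CARD('n) * C * norm v" for y and v :: "complex^'m"
  by (rule norm_vec_scaleR_le) (rule C(3))
 have m2: "(%y. \<chi> j. partial j \<eta> (y + l) *r f y) : borel_measurable (cellM)"
  by (rule borel_measurable_vec_lambda) (intro borel_measurable_scaleR partial_eta_measurable sqintD(1)[OF f])
 have f2: "(%y. \<chi> j. partial j \<eta> (y + l) *r f y) : sqint (cellM)" by (rule sqint_dominated[OF f m2 b2])
 show "sgrad th f g l : sqint (cellM)" unfolding sgrad_def[abs_def] by (rule sqint_add[OF g1 f2])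
 have "l2norm (cellM) (sgrad th f g l) <= l2norm (cellM) (%y. \<eta> (y + l) *r g y) + l2norm (cellM) (%y. \<chi> j. partial j \<eta> (y + l) *r f y)"
  unfolding sgrad_def[abs_def] by (rule l2norm_triangle[OF g1 f2])
 also have "... <= C * l2norm (cellM) g + real CARD('n) * C * l2norm (cellM) f"
  by (intro add_mono l2norm_dominated[OF g m1[OF g] C(1) b1] l2norm_dominated[OF f m2 _ b2]) (use C(1) in simp)
 finally show "l2norm (cellM) (sgrad th f g l) <= C * l2norm (cellM) g + real CARD('n) * C * l2norm (cellM) f" .
qed

end

lemma zsum_section_sqint:
 fixes P :: "real^'n => 'b::complex_structure"
 assumes P: "P : sqint lebesgue"
 shows "(%y. zsum K P (th, y)) : sqint (cellM)"
proof -
 have "(%y. cmul (cis (- (th \<bullet> (y + l)))) (P (y + l))) : sqint (cellM)" for l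
 proof (rule sqint_dominated[where C=1])
  show 1: "(%y. P (y + l)) : sqint (cellM)"
   by (rule sqint_leb_on(1)[OF sqint_affine(1)[OF P] cell_sets(1)])
  have "(%y. cis (- (th \<bullet> (y + l)))) : borel_measurable (cellM)"
   by (intro measurable_restrict_space1 continuous_measurable continuous_intros)
  from borel_measurable_cmul[OF this sqintD(1)[OF 1]]
  show "(%y. cmul (cis (- (th \<bullet> (y + l)))) (P (y + l))) : borel_measurable (cellM)" .
 qed (simp add: norm_cmul)
 then have "(%y. zak_const TYPE('n) *r (\<Sum>l\<in>K. cmul (cis (- (th \<bullet> (y + l)))) (P (y + l)))) : sqint (cellM)"
  by (intro sqint_scaleR sqint_sum)
 then show ?thesis by (simp add: zsum_def[abs_def])
qed

lemma classical_grad_sqint: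
 fixes fi :: "real^'n => complex^'m"
 assumes "fi : test_functions UNIV"
 shows "classical_grad fi : sqint lebesgue"
proof -
 obtain R where R: "!!x. x ~: cball 0 R ==> fi x = 0" "smooth fi" using test_ball_support[OF assms] by blast
 have g0: "classical_grad fi x = 0" if "x ~: cball 0 R" for x
  using derivative_off_support[OF closed_cball R(1) that]
  by (simp add: classical_grad_def partial_def vec_eq_iff)
 show ?thesis by (rule compact_support_sqint[OF smooth_grad_continuous[OF R(2)] compact_cball g0])
qed

context inclusion_cutoff

begin

lemma sgrad_diff: "sgrad th f g l y - sgrad th f' g' l y = sgrad th (%y. f y - f' y) (%y. g y - g' y) l y"
 by (simp add: sgrad_def vec_eq_iff scaleR_diff_right)

text \<open>The smooth approximants of fi give test functions through \<open>ext\<close>, but these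
  are not admissible, as their gradients vanish on the inclusions only in the limit. So the limit
  pair is formed on the whole space; its modulated lattice translates are admissible, and
  \<open>fold_pairing\<close> rewrites the sum of their pairings as one over the cell.\<close>

lemma tested_sum:
 fixes P :: "real^'n => complex^'m^'n" and q :: "real^'n => complex^'m"
 assumes fi: "fi : V_space B th" and P: "P : sqint lebesgue" and q: "q : sqint lebesgue"
  and orth: "!!psi G. [|psi : sqint lebesgue; G : sqint lebesgue; weak_gradient UNIV psi G;
    AE x in lebesgue. x : translates B --> G x = 0|] ==> l2inner lebesgue P G + l2inner lebesgue q psi = 0"
  and K: "finite K" "K \<subseteq> lattice"
 shows "(\<Sum>l\<in>lat 1. l2inner (cellM) (%y. zsum ((%m. m + l) ` K) P (th, y)) (sgrad th fi (bloch_grad th fi) l)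
   + l2inner (cellM) (%y. zsum ((%m. m + l) ` K) q (th, y)) (%y. \<eta> (y + l) *r fi y)) = 0"
proof -
 let ?C = "lebesgue_on (cell :: (real^'n) set)"
 let ?G = "grad (interior cell) fi"
 have h: "fi : H1per" using fi by (simp add: V_space_def)
 note fis = H1perD[OF h]
 obtain f where f: "!!k. smooth (f k)" "!!k. periodic (f k)" "L2_tendsto (interior cell) f fi"
   "L2_tendsto (interior cell) (%k. classical_grad (f k)) ?G"
  using h by (auto simp: H1per_def)
 define L where "L v = imul (tensor th v)" for v :: "complex^'m"
 have L: "bounded_linear L"
  unfolding L_def[abs_def] using bounded_linear_compose[OF bounded_linear_cmul[of \<i>] bounded_linear_tensor] by (simp add: cmul_ii)
 obtain CL where CL: "0 <= CL" "!!v. norm (L v) <= CL * norm v"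
  using bounded_linear.pos_bounded[OF L] by (metis mult.commute less_imp_le)
 define g where "g k y = classical_grad (f k) y + L (f k y)" for k y
 define bg where "bg = bloch_grad th fi"
 have bg: "bg y = ?G y + L (fi y)" for y by (simp add: bg_def bloch_grad_def L_def imul_eq_cscale)
 have fC: "f k : sqint ?C" "classical_grad (f k) : sqint ?C" for k
  using f(3,4) by (auto simp: L2_tendsto_iff L2_eq_sqint intro: interior_cell_cong(2))
 have gC: "g k : sqint ?C" for k
  unfolding g_def[abs_def] by (rule sqint_add[OF fC(2) sqint_linear[OF L fC(1)]])
 have bgC: "bg : sqint ?C" unfolding bg_def by (rule bloch_grad_sqint[OF h])
 define n1 where "n1 k = l2norm ?C (%x. f k x - fi x)" for k
 define n2 where "n2 k = l2norm ?C (%x. g k x - bg x)" for k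
 have d1: "(%x. f k x - fi x) : sqint ?C" for k by (rule sqint_diff[OF fC(1) fis(4)])
 have d2: "(%x. classical_grad (f k) x - ?G x) : sqint ?C" for k by (rule sqint_diff[OF fC(2) fis(5)])
 have n1: "n1 ~> 0"
 proof -
  have "n1 = (%k. l2norm (lebesgue_on (interior cell)) (%x. f k x - fi x))"
   unfolding n1_def[abs_def] using f(3)
   by (intro HOL.ext interior_cell_cong(3) sqint_diff) (auto simp: L2_tendsto_iff L2_eq_sqint)
  then show ?thesis using f(3) by (simp add: L2_tendsto_iff)
 qed
 have n3: "(%k. l2norm ?C (%x. classical_grad (f k) x - ?G x)) ~> 0"
 proof -
  have "(%k. l2norm ?C (%x. classical_grad (f k) x - ?G x)) = (%k. l2norm (lebesgue_on (interior cell)) (%x. classical_grad (f k) x - ?G x))"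
   using f(4) by (intro HOL.ext interior_cell_cong(3) sqint_diff) (auto simp: L2_tendsto_iff L2_eq_sqint)
  then show ?thesis using f(4) by (simp add: L2_tendsto_iff)
 qed
 have n2: "n2 ~> 0"
 proof (rule Lim_null_comparison[OF _ tendsto_add_zero[OF n3 tendsto_mult_right_zero[OF n1, of CL]]], intro always_eventually allI)
  fix k
  have L1: "(%x. L (f k x - fi x)) : sqint ?C" by (rule sqint_linear[OF L d1])
  have "n2 k = l2norm ?C (%x. (classical_grad (f k) x - ?G x) + L (f k x - fi x))"
   unfolding n2_def g_def bg by (simp add: linear_diff[OF bounded_linear.linear[OF L]] algebra_simps)
  also have "... <= l2norm ?C (%x. classical_grad (f k) x - ?G x) + l2norm ?C (%x. L (f k x - fi x))"
   by (rule l2norm_triangle[OF d2 L1])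
  also have "l2norm ?C (%x. L (f k x - fi x)) <= CL * n1 k"
   unfolding n1_def by (rule l2norm_dominated[OF d1 sqintD(1)[OF L1] CL])
  finally show "norm (n2 k) <= l2norm ?C (%x. classical_grad (f k) x - ?G x) + CL * n1 k"
   by (simp add: n2_def l2norm_nonneg)
 qed
 obtain Ce where Ce: "0 <= Ce" "!!x. \<bar>\<eta> x\<bar> <= Ce" "!!x j. \<bar>partial j \<eta> x\<bar> <= Ce" using that by (rule eta_bounds)
 define psi where "psi k = ext th (f k)" for k
 define D where "D k = classical_grad (psi k)" for k
 have psit: "psi k : test_functions UNIV" for k unfolding psi_def by (rule ext_test[OF f(1)])
 have psism: "smooth (psi k)" for k unfolding psi_def by (rule ext_smooth[OF f(1)])
 have psis: "psi k : sqint lebesgue" for k by (rule test_functions_sqint[OF psit])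
 have Ds: "D k : sqint lebesgue" for k
  unfolding D_def by (rule classical_grad_sqint[OF psit])
 have Dk: "D k x = \<eta> x *r cmul (cis (th \<bullet> x)) (g k x) + (\<chi> j. partial j \<eta> x *r cmul (cis (th \<bullet> x)) (f k x))" for k x
  unfolding D_def psi_def classical_grad_ext[OF f(1)] g_def L_def ..
 have Dz: "D k x = 0" "psi k x = 0" if "x ~: tile (lat 1)" for k x
  using eta_tile[OF that] eta_tile_partial[OF that] by (simp_all add: Dk psi_def ext_def zero_vec_def)
 have sg: "cmul (cis (- (th \<bullet> (y + l)))) (D k (y + l)) = sgrad th (f k) (g k) l y"
  "cmul (cis (- (th \<bullet> (y + l)))) (psi k (y + l)) = \<eta> (y + l) *r f k y" if "l : lat 1" for k l y
  using sgrad_eq[OF f(1)[of k] f(2)[of k] subsetD[OF lat_subset that], where th=th and y=y] unfolding D_def psi_def g_def[abs_def] L_def by blast+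
 note me = mult_estimates[OF _ _ Ce]
 have dC: "(%x. f m x - f n x) : sqint ?C" "(%x. g m x - g n x) : sqint ?C" for m n
  by (rule sqint_diff[OF fC(1) fC(1)], rule sqint_diff[OF gC gC])
 have b1: "l2norm ?C (%x. f m x - f n x) <= n1 m + n1 n" for m n
  using l2norm_diff_triangle[OF fC(1) fis(4) fC(1), of m n] l2norm_commute[of ?C fi "f n"] unfolding n1_def by simp
 have b2: "l2norm ?C (%x. g m x - g n x) <= n2 m + n2 n" for m n
  using l2norm_diff_triangle[OF gC bgC gC, of m n] l2norm_commute[of ?C bg "g n"] unfolding n2_def by simp
 define Q where "Q = real (card (lat 1 :: (real^'n) set))"
 have c1: "l2norm lebesgue (%x. psi m x - psi n x) <= Q * Ce * n1 m + Q * Ce * n1 n" for m n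
 proof -
  have "l2norm lebesgue (%x. psi m x - psi n x) <= (\<Sum>l\<in>lat 1. l2norm ?C (%y. psi m (y + l) - psi n (y + l)))"
   by (rule fold_norm[OF sqint_diff[OF psis psis]]) (simp add: Dz)
  also have "... <= (\<Sum>l\<in>(lat 1 :: (real^'n) set). Ce * (n1 m + n1 n))"
  proof (rule sum_mono)
   fix l :: "real^'n" assume l: "l : lat 1"
   have e: "norm (psi m (y + l) - psi n (y + l)) = norm (\<eta> (y + l) *r (f m y - f n y))" for y
   proof -
    have "norm (psi m (y + l) - psi n (y + l)) = norm (cmul (cis (- (th \<bullet> (y + l)))) (psi m (y + l) - psi n (y + l)))"
     by (simp add: norm_cmul)
    then show ?thesis by (simp only: cmul_diff_right sg(2)[OF l] scaleR_diff_right)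
   qed
   have "l2norm ?C (%y. psi m (y + l) - psi n (y + l)) = l2norm ?C (%y. \<eta> (y + l) *r (f m y - f n y))"
    unfolding l2norm_def e ..
   also have "... <= Ce * l2norm ?C (%x. f m x - f n x)" by (rule me(2)[OF dC])
   also have "... <= Ce * (n1 m + n1 n)" by (rule mult_left_mono[OF b1 Ce(1)])
   finally show "l2norm ?C (%y. psi m (y + l) - psi n (y + l)) <= Ce * (n1 m + n1 n)" .
  qed
  finally show ?thesis by (simp add: Q_def algebra_simps)
 qed
 \<comment> \<open>Q counts the neighbouring cells; in each of them \<open>mult_estimates\<close>
   bounds the increment of the gradient by the errors n2 and n1.\<close>
 define s where "s k = Q * (Ce * n2 k + real CARD('n) * Ce * n1 k)" for k
 have c2: "l2norm lebesgue (%x. D m x - D n x) <= s m + s n" for m n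
 proof -
  have "l2norm lebesgue (%x. D m x - D n x) <= (\<Sum>l\<in>lat 1. l2norm ?C (%y. D m (y + l) - D n (y + l)))"
   by (rule fold_norm[OF sqint_diff[OF Ds Ds]]) (simp add: Dz)
  also have "... <= (\<Sum>l\<in>(lat 1 :: (real^'n) set). Ce * (n2 m + n2 n) + real CARD('n) * Ce * (n1 m + n1 n))"
  proof (rule sum_mono)
   fix l :: "real^'n" assume l: "l : lat 1"
   have e: "norm (D m (y + l) - D n (y + l)) = norm (sgrad th (%y. f m y - f n y) (%y. g m y - g n y) l y)" for y
   proof -
    have "norm (D m (y + l) - D n (y + l)) = norm (cmul (cis (- (th \<bullet> (y + l)))) (D m (y + l) - D n (y + l)))"
     by (simp add: norm_cmul)
    then show ?thesis by (simp only: cmul_diff_right sg(1)[OF l] sgrad_diff)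
   qed
   have "l2norm ?C (%y. D m (y + l) - D n (y + l)) = l2norm ?C (sgrad th (%y. f m y - f n y) (%y. g m y - g n y) l)"
    unfolding l2norm_def e ..
   also have "... <= Ce * l2norm ?C (%x. g m x - g n x) + real CARD('n) * Ce * l2norm ?C (%x. f m x - f n x)" by (rule me(4)[OF dC])
   also have "... <= Ce * (n2 m + n2 n) + real CARD('n) * Ce * (n1 m + n1 n)"
    by (intro add_mono mult_left_mono b1 b2) (use Ce(1) in auto)
   finally show "l2norm ?C (%y. D m (y + l) - D n (y + l)) <= Ce * (n2 m + n2 n) + real CARD('n) * Ce * (n1 m + n1 n)" .
  qed
  finally show ?thesis by (simp add: s_def Q_def algebra_simps)
 qed
 have s0: "s ~> 0" unfolding s_def[abs_def]
  by (intro tendsto_mult_right_zero tendsto_add_zero n1 n2)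
 obtain psi' where psi': "psi' : sqint lebesgue" "(%k. l2norm lebesgue (%x. psi k x - psi' x)) ~> 0"
  using sqint_Cauchy_limit[of psi, OF psis tendsto_mult_right_zero[OF n1, of "Q * Ce"] c1] by blast
 obtain G where G: "G : sqint lebesgue" "(%k. l2norm lebesgue (%x. D k x - G x)) ~> 0"
  using sqint_Cauchy_limit[of D, OF Ds s0 c2] by blast
 have wk: "weak_gradient UNIV (psi k) (D k)" for k
  unfolding D_def by (rule weak_gradient_classical[OF psism]) simp
 have wg: "weak_gradient UNIV psi' G"
  by (rule weak_gradient_limit[where u=psi and G=D, OF _ wk]) (simp_all add: L2_eq_sqint lebesgue_on_UNIV_eq psis Ds psi' G)
 let ?T = "translates B"
 note Ts = translates_sets(2)
 \<comment> \<open>On the copies of B the cut-off is locally constant and survives only on B itself,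
   so what is left is the Bloch gradient of \<open>f k\<close> on B, which tends to that of fi and
   hence to zero.\<close>
 have DT: "indicator ?T x *r D k x = indicator B x *r cmul (cis (th \<bullet> x)) (g k x)" for k x
 proof (cases "x : ?T")
  case True
  then show ?thesis using eta_partial_B[OF True] eta_B[OF True] by (simp add: Dk zero_vec_def[symmetric])
 next
  case False
  moreover have "x ~: B" using False B_translates by blast
  ultimately show ?thesis by simp
 qed
 have G0: "AE x in lebesgue. x : ?T --> G x = 0"
 proof -
  have GT: "G : sqint (lebesgue_on ?T)" "D k : sqint (lebesgue_on ?T)" for k
   by (rule sqint_leb_on(1)[OF G(1) Ts], rule sqint_leb_on(1)[OF Ds Ts])
  have BC: "g k : sqint (lebesgue_on B)" "bg : sqint (lebesgue_on B)"
    "l2norm (lebesgue_on B) (%x. g k x - bg x) <= n2 k" for k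
   unfolding n2_def by (rule sqint_subset[OF _ cell_sets(1) B_subset(3,2)] gC bgC sqint_diff)+
  have bz: "AE x in lebesgue_on B. g k x = g k x - bg x" for k
   using V_space_bloch_grad[OF open_B B_subset(1) fi] unfolding bg_def by eventually_elim simp
  have "l2norm (lebesgue_on ?T) G <= l2norm lebesgue (%x. D k x - G x) + n2 k" for k
  proof -
   have "l2norm (lebesgue_on ?T) G = l2norm (lebesgue_on ?T) (%x. (G x - D k x) + D k x)" by simp
   also have "... <= l2norm (lebesgue_on ?T) (%x. G x - D k x) + l2norm (lebesgue_on ?T) (D k)"
    by (rule l2norm_triangle[OF sqint_diff[OF GT] GT(2)])
   also have "l2norm (lebesgue_on ?T) (%x. G x - D k x) = l2norm (lebesgue_on ?T) (%x. D k x - G x)" by (rule l2norm_commute)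
   also have "... <= l2norm lebesgue (%x. D k x - G x)" by (rule sqint_leb_on(2)[OF sqint_diff[OF Ds G(1)] Ts])
   also have "l2norm (lebesgue_on ?T) (D k) = l2norm lebesgue (%x. indicator B x *r cmul (cis (th \<bullet> x)) (g k x))"
    unfolding l2norm_restrict[OF Ts] DT ..
   also have "... = l2norm (lebesgue_on B) (g k)"
    unfolding l2norm_restrict[OF B_subset(3)] unfolding l2norm_def by (simp only: norm_scaleR norm_cmul norm_cis mult_1)
   also have "... = l2norm (lebesgue_on B) (%x. g k x - bg x)"
    by (rule l2norm_cong_AE[OF sqintD(1)[OF BC(1)] sqintD(1)[OF sqint_diff[OF BC(1,2)]] bz])
   also have "... <= n2 k" by (rule BC(3))
   finally show ?thesis by simp
  qed
  then have "l2norm (lebesgue_on ?T) G <= 0"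
   by (intro LIMSEQ_le_const[OF tendsto_add_zero[OF G(2) n2]]) auto
  then have "l2norm (lebesgue_on ?T) G = 0" using l2norm_nonneg[of "lebesgue_on ?T" G] by linarith
  then have "AE x in lebesgue_on ?T. G x = 0" using l2norm_eq_0_iff[OF GT(1)] by blast
  then show ?thesis unfolding AE_leb_on[OF Ts] .
 qed
 let ?P = "%m x. cmul (cis (- (th \<bullet> m))) (P (x + m))" and ?q = "%m x. cmul (cis (- (th \<bullet> m))) (q (x + m))"
 \<comment> \<open>Lattice translation and multiplication by a constant phase preserve
   admissibility; \<open>l2inner_shift\<close> moves both from the test pair to the field.\<close>
 have z: "l2inner lebesgue (?P m) G + l2inner lebesgue (?q m) psi' = 0" if "m : K" for m
 proof -
  let ?c = "cnj (cis (- (th \<bullet> m)))"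
  have m: "m : lattice" using that K(2) by blast
  have s1: "(%x. psi' (x - m)) : sqint lebesgue" "(%x. G (x - m)) : sqint lebesgue"
   by (rule sqint_affine(3)[OF psi'(1)], rule sqint_affine(3)[OF G(1)])
  have w1: "weak_gradient UNIV (%x. psi' (x - m)) (%x. G (x - m))" using weak_gradient_translate[OF wg, of "- m"] by simp
  have "l2inner lebesgue P (%x. cmul ?c (G (x - m))) + l2inner lebesgue q (%x. cmul ?c (psi' (x - m))) = 0"
  proof (rule orth)
   show "weak_gradient UNIV (%x. cmul ?c (psi' (x - m))) (%x. cmul ?c (G (x - m)))"
    by (rule weak_gradient_cmul[OF w1]) (simp_all add: L2_eq_sqint lebesgue_on_UNIV_eq s1)
   show "AE x in lebesgue. x : ?T --> cmul ?c (G (x - m)) = 0"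
    using AE_affine(1)[OF G0, of "- m"]
    by eventually_elim (use translates_lattice[OF lattice_uminus[OF m], of _ B] in \<open>auto simp: cmul_zero\<close>)
  qed (rule sqint_linear[OF bounded_linear_cmul s1(1)], rule sqint_linear[OF bounded_linear_cmul s1(2)])
  then show ?thesis by (simp only: l2inner_shift)
 qed
 have Pm: "?P m : sqint lebesgue" "?q m : sqint lebesgue" for m
  by (rule sqint_linear[OF bounded_linear_cmul sqint_affine(1)[OF P]], rule sqint_linear[OF bounded_linear_cmul sqint_affine(1)[OF q]])
 let ?zP = "%l y. zsum ((%m. m + l) ` K) P (th, y)" and ?zq = "%l y. zsum ((%m. m + l) ` K) q (th, y)"
 \<comment> \<open>S is evaluated twice: on the whole space it tends to the vanishing pairings with
   the limit pair, on the cell to the sum in the claim.\<close>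
 define S where "S k = (\<Sum>l\<in>lat 1. l2inner ?C (?zP l) (sgrad th (f k) (g k) l) + l2inner ?C (?zq l) (%y. \<eta> (y + l) *r f k y))" for k
 have Sk: "S k = zak_const TYPE('n) * (\<Sum>m\<in>K. l2inner lebesgue (?P m) (D k) + l2inner lebesgue (?q m) (psi k))" for k
 proof -
  have "(\<Sum>l\<in>lat 1. l2inner ?C (?zP l) (sgrad th (f k) (g k) l))
    = (\<Sum>l\<in>lat 1. l2inner ?C (?zP l) (%y. cmul (cis (- (th \<bullet> (y + l)))) (D k (y + l))))"
   by (intro sum.cong refl) (simp add: sg)
  moreover have "(\<Sum>l\<in>lat 1. l2inner ?C (?zq l) (%y. \<eta> (y + l) *r f k y))
    = (\<Sum>l\<in>lat 1. l2inner ?C (?zq l) (%y. cmul (cis (- (th \<bullet> (y + l)))) (psi k (y + l))))"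
   by (intro sum.cong refl) (simp add: sg)
  ultimately show ?thesis
   using fold_pairing[OF P Ds[of k] Dz(1) K, where th=th] fold_pairing[OF q psis[of k] Dz(2) K, where th=th]
   unfolding S_def sum.distrib distrib_left by linarith
 qed
 have "S ~> zak_const TYPE('n) * (\<Sum>m\<in>K. l2inner lebesgue (?P m) G + l2inner lebesgue (?q m) psi')"
  unfolding Sk[abs_def]
  by (intro tendsto_intros l2inner_tendsto Pm Ds psis G psi') (simp_all add: l2norm_def)
 then have S0: "S ~> 0" using z by simp
 have zs: "?zP l : sqint ?C" "?zq l : sqint ?C" for l by (rule zsum_section_sqint[OF P], rule zsum_section_sqint[OF q])
 have "(%k. l2norm ?C (%y. sgrad th (f k) (g k) l y - sgrad th fi bg l y)) ~> 0" for l
 proof (rule Lim_null_comparison[OF _ tendsto_add_zero[OF tendsto_mult_right_zero[OF n2, of Ce] tendsto_mult_right_zero[OF n1, of "real CARD('n) * Ce"]]],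
   intro always_eventually allI)
  show "norm (l2norm ?C (%y. sgrad th (f k) (g k) l y - sgrad th fi bg l y)) <= Ce * n2 k + real CARD('n) * Ce * n1 k" for k
   unfolding sgrad_diff n1_def n2_def real_norm_def abs_of_nonneg[OF l2norm_nonneg] by (rule me(4)[OF d1 sqint_diff[OF gC bgC]])
 qed
 moreover have "(%k. l2norm ?C (%y. \<eta> (y + l) *r f k y - \<eta> (y + l) *r fi y)) ~> 0" for l
 proof (rule Lim_null_comparison[OF _ tendsto_mult_right_zero[OF n1, of Ce]], intro always_eventually allI)
  show "norm (l2norm ?C (%y. \<eta> (y + l) *r f k y - \<eta> (y + l) *r fi y)) <= Ce * n1 k" for k
   unfolding scaleR_diff_right[symmetric] n1_def real_norm_def abs_of_nonneg[OF l2norm_nonneg] by (rule me(2)[OF d1 sqint_diff[OF gC bgC]])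
 qed
 ultimately have "S ~> (\<Sum>l\<in>lat 1. l2inner ?C (?zP l) (sgrad th fi bg l) + l2inner ?C (?zq l) (%y. \<eta> (y + l) *r fi y))"
  unfolding S_def[abs_def]
  by (intro tendsto_intros l2inner_tendsto zs me(1)[OF fC(1) gC] me(3)[OF fC(1) gC] me(1)[OF fis(4) bgC] me(3)[OF fis(4) bgC])
   (simp_all add: l2norm_def)
 from LIMSEQ_unique[OF this S0] show ?thesis unfolding bg_def .
qed

text \<open>The limit of \<open>tested_sum\<close> over growing boxes. The null set is fixed by a
  subsequence along which all shifted partial sums converge in the fibre, before an element of the
  fibre space is chosen.\<close>

lemma fibre_testing:
 fixes P :: "real^'n => complex^'m^'n" and q :: "real^'n => complex^'m"
 assumes P: "glim P wP" and q: "glim q wq"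
  and orth: "!!psi G. [|psi : sqint lebesgue; G : sqint lebesgue; weak_gradient UNIV psi G;
    AE x in lebesgue. x : translates B --> G x = 0|] ==> l2inner lebesgue P G + l2inner lebesgue q psi = 0"
 shows "AE th in dualM. \<forall>fi\<in>V_space B th.
  l2inner (cellM) (%y. wP (th, y)) (bloch_grad th fi) + l2inner (cellM) (%y. wq (th, y)) fi = 0"
proof -
 let ?C = "lebesgue_on (cell :: (real^'n) set)"
 note Ps = glimD[OF P] and qs = glimD[OF q]
 \<comment> \<open>Boxes shifted by the neighbours l. Since \<open>K l (N + 1)\<close> contains
   \<open>lat N\<close>, \<open>glim_seq\<close> applies with offset 1.\<close>
 define K where "K l N = (%m. m + l) ` lat N" for l :: "real^'n" and N
 have K: "finite (K l N)" "K l N \<subseteq> lattice" if "l : lat 1" for l N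
  unfolding K_def using finite_lat lattice_add[OF subsetD[OF lat_subset] subsetD[OF lat_subset that]] by auto
 have K1: "lat N \<subseteq> K l (N + 1)" if "l : lat 1" for l N
 proof
  fix x :: "real^'n" assume x: "x : lat N"
  have "\<bar>(x - l) $ i\<bar> <= real (N + 1)" for i
  proof -
   have "\<bar>x $ i\<bar> <= real N" "\<bar>l $ i\<bar> <= real 1" using x that by (auto simp: lat_def)
   then show ?thesis by simp
  qed
  moreover have "x - l : lattice" by (rule lattice_diff[OF subsetD[OF lat_subset x] subsetD[OF lat_subset that]])
  ultimately have "x - l : lat (N + 1)" by (simp add: lat_def)
  then show "x : K l (N + 1)" unfolding K_def by (intro image_eqI[of _ _ "x - l"]) simp_all
 qed
 define hP where "hP l N p = zsum (K l N) P p - wP p" for l N p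
 define hq where "hq l N p = zsum (K l N) q p - wq p" for l N p
 have hs: "hP l N : sqint MDC" "hq l N : sqint MDC" for l N
  unfolding hP_def[abs_def] hq_def[abs_def]
  by (rule sqint_diff[OF zsum_sqint[OF Ps(1)] Ps(2)], rule sqint_diff[OF zsum_sqint[OF qs(1)] qs(2)])
 have h0: "(%N. l2norm MDC (hP l N)) ~> 0" "(%N. l2norm MDC (hq l N)) ~> 0" if "l : lat 1" for l
  unfolding hP_def[abs_def] hq_def[abs_def]
  by (rule glim_seq[OF P K[OF that] K1[OF that]], rule glim_seq[OF q K[OF that] K1[OF that]])
 \<comment> \<open>The errors of both fields for all neighbours are collected in one function, so
   that a single subsequence serves them all.\<close>
 define h where "h N p = (\<Sum>l\<in>lat 1. (norm (hP l N p))\<^sup>2 + (norm (hq l N p))\<^sup>2)" for N p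
 have hi: "integrable MDC (h N)" for N
  unfolding h_def[abs_def] by (intro Bochner_Integration.integrable_sum Bochner_Integration.integrable_add sqintD(2) hs)
 have "integral\<^sup>L MDC (h N) = (\<Sum>l\<in>lat 1. (l2norm MDC (hP l N))\<^sup>2 + (l2norm MDC (hq l N))\<^sup>2)" for N
  unfolding h_def l2norm_sq using sqintD(2)[OF hs(1)] sqintD(2)[OF hs(2)] by simp
 moreover have "(%N. \<Sum>l\<in>(lat 1 :: (real^'n) set). (l2norm MDC (hP l N))\<^sup>2 + (l2norm MDC (hq l N))\<^sup>2) ~> (\<Sum>l\<in>(lat 1 :: (real^'n) set). 0\<^sup>2 + 0\<^sup>2)"
  by (intro tendsto_intros h0)
 ultimately have hl: "(%N. integral\<^sup>L MDC (h N)) ~> 0" by simp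
 have hnn: "0 <= h N p" for N p unfolding h_def by (intro sum_nonneg) simp
 obtain r where r: "AE th in dualM. (\<forall>k. integrable ?C (%y. h (r k) (th, y))) \<and>
   (%k. LINT y|?C. h (r k) (th, y)) ~> 0"
  using section_subsequence[OF dual_cell_sets(2) cell_sets(2) hi hnn hl] by blast
 have sP: "AE th in dualM. (%y. wP (th, y)) : sqint ?C"
  and sq: "AE th in dualM. (%y. wq (th, y)) : sqint ?C"
  by (rule sqint_section[OF dual_cell_sets(2) cell_sets(2) Ps(2)], rule sqint_section[OF dual_cell_sets(2) cell_sets(2) qs(2)])
 from r sP sq show ?thesis
 proof eventually_elim
  case (elim th)
  have hps: "(%y. hP l N (th, y)) : sqint ?C" "(%y. hq l N (th, y)) : sqint ?C" for l N
   unfolding hP_def hq_def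
   by (rule sqint_diff[OF zsum_section_sqint[OF Ps(1)] elim(2)], rule sqint_diff[OF zsum_section_sqint[OF qs(1)] elim(3)])
  have lim: "(%k. l2norm ?C (%y. hP l (r k) (th, y))) ~> 0" "(%k. l2norm ?C (%y. hq l (r k) (th, y))) ~> 0"
   if l: "l : lat 1" for l
  proof -
   have b: "LINT y|?C. (norm (hP l (r k) (th, y)))\<^sup>2 + (norm (hq l (r k) (th, y)))\<^sup>2 <= (LINT y|?C. h (r k) (th, y))" for k
   proof (rule integral_mono)
    show "integrable ?C (%y. (norm (hP l (r k) (th, y)))\<^sup>2 + (norm (hq l (r k) (th, y)))\<^sup>2)"
     by (intro Bochner_Integration.integrable_add sqintD(2) hps)
    show "integrable ?C (%y. h (r k) (th, y))" using elim(1) by blast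
    show "(norm (hP l (r k) (th, y)))\<^sup>2 + (norm (hq l (r k) (th, y)))\<^sup>2 <= h (r k) (th, y)" for y
     unfolding h_def by (rule member_le_sum[OF l _ finite_lat]) simp
   qed
   have "(%k. LINT y|?C. (norm (hP l (r k) (th, y)))\<^sup>2 + (norm (hq l (r k) (th, y)))\<^sup>2) ~> 0"
   proof (rule Lim_null_comparison[OF _ conjunct2[OF elim(1)]], intro always_eventually allI)
    show "norm (LINT y|?C. (norm (hP l (r k) (th, y)))\<^sup>2 + (norm (hq l (r k) (th, y)))\<^sup>2) <= (LINT y|?C. h (r k) (th, y))" for k
     using b[of k] by (subst real_norm_def, subst abs_of_nonneg) (auto intro: integral_nonneg)
   qed
   from sqint_AE_tendsto_helper[OF sqintD(2)[OF hps(1)] this sqintD(2)[OF hps(2)]]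
   show "(%k. l2norm ?C (%y. hP l (r k) (th, y))) ~> 0" "(%k. l2norm ?C (%y. hq l (r k) (th, y))) ~> 0" .
  qed
  show ?case
  proof
   fix fi :: "real^'n => complex^'m" assume fi: "fi : V_space B th"
   have h: "fi : H1per" using fi by (simp add: V_space_def)
   let ?E = "%l. sgrad th fi (bloch_grad th fi) l" and ?e = "%l y. \<eta> (y + l) *r fi y"
   obtain Ce where Ce: "0 <= Ce" "!!x. \<bar>\<eta> x\<bar> <= Ce" "!!x j. \<bar>partial j \<eta> x\<bar> <= Ce" using that by (rule eta_bounds)
   note me = mult_estimates[OF H1perD(4)[OF h] bloch_grad_sqint[OF h, of th] Ce]
   have "(%k. \<Sum>l\<in>lat 1. l2inner ?C (%y. zsum (K l (r k)) P (th, y)) (?E l) + l2inner ?C (%y. zsum (K l (r k)) q (th, y)) (?e l))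
     ~> (\<Sum>l\<in>lat 1. l2inner ?C (%y. wP (th, y)) (?E l) + l2inner ?C (%y. wq (th, y)) (?e l))"
    by (intro tendsto_intros l2inner_tendsto zsum_section_sqint Ps(1) qs(1) elim(2,3) me(1,3) lim[unfolded hP_def hq_def])
     (simp_all add: l2norm_def)
   moreover have "(\<Sum>l\<in>lat 1. l2inner ?C (%y. zsum (K l (r k)) P (th, y)) (?E l) + l2inner ?C (%y. zsum (K l (r k)) q (th, y)) (?e l)) = 0" for k
    unfolding K_def by (rule tested_sum[OF fi Ps(1) qs(1) orth finite_lat lat_subset])
   ultimately have z: "(\<Sum>l\<in>lat 1. l2inner ?C (%y. wP (th, y)) (?E l) + l2inner ?C (%y. wq (th, y)) (?e l)) = 0"
    by (simp add: LIMSEQ_const_iff)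
   \<comment> \<open>Here the partition is undone: on the cell the translates of \<eta> sum to 1 and
     their partial derivatives to 0, so the pieces reassemble to fi and its Bloch gradient.\<close>
   have sE: "(\<Sum>l\<in>lat 1. ?E l y) = bloch_grad th fi y" "(\<Sum>l\<in>lat 1. ?e l y) = fi y" if y: "y : cell" for y
   proof -
    have "(\<Sum>l\<in>lat 1. \<chi> j. partial j \<eta> (y + l) *r fi y) = 0"
     by (simp add: vec_eq_iff[where 'b='n] scaleR_sum_left[symmetric] eta_sum_partial[OF y] del: One_nat_def)
    then show "(\<Sum>l\<in>lat 1. ?E l y) = bloch_grad th fi y"
     unfolding sgrad_def sum.distrib scaleR_sum_left[symmetric] eta_sum[OF y] by simp
    show "(\<Sum>l\<in>lat 1. ?e l y) = fi y" unfolding scaleR_sum_left[symmetric] eta_sum[OF y] by simp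
   qed
   have "(\<Sum>l\<in>lat 1. l2inner ?C (%y. wP (th, y)) (?E l)) = (LINT y|?C. (\<Sum>l\<in>lat 1. wP (th, y) \<bullet> ?E l y))"
    unfolding l2inner_def by (intro Bochner_Integration.integral_sum[symmetric] inner_integrable elim(2) me(3))
   also have "... = l2inner ?C (%y. wP (th, y)) (bloch_grad th fi)"
    unfolding l2inner_def by (rule Bochner_Integration.integral_cong) (simp_all add: inner_sum_right[symmetric] sE del: One_nat_def inner_scaleR_right)
   finally have i1: "(\<Sum>l\<in>lat 1. l2inner ?C (%y. wP (th, y)) (?E l)) = l2inner ?C (%y. wP (th, y)) (bloch_grad th fi)" .
   have "(\<Sum>l\<in>lat 1. l2inner ?C (%y. wq (th, y)) (?e l)) = (LINT y|?C. (\<Sum>l\<in>lat 1. wq (th, y) \<bullet> ?e l y))"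
    unfolding l2inner_def by (intro Bochner_Integration.integral_sum[symmetric] inner_integrable elim(3) me(1))
   also have "... = l2inner ?C (%y. wq (th, y)) fi"
    unfolding l2inner_def by (rule Bochner_Integration.integral_cong) (simp_all add: inner_sum_right[symmetric] sE del: One_nat_def inner_scaleR_right)
   finally have "(\<Sum>l\<in>lat 1. l2inner ?C (%y. wq (th, y)) (?e l)) = l2inner ?C (%y. wq (th, y)) fi" .
   with i1 z show "l2inner ?C (%y. wP (th, y)) (bloch_grad th fi) + l2inner ?C (%y. wq (th, y)) fi = 0"
    by (simp add: sum.distrib)
  qed
 qed
qed

end

section \<open>The boundary of a Lipschitz domain is null\<close>

text \<open>Near each of its points the frontier lies in a graph over a hyperplane, that is, in the
  image of a null set under a Lipschitz map into the same space.\<close>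

lemma lipschitz_frontier_negligible:
 fixes B :: "(real^'n) set"
 assumes B: "open B" "lipschitz_boundary B"
 shows "negligible (frontier B)"
 unfolding locally_negligible_alt[of "frontier B"]
proof
 fix p assume p: "p : frontier B"
 obtain e r L g where e: "norm e = 1" "0 < r" "L-lipschitz_on {z. z \<bullet> e = 0} g"
   "B \<inter> ball p r = {x : ball p r. g (x - (x \<bullet> e) *r e) < x \<bullet> e}"
  using B(2) p unfolding lipschitz_boundary_def by blast
 let ?H = "{z :: real^'n. z \<bullet> e = 0}"
 define h where "h x = g (x - (x \<bullet> e) *r e)" for x :: "real^'n"
 have ee: "e \<bullet> e = 1" using e(1) by (simp add: dot_square_norm)
 have H: "x - (x \<bullet> e) *r e : ?H" for x :: "real^'n" by (simp add: inner_diff_left ee)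
 have hc: "continuous_on UNIV h"
  unfolding h_def by (rule continuous_on_compose2[OF lipschitz_on_continuous_on[OF e(3)]]) (use H in \<open>auto intro!: continuous_intros\<close>)
 have e4: "x : B \<longleftrightarrow> h x < x \<bullet> e" if "x : ball p r" for x
  using e(4) that unfolding h_def by blast
 have graph: "frontier B \<inter> ball p r \<subseteq> (%z. z + g z *r e) ` ?H"
 proof
  fix x assume x: "x : frontier B \<inter> ball p r"
  have nB: "x ~: B" using x B(1) by (simp add: frontier_def interior_open)
  \<comment> \<open>A point strictly below the graph has a neighbourhood free of B, and one strictly
    above belongs to the open set B; a frontier point is neither, hence it lies on the
    graph.\<close>
  have "\<not> x \<bullet> e < h x"
  proof
   assume lt: "x \<bullet> e < h x"
   have "open (ball p r \<inter> {x. x \<bullet> e < h x})"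
    by (intro open_Int open_ball open_Collect_less continuous_intros hc)
   moreover have "x : ball p r \<inter> {x. x \<bullet> e < h x}" using x lt by blast
   moreover have "x : closure B" using x by (simp add: frontier_def)
   ultimately obtain y where "y : B" "y : ball p r" "y \<bullet> e < h y"
    unfolding closure_iff_nhds_not_empty by blast
   then show False using e4[of y] by simp
  qed
  moreover have "\<not> h x < x \<bullet> e" using nB x e4[of x] by simp
  ultimately have "x = (x - (x \<bullet> e) *r e) + g (x - (x \<bullet> e) *r e) *r e" unfolding h_def by simp
  then show "x : (%z. z + g z *r e) ` ?H" using H by blast
 qed
 have "negligible ((%z. z + g z *r e) ` ?H)"
 proof (rule negligible_locally_Lipschitz_image[OF order_refl])
  have "e ~= 0" using e(1) by auto
  then show "negligible ?H" using negligible_hyperplane[of e 0] by (simp add: inner_commute)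
  fix x assume x: "x : ?H"
  have "norm ((y + g y *r e) - (x + g x *r e)) <= (1 + L) * norm (y - x)" if "y : ?H" for y
  proof -
   have "norm ((y + g y *r e) - (x + g x *r e)) = norm ((y - x) + (g y - g x) *r e)"
    by (rule arg_cong[where f=norm]) (simp add: algebra_simps)
   also have "... <= norm (y - x) + norm ((g y - g x) *r e)" by (rule norm_triangle_ineq)
   also have "... = norm (y - x) + dist (g y) (g x)" using e(1) by (simp add: dist_real_def)
   also have "... <= norm (y - x) + L * norm (y - x)" using lipschitz_onD[OF e(3) that x] by (simp add: dist_norm)
   finally show ?thesis by (simp add: algebra_simps)
  qed
  then show "\<exists>T C. open T & x : T & (\<forall>y\<in>?H \<inter> T. norm ((y + g y *r e) - (x + g x *r e)) <= C * norm (y - x))"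
   by (intro exI[of _ UNIV] exI[of _ "1 + L"]) auto
 qed
 then have "negligible (frontier B \<inter> ball p r)" by (rule negligible_subset[OF _ graph])
 moreover have "openin (top_of_set (frontier B)) (frontier B \<inter> ball p r)" by (rule openin_open_Int) simp
 ultimately show "\<exists>U. openin (top_of_set (frontier B)) U & p : U & negligible U"
  using p e(2) by (intro exI[of _ "frontier B \<inter> ball p r"]) auto
qed

section \<open>Riesz representation by minimisation\<close>

text \<open>Here a, b, t stand for q f f, q g g, q f g, and x, y for the functional at f and g; the
  hypothesis on m says that the midpoint does not undercut the infimum.\<close>

lemma parallelogram_bound:
 fixes X a b t x y m :: real
 assumes "m <= 1/4 * (a + 2 * t + b) - (x + y)" "X = a - 2 * t + b"
 shows "X <= 2 * (a - 2 * x - m) + 2 * (b - 2 * y - m)"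
proof -
 have "1/4 * (a + 2 * t + b) = a/4 + t/2 + b/4" by (simp add: field_simps)
 with assms show ?thesis by argo
qed

lemma gap_bound:
 fixes a b c d m x y :: real
 assumes "c <= d" "d <= 2 * (a - m) + 2 * (b - m)" "a < m + x" "b < m + y"
 shows "c <= 2 * x + 2 * y"
 using assms by argo

text \<open>Riesz representation by minimising the quadratic functional \<open>q f f - 2 * lf f\<close>; the
 functions are only identified almost everywhere, so no Hilbert space type is available.\<close>

lemma riesz_representation:
 fixes S :: "('a => 'b::euclidean_space) set" and q :: "('a => 'b) => ('a => 'b) => real"
 assumes S: "S \<subseteq> sqint M" "!!f g. f : S ==> g : S ==> (%x. f x + g x) : S" "!!f c. f : S ==> (%x. c *r f x) : S"
   "(%x. 0) : S"
   "!!f g. (!!k. f k : S) ==> g : sqint M ==> (%k. l2norm M (%x. f k x - g x)) ~> 0 ==> g : S"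
  and q: "!!f g. f : S ==> g : S ==> q f g = q g f"
   "!!f g h. f : S ==> g : S ==> h : S ==> q f (%x. g x + h x) = q f g + q f h"
   "!!f g c. f : S ==> g : S ==> q f (%x. c *r g x) = c * q f g"
   "!!f. f : S ==> c * (l2norm M f)\<^sup>2 <= q f f" "0 < c"
   "!!f. f : S ==> q f f <= C * (l2norm M f)\<^sup>2"
  and l: "!!f g. f : S ==> g : S ==> lf (%x. f x + g x) = lf f + lf g"
   "!!f c. f : S ==> lf (%x. c *r f x) = c * lf f"
   "!!f. f : S ==> \<bar>lf f\<bar> <= K * l2norm M f"
 shows "\<exists>u\<in>S. \<forall>f\<in>S. q u f = lf f"
proof -
 define J where "J f = q f f - 2 * lf f" for f
 have qadd: "q (%x. f x + g x) h = q f h + q g h" if "f : S" "g : S" "h : S" for f g h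
  using q(1)[OF S(2)[OF that(1,2)] that(3)] q(2)[OF that(3,1,2)] q(1)[OF that(3,1)] q(1)[OF that(3,2)] by simp
 have qsc: "q (%x. t *r f x) h = t * q f h" if "f : S" "h : S" for f h t
  using q(1)[OF S(3)[OF that(1)] that(2), of t] q(3)[OF that(2,1), of t] q(1)[OF that(2,1)] by simp
 have qexp: "q (%x. f x + t *r g x) (%x. f x + t *r g x) = q f f + 2 * t * q f g + t\<^sup>2 * q g g"
  if "f : S" "g : S" for f g t
 proof -
  note tg = S(3)[OF that(2), of t]
  have "q (%x. f x + t *r g x) (%x. f x + t *r g x) = (q f f + t * q f g) + t * (q g f + t * q g g)"
   unfolding qadd[OF that(1) tg S(2)[OF that(1) tg]] qsc[OF that(2) S(2)[OF that(1) tg]]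
    q(2)[OF that(1,1) tg] q(2)[OF that(2,1) tg] q(3)[OF that] q(3)[OF that(2,2)] ..
  then show ?thesis using q(1)[OF that] by (simp add: algebra_simps power2_eq_square)
 qed
 have qpos: "0 <= q f f" if "f : S" for f using q(4)[OF that] q(5) by (meson mult_nonneg_nonneg less_imp_le order_trans zero_le_power2)
 have CS: "\<bar>q f g\<bar> <= sqrt (q f f) * sqrt (q g g)" if "f : S" "g : S" for f g
  by (rule quadratic_discriminant_le)
   (use qpos[OF S(2)[OF that(1) S(3)[OF that(2)]]] qexp[OF that] qpos[OF that(1)] qpos[OF that(2)] in simp_all)
 \<comment> \<open>Completing the square in the norm gives the lower bound -K^2/c.\<close>
 have Jb: "- (K\<^sup>2 / c) <= J f" if "f : S" for f
 proof -
  let ?n = "l2norm M f"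
  have "0 <= (c * ?n - K)\<^sup>2 / c" using q(5) by simp
  also have "... = c * ?n\<^sup>2 - 2 * (K * ?n) + K\<^sup>2 / c" using q(5) by (simp add: field_simps power2_eq_square)
  finally show ?thesis using q(4)[OF that] l(3)[OF that] unfolding J_def by linarith
 qed
 define m where "m = Inf (J ` S)"
 have bdd: "bdd_below (J ` S)" using Jb by (intro bdd_belowI2)
 have mle: "m <= J f" if "f : S" for f unfolding m_def by (rule cINF_lower[OF bdd that])
 have "\<exists>f\<in>S. J f < m + 1 / real (Suc k)" for k
  using cInf_lessD[of "J ` S" "m + 1 / real (Suc k)"] S(4) unfolding m_def by auto
 then have "\<exists>u. \<forall>k. u k : S & J (u k) < m + 1 / real (Suc k)" by (intro choice) blast
 then obtain u where u: "!!k. u k : S" "!!k. J (u k) < m + 1 / real (Suc k)" by blast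
 have dS: "(%x. f x - g x) : S" if "f : S" "g : S" for f g
  using S(2)[OF that(1) S(3)[OF that(2), of "-1"]] by simp
 have par: "q (%x. f x - g x) (%x. f x - g x) <= 2 * (J f - m) + 2 * (J g - m)" if fg: "f : S" "g : S" for f g
 proof -
  let ?h = "%x. (1/2) *r (f x + 1 *r g x)"
  have s: "(%x. f x + 1 *r g x) : S" using S(2)[OF fg] by simp
  have h1: "q ?h ?h = (1/4) * q (%x. f x + 1 *r g x) (%x. f x + 1 *r g x)"
   unfolding qsc[OF s S(3)[OF s]] q(3)[OF s s] by simp
  have h2: "lf ?h = (1/2) * (lf f + lf g)" unfolding l(2)[OF s] using l(1)[OF fg] by simp
  have "J ?h = (1/4) * (q f f + 2 * q f g + q g g) - (lf f + lf g)"
   unfolding J_def h1 h2 qexp[OF fg] by (simp add: algebra_simps)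
  then have "m <= (1/4) * (q f f + 2 * q f g + q g g) - (lf f + lf g)"
   using mle[OF S(3)[OF s, of "1/2"]] by (simp only:)
  moreover have "q (%x. f x - g x) (%x. f x - g x) = q f f - 2 * q f g + q g g" using qexp[OF fg, of "-1"] by simp
  moreover have "X <= 2 * (a - 2 * x - m) + 2 * (b - 2 * y - m)"
   if "m <= 1/4 * (a + 2 * t + b) - (x + y)" "X = a - 2 * t + b" for X a b t x y m :: real
   by (rule parallelogram_bound[OF that])
  ultimately show ?thesis unfolding J_def by blast
 qed
 have us: "u k : sqint M" for k using u(1) S(1) by blast
 \<comment> \<open>\<open>u k\<close> comes within 1/(k + 1) of the infimum. The parallelogram bound
   and coercivity then limit squared distances by (2/(i + 1) + 2/(j + 1))/c, and the square root is
   subadditive.\<close>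
 define s where "s k = sqrt (2 / (c * real (Suc k)))" for k
 have "l2norm M (%x. u i x - u j x) <= s i + s j" for i j
 proof -
  have "c * (l2norm M (%x. u i x - u j x))\<^sup>2 <= 2 * (1 / real (Suc i)) + 2 * (1 / real (Suc j))"
   by (rule gap_bound[OF q(4)[OF dS[OF u(1) u(1)]] par[OF u(1) u(1)] u(2) u(2)])
  then have "(l2norm M (%x. u i x - u j x))\<^sup>2 <= (2 * (1 / real (Suc i)) + 2 * (1 / real (Suc j))) / c"
   by (subst pos_le_divide_eq[OF q(5)]) (simp only: mult.commute[of _ c])
  also have "... = 2 / (c * real (Suc i)) + 2 / (c * real (Suc j))"
   by (simp add: add_divide_distrib mult.commute del: of_nat_Suc)
  finally have "(l2norm M (%x. u i x - u j x))\<^sup>2 <= 2 / (c * real (Suc i)) + 2 / (c * real (Suc j))" .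
  then have "l2norm M (%x. u i x - u j x) <= sqrt (2 / (c * real (Suc i)) + 2 / (c * real (Suc j)))" by (rule real_le_rsqrt)
  also have "... <= s i + s j" unfolding s_def by (rule sqrt_add_le_add_sqrt) (use q(5) in simp_all)
  finally show ?thesis .
 qed
 moreover have inv0: "(%k. a / real (Suc k)) ~> 0" for a :: real
  by (rule LIMSEQ_Suc[OF lim_const_over_n])
 moreover have "s ~> 0"
  using tendsto_real_sqrt[OF inv0[of "2 / c"]] unfolding s_def[abs_def] by (simp only: divide_divide_eq_left real_sqrt_zero)
 ultimately obtain v where v: "v : sqint M" "(%k. l2norm M (%x. u k x - v x)) ~> 0"
  using sqint_Cauchy_limit[of u M s, OF us] by blast
 have vS: "v : S" by (rule S(5)[OF u(1) v])
 have "q v f = lf f" if f: "f : S" for f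
 proof -
  \<comment> \<open>Near-minimality says that a quadratic polynomial in the step t along f is
    nonnegative; its discriminant bounds the first variation at \<open>u k\<close>.\<close>
  have 1: "\<bar>q (u k) f - lf f\<bar> <= sqrt (1 / real (Suc k)) * sqrt (q f f)" for k
  proof (rule quadratic_discriminant_le)
   fix t
   have "m <= q (u k) (u k) + 2 * t * q (u k) f + t\<^sup>2 * q f f - 2 * (lf (u k) + t * lf f)"
    using mle[OF S(2)[OF u(1) S(3)[OF f]], of k t] unfolding J_def qexp[OF u(1) f] l(1)[OF u(1) S(3)[OF f]] l(2)[OF f] .
   then show "0 <= 1 / real (Suc k) + 2 * t * (q (u k) f - lf f) + t\<^sup>2 * q f f"
    using u(2)[of k] unfolding J_def by (simp add: algebra_simps)
  qed (use qpos[OF f] in simp_all)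
  have 2: "\<bar>q (u k) f - q v f\<bar> <= sqrt C * l2norm M (%x. u k x - v x) * sqrt (q f f)" for k
  proof -
   note d = dS[OF u(1) vS, of k]
   have "q (%x. u k x + (-1) *r v x) f = q (u k) f + (-1) * q v f" unfolding qadd[OF u(1) S(3)[OF vS] f] qsc[OF vS f] ..
   then have e: "q (%x. u k x - v x) f = q (u k) f - q v f" by simp
   have "\<bar>q (%x. u k x - v x) f\<bar> <= sqrt (q (%x. u k x - v x) (%x. u k x - v x)) * sqrt (q f f)" by (rule CS[OF d f])
   also have "... <= sqrt (C * (l2norm M (%x. u k x - v x))\<^sup>2) * sqrt (q f f)"
    by (intro mult_right_mono real_sqrt_le_mono q(6) d) (use qpos[OF f] in simp)
   finally show ?thesis unfolding e by (simp add: real_sqrt_mult l2norm_nonneg)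
  qed
  have "(%k. sqrt (1 / real (Suc k)) * sqrt (q f f)) ~> sqrt 0 * sqrt (q f f)"
   by (intro tendsto_mult_right tendsto_real_sqrt inv0)
  then have "(%k. sqrt (1 / real (Suc k)) * sqrt (q f f)) ~> 0" by (simp only: real_sqrt_zero mult_zero_left)
  then have "(%k. sqrt (1 / real (Suc k)) * sqrt (q f f) + sqrt C * l2norm M (%x. u k x - v x) * sqrt (q f f)) ~> 0"
   by (rule tendsto_add_zero) (rule tendsto_mult_left_zero[OF tendsto_mult_right_zero[OF v(2)]])
  moreover have "\<bar>q v f - lf f\<bar> <= sqrt (1 / real (Suc k)) * sqrt (q f f) + sqrt C * l2norm M (%x. u k x - v x) * sqrt (q f f)" for k
   using 1[of k] 2[of k] by linarith
  ultimately have "\<bar>q v f - lf f\<bar> <= 0" by (intro LIMSEQ_le_const) auto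
  then show ?thesis by simp
 qed
 with vS show ?thesis by blast
qed

section \<open>Ellipticity\<close>

lemma hdot_eq: "hdot u v = Complex (u \<bullet> v) (u \<bullet> imul v)"
 by (simp add: complex_eq_iff hdot_def inner_vec_def imul_vec_nth imul_complex_def inner_complex_def)

lemma contract_eq: "contract M N = Complex (M \<bullet> N) (M \<bullet> imul N)"
 by (simp add: complex_eq_iff contract_def inner_vec_def imul_vec_nth imul_complex_def inner_complex_def)

lemma integral_Complex_inner:
 fixes f g :: "'a => 'b::complex_structure"
 assumes f: "f : sqint M" and g: "g : sqint M"
 shows "(LINT x|M. Complex (f x \<bullet> g x) (f x \<bullet> imul (g x))) = Complex (l2inner M f g) (l2inner M f (%x. imul (g x)))"
proof -
 have g': "(%x. imul (g x)) : sqint M" using sqint_linear[OF bounded_linear_cmul[of \<i>] g] by (simp add: cmul_ii)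
 note i = inner_integrable[OF f g] inner_integrable[OF f g']
 have i1: "integrable M (%x. complex_of_real (f x \<bullet> g x))" by (intro integrable_of_real i)
 have i2: "integrable M (%x. \<i> * complex_of_real (f x \<bullet> imul (g x)))" by (intro integrable_mult_right integrable_of_real i)
 show ?thesis
  unfolding Complex_eq Bochner_Integration.integral_add[OF i1 i2] by (simp add: l2inner_def)
qed

lemma set_integral_hdot:
 fixes f g :: "real^'n => complex^'m"
 assumes Om: "Om : sets lebesgue" and "f : sqint (lebesgue_on Om)" "g : sqint (lebesgue_on Om)"
 shows "(LINT y:Om|lebesgue. hdot (f y) (g y)) = Complex (l2inner (lebesgue_on Om) f g) (l2inner (lebesgue_on Om) f (%x. imul (g x)))"
 using integral_Complex_inner[OF assms(2,3)]
 by (simp only: set_lebesgue_integral_def hdot_eq integral_leb_on[OF Om])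

lemma set_integral_contract:
 fixes f g :: "real^'n => complex^'m^'n"
 assumes Om: "Om : sets lebesgue" and "f : sqint (lebesgue_on Om)" "g : sqint (lebesgue_on Om)"
 shows "(LINT y:Om|lebesgue. contract (f y) (g y)) = Complex (l2inner (lebesgue_on Om) f g) (l2inner (lebesgue_on Om) f (%x. imul (g x)))"
 using integral_Complex_inner[OF assms(2,3)]
 by (simp only: set_lebesgue_integral_def contract_eq integral_leb_on[OF Om])

lemma bounded_bilinear_tapply: "bounded_bilinear (tapply :: complex^'m^'n^'m^'n => _)"
proof -
 have "linear (%M. tapply A M)" "linear (%A :: complex^'m^'n^'m^'n. tapply A M)" for A :: "complex^'m^'n^'m^'n" and M :: "complex^'m^'n"
  by (auto intro!: linearI simp: tapply_def vec_eq_iff algebra_simps sum.distrib scaleR_sum_right)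
 then show ?thesis by (simp add: bilinear_conv_bounded_bilinear[symmetric] bilinear_def)
qed

lemma tapply_cmul: "tapply A (cmul c M) = cmul c (tapply A M)"
 by (simp add: tapply_def vec_eq_iff cmul_nth cmul_complex sum_distrib_left mult_ac)

lemma sum4_swap:
 "(\<Sum>j\<in>A. \<Sum>k\<in>B. \<Sum>p\<in>C. \<Sum>q\<in>D. t j k p q) = (\<Sum>p\<in>C. \<Sum>q\<in>D. \<Sum>j\<in>A. \<Sum>k\<in>B. t j k p q)"
proof -
 have "(\<Sum>j\<in>A. \<Sum>k\<in>B. \<Sum>p\<in>C. \<Sum>q\<in>D. t j k p q) = (\<Sum>j\<in>A. \<Sum>p\<in>C. \<Sum>k\<in>B. \<Sum>q\<in>D. t j k p q)"
  by (rule sum.cong[OF refl]) (rule sum.swap)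
 also have "... = (\<Sum>p\<in>C. \<Sum>j\<in>A. \<Sum>k\<in>B. \<Sum>q\<in>D. t j k p q)" by (rule sum.swap)
 also have "... = (\<Sum>p\<in>C. \<Sum>j\<in>A. \<Sum>q\<in>D. \<Sum>k\<in>B. t j k p q)"
  by (rule sum.cong[OF refl], rule sum.cong[OF refl]) (rule sum.swap)
 also have "... = (\<Sum>p\<in>C. \<Sum>q\<in>D. \<Sum>j\<in>A. \<Sum>k\<in>B. t j k p q)"
  by (rule sum.cong[OF refl]) (rule sum.swap)
 finally show ?thesis .
qed

lemma tapply_symmetric:
 assumes "hermitian_tensor A"
 shows "tapply A M \<bullet> N = M \<bullet> tapply A N"
proof -
 have "contract (tapply A M) N = (\<Sum>j\<in>UNIV. \<Sum>k\<in>UNIV. \<Sum>p\<in>UNIV. \<Sum>q\<in>UNIV. A $ j $ k $ p $ q * M $ p $ q * cnj (N $ j $ k))"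
  by (simp add: contract_def tapply_def sum_distrib_right)
 also have "... = (\<Sum>p\<in>UNIV. \<Sum>q\<in>UNIV. \<Sum>j\<in>UNIV. \<Sum>k\<in>UNIV. A $ j $ k $ p $ q * M $ p $ q * cnj (N $ j $ k))"
  by (rule sum4_swap)
 also have "... = (\<Sum>p\<in>UNIV. \<Sum>q\<in>UNIV. \<Sum>j\<in>UNIV. \<Sum>k\<in>UNIV. M $ p $ q * (cnj (A $ p $ q $ j $ k) * cnj (N $ j $ k)))"
 proof -
  have "A $ j $ k $ p $ q * M $ p $ q * cnj (N $ j $ k) = M $ p $ q * (cnj (A $ p $ q $ j $ k) * cnj (N $ j $ k))" for j k p q
  proof -
   have e: "A $ j $ k $ p $ q = cnj (A $ p $ q $ j $ k)" using assms unfolding hermitian_tensor_def by blast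
   show ?thesis unfolding e complex_cnj_cnj by (simp only: mult_ac)
  qed
  then show ?thesis by (intro sum.cong refl)
 qed
 also have "... = contract M (tapply A N)" by (simp add: contract_def tapply_def sum_distrib_left)
 finally show ?thesis by (simp add: contract_eq)
qed

lemma coefficient_bound:
 fixes A :: "real^'n => complex^'m^'n^'m^'n"
 assumes "coefficient A"
 obtains C where "0 <= C" "!!y M. norm (tapply (A y) M) <= C * norm M"
proof -
 obtain a where a: "!!y. norm (A y) <= a" using assms by (auto simp: coefficient_def bounded_iff)
 obtain K where K: "!!A M. norm (tapply (A :: complex^'m^'n^'m^'n) M) <= norm A * norm M * K" "0 < K"
  using bounded_bilinear.pos_bounded[OF bounded_bilinear_tapply] by blast
 have a0: "0 <= a" using a[of undefined] norm_ge_zero order_trans by blast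
 have "norm (tapply (A y) M) <= (a * K) * norm M" for y M
 proof -
  have "norm (tapply (A y) M) <= norm (A y) * (norm M * K)" using K(1)[of "A y" M] by (simp add: mult.assoc)
  also have "... <= a * (norm M * K)" by (rule mult_right_mono[OF a]) (use K(2) in simp)
  finally show ?thesis by (simp add: mult_ac)
 qed
 then show ?thesis using a0 K(2) by (intro that[of "a * K"]) simp_all
qed

lemma borel_measurable_tapply:
 assumes "A : borel_measurable M" "f : borel_measurable M"
 shows "(%x. tapply (A x) (f x)) : borel_measurable M"
 by (rule borel_measurable_continuous_Pair[OF assms])
  (intro bounded_bilinear.continuous_on[OF bounded_bilinear_tapply] continuous_intros)

lemma coefficient_sqint:
 assumes A: "coefficient A" and f: "f : sqint (lebesgue_on Om)"
 shows "(%y. tapply (A y) (f y)) : sqint (lebesgue_on Om)"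
proof -
 obtain C where C: "0 <= C" "!!y M. norm (tapply (A y) M) <= C * norm M" using that by (rule coefficient_bound[OF A])
 have "A : borel_measurable (lebesgue_on Om)"
  using A unfolding coefficient_def by (intro measurable_restrict_space1) blast
 from sqint_dominated[OF f borel_measurable_tapply[OF this sqintD(1)[OF f]] C(2)] show ?thesis .
qed

lemma l2inner_cong_AE:
 assumes "f : sqint M" "g : sqint M" "f' : sqint M" "g' : sqint M" "AE x in M. f x = f' x" "AE x in M. g x = g' x"
 shows "l2inner M f g = l2inner M f' g'"
 unfolding l2inner_def
proof (rule integral_cong_AE)
 show "AE x in M. f x \<bullet> g x = f' x \<bullet> g' x" using assms(5,6) by eventually_elim simp
qed (use assms(1-4) sqintD(1) in \<open>blast intro: borel_measurable_inner\<close>)+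

text \<open>The hypothesis speaks of the chosen gradient; it is carried over to an arbitrary square
  integrable weak gradient, which differs from the choice by a null set.\<close>

lemma elliptic_pair:
 fixes u :: "real^'n => complex^'m"
 assumes Om: "open Om" and A: "coefficient A" and e: "elliptic_on Om A \<gamma>"
  and u: "u : sqint (lebesgue_on Om)" and G: "G : sqint (lebesgue_on Om)" and wg: "weak_gradient Om u G"
 shows "inverse \<gamma> * (l2norm (lebesgue_on Om) G)\<^sup>2 <= l2inner (lebesgue_on Om) (%y. tapply (A y) (G y)) G"
proof -
 let ?g = "grad Om u"
 note Os = open_leb[OF Om]
 have L: "u : L2 Om" "G : L2 Om" using u G by (simp_all add: L2_eq_sqint)
 have g: "?g : sqint (lebesgue_on Om)" using grad_eqI(2)[OF Om L(2) wg] by (simp add: L2_eq_sqint)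
 note ae = grad_eqI(1)[OF Om L(2) wg]
 have "inverse \<gamma> * (LINT y:Om|lebesgue. (norm (?g y))\<^sup>2) <= Re (LINT y:Om|lebesgue. contract (tapply (A y) (?g y)) (?g y))"
  using e H1I[OF L wg] unfolding elliptic_on_def by blast
 moreover have "(LINT y:Om|lebesgue. (norm (?g y))\<^sup>2) = (l2norm (lebesgue_on Om) ?g)\<^sup>2"
  by (simp only: set_lebesgue_integral_def l2norm_sq integral_leb_on[OF Os])
 ultimately have "inverse \<gamma> * (l2norm (lebesgue_on Om) ?g)\<^sup>2 <= l2inner (lebesgue_on Om) (%y. tapply (A y) (?g y)) ?g"
  by (simp add: set_integral_contract[OF Os coefficient_sqint[OF A g] g])
 moreover have "l2norm (lebesgue_on Om) ?g = l2norm (lebesgue_on Om) G"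
  by (rule l2norm_cong_AE[OF sqintD(1)[OF g] sqintD(1)[OF G] ae])
 moreover have "AE y in lebesgue_on Om. tapply (A y) (?g y) = tapply (A y) (G y)" using ae by eventually_elim simp
 from l2inner_cong_AE[OF coefficient_sqint[OF A g] g coefficient_sqint[OF A G] G this ae]
 have "l2inner (lebesgue_on Om) (%y. tapply (A y) (?g y)) ?g = l2inner (lebesgue_on Om) (%y. tapply (A y) (G y)) G" .
 ultimately show ?thesis by simp
qed

lemma cellwise_nonneg:
 fixes H :: "real^'n => real"
 assumes H: "integrable lebesgue H" and nn: "!!l. l : lattice ==> 0 <= (LINT y|cellM. H (y + l))"
 shows "0 <= integral\<^sup>L lebesgue H"
proof (rule LIMSEQ_le_const)
 show "(%N. LINT x|lebesgue. indicator (tile (lat N)) x * H x) ~> integral\<^sup>L lebesgue H"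
 proof (rule integral_dominated_convergence[where w="%x. \<bar>H x\<bar>"])
  show "H : borel_measurable lebesgue" using H by simp
  show "(%x. indicator (tile (lat N)) x * H x) : borel_measurable lebesgue" for N
   using H tile_sets[OF finite_lat lat_subset, of N] by (intro borel_measurable_times borel_measurable_indicator) auto
  show "integrable lebesgue (%x. \<bar>H x\<bar>)" using H by simp
  show "AE x in lebesgue. (%N. indicator (tile (lat N)) x * H x) ~> H x"
  proof (intro AE_I2 tendsto_eventually)
   fix x :: "real^'n"
   define l :: "real^'n" where "l = (\<chi> i. of_int \<lfloor>x $ i + 1/2\<rfloor>)"
   have xl: "x - l : hcube (1/2)" unfolding hcube_def l_def by (auto; linarith)
   have "l : lattice" by (simp add: lattice_def l_def)
   then obtain N0 where "{l} \<subseteq> lat N0" using lat_exhaust[of "{l}"] by auto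
   then have "l : lat N" if "N \<ge> N0" for N using lat_mono[OF that] by blast
   then have "x : tile (lat N)" if "N \<ge> N0" for N using xl that unfolding tile_def by blast
   then show "\<forall>\<^sub>F N in sequentially. indicator (tile (lat N)) x * H x = H x"
    unfolding eventually_sequentially by (intro exI[of _ N0]) simp
  qed
 qed (auto simp: indicator_def)
 show "\<exists>N. \<forall>n\<ge>N. 0 <= (LINT x|lebesgue. indicator (tile (lat n)) x * H x)"
  unfolding sum_cell_integrals[OF finite_lat lat_subset H, symmetric]
  by (intro exI allI impI sum_nonneg nn) (use lat_subset in blast)
qed

lemma translates_cell:
 fixes B :: "(real^'n) set"
 assumes "B \<subseteq> interior cell" "y : interior cell"
 shows "y : translates B \<longleftrightarrow> y : B"
proof
 have Q: "interior cell \<subseteq> (hcube (1/2) :: (real^'n) set)" by (auto simp: cell_def interior_cbox mem_box_cart hcube_def less_imp_le)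
 assume "y : translates B"
 then obtain l b where lb: "l : lattice" "b : B" "y = b + l" by (auto simp: translates_def)
 have "y - l : hcube (1/2)" using lb assms(1) Q by auto
 moreover have "y - 0 : hcube (1/2)" using assms(2) Q by auto
 ultimately have "l = 0" using hcube_lattice_unique[of y l 0] lb(1) lattice_zero by blast
 then show "y : B" using lb by simp
next
 assume "y : B"
 then show "y : translates B" unfolding translates_def using lattice_zero by force
qed

text \<open>Ellipticity is an integral inequality over one cell, not a pointwise one, so periodicity
  of A alone does not extend it. Instead every lattice translate of u is restricted to
  \<open>Om\<close>, and the inequalities obtained are added up.\<close>

lemma elliptic_periodic:
 fixes u :: "real^'n => complex^'m"
 assumes Om: "open Om" "Om \<subseteq> cell" and A: "coefficient A" and e: "elliptic_on Om A \<gamma>"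
  and T: "T : sets lebesgue" "!!l x. l : lattice ==> x + l : T \<longleftrightarrow> x : T"
   "AE y in lebesgue. y : cell --> (y : T \<longleftrightarrow> y : Om)"
  and u: "u : sqint lebesgue" and G: "G : sqint lebesgue" and wg: "weak_gradient UNIV u G"
 shows "inverse \<gamma> * (l2norm (lebesgue_on T) G)\<^sup>2 <= l2inner (lebesgue_on T) (%y. tapply (A y) (G y)) G"
proof -
 note Os = open_leb[OF Om(1)]
 define h where "h x = tapply (A x) (G x) \<bullet> G x - inverse \<gamma> * (norm (G x))\<^sup>2" for x
 have AG: "(%x. tapply (A x) (G x)) : sqint lebesgue"
  using coefficient_sqint[OF A, of G UNIV] G by (simp add: lebesgue_on_UNIV_eq)
 have hi: "integrable lebesgue h"
  unfolding h_def[abs_def] by (intro Bochner_Integration.integrable_diff integrable_mult_right inner_integrable AG G sqintD(2))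
 have Hi: "integrable lebesgue (%x. indicator T x * h x)"
  using integrable_mult_indicator[OF T(1) hi] by simp
 have "0 <= (LINT x|lebesgue. indicator T x * h x)"
 proof (rule cellwise_nonneg[OF Hi])
  fix l :: "real^'n" assume l: "l : lattice"
  have hl: "integrable lebesgue (%y. h (y + l))" by (rule integrable_affine(1)[OF hi])
  have Al: "A (y + l) = A y" for y using A l by (simp add: coefficient_def periodic_def)
  have us: "(%y. u (y + l)) : sqint (lebesgue_on Om)" "(%y. G (y + l)) : sqint (lebesgue_on Om)"
   by (rule sqint_leb_on(1)[OF sqint_affine(1)[OF u] Os], rule sqint_leb_on(1)[OF sqint_affine(1)[OF G] Os])
  have "inverse \<gamma> * (l2norm (lebesgue_on Om) (%y. G (y + l)))\<^sup>2 <= l2inner (lebesgue_on Om) (%y. tapply (A y) (G (y + l))) (%y. G (y + l))"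
   by (rule elliptic_pair[OF Om(1) A e us weak_gradient_subset[OF weak_gradient_translate[OF wg] _ Os]]) simp_all
  moreover have "(LINT y|lebesgue_on Om. h (y + l)) = l2inner (lebesgue_on Om) (%y. tapply (A y) (G (y + l))) (%y. G (y + l))
    - inverse \<gamma> * (l2norm (lebesgue_on Om) (%y. G (y + l)))\<^sup>2"
   unfolding h_def Al l2inner_def l2norm_sq
   using Bochner_Integration.integral_diff[OF inner_integrable[OF coefficient_sqint[OF A us(2)] us(2)]
     integrable_mult_right[OF sqintD(2)[OF us(2)], of "inverse \<gamma>"]] by simp
  moreover have "(LINT y|cellM. indicator T (y + l) * h (y + l)) = (LINT y|lebesgue_on Om. h (y + l))"
   unfolding integral_leb_on[OF cell_sets(1)] integral_leb_on[OF Os]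
  proof (rule integral_cong_AE)
   have "(%y. indicator T (y + l) * h (y + l)) : borel_measurable lebesgue"
    using integrable_affine(1)[OF Hi, of l] by simp
   then show "(%y. indicator cell y *r (indicator T (y + l) * h (y + l))) : borel_measurable lebesgue"
    by (intro borel_measurable_scaleR borel_measurable_indicator cell_sets)
   show "(%y. indicator Om y *r h (y + l)) : borel_measurable lebesgue"
    using hl by (intro borel_measurable_scaleR borel_measurable_indicator Os) simp
   show "AE y in lebesgue. indicator cell y *r (indicator T (y + l) * h (y + l)) = indicator Om y *r h (y + l)"
    using T(3) by eventually_elim (use T(2)[OF l] Om(2) in \<open>auto simp: indicator_def\<close>)
  qed
  ultimately show "0 <= (LINT y|cellM. indicator T (y + l) * h (y + l))" by simp
 qed
 also have "(LINT x|lebesgue. indicator T x * h x) = (LINT x|lebesgue_on T. h x)"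
  unfolding integral_leb_on[OF T(1)] by simp
 also have "... = l2inner (lebesgue_on T) (%y. tapply (A y) (G y)) G - inverse \<gamma> * (l2norm (lebesgue_on T) G)\<^sup>2"
 proof -
  have GT: "G : sqint (lebesgue_on T)" by (rule sqint_leb_on(1)[OF G T(1)])
  show ?thesis
   unfolding h_def l2inner_def l2norm_sq
   using Bochner_Integration.integral_diff[OF inner_integrable[OF coefficient_sqint[OF A GT] GT]
     integrable_mult_right[OF sqintD(2)[OF GT], of "inverse \<gamma>"]] by simp
 qed
 finally show ?thesis by simp
qed

section \<open>Bloch gradients as ordinary gradients\<close>

lemma sqint_cmul_cis:
 fixes f :: "'a::euclidean_space => 'b::complex_structure"
 assumes "f : sqint (lebesgue_on Om)"
 shows "(%y. cmul (cis (th \<bullet> y)) (f y)) : sqint (lebesgue_on Om)"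
proof (rule sqint_dominated[OF assms, where C=1])
 show "(%y. cmul (cis (th \<bullet> y)) (f y)) : borel_measurable (lebesgue_on Om)"
  by (intro borel_measurable_cmul sqintD(1)[OF assms] measurable_restrict_space1 continuous_measurable continuous_intros)
qed (simp add: norm_cmul)

text \<open>Multiplication by exp(i \<theta> . y) turns the Bloch gradient into an ordinary
  gradient. This is the product rule for the smooth approximants supplied by \<open>H1per\<close>,
  passed to the L2 limit.\<close>

lemma bloch_weak_gradient:
 fixes d :: "real^'n => complex^'m"
 assumes d: "d : H1per" and Om: "open Om" "Om \<subseteq> interior cell"
 shows "d : sqint (lebesgue_on Om)" "bloch_grad th d : sqint (lebesgue_on Om)"
  "weak_gradient Om (%y. cmul (cis (th \<bullet> y)) (d y)) (%y. cmul (cis (th \<bullet> y)) (bloch_grad th d y))"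
proof -
 let ?I = "lebesgue_on (interior cell :: (real^'n) set)" and ?G = "grad (interior cell) d"
 note Os = open_leb[OF Om(1)]
 note sub = sqint_subset[OF _ interior_cell_sets(1) Os Om(2)]
 define L where "L v = imul (tensor th v)" for v :: "complex^'m"
 have L: "bounded_linear L"
  unfolding L_def[abs_def] using bounded_linear_compose[OF bounded_linear_cmul[of \<i>] bounded_linear_tensor] by (simp add: cmul_ii)
 obtain CL where CL: "0 <= CL" "!!v. norm (L v) <= CL * norm v"
  using bounded_linear.pos_bounded[OF L] by (metis mult.commute less_imp_le)
 have bg: "bloch_grad th d = (%y. ?G y + L (d y))" by (rule ext) (simp add: bloch_grad_def L_def imul_eq_cscale)
 have bgI: "bloch_grad th d : sqint ?I" unfolding bg by (rule sqint_add[OF H1perD(2)[OF d] sqint_linear[OF L H1perD(1)[OF d]]])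
 show dO: "d : sqint (lebesgue_on Om)" and bgO: "bloch_grad th d : sqint (lebesgue_on Om)"
  by (rule sub(1)[OF H1perD(1)[OF d]], rule sub(1)[OF bgI])
 obtain f where f: "!!k. smooth (f k)" "L2_tendsto (interior cell) f d"
   "L2_tendsto (interior cell) (%k. classical_grad (f k)) ?G"
  using d by (auto simp: H1per_def)
 have fI: "f k : sqint ?I" "classical_grad (f k) : sqint ?I" for k
  using f(2,3) by (auto simp: L2_tendsto_iff L2_eq_sqint)
 have n: "(%k. l2norm ?I (%x. f k x - d x)) ~> 0" "(%k. l2norm ?I (%x. classical_grad (f k) x - ?G x)) ~> 0"
  using f(2,3) by (auto simp: L2_tendsto_iff)
 have d1: "(%x. f k x - d x) : sqint ?I" for k by (rule sqint_diff[OF fI(1) H1perD(1)[OF d]])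
 have d2: "(%x. classical_grad (f k) x - ?G x) : sqint ?I" for k by (rule sqint_diff[OF fI(2) H1perD(2)[OF d]])
 define g where "g k y = classical_grad (f k) y + L (f k y)" for k y
 have gI: "g k : sqint ?I" for k unfolding g_def[abs_def] by (rule sqint_add[OF fI(2) sqint_linear[OF L fI(1)]])
 let ?e = "%y. cmul (cis (th \<bullet> y)) :: complex^'m => _" and ?E = "%y. cmul (cis (th \<bullet> y)) :: complex^'m^'n => _"
 have iso: "l2norm (lebesgue_on Om) (%y. cmul (cis (th \<bullet> y)) (a y) - cmul (cis (th \<bullet> y)) (b y)) <= l2norm ?I (%y. a y - b y)"
  if "(%y. a y - b y) : sqint ?I" for a b :: "real^'n => 'z::complex_structure"
 proof -
  have "l2norm (lebesgue_on Om) (%y. cmul (cis (th \<bullet> y)) (a y) - cmul (cis (th \<bullet> y)) (b y)) = l2norm (lebesgue_on Om) (%y. a y - b y)"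
   unfolding cmul_diff_right[symmetric] l2norm_def by (simp only: norm_cmul norm_cis mult_1)
  then show ?thesis using sub(2)[OF that] by simp
 qed
 show "weak_gradient Om (%y. cmul (cis (th \<bullet> y)) (d y)) (%y. cmul (cis (th \<bullet> y)) (bloch_grad th d y))"
 proof (rule weak_gradient_limit[where u="%k y. cmul (cis (th \<bullet> y)) (f k y)" and G="%k y. cmul (cis (th \<bullet> y)) (g k y)", OF Os])
  show "weak_gradient Om (%y. cmul (cis (th \<bullet> y)) (f k y)) (%y. cmul (cis (th \<bullet> y)) (g k y))" for k
  proof -
   have cg: "classical_grad (%y. cmul (cis (th \<bullet> y + 0)) (f k y)) = (%y. cmul (cis (th \<bullet> y + 0)) (g k y))"
    unfolding g_def L_def by (rule ext) (rule classical_grad_cmul_cis[OF f(1)])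
   have "weak_gradient Om (%y. cmul (cis (th \<bullet> y + 0)) (f k y)) (%y. cmul (cis (th \<bullet> y + 0)) (g k y))"
    using weak_gradient_classical[OF smooth_cmul[OF smooth_cis_affine[of th 0] f(1)[of k]] Os] unfolding cg .
   then show ?thesis by (simp only: add_0_right)
  qed
  show "(%y. cmul (cis (th \<bullet> y)) (f k y)) : L2 Om" "(%y. cmul (cis (th \<bullet> y)) (g k y)) : L2 Om" for k
   unfolding L2_eq_sqint by (rule sqint_cmul_cis[OF sub(1)[OF fI(1)]], rule sqint_cmul_cis[OF sub(1)[OF gI]])
  show "(%y. cmul (cis (th \<bullet> y)) (d y)) : L2 Om" "(%y. cmul (cis (th \<bullet> y)) (bloch_grad th d y)) : L2 Om"
   unfolding L2_eq_sqint by (rule sqint_cmul_cis[OF dO], rule sqint_cmul_cis[OF bgO])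
  show "(%k. l2norm (lebesgue_on Om) (%x. cmul (cis (th \<bullet> x)) (f k x) - cmul (cis (th \<bullet> x)) (d x))) ~> 0"
   by (rule Lim_null_comparison[OF always_eventually n(1)], intro allI) (simp only: real_norm_def abs_of_nonneg[OF l2norm_nonneg] iso[OF d1])
  show "(%k. l2norm (lebesgue_on Om) (%x. cmul (cis (th \<bullet> x)) (g k x) - cmul (cis (th \<bullet> x)) (bloch_grad th d x))) ~> 0"
  proof (rule Lim_null_comparison[OF always_eventually tendsto_add_zero[OF n(2) tendsto_mult_right_zero[OF n(1), of CL]]], intro allI)
   fix k
   have Ld: "(%x. L (f k x - d x)) : sqint ?I" by (rule sqint_linear[OF L d1])
   have "norm (l2norm (lebesgue_on Om) (%x. cmul (cis (th \<bullet> x)) (g k x) - cmul (cis (th \<bullet> x)) (bloch_grad th d x)))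
     <= l2norm ?I (%x. g k x - bloch_grad th d x)"
    unfolding real_norm_def abs_of_nonneg[OF l2norm_nonneg] by (rule iso[OF sqint_diff[OF gI bgI]])
   also have "l2norm ?I (%x. g k x - bloch_grad th d x) = l2norm ?I (%x. (classical_grad (f k) x - ?G x) + L (f k x - d x))"
    unfolding g_def bg by (simp add: linear_diff[OF bounded_linear.linear[OF L]] algebra_simps)
   also have "... <= l2norm ?I (%x. classical_grad (f k) x - ?G x) + l2norm ?I (%x. L (f k x - d x))"
    by (rule l2norm_triangle[OF d2 Ld])
   also have "l2norm ?I (%x. L (f k x - d x)) <= CL * l2norm ?I (%x. f k x - d x)"
    by (rule l2norm_dominated[OF d1 sqintD(1)[OF Ld] CL])
   finally show "norm (l2norm (lebesgue_on Om) (%x. cmul (cis (th \<bullet> x)) (g k x) - cmul (cis (th \<bullet> x)) (bloch_grad th d x)))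
     <= l2norm ?I (%x. classical_grad (f k) x - ?G x) + CL * l2norm ?I (%x. f k x - d x)" by simp
  qed
 qed
qed

text \<open>Ordinary ellipticity is applied to exp(i \<theta> . y) d; the phase drops out of the
  quadratic form because the tensor acts complex linearly.\<close>

lemma bloch_elliptic:
 fixes d :: "real^'n => complex^'m"
 assumes d: "d : H1per" and Om: "open Om" "Om \<subseteq> interior cell" and A: "coefficient A" and e: "elliptic_on Om A \<gamma>" and \<gamma>: "1 <= \<gamma>"
 shows "0 <= l2inner (lebesgue_on Om) (%y. tapply (A y) (bloch_grad th d y)) (bloch_grad th d)"
proof -
 note b = bloch_weak_gradient(1)[OF d Om] bloch_weak_gradient(2,3)[OF d Om, where th=th]
 have "0 <= inverse \<gamma> * (l2norm (lebesgue_on Om) (%y. cmul (cis (th \<bullet> y)) (bloch_grad th d y)))\<^sup>2" using \<gamma> by simp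
 also have "... <= l2inner (lebesgue_on Om) (%y. tapply (A y) (cmul (cis (th \<bullet> y)) (bloch_grad th d y))) (%y. cmul (cis (th \<bullet> y)) (bloch_grad th d y))"
  by (rule elliptic_pair[OF Om(1) A e sqint_cmul_cis[OF b(1)] sqint_cmul_cis[OF b(2)] b(3)])
 finally show ?thesis by (simp add: l2inner_def tapply_cmul inner_cmul_cis)
qed

text \<open>Converse of \<open>V_space_bloch_grad\<close>. Connectedness of B enters through the
  function exp(i \<theta> . y) w, whose gradient vanishes on B.\<close>

lemma V_spaceI:
 fixes w :: "real^'n => complex^'m"
 assumes w: "w : H1per" and B: "open B" "connected B" "B \<subseteq> interior cell" and z: "AE y in lebesgue_on B. bloch_grad th w y = 0"
 shows "w : V_space B th"
proof -
 note b = bloch_weak_gradient(1)[OF w B(1,3)] bloch_weak_gradient(2,3)[OF w B(1,3), where th=th]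
 have "\<exists>c. AE y in lebesgue_on B. cmul (cis (th \<bullet> y)) (w y) = c"
 proof (rule zero_gradient_constant[OF B(1,2) _ _ b(3)])
  show "AE y in lebesgue_on B. cmul (cis (th \<bullet> y)) (bloch_grad th w y) = 0" using z by eventually_elim (simp add: cmul_zero)
 qed (simp_all only: L2_eq_sqint sqint_cmul_cis[OF b(1)] sqint_cmul_cis[OF b(2)])
 then obtain c where c: "AE y in lebesgue_on B. cmul (cis (th \<bullet> y)) (w y) = c" by blast
 have "AE y in lebesgue_on B. w y = exp (- \<i> * complex_of_real (th \<bullet> y)) *s c"
  using c
 proof eventually_elim
  case (elim y)
  have "exp (- \<i> * complex_of_real (th \<bullet> y)) *s c = cmul (cis (- (th \<bullet> y))) c" by (simp add: cmul_eq_smult cis_conv_exp)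
  also have "... = cmul (cis (- (th \<bullet> y)) * cis (th \<bullet> y)) (w y)" unfolding elim[symmetric] cmul_assoc ..
  also have "... = w y" by (simp add: cis_mult cmul_one)
  finally show ?case by simp
 qed
 with w show ?thesis by (auto simp: V_space_def)
qed

section \<open>The limit problem\<close>

lemma L2_UNIV: "L2 UNIV = sqint lebesgue"
 by (simp add: L2_eq_sqint lebesgue_on_UNIV_eq)

lemma AE_leb_on_UNIV: "(AE x in lebesgue_on UNIV. Q x) \<longleftrightarrow> (AE x in lebesgue. Q x)"
 by (simp add: AE_leb_on)

lemma H1_UNIV:
 fixes u :: "real^'n => complex^'m"
 assumes "u : H1 UNIV"
 shows "u : sqint lebesgue" "grad UNIV u : sqint lebesgue" "weak_gradient UNIV u (grad UNIV u)"
 using H1_grad[OF assms] by (simp_all add: L2_UNIV)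

lemma H1_UNIV_I:
 fixes u :: "real^'n => complex^'m"
 assumes "u : sqint lebesgue" "G : sqint lebesgue" "weak_gradient UNIV u G"
 shows "u : H1 UNIV" "AE x in lebesgue. grad UNIV u x = G x"
 using H1I[of u UNIV G] grad_eqI(1)[of UNIV G u, unfolded AE_leb_on_UNIV] assms by (simp_all add: L2_UNIV)

lemma sqint_cmul:
 fixes f :: "'a => 'b::complex_structure"
 assumes "f : sqint M"
 shows "(%x. cmul c (f x)) : sqint M"
 by (rule sqint_linear[OF bounded_linear_cmul assms])

lemma sqint_imul:
 fixes f :: "'a => 'b::complex_structure"
 assumes "f : sqint M"
 shows "(%x. imul (f x)) : sqint M"
 using sqint_cmul[OF assms, of \<i>] by (simp add: cmul_ii)

lemma l2norm_cmul: "l2norm M (%x. cmul c (f x)) = cmod c * l2norm M f"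
 by (simp add: l2norm_def norm_cmul power_mult_distrib real_sqrt_mult)

lemma l2norm_combine:
 fixes f g :: "'a => 'b::complex_structure"
 assumes "f : sqint M" "g : sqint M"
 shows "l2norm M (%x. cmul a (f x) + cmul b (g x)) <= cmod a * l2norm M f + cmod b * l2norm M g"
 using l2norm_triangle[OF sqint_cmul[OF assms(1), of a] sqint_cmul[OF assms(2), of b]] by (simp add: l2norm_cmul)

lemma classical_grad_combine:
 fixes f g :: "real^'n => complex^'m"
 assumes f: "smooth f" and g: "smooth g"
 shows "classical_grad (%y. cmul a (f y) + cmul b (g y)) y = cmul a (classical_grad f y) + cmul b (classical_grad g y)"
proof -
 have "((%y. cmul a (f y) + cmul b (g y)) has_derivative
   (%h. cmul a (frechet_derivative f (at y) h) + cmul b (frechet_derivative g (at y) h))) (at y)"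
  by (intro has_derivative_add bounded_linear.has_derivative[OF bounded_linear_cmul] smooth_derivative f g)
 from frechet_derivative_at[OF this, symmetric] show ?thesis
  by (simp add: classical_grad_def partial_def vec_eq_iff[where 'b='n] cmul_nth)
qed

text \<open>\<open>H1per\<close> refers to the chosen gradient, so closure under complex
  combinations has to compare the choice for the sum with the combination of the choices.\<close>

lemma H1per_combine:
 fixes fi fi' :: "real^'n => complex^'m"
 assumes h: "fi : H1per" "fi' : H1per"
 shows "(%y. cmul a (fi y) + cmul b (fi' y)) : H1per"
  and "AE y in cellM. bloch_grad th (%y. cmul a (fi y) + cmul b (fi' y)) y = cmul a (bloch_grad th fi y) + cmul b (bloch_grad th fi' y)"
proof -
 let ?I = "interior cell :: (real^'n) set" and ?u = "%y. cmul a (fi y) + cmul b (fi' y)"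
 let ?G = "%y. cmul a (grad (interior cell) fi y) + cmul b (grad (interior cell) fi' y)"
 note p = H1perD(1-3)[OF h(1)] and p' = H1perD(1-3)[OF h(2)]
 note s = sqint_add[OF sqint_cmul[OF p(1), of a] sqint_cmul[OF p'(1), of b]] sqint_add[OF sqint_cmul[OF p(2), of a] sqint_cmul[OF p'(2), of b]]
 have wg: "weak_gradient ?I ?u ?G"
  by (rule weak_gradient_add[OF weak_gradient_cmul[OF p(3)] weak_gradient_cmul[OF p'(3)]])
   (simp_all add: L2_eq_sqint p p' sqint_cmul interior_cell_sets)
 have L: "?u : L2 ?I" "?G : L2 ?I" using s by (simp_all add: L2_eq_sqint)
 note gr = grad_eqI[OF interior_cell_sets(2) L(2) wg]
 obtain f where f: "!!k. smooth (f k)" "!!k. periodic (f k)" "L2_tendsto ?I f fi"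
   "L2_tendsto ?I (%k. classical_grad (f k)) (grad ?I fi)"
  using h(1) by (auto simp: H1per_def)
 obtain g where g: "!!k. smooth (g k)" "!!k. periodic (g k)" "L2_tendsto ?I g fi'"
   "L2_tendsto ?I (%k. classical_grad (g k)) (grad ?I fi')"
  using h(2) by (auto simp: H1per_def)
 note fs = f(3,4)[unfolded L2_tendsto_iff L2_eq_sqint] and gs = g(3,4)[unfolded L2_tendsto_iff L2_eq_sqint]
 define c where "c k y = cmul a (f k y) + cmul b (g k y)" for k y
 have cs: "smooth (c k)" for k
  unfolding c_def[abs_def] by (intro smooth_add smooth_cmul smooth_const f(1) g(1))
 have cp: "periodic (c k)" for k using f(2)[of k] g(2)[of k] by (simp add: periodic_def c_def)
 have cg: "classical_grad (c k) = (%y. cmul a (classical_grad (f k) y) + cmul b (classical_grad (g k) y))" for k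
  unfolding c_def[abs_def] by (rule ext) (rule classical_grad_combine[OF f(1) g(1)])
 have lim: "(%k. l2norm M (%x. (cmul a (F k x) + cmul b (F' k x)) - (cmul a (H x) + cmul b (H' x)))) ~> 0"
  if F: "!!k. F k : sqint M" "H : sqint M" "(%k. l2norm M (%x. F k x - H x)) ~> 0"
   and F': "!!k. F' k : sqint M" "H' : sqint M" "(%k. l2norm M (%x. F' k x - H' x)) ~> 0"
  for F F' :: "nat => real^'n => 'z::complex_structure" and H H' M
 proof (rule Lim_null_comparison[OF always_eventually tendsto_add_zero[OF tendsto_mult_right_zero[OF F(3), of "cmod a"] tendsto_mult_right_zero[OF F'(3), of "cmod b"]]], intro allI)
  fix k
  have e: "(cmul a (F k x) + cmul b (F' k x)) - (cmul a (H x) + cmul b (H' x)) = cmul a (F k x - H x) + cmul b (F' k x - H' x)" for x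
   by (simp add: cmul_diff_right)
  show "norm (l2norm M (%x. (cmul a (F k x) + cmul b (F' k x)) - (cmul a (H x) + cmul b (H' x))))
    <= cmod a * l2norm M (%x. F k x - H x) + cmod b * l2norm M (%x. F' k x - H' x)"
   unfolding e real_norm_def abs_of_nonneg[OF l2norm_nonneg] by (rule l2norm_combine[OF sqint_diff[OF F(1,2)] sqint_diff[OF F'(1,2)]])
 qed
 have t1: "L2_tendsto ?I c ?u"
  unfolding L2_tendsto_iff L2_eq_sqint c_def[abs_def] using fs gs s
  by (intro conjI allI sqint_add sqint_cmul lim) auto
 have gs2: "grad ?I ?u : sqint (lebesgue_on ?I)" using gr(2) by (simp add: L2_eq_sqint)
 have ck: "classical_grad (c k) : sqint (lebesgue_on ?I)" for k
  unfolding cg using fs gs by (intro sqint_add sqint_cmul) auto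
 have "(%k. l2norm (lebesgue_on ?I) (%x. classical_grad (c k) x - ?G x)) ~> 0"
  unfolding cg using fs gs by (intro lim) auto
 moreover have "l2norm (lebesgue_on ?I) (%x. classical_grad (c k) x - grad ?I ?u x) = l2norm (lebesgue_on ?I) (%x. classical_grad (c k) x - ?G x)" for k
 proof (rule l2norm_cong_AE[OF sqintD(1)[OF sqint_diff[OF ck gs2]] sqintD(1)[OF sqint_diff[OF ck s(2)]]])
  show "AE x in lebesgue_on ?I. classical_grad (c k) x - grad ?I ?u x = classical_grad (c k) x - ?G x"
   using gr(1) by eventually_elim simp
 qed
 ultimately have t2: "L2_tendsto ?I (%k. classical_grad (c k)) (grad ?I ?u)"
  unfolding L2_tendsto_iff L2_eq_sqint using ck gs2 by simp
 show "?u : H1per" unfolding H1per_def using H1I[OF L wg] cs cp t1 t2 by blast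
 have tc: "tensor th (cmul z v) = cmul z (tensor th v)" for z and v :: "complex^'m"
  by (simp add: vec_eq_iff[where 'b='n] tensor_nth cmul_nth cmul_scaleR_right)
 have ta: "tensor th (v + w) = tensor th v + tensor th w" for v w :: "complex^'m"
  by (rule linear_add[OF bounded_linear.linear[OF bounded_linear_tensor]])
 show "AE y in cellM. bloch_grad th ?u y = cmul a (bloch_grad th fi y) + cmul b (bloch_grad th fi' y)"
  using bloch_grad_lebesgue[OF L wg, of th]
  by eventually_elim (simp add: bloch_grad_def imul_eq_cscale[symmetric] ta tc imul_add imul_cmul cmul_add_right)
qed

lemma V_space_combine:
 fixes fi fi' :: "real^'n => complex^'m"
 assumes "fi : V_space B th" "fi' : V_space B th"
 shows "(%y. cmul a (fi y) + cmul b (fi' y)) : V_space B th"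
proof -
 obtain c where c: "AE y in lebesgue_on B. fi y = exp (- \<i> * complex_of_real (th \<bullet> y)) *s c" using assms(1) by (auto simp: V_space_def)
 obtain c' where c': "AE y in lebesgue_on B. fi' y = exp (- \<i> * complex_of_real (th \<bullet> y)) *s c'" using assms(2) by (auto simp: V_space_def)
 have "AE y in lebesgue_on B. cmul a (fi y) + cmul b (fi' y) = exp (- \<i> * complex_of_real (th \<bullet> y)) *s (cmul a c + cmul b c')"
  using c c' by eventually_elim (simp add: cmul_eq_smult vec_eq_iff algebra_simps)
 moreover have "(%y. cmul a (fi y) + cmul b (fi' y)) : H1per"
  by (rule H1per_combine(1)) (use assms in \<open>simp_all add: V_space_def\<close>)
 ultimately show ?thesis unfolding V_space_def by blast
qed

section \<open>Coefficient forms on periodic sets\<close>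

text \<open>The coefficient cut down to S, as a pointwise operator. For lattice invariant S it is
  periodic, so \<open>glim_op\<close> carries it into the fibres; inclusions and matrix are the
  cases \<open>translates B\<close> and its complement.\<close>

definition wop :: "(real^'n) set => (real^'n => complex^'m^'n^'m^'n) => real^'n => complex^'m^'n => complex^'m^'n" where
 "wop S A x M = indicator S x *r tapply (A x) M"

definition wform :: "(real^'n) set => (real^'n => complex^'m^'n^'m^'n) => (real^'n => complex^'m^'n) => (real^'n => complex^'m^'n) => real" where
 "wform S A f g = l2inner lebesgue (%x. wop S A x (f x)) g"

lemma linear_tapply: "linear (tapply A)"
 by (rule bounded_linear.linear[OF bounded_bilinear.bounded_linear_right[OF bounded_bilinear_tapply]])

lemma linear_wop: "linear (wop S A x)"
 by (rule linearI) (simp_all add: wop_def linear_add[OF linear_tapply] linear_cmul[OF linear_tapply] scaleR_add_right)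

lemma wop_cmul: "wop S A x (cmul c M) = cmul c (wop S A x M)"
 by (simp add: wop_def tapply_cmul cmul_scaleR_right)

lemma wop_sym: "coefficient A ==> wop S A x M \<bullet> N = M \<bullet> wop S A x N"
 by (simp add: wop_def coefficient_def tapply_symmetric)

lemma wop_bound:
 fixes A :: "real^'n => complex^'m^'n^'m^'n"
 assumes "coefficient A"
 obtains C where "0 <= C" "!!S y M. norm (wop S A y M) <= C * norm M"
proof -
 obtain C where C: "0 <= C" "!!y M. norm (tapply (A y) M) <= C * norm M" using that by (rule coefficient_bound[OF assms])
 have "norm (wop S A y M) <= C * norm M" for S y M
  using C(2)[of y M] order_trans[OF norm_ge_zero C(2)[of y M]] by (simp add: wop_def indicator_def)
 with C(1) show ?thesis by (rule that)
qed

lemma wop_sqint: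
 assumes A: "coefficient A" and S: "S : sets lebesgue" and f: "f : sqint (lebesgue_on Om)"
 shows "(%x. wop S A x (f x)) : sqint (lebesgue_on Om)"
 unfolding wop_def
 by (rule sqint_dominated[OF coefficient_sqint[OF A f], where C=1])
  (intro borel_measurable_scaleR measurable_restrict_space1[OF borel_measurable_indicator[OF S]] sqintD(1)[OF coefficient_sqint[OF A f]],
   simp add: indicator_def)

lemmas wop_sqint_UNIV = wop_sqint[where Om=UNIV, unfolded lebesgue_on_UNIV_eq]

lemma glim_wop:
 fixes A :: "real^'n => complex^'m^'n^'m^'n"
 assumes G: "glim G W" and A: "coefficient A" and S: "S : sets lebesgue" "!!l x. l : lattice ==> x + l : S \<longleftrightarrow> x : S"
 shows "glim (%x. wop S A x (G x)) (%p. wop S A (snd p) (W p))"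
proof -
 obtain C where C: "0 <= C" "!!S y M. norm (wop S A y M) <= C * norm M" using that by (rule wop_bound[OF A])
 have Am: "A : borel_measurable lebesgue" using A by (simp add: coefficient_def)
 show ?thesis
 proof (rule glim_op[OF G, where C=C])
  show "periodic (wop S A)" using A S(2) by (simp add: periodic_def wop_def coefficient_def fun_eq_iff indicator_def)
  fix f :: "real^'n => complex^'m^'n" assume "f : borel_measurable lebesgue"
  then show "(%x. wop S A x (f x)) : borel_measurable lebesgue"
   unfolding wop_def by (intro borel_measurable_scaleR borel_measurable_indicator S borel_measurable_tapply Am)
 next
  fix f :: "(real^'n) \<times> (real^'n) => complex^'m^'n" assume f: "f : borel_measurable MDC"
  have 1: "(%p. indicat_real S (snd p)) : borel_measurable MDC"
   using borel_measurable_MDC_snd[OF borel_measurable_indicator[OF S(1)], where l=0] by simp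
  have 2: "(%p. A (snd p)) : borel_measurable MDC" using borel_measurable_MDC_snd[OF Am, where l=0] by simp
  show "(%p. wop S A (snd p) (f p)) : borel_measurable MDC"
   unfolding wop_def by (rule borel_measurable_scaleR[OF 1 borel_measurable_tapply[OF 2 f]])
 qed (simp_all add: linear_wop wop_cmul C(2))
qed

lemma wform_sym:
 assumes "coefficient A"
 shows "wform S A f g = wform S A g f"
proof -
 have "wop S A x (f x) \<bullet> g x = wop S A x (g x) \<bullet> f x" for x
  unfolding wop_sym[OF assms, of S x "f x" "g x"] by (rule inner_commute)
 then show ?thesis by (simp add: wform_def l2inner_def)
qed

lemma wform_restrict: "S : sets lebesgue ==> l2inner (lebesgue_on S) (%y. tapply (A y) (f y)) g = wform S A f g"
 by (simp only: l2inner_restrict wform_def wop_def)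

lemma wform_diff_left:
 assumes "coefficient A" "S : sets lebesgue" "f : sqint lebesgue" "g : sqint lebesgue" "h : sqint lebesgue"
 shows "wform S A (%x. f x - g x) h = wform S A f h - wform S A g h"
 unfolding wform_def linear_diff[OF linear_wop] by (rule l2inner_diff_left[OF wop_sqint_UNIV[OF assms(1-3)] wop_sqint_UNIV[OF assms(1,2,4)] assms(5)])

lemma wform_cong_AE:
 assumes A: "coefficient A" and S: "S : sets lebesgue"
  and s: "f : sqint lebesgue" "g : sqint lebesgue" "f' : sqint lebesgue" "g' : sqint lebesgue"
  and e: "AE x in lebesgue. f x = f' x" "AE x in lebesgue. g x = g' x"
 shows "wform S A f g = wform S A f' g'"
proof -
 have "AE x in lebesgue. wop S A x (f x) = wop S A x (f' x)" using e(1) by eventually_elim simp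
 from l2inner_cong_AE[OF wop_sqint_UNIV[OF A S s(1)] s(2) wop_sqint_UNIV[OF A S s(3)] s(4) this e(2)] show ?thesis unfolding wform_def .
qed

lemma wform_zero_right:
 fixes A :: "real^'n => complex^'m^'n^'m^'n"
 assumes A: "coefficient A" and S: "S : sets lebesgue" and s: "f : sqint lebesgue" "g : sqint lebesgue"
  and z: "AE x in lebesgue. x : S --> g x = 0"
 shows "wform S A f g = 0"
proof -
 have "wform S A f g = (LINT x::real^'n|lebesgue. 0)"
  unfolding wform_def l2inner_def
 proof (rule integral_cong_AE)
  show "AE x in lebesgue. wop S A x (f x) \<bullet> g x = 0" using z by eventually_elim (auto simp: wop_def indicator_def)
 qed (intro borel_measurable_inner sqintD(1) wop_sqint_UNIV A S s borel_measurable_const)+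
 then show ?thesis by simp
qed

lemma l2norm_Pair:
 fixes f :: "'a => 'b::euclidean_space \<times> 'c::euclidean_space"
 assumes "f : sqint M"
 shows "(l2norm M f)\<^sup>2 = (l2norm M (%x. fst (f x)))\<^sup>2 + (l2norm M (%x. snd (f x)))\<^sup>2"
proof -
 note s = sqint_linear[OF bounded_linear_fst assms] sqint_linear[OF bounded_linear_snd assms]
 have "(norm p)\<^sup>2 = (norm (fst p))\<^sup>2 + (norm (snd p))\<^sup>2" for p :: "'b \<times> 'c" by (simp add: norm_prod_def)
 then show ?thesis unfolding l2norm_sq using sqintD(2)[OF s(1)] sqintD(2)[OF s(2)] by simp
qed

section \<open>The composite medium and its limit problem\<close>

locale composite =
 fixes B :: "(real^'n) set" and A1 A2 :: "real^'n => complex^'m^'n^'m^'n" and \<gamma> :: real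
 assumes B: "open B" "connected B" "lipschitz_boundary B" "closure B \<subseteq> interior cell"
  and A1: "coefficient A1" and A2: "coefficient A2" and \<gamma>: "1 <= \<gamma>"
  and e1: "elliptic_on B A1 \<gamma>" and e2: "elliptic_on (interior (cell - B)) A2 \<gamma>"

begin

abbreviation "T \<equiv> translates B"

lemma B_sub: "B \<subseteq> interior cell" "B \<subseteq> cell" "B : sets lebesgue"
 using B(4) closure_subset[of B] interior_subset[of cell] open_leb[OF B(1)] by auto

lemma T_sets: "T : sets lebesgue" "- T : sets lebesgue"
proof -
 have "open T"
  unfolding translates_def by (intro open_UN ballI) (simp add: open_translation[OF B(1)] add.commute[of _ "_ :: real^'n"])
 then show "T : sets lebesgue" by (rule open_leb)
 from sets.compl_sets[OF this] show "- T : sets lebesgue" by (simp add: Compl_eq_Diff_UNIV)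
qed

lemma T_lattice: "l : lattice ==> x + l : T \<longleftrightarrow> x : T" "l : lattice ==> x + l : - T \<longleftrightarrow> x : - T"
 by (simp_all add: translates_lattice)

lemma T_cell: "AE y in lebesgue. y : cell --> (y : T \<longleftrightarrow> y : B)"
 using interior_cell_eq_AE by eventually_elim (use translates_cell[OF B_sub(1)] in blast)

text \<open>The Lipschitz boundary enters here: \<open>b_form\<close> integrates over
  \<open>cell - B\<close>, ellipticity is assumed on the interior of that set, and the two differ
  only by parts of the frontiers of B and of the cell.\<close>

lemma matrix_AE: "AE y in lebesgue. y : cell - B \<longleftrightarrow> y : interior (cell - B)"
proof -
 have "AE y in lebesgue. y ~: frontier B"
  using lipschitz_frontier_negligible[OF B(1,3)] by (intro AE_not_in) (simp add: negligible_iff_null_sets)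
 then show ?thesis
  using interior_cell_eq_AE
 proof eventually_elim
  case (elim y)
  have "interior cell - closure B \<subseteq> interior (cell - B)"
   by (rule interior_maximal) (use interior_subset closure_subset in blast, simp add: open_Diff)
  then show ?case using elim interior_subset[of "cell - B"] B(1) by (auto simp: frontier_def interior_open)
 qed
qed

lemma nT_cell: "AE y in lebesgue. y : cell --> (y : - T \<longleftrightarrow> y : interior (cell - B))"
 using T_cell matrix_AE by eventually_elim blast

lemma elliptic_T:
 assumes "u : sqint lebesgue" "G : sqint lebesgue" "weak_gradient UNIV u G"
 shows "inverse \<gamma> * (l2norm (lebesgue_on T) G)\<^sup>2 <= wform T A1 G G"
  and "inverse \<gamma> * (l2norm (lebesgue_on (- T)) G)\<^sup>2 <= wform (- T) A2 G G"
 using elliptic_periodic[OF B(1) B_sub(2) A1 e1 T_sets(1) T_lattice(1) T_cell assms]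
  elliptic_periodic[OF open_interior order_trans[OF interior_subset Diff_subset] A2 e2 T_sets(2) T_lattice(2) nT_cell assms]
 unfolding wform_restrict[OF T_sets(1)] wform_restrict[OF T_sets(2)] by blast+

lemma l2norm_split:
 assumes "G : sqint lebesgue"
 shows "(l2norm lebesgue G)\<^sup>2 = (l2norm (lebesgue_on T) G)\<^sup>2 + (l2norm (lebesgue_on (- T)) G)\<^sup>2"
proof -
 have s: "(%x. indicator S x *r G x) : sqint lebesgue" if "S : sets lebesgue" for S
  using sqint_leb_on(1)[OF assms that] sqint_restrict_iff[OF that] by blast
 have "(norm (G x))\<^sup>2 = (norm (indicator T x *r G x))\<^sup>2 + (norm (indicator (- T) x *r G x))\<^sup>2" for x by (simp add: indicator_def)
 then have "(l2norm lebesgue G)\<^sup>2 = (LINT x|lebesgue. (norm (indicator T x *r G x))\<^sup>2 + (norm (indicator (- T) x *r G x))\<^sup>2)"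
  unfolding l2norm_sq by (simp only:)
 also have "... = (LINT x|lebesgue. (norm (indicator T x *r G x))\<^sup>2) + (LINT x|lebesgue. (norm (indicator (- T) x *r G x))\<^sup>2)"
  by (rule Bochner_Integration.integral_add[OF sqintD(2)[OF s[OF T_sets(1)]] sqintD(2)[OF s[OF T_sets(2)]]])
 finally show ?thesis unfolding l2norm_restrict[OF T_sets(1)] l2norm_restrict[OF T_sets(2)] l2norm_sq .
qed

text \<open>An element of the limit space together with a weak gradient. With the gradient explicit,
  linear combinations and L2 limits are immediate, where \<open>H0\<close> would involve the chosen
  gradient each time.\<close>

definition adm :: "(real^'n => complex^'m) => (real^'n => complex^'m^'n) => bool" where
 "adm psi G \<longleftrightarrow> psi : sqint lebesgue & G : sqint lebesgue & weak_gradient UNIV psi G & (AE x in lebesgue. x : T --> G x = 0)"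

text \<open>The real part of the limit equation, for pairs. The imaginary part is contained in it,
  since admissible pairs may be multiplied by the imaginary unit.\<close>

definition limit_eq :: "(real^'n => complex^'m) => (real^'n => complex^'m) => (real^'n => complex^'m^'n) => bool" where
 "limit_eq F u G \<longleftrightarrow> adm u G & (\<forall>psi H. adm psi H --> wform (- T) A2 G H + l2inner lebesgue u psi = l2inner lebesgue F psi)"

lemma admD:
 assumes "adm psi G"
 shows "psi : sqint lebesgue" "G : sqint lebesgue" "weak_gradient UNIV psi G" "AE x in lebesgue. x : T --> G x = 0"
 using assms by (simp_all add: adm_def)

lemma adm_add:
 assumes "adm psi G" "adm psi' G'"
 shows "adm (%x. psi x + psi' x) (%x. G x + G' x)"
proof -
 note a = admD[OF assms(1)] and b = admD[OF assms(2)]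
 have "weak_gradient UNIV (%x. psi x + psi' x) (%x. G x + G' x)"
  by (rule weak_gradient_add[OF a(3) b(3)]) (simp_all add: L2_UNIV a b)
 moreover have "AE x in lebesgue. x : T --> G x + G' x = 0" using a(4) b(4) by eventually_elim simp
 ultimately show ?thesis using sqint_add[OF a(1) b(1)] sqint_add[OF a(2) b(2)] by (simp add: adm_def)
qed

lemma adm_cmul:
 assumes "adm psi G"
 shows "adm (%x. cmul c (psi x)) (%x. cmul c (G x))"
proof -
 note a = admD[OF assms]
 have "weak_gradient UNIV (%x. cmul c (psi x)) (%x. cmul c (G x))"
  by (rule weak_gradient_cmul[OF a(3)]) (simp_all add: L2_UNIV a)
 moreover have "AE x in lebesgue. x : T --> cmul c (G x) = 0" using a(4) by eventually_elim (simp add: cmul_zero)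
 ultimately show ?thesis using sqint_cmul[OF a(1)] sqint_cmul[OF a(2)] by (simp add: adm_def)
qed

lemma adm_diff:
 assumes "adm psi G" "adm psi' G'"
 shows "adm (%x. psi x - psi' x) (%x. G x - G' x)"
 using adm_add[OF assms(1) adm_cmul[OF assms(2), of "-1"]] by (simp add: cmul_minus_one)

lemma adm_H0:
 assumes "u : H0 B"
 shows "adm u (grad UNIV u)"
proof -
 have u: "u : H1 UNIV" using assms by (simp add: H0_def)
 have "AE x in lebesgue. x : T --> grad UNIV u x = 0" using assms unfolding H0_def AE_leb_on[OF T_sets(1)] by blast
 then show ?thesis using H1_UNIV[OF u] by (simp add: adm_def)
qed

lemma H0_adm:
 assumes "adm u G"
 shows "u : H0 B" "AE x in lebesgue. grad UNIV u x = G x"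
proof -
 note a = admD[OF assms]
 show g: "AE x in lebesgue. grad UNIV u x = G x" by (rule H1_UNIV_I(2)[OF a(1-3)])
 have "AE x in lebesgue. x : T --> grad UNIV u x = 0" using g a(4) by eventually_elim simp
 then show "u : H0 B" using H1_UNIV_I(1)[OF a(1-3)] unfolding H0_def AE_leb_on[OF T_sets(1)] by blast
qed

lemma limit_exists:
 assumes F: "F : sqint lebesgue"
 shows "\<exists>u G. limit_eq F u G"
proof -
 \<comment> \<open>Pairs are packed into one function with values in a product space, so the Riesz
   argument runs in a closed subspace of L2 rather than in a Sobolev space.\<close>
 define S where "S = {f :: real^'n => (complex^'m) \<times> (complex^'m^'n). f : sqint lebesgue & adm (%x. fst (f x)) (%x. snd (f x))}"
 define q where "q f g = wform (- T) A2 (%x. snd (f x)) (%x. snd (g x)) + l2inner lebesgue (%x. fst (f x)) (%x. fst (g x))"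
  for f g :: "real^'n => (complex^'m) \<times> (complex^'m^'n)"
 define lf where "lf f = l2inner lebesgue F (%x. fst (f x))" for f :: "real^'n => (complex^'m) \<times> (complex^'m^'n)"
 obtain C where C: "0 <= C" "!!S y M. norm (wop S A2 y M) <= C * norm M" using that by (rule wop_bound[OF A2])
 have nf: "norm (fst p) <= norm p" "norm (snd p) <= norm p" for p :: "(complex^'m) \<times> (complex^'m^'n)"
  by (metis norm_fst_le norm_snd_le prod.collapse)+
 have S: "f : sqint lebesgue" "adm (%x. fst (f x)) (%x. snd (f x))" "(%x. fst (f x)) : sqint lebesgue" "(%x. snd (f x)) : sqint lebesgue"
  if "f : S" for f using that by (simp_all add: S_def adm_def)
 have W: "(%x. wop (- T) A2 x (snd (f x))) : sqint lebesgue" if "f : S" for f by (rule wop_sqint_UNIV[OF A2 T_sets(2) S(4)[OF that]])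
 have "\<exists>u\<in>S. \<forall>f\<in>S. q u f = lf f"
 proof (rule riesz_representation[where c="inverse \<gamma>" and C="C + 1" and K="l2norm lebesgue F" and M=lebesgue])
  show "S \<subseteq> sqint lebesgue" by (auto simp: S_def)
  show "(%x. f x + g x) : S" if "f : S" "g : S" for f g
   using adm_add[OF S(2)[OF that(1)] S(2)[OF that(2)]] sqint_add[OF S(1)[OF that(1)] S(1)[OF that(2)]] by (simp add: S_def)
  show "(%x. c *r f x) : S" if "f : S" for f c
   using adm_cmul[OF S(2)[OF that], of "complex_of_real c"] sqint_scaleR[OF S(1)[OF that], of c] by (simp add: S_def cmul_of_real)
  show "(%x. 0) : S" by (simp add: S_def adm_def weak_gradient_def sqint_zero)
  \<comment> \<open>Closedness: both the weak gradient relation and the vanishing on the inclusions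
    survive L2 limits.\<close>
  show "g : S" if f: "!!k. f k : S" and g: "g : sqint lebesgue" and l: "(%k. l2norm lebesgue (%x. f k x - g x)) ~> 0" for f g
  proof -
   note gs = sqint_linear[OF bounded_linear_fst g] sqint_linear[OF bounded_linear_snd g]
   note fk = sqint_diff[OF S(1)[OF f] g]
   have l1: "(%k. l2norm lebesgue (%x. fst (f k x) - fst (g x))) ~> 0"
   proof (rule Lim_null_comparison[OF always_eventually l], intro allI)
    show "norm (l2norm lebesgue (%x. fst (f k x) - fst (g x))) <= l2norm lebesgue (%x. f k x - g x)" for k
     using l2norm_dominated[OF fk sqintD(1)[OF sqint_diff[OF S(3)[OF f] gs(1)]], of 1 k k] nf(1)
     by (simp add: l2norm_nonneg fst_diff[symmetric] del: fst_diff)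
   qed
   have b2: "l2norm lebesgue (%x. snd (f k x) - snd (g x)) <= l2norm lebesgue (%x. f k x - g x)" for k
    using l2norm_dominated[OF fk sqintD(1)[OF sqint_diff[OF S(4)[OF f] gs(2)]], of 1 k k] nf(2)
    by (simp add: snd_diff[symmetric] del: snd_diff)
   have l2: "(%k. l2norm lebesgue (%x. snd (f k x) - snd (g x))) ~> 0"
    by (rule Lim_null_comparison[OF always_eventually l]) (use b2 in \<open>simp add: l2norm_nonneg\<close>)
   have wg: "weak_gradient UNIV (%x. fst (g x)) (%x. snd (g x))"
    by (rule weak_gradient_limit[where u="%k x. fst (f k x)" and G="%k x. snd (f k x)"])
     (simp_all add: admD(3)[OF S(2)[OF f]] L2_UNIV S(3,4)[OF f] gs l1 l2 lebesgue_on_UNIV_eq)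
   have gT: "(%x. snd (g x)) : sqint (lebesgue_on T)" by (rule sqint_leb_on(1)[OF gs(2) T_sets(1)])
   have "l2norm (lebesgue_on T) (%x. snd (g x)) <= l2norm lebesgue (%x. snd (f k x) - snd (g x))" for k
   proof -
    have d: "(%x. snd (f k x) - snd (g x)) : sqint lebesgue" by (rule sqint_diff[OF S(4)[OF f] gs(2)])
    have "AE x in lebesgue_on T. snd (g x) = snd (g x) - snd (f k x)"
     using admD(4)[OF S(2)[OF f[of k]]] unfolding AE_leb_on[OF T_sets(1)] by eventually_elim simp
    from l2norm_cong_AE[OF sqintD(1)[OF gT] sqintD(1)[OF sqint_leb_on(1)[OF sqint_diff[OF gs(2) S(4)[OF f]] T_sets(1)]] this]
    have "l2norm (lebesgue_on T) (%x. snd (g x)) = l2norm (lebesgue_on T) (%x. snd (f k x) - snd (g x))"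
     by (simp add: l2norm_commute[of _ "%x. snd (g x)"])
    also have "... <= l2norm lebesgue (%x. snd (f k x) - snd (g x))" by (rule sqint_leb_on(2)[OF d T_sets(1)])
    finally show ?thesis .
   qed
   then have "l2norm (lebesgue_on T) (%x. snd (g x)) <= 0" by (intro LIMSEQ_le_const[OF l2]) auto
   then have "l2norm (lebesgue_on T) (%x. snd (g x)) = 0" using l2norm_nonneg[of "lebesgue_on T" "%x. snd (g x)"] by linarith
   then have "AE x in lebesgue. x : T --> snd (g x) = 0" using l2norm_eq_0_iff[OF gT] unfolding AE_leb_on[OF T_sets(1)] by blast
   with wg gs g show ?thesis by (simp add: S_def adm_def)
  qed
  show "q f g = q g f" for f g
   unfolding q_def using wform_sym[OF A2, of "- T"] l2inner_commute by (metis (no_types, lifting))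
  show "q f (%x. g x + h x) = q f g + q f h" if "f : S" "g : S" "h : S" for f g h
  proof -
   have "l2inner lebesgue (%x. wop (- T) A2 x (snd (f x))) (%x. snd (g x) + snd (h x))
     = l2inner lebesgue (%x. wop (- T) A2 x (snd (f x))) (%x. snd (g x)) + l2inner lebesgue (%x. wop (- T) A2 x (snd (f x))) (%x. snd (h x))"
    by (rule l2inner_add_right) (use W[OF that(1)] S(4)[OF that(2)] S(4)[OF that(3)] in simp_all)
   moreover have "l2inner lebesgue (%x. fst (f x)) (%x. fst (g x) + fst (h x)) = l2inner lebesgue (%x. fst (f x)) (%x. fst (g x)) + l2inner lebesgue (%x. fst (f x)) (%x. fst (h x))"
    by (rule l2inner_add_right) (use S(3)[OF that(1)] S(3)[OF that(2)] S(3)[OF that(3)] in simp_all)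
   ultimately show ?thesis unfolding q_def wform_def fst_add snd_add by simp
  qed
  show "q f (%x. c *r g x) = c * q f g" for f g c
   unfolding q_def wform_def by (simp add: l2inner_scaleR_right distrib_left)
  \<comment> \<open>Coercivity: the gradient vanishes on the inclusions, so ellipticity on the
    matrix controls all of it; inverse \<gamma> \<le> 1 takes care of the zero-order term.\<close>
  show "inverse \<gamma> * (l2norm lebesgue f)\<^sup>2 <= q f f" if "f : S" for f
  proof -
   note a = admD[OF S(2)[OF that]]
   have "AE x in lebesgue_on T. snd (f x) = 0" using a(4) unfolding AE_leb_on[OF T_sets(1)] .
   then have "l2norm (lebesgue_on T) (%x. snd (f x)) = 0" using l2norm_eq_0_iff[OF sqint_leb_on(1)[OF a(2) T_sets(1)]] by blast
   then have "(l2norm lebesgue (%x. snd (f x)))\<^sup>2 = (l2norm (lebesgue_on (- T)) (%x. snd (f x)))\<^sup>2"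
    using l2norm_split[OF a(2)] by simp
   then have 1: "inverse \<gamma> * (l2norm lebesgue (%x. snd (f x)))\<^sup>2 <= wform (- T) A2 (%x. snd (f x)) (%x. snd (f x))"
    using elliptic_T(2)[OF a(1-3)] by simp
   have "inverse \<gamma> * (l2norm lebesgue (%x. fst (f x)))\<^sup>2 <= 1 * (l2norm lebesgue (%x. fst (f x)))\<^sup>2"
    by (rule mult_right_mono) (use \<gamma> in \<open>simp_all add: inverse_le_1_iff\<close>)
   with 1 show ?thesis unfolding q_def l2norm_Pair[OF S(1)[OF that]] l2norm_sq_inner[symmetric] distrib_left by simp
  qed
  show "0 < inverse \<gamma>" using \<gamma> by simp
  show "q f f <= (C + 1) * (l2norm lebesgue f)\<^sup>2" if "f : S" for f
  proof -
   let ?s = "l2norm lebesgue (%x. snd (f x))"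
   have "wform (- T) A2 (%x. snd (f x)) (%x. snd (f x)) <= l2norm lebesgue (%x. wop (- T) A2 x (snd (f x))) * ?s"
    unfolding wform_def using l2inner_le[OF W[OF that] S(4)[OF that]] by (rule order_trans[OF abs_ge_self])
   also have "... <= (C * ?s) * ?s"
    by (rule mult_right_mono[OF l2norm_dominated[OF S(4)[OF that] sqintD(1)[OF W[OF that]] C(1) C(2)] l2norm_nonneg])
   finally have "wform (- T) A2 (%x. snd (f x)) (%x. snd (f x)) <= C * ?s\<^sup>2" by (simp add: power2_eq_square mult_ac)
   moreover have "0 <= ?s\<^sup>2" "0 <= C * (l2norm lebesgue (%x. fst (f x)))\<^sup>2" using C(1) by simp_all
   ultimately show ?thesis unfolding q_def l2norm_Pair[OF S(1)[OF that]] l2norm_sq_inner[symmetric] distrib_left distrib_right by (linarith | argo)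
  qed
  show "lf (%x. f x + g x) = lf f + lf g" if "f : S" "g : S" for f g
   unfolding lf_def fst_add by (rule l2inner_add_right) (use F S(3)[OF that(1)] S(3)[OF that(2)] in simp_all)
  show "lf (%x. c *r f x) = c * lf f" for f c unfolding lf_def by (simp add: l2inner_scaleR_right)
  show "\<bar>lf f\<bar> <= l2norm lebesgue F * l2norm lebesgue f" if "f : S" for f
  proof -
   have "\<bar>lf f\<bar> <= l2norm lebesgue F * l2norm lebesgue (%x. fst (f x))" unfolding lf_def by (rule l2inner_le[OF F S(3)[OF that]])
   also have "... <= l2norm lebesgue F * (1 * l2norm lebesgue f)"
    by (intro mult_left_mono l2norm_dominated[OF S(1)[OF that] sqintD(1)[OF S(3)[OF that]]] l2norm_nonneg) (simp_all add: nf)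
   finally show ?thesis by simp
  qed
 qed
 then obtain u where u: "u : S" "!!f. f : S ==> q u f = lf f" by blast
 have "limit_eq F (%x. fst (u x)) (%x. snd (u x))"
  unfolding limit_eq_def
 proof (intro conjI allI impI)
  show "adm (%x. fst (u x)) (%x. snd (u x))" by (rule S(2)[OF u(1)])
  fix psi H assume a: "adm psi H"
  have "(%x. (psi x, H x)) : sqint lebesgue"
  proof -
   have b: "bounded_linear (%v :: complex^'m. (v, 0 :: complex^'m^'n))" "bounded_linear (%M :: complex^'m^'n. (0 :: complex^'m, M))"
    by (rule bounded_linear_Pair[OF bounded_linear_ident bounded_linear_zero], rule bounded_linear_Pair[OF bounded_linear_zero bounded_linear_ident])
   show ?thesis using sqint_add[OF sqint_linear[OF b(1) admD(1)[OF a]] sqint_linear[OF b(2) admD(2)[OF a]]] by simp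
  qed
  then have "(%x. (psi x, H x)) : S" using a by (simp add: S_def)
  from u(2)[OF this] show "wform (- T) A2 (%x. snd (u x)) H + l2inner lebesgue (%x. fst (u x)) psi = l2inner lebesgue F psi"
   by (simp add: q_def lf_def)
 qed
 then show ?thesis by blast
qed

lemma wform_nonneg:
 assumes "u : sqint lebesgue" "G : sqint lebesgue" "weak_gradient UNIV u G"
 shows "0 <= wform T A1 G G" "0 <= wform (- T) A2 G G"
proof -
 have "0 <= inverse \<gamma> * (l2norm (lebesgue_on T) G)\<^sup>2" "0 <= inverse \<gamma> * (l2norm (lebesgue_on (- T)) G)\<^sup>2" using \<gamma> by simp_all
 then show "0 <= wform T A1 G G" "0 <= wform (- T) A2 G G" using elliptic_T[OF assms] by linarith+
qed

text \<open>Both equations are tested with the difference; the matrix energy is nonnegative, so the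
  zero-order term forces the difference to vanish.\<close>

lemma limit_unique:
 assumes l: "limit_eq F u G" "limit_eq F u' G'"
 shows "AE x in lebesgue. u x = u' x"
proof -
 have a: "adm u G" "adm u' G'" using l by (simp_all add: limit_eq_def)
 note d = admD[OF adm_diff[OF a]]
 have "wform (- T) A2 G (%x. G x - G' x) + l2inner lebesgue u (%x. u x - u' x)
   = wform (- T) A2 G' (%x. G x - G' x) + l2inner lebesgue u' (%x. u x - u' x)"
  using l adm_diff[OF a] unfolding limit_eq_def by simp
 then have "wform (- T) A2 (%x. G x - G' x) (%x. G x - G' x) + l2inner lebesgue (%x. u x - u' x) (%x. u x - u' x) = 0"
  using wform_diff_left[OF A2 T_sets(2) admD(2)[OF a(1)] admD(2)[OF a(2)] d(2)] l2inner_diff_left[OF admD(1)[OF a(1)] admD(1)[OF a(2)] d(1)] by simp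
 then have "(l2norm lebesgue (%x. u x - u' x))\<^sup>2 <= 0" using wform_nonneg(2)[OF d(1-3)] unfolding l2norm_sq_inner by linarith
 then have "l2norm lebesgue (%x. u x - u' x) = 0" by simp
 then have "AE x in lebesgue. u x - u' x = 0" using l2norm_eq_0_iff[OF d(1)] by blast
 then show ?thesis by eventually_elim simp
qed

lemma limit_eq_cong:
 assumes l: "limit_eq F u G" and s: "u' : sqint lebesgue" "G' : sqint lebesgue"
  and e: "AE x in lebesgue. u x = u' x" "AE x in lebesgue. G x = G' x"
 shows "limit_eq F u' G'"
proof -
 have au: "adm u G" using l by (simp add: limit_eq_def)
 note a = admD[OF au]
 have "weak_gradient UNIV u' G'"
  by (rule weak_gradient_cong_AE[OF _ _ _ _ _ _ _ a(3)]) (use a s e in \<open>simp_all add: L2_UNIV AE_leb_on_UNIV\<close>)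
 moreover have "AE x in lebesgue. x : T --> G' x = 0" using a(4) e(2) by eventually_elim simp
 ultimately have "adm u' G'" using s by (simp add: adm_def)
 moreover have "wform (- T) A2 G' H + l2inner lebesgue u' psi = l2inner lebesgue F psi" if h: "adm psi H" for psi H
 proof -
  have "wform (- T) A2 G H = wform (- T) A2 G' H"
   by (rule wform_cong_AE[OF A2 T_sets(2) a(2) admD(2)[OF h] s(2) admD(2)[OF h] e(2)]) simp
  moreover have "l2inner lebesgue u psi = l2inner lebesgue u' psi"
   by (rule l2inner_cong_AE[OF a(1) admD(1)[OF h] s(1) admD(1)[OF h] e(1)]) simp
  ultimately show ?thesis using l h unfolding limit_eq_def by metis
 qed
 ultimately show ?thesis by (simp add: limit_eq_def)
qed

lemma integral_limit_terms:
 assumes "f : sqint lebesgue" "g : sqint lebesgue" "u : sqint lebesgue" "v : sqint lebesgue"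
 shows "(LINT y:- T|lebesgue. contract (tapply (A2 y) (f y)) (g y)) = Complex (wform (- T) A2 f g) (wform (- T) A2 f (%x. imul (g x)))"
  and "(LINT y|lebesgue. hdot (u y) (v y)) = Complex (l2inner lebesgue u v) (l2inner lebesgue u (%x. imul (v x)))"
proof -
 have r: "f : sqint (lebesgue_on (- T))" "g : sqint (lebesgue_on (- T))"
  by (rule sqint_leb_on(1)[OF _ T_sets(2)], rule assms)+
 show "(LINT y:- T|lebesgue. contract (tapply (A2 y) (f y)) (g y)) = Complex (wform (- T) A2 f g) (wform (- T) A2 f (%x. imul (g x)))"
  unfolding set_integral_contract[OF T_sets(2) coefficient_sqint[OF A2 r(1)] r(2)] wform_restrict[OF T_sets(2)] ..
 show "(LINT y|lebesgue. hdot (u y) (v y)) = Complex (l2inner lebesgue u v) (l2inner lebesgue u (%x. imul (v x)))"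
  unfolding hdot_eq by (rule integral_Complex_inner[OF assms(3,4)])
qed

lemma solves_limit_iff:
 assumes F: "F : sqint lebesgue"
 shows "solves_limit B A2 F u \<longleftrightarrow> u : H0 B & limit_eq F u (grad UNIV u)"
proof
 assume s: "solves_limit B A2 F u"
 then have u: "u : H0 B" by (simp add: solves_limit_def)
 note a = admD[OF adm_H0[OF u]]
 have "wform (- T) A2 (grad UNIV u) H + l2inner lebesgue u psi = l2inner lebesgue F psi" if h: "adm psi H" for psi H
 proof -
  note b = admD[OF h] and b' = admD[OF adm_H0[OF H0_adm(1)[OF h]]]
  have "(LINT y:- T|lebesgue. contract (tapply (A2 y) (grad UNIV u y)) (grad UNIV psi y)) + (LINT y|lebesgue. hdot (u y) (psi y)) = (LINT y|lebesgue. hdot (F y) (psi y))"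
   using s H0_adm(1)[OF h] unfolding solves_limit_def by blast
  then have "wform (- T) A2 (grad UNIV u) (grad UNIV psi) + l2inner lebesgue u psi = l2inner lebesgue F psi"
   unfolding integral_limit_terms(1)[OF a(2) b'(2) a(1) b(1)] integral_limit_terms(2)[OF a(2) b'(2) a(1) b(1)] integral_limit_terms(2)[OF a(2) b'(2) F b(1)]
   by (simp add: complex_eq_iff)
  moreover have "wform (- T) A2 (grad UNIV u) (grad UNIV psi) = wform (- T) A2 (grad UNIV u) H"
   by (rule wform_cong_AE[OF A2 T_sets(2) a(2) b'(2) a(2) b(2) _ H0_adm(2)[OF h]]) simp
  ultimately show ?thesis by simp
 qed
 then show "u : H0 B & limit_eq F u (grad UNIV u)" using u adm_H0[OF u] by (simp add: limit_eq_def)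
next
 assume l: "u : H0 B & limit_eq F u (grad UNIV u)"
 then have "adm u (grad UNIV u)" by (simp add: limit_eq_def)
 note a = admD[OF this]
 have "(LINT y:- T|lebesgue. contract (tapply (A2 y) (grad UNIV u y)) (grad UNIV fi y)) + (LINT y|lebesgue. hdot (u y) (fi y)) = (LINT y|lebesgue. hdot (F y) (fi y))"
  if p: "fi : H0 B" for fi
 proof -
  \<comment> \<open>The pair multiplied by the imaginary unit supplies the imaginary part of the
    complex equation.\<close>
  note b0 = adm_H0[OF p] and b1 = adm_cmul[OF adm_H0[OF p], of \<i>, unfolded cmul_ii]
  note b = admD[OF b0]
  have "wform (- T) A2 (grad UNIV u) (grad UNIV fi) + l2inner lebesgue u fi = l2inner lebesgue F fi"
   "wform (- T) A2 (grad UNIV u) (%x. imul (grad UNIV fi x)) + l2inner lebesgue u (%x. imul (fi x)) = l2inner lebesgue F (%x. imul (fi x))"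
   using l b0 b1 unfolding limit_eq_def by blast+
  then show ?thesis
   unfolding integral_limit_terms(1)[OF a(2) b(2) a(1) b(1)] integral_limit_terms(2)[OF a(2) b(2) a(1) b(1)] integral_limit_terms(2)[OF a(2) b(2) F b(1)]
   by (simp add: complex_eq_iff)
 qed
 then show "solves_limit B A2 F u" using l unfolding solves_limit_def by blast
qed

lemma delta_equation:
 assumes s: "solves_delta B A1 A2 \<delta> F u" and F: "F : sqint lebesgue"
  and p: "psi : sqint lebesgue" "H : sqint lebesgue" "weak_gradient UNIV psi H"
 shows "inverse \<delta> * wform T A1 (grad UNIV u) H + wform (- T) A2 (grad UNIV u) H + l2inner lebesgue u psi = l2inner lebesgue F psi"
proof -
 have u: "u : H1 UNIV" using s by (simp add: solves_delta_def)
 note a = H1_UNIV[OF u] and b = H1_UNIV[OF H1_UNIV_I(1)[OF p]]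
 let ?P = "%y. tapply (A_delta B A1 A2 \<delta> y) (grad UNIV u y)"
 have P: "?P y = inverse \<delta> *r wop T A1 y (grad UNIV u y) + wop (- T) A2 y (grad UNIV u y)" for y
 proof -
  have "1 - indicat_real T y = indicat_real (- T) y" by (simp add: indicator_def)
  then show ?thesis
   unfolding A_delta_def wop_def bounded_bilinear.add_left[OF bounded_bilinear_tapply] bounded_bilinear.scaleR_left[OF bounded_bilinear_tapply] by simp
 qed
 note W = wop_sqint_UNIV[OF A1 T_sets(1) a(2)] wop_sqint_UNIV[OF A2 T_sets(2) a(2)]
 have Ps: "?P : sqint lebesgue" unfolding P by (rule sqint_add[OF sqint_scaleR[OF W(1)] W(2)])
 have "(LINT y|lebesgue. contract (?P y) (grad UNIV psi y)) + (LINT y|lebesgue. hdot (u y) (psi y)) = (LINT y|lebesgue. hdot (F y) (psi y))"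
  using s H1_UNIV_I(1)[OF p] unfolding solves_delta_def by blast
 then have "l2inner lebesgue ?P (grad UNIV psi) + l2inner lebesgue u psi = l2inner lebesgue F psi"
  unfolding hdot_eq contract_eq integral_Complex_inner[OF Ps b(2)] integral_Complex_inner[OF a(1) p(1)] integral_Complex_inner[OF F p(1)]
  by (simp add: complex_eq_iff)
 moreover have "l2inner lebesgue ?P (grad UNIV psi) = l2inner lebesgue ?P H"
  by (rule l2inner_cong_AE[OF Ps b(2) Ps p(2) _ H1_UNIV_I(2)[OF p]]) simp
 moreover have "l2inner lebesgue ?P H = inverse \<delta> * wform T A1 (grad UNIV u) H + wform (- T) A2 (grad UNIV u) H"
  unfolding P wform_def l2inner_add_left[OF sqint_scaleR[OF W(1)] W(2) p(2)] l2inner_scaleR_left ..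
 ultimately show ?thesis by simp
qed

end

section \<open>The fibre problems and the error estimate\<close>

text \<open>Bridges the periodic sets used on the whole space and the sets B and
  \<open>cell - B\<close> over which the fibre forms integrate.\<close>

lemma l2inner_cell_restrict:
 fixes f g :: "real^'n => 'b::euclidean_space"
 assumes S: "S : sets lebesgue" and Om: "Om : sets lebesgue" "Om \<subseteq> cell" and e: "AE y in lebesgue. y : cell --> (y : S \<longleftrightarrow> y : Om)"
  and f: "f : sqint (cellM)" and g: "g : sqint (cellM)"
 shows "l2inner (cellM) (%y. indicator S y *r f y) g = l2inner (lebesgue_on Om) f g"
 unfolding l2inner_def integral_leb_on[OF cell_sets(1)] integral_leb_on[OF Om(1)]
proof (rule integral_cong_AE)
 have "(%y. (indicator S y *r f y) \<bullet> g y) : borel_measurable (cellM)"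
  by (rule borel_measurable_inner[OF borel_measurable_scaleR[OF measurable_restrict_space1[OF borel_measurable_indicator[OF S]] sqintD(1)[OF f]] sqintD(1)[OF g]])
 then show "(%y. indicator cell y *r ((indicator S y *r f y) \<bullet> g y)) : borel_measurable lebesgue"
  by (simp only: measurable_leb_on[OF cell_sets(1)])
 have "(%y. f y \<bullet> g y) : borel_measurable (lebesgue_on Om)"
  by (rule borel_measurable_inner[OF sqintD(1)[OF sqint_subset(1)[OF f cell_sets(1) Om]] sqintD(1)[OF sqint_subset(1)[OF g cell_sets(1) Om]]])
 then show "(%y. indicator Om y *r (f y \<bullet> g y)) : borel_measurable lebesgue"
  by (simp only: measurable_leb_on[OF Om(1)])
 show "AE y in lebesgue. indicator cell y *r ((indicator S y *r f y) \<bullet> g y) = indicator Om y *r (f y \<bullet> g y)"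
  using e by eventually_elim (use Om(2) in \<open>auto simp: indicator_def\<close>)
qed

definition cform :: "(real^'n) set => (real^'n => complex^'m^'n^'m^'n) => (real^'n => complex^'m^'n) => (real^'n => complex^'m^'n) => real" where
 "cform S A f g = l2inner (cellM) (%x. wop S A x (f x)) g"

lemma cform_cong_AE:
 assumes A: "coefficient A" and S: "S : sets lebesgue"
  and s: "f : sqint (cellM)" "g : sqint (cellM)" "f' : sqint (cellM)" "g' : sqint (cellM)"
  and e: "AE x in cellM. f x = f' x" "AE x in cellM. g x = g' x"
 shows "cform S A f g = cform S A f' g'"
proof -
 have "AE x in cellM. wop S A x (f x) = wop S A x (f' x)" using e(1) by eventually_elim simp
 from l2inner_cong_AE[OF wop_sqint[OF A S s(1)] s(2) wop_sqint[OF A S s(3)] s(4) this e(2)] show ?thesis unfolding cform_def .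
qed

lemma cmul_0_left: "cmul 0 x = 0"
 using norm_cmul[of 0 x] by simp

lemma V_space_H1per: "fi : V_space B th ==> fi : H1per"
 by (simp add: V_space_def)

lemma V_space_imul:
 fixes fi :: "real^'n => complex^'m"
 assumes "fi : V_space B th"
 shows "(%y. imul (fi y)) : V_space B th" "AE y in cellM. bloch_grad th (%y. imul (fi y)) y = imul (bloch_grad th fi y)"
 using V_space_combine[OF assms assms, of \<i> 0] H1per_combine(2)[OF V_space_H1per[OF assms] V_space_H1per[OF assms], of th \<i> 0]
 by (simp_all add: cmul_0_left cmul_ii)

text \<open>A real orthogonality becomes a complex one, because the fibre space is closed under
  multiplication by i and the Bloch gradient commutes with it.\<close>

lemma test_imul:
 fixes fi h :: "real^'n => complex^'m"
 assumes t: "!!fi. fi : V_space B th ==> l2inner (cellM) f (bloch_grad th fi) + l2inner (cellM) h fi = 0"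
  and f: "f : sqint (cellM)" and fi: "fi : V_space B th"
 shows "l2inner (cellM) f (%y. imul (bloch_grad th fi y)) + l2inner (cellM) h (%y. imul (fi y)) = 0"
proof -
 note V = V_space_imul[OF fi]
 have "l2inner (cellM) f (bloch_grad th (%y. imul (fi y))) = l2inner (cellM) f (%y. imul (bloch_grad th fi y))"
  by (rule l2inner_cong_AE[OF f bloch_grad_sqint[OF V_space_H1per[OF V(1)]] f sqint_imul[OF bloch_grad_sqint[OF V_space_H1per[OF fi]]] _ V(2)]) simp
 with t[OF V(1)] show ?thesis by simp
qed

text \<open>Write a/\<delta> + b as E + (1/\<delta> - 1) a and insert a \<ge> \<nu> E. As \<nu>
  \<le> 1, the result is at least \<nu> E/\<delta>, so \<nu> E \<le> \<delta> f n. After squaring,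
  n^2 \<le> E cancels one factor E, and \<delta>^2/\<nu>^2 remains.\<close>

lemma energy_bound:
 fixes a b E n f \<nu> \<delta> :: real
 assumes E: "E = a + b" and b: "0 <= b" and n: "0 <= n" "n\<^sup>2 <= E" and f: "0 <= f" and e: "inverse \<delta> * a + b <= f * n"
  and \<nu>: "\<nu> * E <= a" "0 < \<nu>" and \<delta>: "0 < \<delta>" "\<delta> < 1"
 shows "E <= inverse (\<nu>\<^sup>2) * \<delta>\<^sup>2 * f\<^sup>2"
proof (cases "E = 0")
 case False
 then have Ep: "0 < E" using n by (smt (verit) zero_le_power2)
 \<comment> \<open>Since b is nonnegative, the gap itself forces \<nu> \<le> 1 as soon as E >
   0.\<close>
 have "\<nu> * E <= 1 * E" using \<nu>(1) E b by linarith
 then have "\<nu> <= 1" using Ep by (simp only: mult_le_cancel_right_pos)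
 then have 1: "\<nu> * E <= E" using Ep by simp
 have "1 <= inverse \<delta>" using \<delta> by (simp add: one_le_inverse_iff)
 then have "(inverse \<delta> - 1) * (\<nu> * E) <= (inverse \<delta> - 1) * a" by (intro mult_left_mono \<nu>(1)) simp
 moreover have "(inverse \<delta> - 1) * (\<nu> * E) = inverse \<delta> * (\<nu> * E) - \<nu> * E" "(inverse \<delta> - 1) * a = inverse \<delta> * a - a"
  by (simp_all add: left_diff_distrib)
 ultimately have "inverse \<delta> * (\<nu> * E) <= f * n" using e E 1 by linarith
 then have "\<delta> * (inverse \<delta> * (\<nu> * E)) <= \<delta> * (f * n)" using \<delta> by (intro mult_left_mono) simp_all
 moreover have "\<delta> * inverse \<delta> = 1" using \<delta> by simp
 then have "\<delta> * (inverse \<delta> * (\<nu> * E)) = \<nu> * E" by (simp only: mult.assoc[symmetric] mult_1_left)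
 ultimately have "\<nu> * E <= \<delta> * (f * n)" by (simp only:)
 then have "(\<nu> * E)\<^sup>2 <= (\<delta> * (f * n))\<^sup>2" using \<nu>(2) Ep by (intro power_mono) simp_all
 also have "... = \<delta>\<^sup>2 * f\<^sup>2 * n\<^sup>2" by (simp add: power_mult_distrib)
 also have "... <= \<delta>\<^sup>2 * f\<^sup>2 * E" by (rule mult_left_mono[OF n(2)]) simp
 finally have "(\<nu>\<^sup>2 * E) * E <= (\<delta>\<^sup>2 * f\<^sup>2) * E" by (simp add: power2_eq_square mult_ac)
 then have "\<nu>\<^sup>2 * E <= \<delta>\<^sup>2 * f\<^sup>2" using Ep by (rule mult_right_le_imp_le)
 then show ?thesis using \<nu>(2) by (simp add: field_simps)
qed simp

section \<open>Fibre solutions, spectral gap and error\<close>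

context composite

begin

lemma cform_fibre:
 assumes f: "f : sqint (cellM)" and g: "g : sqint (cellM)"
 shows "cform T A1 f g = l2inner (lebesgue_on B) (%y. tapply (A1 y) (f y)) g"
  "cform (- T) A2 f g = l2inner (lebesgue_on (cell - B)) (%y. tapply (A2 y) (f y)) g"
  "cform (- T) A2 f g = l2inner (lebesgue_on (interior (cell - B))) (%y. tapply (A2 y) (f y)) g"
proof -
 have s: "cell - B : sets lebesgue" by (rule sets.Diff[OF cell_sets(1) B_sub(3)])
 have c: "AE y in lebesgue. y : cell --> (y : - T \<longleftrightarrow> y : cell - B)" using T_cell by eventually_elim blast
 show "cform T A1 f g = l2inner (lebesgue_on B) (%y. tapply (A1 y) (f y)) g"
  unfolding cform_def wop_def by (rule l2inner_cell_restrict[OF T_sets(1) B_sub(3,2) T_cell coefficient_sqint[OF A1 f] g])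
 show "cform (- T) A2 f g = l2inner (lebesgue_on (cell - B)) (%y. tapply (A2 y) (f y)) g"
  unfolding cform_def wop_def by (rule l2inner_cell_restrict[OF T_sets(2) s Diff_subset c coefficient_sqint[OF A2 f] g])
 show "cform (- T) A2 f g = l2inner (lebesgue_on (interior (cell - B))) (%y. tapply (A2 y) (f y)) g"
  unfolding cform_def wop_def
  by (rule l2inner_cell_restrict[OF T_sets(2) open_leb[OF open_interior] order_trans[OF interior_subset Diff_subset] nT_cell coefficient_sqint[OF A2 f] g])
qed

lemma a_form_eq:
 assumes u: "u : H1per" and w: "w : H1per"
 shows "a_form B A1 th u w = Complex (cform T A1 (bloch_grad th u) (bloch_grad th w)) (cform T A1 (bloch_grad th u) (%y. imul (bloch_grad th w y)))"
proof -
 note s = bloch_grad_sqint[OF u, of th] bloch_grad_sqint[OF w, of th]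
 note r = sqint_subset(1)[OF s(1) cell_sets(1) B_sub(3,2)] sqint_subset(1)[OF s(2) cell_sets(1) B_sub(3,2)]
 show ?thesis
  unfolding a_form_def set_integral_contract[OF B_sub(3) coefficient_sqint[OF A1 r(1)] r(2)] cform_fibre(1)[OF s] cform_fibre(1)[OF s(1) sqint_imul[OF s(2)]] ..
qed

lemma b_form_eq:
 assumes u: "u : H1per" and w: "w : H1per"
 shows "b_form B A2 th u w = Complex (cform (- T) A2 (bloch_grad th u) (bloch_grad th w) + l2inner (cellM) u w)
  (cform (- T) A2 (bloch_grad th u) (%y. imul (bloch_grad th w y)) + l2inner (cellM) u (%y. imul (w y)))"
proof -
 note s = bloch_grad_sqint[OF u, of th] bloch_grad_sqint[OF w, of th]
 have c: "cell - B : sets lebesgue" by (rule sets.Diff[OF cell_sets(1) B_sub(3)])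
 note r = sqint_subset(1)[OF s(1) cell_sets(1) c Diff_subset] sqint_subset(1)[OF s(2) cell_sets(1) c Diff_subset]
 show ?thesis
  unfolding b_form_def set_integral_contract[OF c coefficient_sqint[OF A2 r(1)] r(2)] cform_fibre(2)[OF s] cform_fibre(2)[OF s(1) sqint_imul[OF s(2)]]
   set_integral_hdot[OF cell_sets(1) H1perD(4)[OF u] H1perD(4)[OF w]]
  by (simp add: complex_eq_iff)
qed

text \<open>Supplies the concrete cut-off, which exists because the closure of B lies in the open
  cell.\<close>

lemma fibre_test:
 fixes P :: "real^'n => complex^'m^'n" and q :: "real^'n => complex^'m"
 assumes P: "glim P wP" and q: "glim q wq"
  and orth: "!!psi G. adm psi G ==> l2inner lebesgue P G + l2inner lebesgue q psi = 0"
 shows "AE th in dualM. \<forall>fi\<in>V_space B th.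
  l2inner (cellM) (%y. wP (th, y)) (bloch_grad th fi) + l2inner (cellM) (%y. wq (th, y)) fi = 0"
proof -
 obtain \<eta> :: "real^'n => real" where \<eta>: "\<eta> : test_functions UNIV" "\<forall>x. x ~: tile (lat 1) --> \<eta> x = 0 & (\<forall>j. partial j \<eta> x = 0)"
  "\<forall>y\<in>cell. (\<Sum>l\<in>lat 1. \<eta> (y + l)) = 1" "\<forall>y\<in>cell. \<forall>j. (\<Sum>l\<in>lat 1. partial j \<eta> (y + l)) = 0"
  "\<forall>x\<in>T. (\<forall>j. partial j \<eta> x = 0) & \<eta> x = indicator B x"
  using periodic_partition[OF B(1,4)] by blast
 interpret inclusion_cutoff B \<eta>
  by (rule inclusion_cutoff.intro) (use B(1,4) \<eta> in blast)+
 show ?thesis by (rule fibre_testing[OF P q]) (rule orth, simp add: adm_def)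
qed

lemma glim_indicator:
 fixes G :: "real^'n => 'b::complex_structure"
 assumes "glim G W"
 shows "glim (%x. indicator T x *r G x) (%p. indicator T (snd p) *r W p)"
proof (rule glim_op[OF assms, where C=1])
 show "periodic (%y. (*\<^sub>R) (indicat_real T y))" using T_lattice(1) by (simp add: periodic_def indicator_def fun_eq_iff)
 have 1: "(%p. indicat_real T (snd p)) : borel_measurable MDC"
  using borel_measurable_MDC_snd[OF borel_measurable_indicator[OF T_sets(1)], where l=0] by simp
 show "(%p. indicator T (snd p) *r f p) : borel_measurable MDC" if "f : borel_measurable MDC" for f :: "(real^'n) \<times> (real^'n) => 'b"
  by (rule borel_measurable_scaleR[OF 1 that])
 show "(%x. indicator T x *r f x) : borel_measurable lebesgue" if "f : borel_measurable lebesgue" for f :: "real^'n => 'b"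
  by (rule borel_measurable_scaleR[OF borel_measurable_indicator[OF T_sets(1)] that])
qed (auto simp: cmul_scaleR_right indicator_def intro!: linearI simp: scaleR_add_right)

text \<open>G vanishes on the inclusions, so by the isometry its transform vanishes there in almost
  every fibre, which puts the fibre of u into \<open>V_space\<close>. The limit equation says that
  the flux paired with u - F is orthogonal to all admissible pairs, and \<open>fibre_test\<close>
  turns this into the fibre equation.\<close>

lemma solves_fibre_AE:
 assumes l: "limit_eq F u G" and F: "F : sqint lebesgue"
 shows "AE th in dualM. solves_fibre B A2 F th (gelfand u th)"
proof -
 have au: "adm u G" using l by (simp add: limit_eq_def)
 note a = admD[OF au]
 have w: "glim u (case_prod (gelfand u))" and gF: "glim F (case_prod (gelfand F))"
  by (rule gelfand_glim, simp add: L2_UNIV a F)+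
 obtain W where W: "glim G W" using glim_exists[OF a(2)] by blast
 note zW = glim_indicator[OF W]
 have "l2norm lebesgue (%x. indicator T x *r G x) = 0"
  using l2norm_eq_0_iff[OF glimD(1)[OF zW]] a(4) by (auto elim!: eventually_mono simp: indicator_def)
 then have "l2norm MDC (%p. indicator T (snd p) *r W p) = 0" using glim_norm[OF zW] by simp
 then have "AE p in MDC. indicator T (snd p) *r W p = 0" using l2norm_eq_0_iff[OF glimD(2)[OF zW]] by blast
 from AE_section_on[OF dual_cell_sets(2) cell_sets(2) this]
 have z: "AE th in dualM. AE y in cellM. indicator T y *r W (th, y) = 0" by simp
 have test: "AE th in dualM. \<forall>fi\<in>V_space B th.
   l2inner (cellM) (%y. wop (- T) A2 (snd (th, y)) (W (th, y))) (bloch_grad th fi)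
   + l2inner (cellM) (%y. case_prod (gelfand u) (th, y) - case_prod (gelfand F) (th, y)) fi = 0"
 proof (rule fibre_test[OF glim_wop[OF W A2 T_sets(2) T_lattice(2)] glim_diff[OF w gF]])
  fix psi H assume h: "adm psi H"
  have "wform (- T) A2 G H + l2inner lebesgue u psi = l2inner lebesgue F psi" using l h unfolding limit_eq_def by blast
  then show "l2inner lebesgue (%x. wop (- T) A2 x (G x)) H + l2inner lebesgue (%x. u x - F x) psi = 0"
   unfolding l2inner_diff_left[OF a(1) F admD(1)[OF h]] wform_def by simp
 qed
 have sF: "AE th in dualM. (%y. case_prod (gelfand F) (th, y)) : sqint (cellM)"
  by (rule sqint_section[OF dual_cell_sets(2) cell_sets(2) glimD(2)[OF gF]])
 from glim_H1per[OF a(3) w W] z test sF show ?thesis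
 proof eventually_elim
  case (elim th)
  let ?u = "gelfand u th" and ?W = "%y. W (th, y)" and ?F = "gelfand F th" and ?C = "lebesgue_on (cell :: (real^'n) set)"
  have h: "?u : H1per" and Ws: "?W : sqint ?C" and bW: "AE y in ?C. bloch_grad th ?u y = W (th, y)" using elim(1) by simp_all
  have Fs: "?F : sqint ?C" using elim(4) by simp
  have us: "?u : sqint ?C" by (rule H1perD(4)[OF h])
  have "AE y in lebesgue. y : B --> bloch_grad th ?u y = 0"
   using bW elim(2) unfolding AE_leb_on[OF cell_sets(1)]
  proof eventually_elim
   case (elim y)
   show ?case
   proof
    assume y: "y : B"
    then have "y : T" "y : cell" using translates_cell[OF B_sub(1), of y] B_sub by blast+
    then show "bloch_grad th ?u y = 0" using elim by simp
   qed
  qed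
  then have "AE y in lebesgue_on B. bloch_grad th ?u y = 0" unfolding AE_leb_on[OF B_sub(3)] .
  then have V: "?u : V_space B th" by (rule V_spaceI[OF h B(1,2) B_sub(1)])
  have t: "l2inner ?C (%y. wop (- T) A2 y (W (th, y))) (bloch_grad th fi) + l2inner ?C (%y. ?u y - ?F y) fi = 0"
   if "fi : V_space B th" for fi using elim(3) that by simp
  have "b_form B A2 th ?u fi = (LINT y:cell|lebesgue. hdot (?F y) (fi y))" if p: "fi : V_space B th" for fi
  proof -
   note ph = V_space_H1per[OF p] and Wop = wop_sqint[OF A2 T_sets(2) Ws]
   note ps = H1perD(4)[OF ph] and bs = bloch_grad_sqint[OF ph, of th] and us' = bloch_grad_sqint[OF h, of th]
   have c: "cform (- T) A2 (bloch_grad th ?u) g = l2inner ?C (%y. wop (- T) A2 y (W (th, y))) g" if "g : sqint ?C" for g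
    using cform_cong_AE[OF A2 T_sets(2) us' that Ws that bW] by (simp add: cform_def)
   show ?thesis
    unfolding b_form_eq[OF h ph] set_integral_hdot[OF cell_sets(1) Fs ps] c[OF bs] c[OF sqint_imul[OF bs]]
    using t[OF p] test_imul[OF t Wop p] l2inner_diff_left[OF us Fs ps] l2inner_diff_left[OF us Fs sqint_imul[OF ps]]
    by (simp add: complex_eq_iff)
  qed
  with V show ?case by (simp add: solves_fibre_def)
 qed
qed

text \<open>The difference is tested with itself, at any \<theta>: the matrix energy is nonnegative
  by \<open>bloch_elliptic\<close>, and the zero-order term controls the L2 norm.\<close>

lemma fibre_unique:
 assumes v: "solves_fibre B A2 F th v" and v': "solves_fibre B A2 F th v'"
 shows "AE y in cellM. v y = v' y"
proof -
 let ?C = "lebesgue_on (cell :: (real^'n) set)"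
 have V: "v : V_space B th" "v' : V_space B th" using v v' by (simp_all add: solves_fibre_def)
 note h = V_space_H1per[OF V(1)] V_space_H1per[OF V(2)]
 define d where "d y = cmul 1 (v y) + cmul (-1) (v' y)" for y
 have dV: "d : V_space B th" unfolding d_def[abs_def] by (rule V_space_combine[OF V])
 note dh = V_space_H1per[OF dV]
 have dv: "d = (%y. v y - v' y)" by (simp add: d_def[abs_def] cmul_minus_one cmul_one)
 note bs = bloch_grad_sqint[OF h(1), of th] bloch_grad_sqint[OF h(2), of th] bloch_grad_sqint[OF dh, of th]
 note hs = H1perD(4)[OF h(1)] H1perD(4)[OF h(2)] H1perD(4)[OF dh]
 have bd: "AE y in ?C. bloch_grad th v y - bloch_grad th v' y = bloch_grad th d y"
  using H1per_combine(2)[OF h, of th 1 "-1"] unfolding d_def[abs_def, symmetric] by eventually_elim (simp add: cmul_minus_one cmul_one)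
 have "b_form B A2 th v d = b_form B A2 th v' d" using v v' dV by (simp add: solves_fibre_def)
 then have "cform (- T) A2 (bloch_grad th v) (bloch_grad th d) + l2inner ?C v d = cform (- T) A2 (bloch_grad th v') (bloch_grad th d) + l2inner ?C v' d"
  unfolding b_form_eq[OF h(1) dh] b_form_eq[OF h(2) dh] by (simp add: complex_eq_iff)
 moreover have "cform (- T) A2 (%y. bloch_grad th v y - bloch_grad th v' y) (bloch_grad th d) = cform (- T) A2 (bloch_grad th v) (bloch_grad th d) - cform (- T) A2 (bloch_grad th v') (bloch_grad th d)"
  unfolding cform_def linear_diff[OF linear_wop] by (rule l2inner_diff_left[OF wop_sqint[OF A2 T_sets(2) bs(1)] wop_sqint[OF A2 T_sets(2) bs(2)] bs(3)])
 moreover have "cform (- T) A2 (%y. bloch_grad th v y - bloch_grad th v' y) (bloch_grad th d) = cform (- T) A2 (bloch_grad th d) (bloch_grad th d)"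
  by (rule cform_cong_AE[OF A2 T_sets(2) sqint_diff[OF bs(1,2)] bs(3) bs(3) bs(3) bd]) simp
 moreover have "l2inner ?C d d = l2inner ?C v d - l2inner ?C v' d"
  using l2inner_diff_left[OF hs] unfolding dv .
 moreover have "0 <= cform (- T) A2 (bloch_grad th d) (bloch_grad th d)"
  unfolding cform_fibre(3)[OF bs(3) bs(3)] by (rule bloch_elliptic[OF dh open_interior interior_mono[OF Diff_subset] A2 e2 \<gamma>])
 ultimately have "(l2norm ?C d)\<^sup>2 <= 0" unfolding l2norm_sq_inner by linarith
 then have "l2norm ?C d = 0" by simp
 then have "AE y in ?C. d y = 0" using l2norm_eq_0_iff[OF hs(3)] by blast
 then show ?thesis unfolding dv by eventually_elim simp
qed

text \<open>By uniqueness in almost every fibre and Fubini, v is the transform of u almost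
  everywhere on the product. Hence u witnesses the choice in \<open>gelfand_inv\<close>, and
  injectivity of the transform identifies the chosen function with u.\<close>

lemma gelfand_inv_limit:
 assumes l: "limit_eq F u G" and F: "F : sqint lebesgue"
  and v: "case_prod v : L2 (dual_cell \<times> cell)" "AE th in dualM. solves_fibre B A2 F th (v th)"
 shows "gelfand_inv v : sqint lebesgue" "AE x in lebesgue. u x = gelfand_inv v x"
proof -
 have us: "u : sqint lebesgue" using l by (simp add: limit_eq_def adm_def)
 have w: "glim u (case_prod (gelfand u))" by (rule gelfand_glim) (simp add: L2_UNIV us)
 have vs: "case_prod v : sqint MDC" using v(1) by (simp add: L2_eq_sqint)
 define k where "k p = (norm (case_prod (gelfand u) p - case_prod v p))\<^sup>2" for p
 have ds: "(%p. case_prod (gelfand u) p - case_prod v p) : sqint MDC" by (rule sqint_diff[OF glimD(2)[OF w] vs])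
 have ki: "integrable MDC k" unfolding k_def[abs_def] by (rule sqintD(2)[OF ds])
 note Fb = lebesgue_on_Fubini[OF dual_cell_sets(2) cell_sets(2) ki]
 have "AE th in dualM. (LINT y|cellM. k (th, y)) = 0"
  using solves_fibre_AE[OF l F] v(2)
 proof eventually_elim
  case (elim th)
  from fibre_unique[OF elim] have "AE y in cellM. k (th, y) = 0" by eventually_elim (simp add: k_def)
  then show ?case by (rule integral_eq_zero_AE)
 qed
 then have "(LINT th|dualM. LINT y|cellM. k (th, y)) = 0" by (rule integral_eq_zero_AE)
 then have "integral\<^sup>L MDC k = 0" by (simp only: Fb(3))
 then have "(l2norm MDC (%p. case_prod (gelfand u) p - case_prod v p))\<^sup>2 = 0" unfolding l2norm_sq k_def[abs_def] .
 then have "l2norm MDC (%p. case_prod (gelfand u) p - case_prod v p) = 0" by simp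
 then have "AE p in MDC. case_prod (gelfand u) p - case_prod v p = 0" using l2norm_eq_0_iff[OF ds] by blast
 then have e: "AE p in MDC. case_prod (gelfand u) p = case_prod v p" by eventually_elim (simp add: case_prod_beta)
 let ?Q = "%F'. F' : L2 UNIV & (AE (th, y) in MDC. gelfand F' th y = v th y)"
 have "?Q u" using us e by (simp add: L2_UNIV case_prod_beta)
 from someI[of ?Q, OF this] have Q: "?Q (gelfand_inv v)" unfolding gelfand_inv_def .
 then show "gelfand_inv v : sqint lebesgue" by (simp add: L2_UNIV)
 have w': "glim (gelfand_inv v) (case_prod (gelfand (gelfand_inv v)))" using Q by (intro gelfand_glim) simp
 have "AE p in MDC. case_prod (gelfand (gelfand_inv v)) p = case_prod v p" using Q by (simp add: case_prod_beta)
 with e have "AE p in MDC. case_prod (gelfand u) p = case_prod (gelfand (gelfand_inv v)) p" by eventually_elim simp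
 then show "AE x in lebesgue. u x = gelfand_inv v x" by (rule glim_inj[OF w w'])
qed

text \<open>By the orthogonality almost every fibre of w lies in \<open>W_space\<close>, where the
  gap is assumed. Integrating over the dual cell, the isometry returns the energies of w on the
  whole space.\<close>

lemma spectral_gap:
 assumes gap: "\<forall>th\<in>dual_cell. \<forall>w\<in>W_space B A1 A2 th. \<nu> * Re (a_form B A1 th w w + b_form B A2 th w w) <= Re (a_form B A1 th w w)"
  and w: "w : sqint lebesgue" "D : sqint lebesgue" "weak_gradient UNIV w D"
  and orth: "!!psi H. adm psi H ==> wform T A1 D H + wform (- T) A2 D H + l2inner lebesgue w psi = 0"
 shows "\<nu> * (wform T A1 D D + wform (- T) A2 D D + l2inner lebesgue w w) <= wform T A1 D D"
proof -
 have g: "glim w (case_prod (gelfand w))" by (rule gelfand_glim) (simp add: L2_UNIV w)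
 obtain W where W: "glim D W" using glim_exists[OF w(2)] by blast
 have P1: "glim (%x. wop T A1 x (D x)) (%p. wop T A1 (snd p) (W p))"
  by (rule glim_wop[OF W A1 T_sets(1)]) (rule T_lattice(1))
 have P2: "glim (%x. wop (- T) A2 x (D x)) (%p. wop (- T) A2 (snd p) (W p))"
  by (rule glim_wop[OF W A2 T_sets(2)]) (rule T_lattice(2))
 have test: "AE th in dualM. \<forall>fi\<in>V_space B th.
   l2inner (cellM) (%y. wop T A1 (snd (th, y)) (W (th, y)) + wop (- T) A2 (snd (th, y)) (W (th, y))) (bloch_grad th fi)
   + l2inner (cellM) (%y. case_prod (gelfand w) (th, y)) fi = 0"
 proof (rule fibre_test[OF glim_add[OF P1 P2] g])
  fix psi H assume h: "adm psi H"
  have "l2inner lebesgue (%x. wop T A1 x (D x) + wop (- T) A2 x (D x)) H = wform T A1 D H + wform (- T) A2 D H"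
   unfolding wform_def by (rule l2inner_add_left) (simp_all add: wop_sqint_UNIV A1 A2 T_sets w(2) admD(2)[OF h])
  then show "l2inner lebesgue (%x. wop T A1 x (D x) + wop (- T) A2 x (D x)) H + l2inner lebesgue w psi = 0"
   using orth[OF h] by simp
 qed
 define k1 where "k1 p = wop T A1 (snd p) (W p) \<bullet> W p" for p
 define k2 where "k2 p = wop (- T) A2 (snd p) (W p) \<bullet> W p" for p
 define k3 where "k3 p = case_prod (gelfand w) p \<bullet> case_prod (gelfand w) p" for p
 have k: "integrable MDC k1" "integrable MDC k2" "integrable MDC k3"
  unfolding k1_def[abs_def] k2_def[abs_def] k3_def[abs_def]
  by (rule inner_integrable[OF glimD(2)[OF P1] glimD(2)[OF W]],
   rule inner_integrable[OF glimD(2)[OF P2] glimD(2)[OF W]],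
   rule inner_integrable[OF glimD(2)[OF g] glimD(2)[OF g]])
 note F1 = lebesgue_on_Fubini[OF dual_cell_sets(2) cell_sets(2) k(1)]
  and F2 = lebesgue_on_Fubini[OF dual_cell_sets(2) cell_sets(2) k(2)]
  and F3 = lebesgue_on_Fubini[OF dual_cell_sets(2) cell_sets(2) k(3)]
 have I: "integral\<^sup>L MDC k1 = wform T A1 D D" "integral\<^sup>L MDC k2 = wform (- T) A2 D D" "integral\<^sup>L MDC k3 = l2inner lebesgue w w"
  using glim_inner[OF P1 W] glim_inner[OF P2 W] glim_inner[OF g g]
  by (simp_all add: l2inner_def wform_def k1_def[abs_def] k2_def[abs_def] k3_def[abs_def])
 let ?K1 = "%th. LINT y|cellM. k1 (th, y)" and ?K2 = "%th. LINT y|cellM. k2 (th, y)" and ?K3 = "%th. LINT y|cellM. k3 (th, y)"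
 have dual: "AE th in lebesgue_on (dual_cell :: (real^'n) set). th : dual_cell" unfolding AE_leb_on[OF dual_cell_sets(1)] by simp
 have "AE th in dualM. \<nu> * (?K1 th + ?K2 th + ?K3 th) <= ?K1 th"
  using glim_H1per[OF w(3) g W] test dual
 proof eventually_elim
  case (elim th)
  let ?w = "gelfand w th" and ?W = "%y. W (th, y)" and ?C = "lebesgue_on (cell :: (real^'n) set)"
  have h: "?w : H1per" and Ws: "?W : sqint ?C" and bW: "AE y in ?C. bloch_grad th ?w y = ?W y" using elim(1) by simp_all
  note ws = H1perD(4)[OF h] and bs = bloch_grad_sqint[OF h, of th]
  note O1 = wop_sqint[OF A1 T_sets(1) Ws] and O2 = wop_sqint[OF A2 T_sets(2) Ws]
  have c1: "cform T A1 (bloch_grad th ?w) f = l2inner ?C (%y. wop T A1 y (?W y)) f" if "f : sqint ?C" for f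
   using cform_cong_AE[OF A1 T_sets(1) bs that Ws that bW] by (simp add: cform_def)
  have c2: "cform (- T) A2 (bloch_grad th ?w) f = l2inner ?C (%y. wop (- T) A2 y (?W y)) f" if "f : sqint ?C" for f
   using cform_cong_AE[OF A2 T_sets(2) bs that Ws that bW] by (simp add: cform_def)
  have t: "l2inner ?C (%y. wop T A1 y (?W y) + wop (- T) A2 y (?W y)) (bloch_grad th fi) + l2inner ?C ?w fi = 0"
   if "fi : V_space B th" for fi using elim(2) that by simp
  \<comment> \<open>\<open>W_space\<close> demands complex orthogonality; \<open>test_imul\<close>
    provides the imaginary part.\<close>
  have "a_form B A1 th ?w fi + b_form B A2 th ?w fi = 0" if p: "fi : V_space B th" for fi
  proof -
   note ph = V_space_H1per[OF p]
   note pb = bloch_grad_sqint[OF ph, of th]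
   show ?thesis
    unfolding a_form_eq[OF h ph] b_form_eq[OF h ph] c1[OF pb] c2[OF pb] c1[OF sqint_imul[OF pb]] c2[OF sqint_imul[OF pb]]
    using t[OF p] test_imul[OF t sqint_add[OF O1 O2] p] l2inner_add_left[OF O1 O2 pb] l2inner_add_left[OF O1 O2 sqint_imul[OF pb]]
    by (simp add: complex_eq_iff)
  qed
  then have "?w : W_space B A1 A2 th" using h by (simp add: W_space_def)
  then have "\<nu> * Re (a_form B A1 th ?w ?w + b_form B A2 th ?w ?w) <= Re (a_form B A1 th ?w ?w)" using gap elim(3) by blast
  moreover have "l2inner ?C f (bloch_grad th ?w) = l2inner ?C f ?W" if "f : sqint ?C" for f
   by (rule l2inner_cong_AE[OF that bs that Ws _ bW]) simp
  then have "Re (a_form B A1 th ?w ?w) = ?K1 th" "Re (b_form B A2 th ?w ?w) = ?K2 th + ?K3 th"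
   unfolding a_form_eq[OF h h] b_form_eq[OF h h] c1[OF bs] c2[OF bs] using O1 O2
   by (simp_all add: l2inner_def k1_def k2_def k3_def)
  ultimately show ?case by (simp add: add.assoc)
 qed
 then have "(LINT th|dualM. \<nu> * (?K1 th + ?K2 th + ?K3 th)) <= (LINT th|dualM. ?K1 th)"
  by (intro integral_mono_AE integrable_mult_right Bochner_Integration.integrable_add F1(2) F2(2) F3(2))
 moreover have "(LINT th|dualM. \<nu> * (?K1 th + ?K2 th + ?K3 th)) = \<nu> * (wform T A1 D D + wform (- T) A2 D D + l2inner lebesgue w w)"
  using F1(2) F2(2) F3(2) by (simp add: Bochner_Integration.integral_add[OF Bochner_Integration.integrable_add[OF F1(2) F2(2)] F3(2)]
   Bochner_Integration.integral_add[OF F1(2) F2(2)] F1(3) F2(3) F3(3) I)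
 ultimately show ?thesis unfolding F1(3) I(1) by (simp only:)
qed

text \<open>Against an admissible pair the inclusion term vanishes whatever its factor, so there the
  equations for v and u agree and the error is orthogonal to all admissible pairs; this is what
  \<open>spectral_gap\<close> needs. Testing the equation for v with the error then gives the energy
  identity with the factor 1/\<delta> on the inclusions.\<close>

lemma error_estimate:
 assumes gap: "\<forall>th\<in>dual_cell. \<forall>w\<in>W_space B A1 A2 th. \<nu> * Re (a_form B A1 th w w + b_form B A2 th w w) <= Re (a_form B A1 th w w)"
  and \<nu>: "0 < \<nu>" and \<delta>: "0 < \<delta>" "\<delta> < 1" and F: "F : sqint lebesgue"
  and s: "solves_delta B A1 A2 \<delta> F v" and l: "limit_eq F u G"
 shows "inverse \<gamma> * (l2norm lebesgue (%x. grad UNIV v x - G x))\<^sup>2 + (l2norm lebesgue (%x. v x - u x))\<^sup>2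
   <= inverse (\<nu>\<^sup>2) * \<delta>\<^sup>2 * (l2norm lebesgue F)\<^sup>2"
  and "(l2norm (lebesgue_on T) (grad UNIV v))\<^sup>2 <= \<gamma> * inverse (\<nu>\<^sup>2) * \<delta>\<^sup>2 * (l2norm lebesgue F)\<^sup>2"
proof -
 let ?g = "grad UNIV v" and ?w = "%x. v x - u x"
 let ?D = "%x. ?g x - G x"
 have au: "adm u G" using l by (simp add: limit_eq_def)
 note a = admD[OF au]
 have "v : H1 UNIV" using s by (simp add: solves_delta_def)
 note b = H1_UNIV[OF this]
 note ws = sqint_diff[OF b(1) a(1)] and Ds = sqint_diff[OF b(2) a(2)]
 have "weak_gradient UNIV (%x. v x + cmul (-1) (u x)) (%x. ?g x + cmul (-1) (G x))"
  by (rule weak_gradient_add[OF b(3) weak_gradient_cmul[OF a(3)]]) (simp_all add: L2_UNIV a b sqint_cmul)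
 then have wg: "weak_gradient UNIV ?w ?D" by (simp add: cmul_minus_one)
 let ?a = "wform T A1 ?D ?D" and ?b = "wform (- T) A2 ?D ?D + l2inner lebesgue ?w ?w"
 have z: "wform T A1 f H = 0" if "f : sqint lebesgue" "adm psi H" for f psi H
  by (rule wform_zero_right[OF A1 T_sets(1) that(1) admD(2)[OF that(2)] admD(4)[OF that(2)]])
 have orth: "wform T A1 ?D H + wform (- T) A2 ?D H + l2inner lebesgue ?w psi = 0" if h: "adm psi H" for psi H
 proof -
  have "wform (- T) A2 G H + l2inner lebesgue u psi = l2inner lebesgue F psi" using l h unfolding limit_eq_def by blast
  moreover have "wform (- T) A2 ?g H + l2inner lebesgue v psi = l2inner lebesgue F psi"
   using delta_equation[OF s F admD(1-3)[OF h]] z[OF b(2) h] by simp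
  ultimately show ?thesis
   using z[OF Ds h] wform_diff_left[OF A2 T_sets(2) b(2) a(2) admD(2)[OF h]] l2inner_diff_left[OF b(1) a(1) admD(1)[OF h]] by simp
 qed
 have gapE: "\<nu> * (?a + ?b) <= ?a" using spectral_gap[OF gap ws Ds wg orth] by (simp add: add.assoc)
 \<comment> \<open>The pair (u, G) is itself admissible, so by symmetry of the forms its
   contributions vanish, and v may be replaced by the error in the first argument.\<close>
 have "wform T A1 G ?D = 0" using wform_sym[OF A1, of T G ?D] z[OF Ds au] by simp
 then have "?a = wform T A1 ?g ?D" using wform_diff_left[OF A1 T_sets(1) b(2) a(2) Ds] by simp
 moreover have "wform (- T) A2 G ?D + l2inner lebesgue u ?w = 0"
  using orth[OF au] z[OF Ds au] wform_sym[OF A2, of "- T" G ?D] l2inner_commute[of lebesgue u ?w] by simp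
 then have "?b = wform (- T) A2 ?g ?D + l2inner lebesgue v ?w"
  using wform_diff_left[OF A2 T_sets(2) b(2) a(2) Ds] l2inner_diff_left[OF b(1) a(1) ws] by simp
 ultimately have en: "inverse \<delta> * ?a + ?b = l2inner lebesgue F ?w" using delta_equation[OF s F ws Ds wg] by simp
 have "l2inner lebesgue F ?w <= l2norm lebesgue F * l2norm lebesgue ?w" using l2inner_le[OF F ws] by (rule order_trans[OF abs_ge_self])
 then have en': "inverse \<delta> * ?a + ?b <= l2norm lebesgue F * l2norm lebesgue ?w" unfolding en .
 note nn = wform_nonneg[OF ws Ds wg]
 have n: "(l2norm lebesgue ?w)\<^sup>2 <= ?a + ?b" "0 <= ?b"
  using nn unfolding l2norm_sq_inner[symmetric] by simp_all
 have E: "?a + ?b <= inverse (\<nu>\<^sup>2) * \<delta>\<^sup>2 * (l2norm lebesgue F)\<^sup>2"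
  by (rule energy_bound[OF refl n(2) l2norm_nonneg n(1) l2norm_nonneg en' gapE \<nu> \<delta>])
 note el = elliptic_T[OF ws Ds wg]
 have "inverse \<gamma> * (l2norm lebesgue ?D)\<^sup>2 + (l2norm lebesgue ?w)\<^sup>2 <= ?a + ?b"
  using el unfolding l2norm_split[OF Ds] distrib_left l2norm_sq_inner[symmetric, of lebesgue ?w] by simp
 with E show "inverse \<gamma> * (l2norm lebesgue ?D)\<^sup>2 + (l2norm lebesgue ?w)\<^sup>2 <= inverse (\<nu>\<^sup>2) * \<delta>\<^sup>2 * (l2norm lebesgue F)\<^sup>2" by (rule order_trans[rotated])
 \<comment> \<open>G vanishes on the inclusions, so there the gradient of v is the gradient of the
   error, and the second estimate bounds just one term of the energy.\<close>
 have "AE x in lebesgue_on T. ?g x = ?D x" using a(4) unfolding AE_leb_on[OF T_sets(1)] by eventually_elim simp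
 then have "l2norm (lebesgue_on T) ?g = l2norm (lebesgue_on T) ?D"
  by (rule l2norm_cong_AE[OF sqintD(1)[OF sqint_leb_on(1)[OF b(2) T_sets(1)]] sqintD(1)[OF sqint_leb_on(1)[OF Ds T_sets(1)]]])
 moreover have "inverse \<gamma> * (l2norm (lebesgue_on T) ?D)\<^sup>2 <= inverse (\<nu>\<^sup>2) * \<delta>\<^sup>2 * (l2norm lebesgue F)\<^sup>2"
  using el(1) n(2) E by linarith
 then have "\<gamma> * (inverse \<gamma> * (l2norm (lebesgue_on T) ?D)\<^sup>2) <= \<gamma> * (inverse (\<nu>\<^sup>2) * \<delta>\<^sup>2 * (l2norm lebesgue F)\<^sup>2)"
  using \<gamma> by (intro mult_left_mono) simp_all
 ultimately show "(l2norm (lebesgue_on T) ?g)\<^sup>2 <= \<gamma> * inverse (\<nu>\<^sup>2) * \<delta>\<^sup>2 * (l2norm lebesgue F)\<^sup>2"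
  using \<gamma> by (simp add: mult.assoc[symmetric])
qed

end

theorem theorem7p20:
  fixes B :: "(real^'n) set"
    and A1 A2 :: "real^'n \<Rightarrow> complex^'m^'n^'m^'n"
    and F u\<^sub>\<delta> :: "real^'n \<Rightarrow> complex^'m"
    and \<gamma>\<^sub>0 \<nu> \<delta> :: real
  assumes "open B" and "connected B" and "lipschitz_boundary B" and "closure B \<subseteq> interior cell"
    and "coefficient A1" and "coefficient A2"
    and "\<gamma>\<^sub>0 \<ge> 1"
    and "elliptic_on B A1 \<gamma>\<^sub>0"
    and "elliptic_on (interior (cell - B)) A2 \<gamma>\<^sub>0"
    and "\<nu> > 0"
    and "\<forall>\<theta>\<in>dual_cell. \<forall>w\<in>W_space B A1 A2 \<theta>.
           \<nu> * Re (a_form B A1 \<theta> w w + b_form B A2 \<theta> w w) \<le> Re (a_form B A1 \<theta> w w)"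
    and "0 < \<delta>" and "\<delta> < 1"
    and "F \<in> L2 UNIV"
    and "solves_delta B A1 A2 \<delta> F u\<^sub>\<delta>"
  shows
    "(AE \<theta> in lebesgue_on dual_cell.
        (\<exists>v. solves_fibre B A2 F \<theta> v) \<and>
        (\<forall>v v'. solves_fibre B A2 F \<theta> v \<and> solves_fibre B A2 F \<theta> v'
           \<longrightarrow> (AE y in lebesgue_on cell. v y = v' y))) \<and>
     (\<exists>v. case_prod v \<in> L2 (dual_cell \<times> cell) \<and>
        (AE \<theta> in lebesgue_on dual_cell. solves_fibre B A2 F \<theta> (v \<theta>))) \<and>
     (\<forall>v. case_prod v \<in> L2 (dual_cell \<times> cell) \<and>
        (AE \<theta> in lebesgue_on dual_cell. solves_fibre B A2 F \<theta> (v \<theta>)) \<longrightarrow>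
        (let u\<^sub>0 = gelfand_inv v in
           inverse \<gamma>\<^sub>0 * (LINT y|lebesgue. (norm (grad UNIV u\<^sub>\<delta> y - grad UNIV u\<^sub>0 y))\<^sup>2)
             + (LINT y|lebesgue. (norm (u\<^sub>\<delta> y - u\<^sub>0 y))\<^sup>2)
             \<le> inverse (\<nu>\<^sup>2) * \<delta>\<^sup>2 * (LINT y|lebesgue. (norm (F y))\<^sup>2) \<and>
           solves_limit B A2 F u\<^sub>0 \<and>
           (\<forall>u. solves_limit B A2 F u \<longrightarrow> (AE y in lebesgue. u y = u\<^sub>0 y)))) \<and>
     (LINT y:translates B|lebesgue. (norm (grad UNIV u\<^sub>\<delta> y))\<^sup>2)
       \<le> \<gamma>\<^sub>0 * inverse (\<nu>\<^sup>2) * \<delta>\<^sup>2 * (LINT y|lebesgue. (norm (F y))\<^sup>2)"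
proof -
 interpret composite B A1 A2 \<gamma>\<^sub>0
  by (rule composite.intro) (use assms in blast)+
 have F: "F : sqint lebesgue" using assms by (simp add: L2_UNIV)
 obtain u G where l: "limit_eq F u G" using limit_exists[OF F] by blast
 note est = error_estimate[OF assms(11) assms(10) assms(12,13) F assms(15)]
 have us: "u : L2 UNIV" using l by (simp add: limit_eq_def adm_def L2_UNIV)
 have 1: "AE th in dualM. (\<exists>v. solves_fibre B A2 F th v) \<and>
    (\<forall>v v'. solves_fibre B A2 F th v & solves_fibre B A2 F th v' --> (AE y in cellM. v y = v' y))"
  using solves_fibre_AE[OF l F]
 proof eventually_elim
  case (elim th)
  show ?case
  proof (intro conjI allI impI)
   show "\<exists>v. solves_fibre B A2 F th v" using elim by blast
   show "AE y in cellM. v y = v' y" if "solves_fibre B A2 F th v & solves_fibre B A2 F th v'" for v v'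
    by (rule fibre_unique[OF conjunct1[OF that] conjunct2[OF that]])
  qed
 qed
 have 2: "case_prod (gelfand u) : L2 (dual_cell \<times> cell)"
  using glimD(2)[OF gelfand_glim[OF us]] by (simp add: L2_eq_sqint)
 have 3: "let u\<^sub>0 = gelfand_inv v in
     inverse \<gamma>\<^sub>0 * (LINT y|lebesgue. (norm (grad UNIV u\<^sub>\<delta> y - grad UNIV u\<^sub>0 y))\<^sup>2)
      + (LINT y|lebesgue. (norm (u\<^sub>\<delta> y - u\<^sub>0 y))\<^sup>2)
      <= inverse (\<nu>\<^sup>2) * \<delta>\<^sup>2 * (LINT y|lebesgue. (norm (F y))\<^sup>2) \<and>
     solves_limit B A2 F u\<^sub>0 \<and>
     (\<forall>u. solves_limit B A2 F u --> (AE y in lebesgue. u y = u\<^sub>0 y))"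
  if v: "case_prod v : L2 (dual_cell \<times> cell)" "AE th in dualM. solves_fibre B A2 F th (v th)" for v
 proof -
  note g = gelfand_inv_limit[OF l F v]
  have au: "adm u G" using l by (simp add: limit_eq_def)
  \<comment> \<open>\<open>gelfand_inv v\<close> is known only up to null sets. The limit equation
    is transferred to it with G kept, and then rewritten with
    \<open>grad UNIV (gelfand_inv v)\<close>, the gradient in the statement.\<close>
  have l': "limit_eq F (gelfand_inv v) G" by (rule limit_eq_cong[OF l g(1) admD(2)[OF au] g(2)]) simp
  then have a': "adm (gelfand_inv v) G" by (simp add: limit_eq_def)
  note h = H0_adm[OF a']
  have "AE x in lebesgue. G x = grad UNIV (gelfand_inv v) x" using h(2) by eventually_elim simp
  then have L: "limit_eq F (gelfand_inv v) (grad UNIV (gelfand_inv v))"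
   by (rule limit_eq_cong[OF l' g(1) admD(2)[OF adm_H0[OF h(1)]] AE_I2[OF refl]])
  show ?thesis
   unfolding Let_def
  proof (intro conjI allI impI)
   show "inverse \<gamma>\<^sub>0 * (LINT y|lebesgue. (norm (grad UNIV u\<^sub>\<delta> y - grad UNIV (gelfand_inv v) y))\<^sup>2)
      + (LINT y|lebesgue. (norm (u\<^sub>\<delta> y - gelfand_inv v y))\<^sup>2)
      <= inverse (\<nu>\<^sup>2) * \<delta>\<^sup>2 * (LINT y|lebesgue. (norm (F y))\<^sup>2)"
    using est(1)[OF L] unfolding l2norm_sq .
   show "solves_limit B A2 F (gelfand_inv v)" unfolding solves_limit_iff[OF F] using h(1) L by blast
   show "AE y in lebesgue. u y = gelfand_inv v y" if "solves_limit B A2 F u" for u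
    using limit_unique[OF _ L] that unfolding solves_limit_iff[OF F] by blast
  qed
 qed
 have 4: "(LINT y:translates B|lebesgue. (norm (grad UNIV u\<^sub>\<delta> y))\<^sup>2)
   <= \<gamma>\<^sub>0 * inverse (\<nu>\<^sup>2) * \<delta>\<^sup>2 * (LINT y|lebesgue. (norm (F y))\<^sup>2)"
  using est(2)[OF l] unfolding l2norm_sq integral_leb_on[OF T_sets(1)] set_lebesgue_integral_def .
 show ?thesis using 1 2 3 4 solves_fibre_AE[OF l F] by blast
qed

end
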